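(* For every $A>0$ there exist a constant $K>0$ depending only on $A$ and a number $\varepsilon_0>0$ such that for every $0<\varepsilon<\varepsilon_0$ there exists $\delta>0$ with the following property. Let $v_0\in\mathcal{X}^1$ satisfy $d_{A,\mathcal{X}^1}(v_0,\mathfrak{v}_0)\le\delta$ and let $v$ be the global solution of (GP) with initial datum $v_0$. Then for every $t\in\mathbb{R}$ and every $a\in\mathbb{R}$ for which there exists $\theta\in\mathbb{R}$ with $d_{A,\mathcal{X}^1}\big(v(\cdot+a,t),e^{i\theta}\mathfrak{v}_0(\cdot)\big)<\varepsilon$, one has $$|a|\le K\varepsilon(1+|t|).$$
   Context: The one-dimensional Gross–Pitaevskii equation (GP) is $i\Psi_t+\Psi_{xx}=\Psi(|\Psi|^2-1)$ on $\mathbb{R}\times\mathbb{R}$. The energy space is $\mathcal{X}^1=\{w\in L^\infty(\mathbb{R}):\ w'\in L^2(\mathbb{R}),\ 1-|w|^2\in L^2(\mathbb{R})\}$. For $v_0\in\mathcal{X}^1$, the global solution of (GP) with initial datum $v_0$ is the unique solution $v$ with $v(0)=v_0$ and $t\mapsto v(t)-v_0\in\mathcal{C}^0(\mathbb{R},H^1(\mathbb{R}))$. For $A>0$, $d_{A,\mathcal{X}^1}(v_1,v_2)=\|v_1-v_2\|_{L^\infty([-A,A])}+\|v_1'-v_2'\|_{L^2(\mathbb{R})}+\||v_1|-|v_2|\|_{L^2(\mathbb{R})}$. The kink is $\mathfrak{v}_0(x)=\tanh(x/\sqrt{2})$. *)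

theory Defs
  imports "HOL-Analysis.Analysis" "HOL-Probability.Essential_Supremum"
begin

definition test_fun :: "(real \<Rightarrow> real) \<Rightarrow> bool" where
  "test_fun \<phi> \<longleftrightarrow> (\<forall>n. (deriv ^^ n) \<phi> differentiable_on UNIV) \<and> bounded {x. \<phi> x \<noteq> 0}"

definition loc_int :: "(real \<Rightarrow> complex) \<Rightarrow> bool" where
  "loc_int f \<longleftrightarrow> f \<in> borel_measurable lborel \<and>
     (\<forall>a b. set_integrable lborel {a..b} f)"

definition has_weak_deriv :: "(real \<Rightarrow> complex) \<Rightarrow> (real \<Rightarrow> complex) \<Rightarrow> bool" where
  "has_weak_deriv f g \<longleftrightarrow> loc_int f \<and> loc_int g \<and>
     (\<forall>\<phi>. test_fun \<phi> \<longrightarrow>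
        (LINT x|lborel. f x * complex_of_real (deriv \<phi> x))
          = - (LINT x|lborel. g x * complex_of_real (\<phi> x)))"

definition wderiv :: "(real \<Rightarrow> complex) \<Rightarrow> (real \<Rightarrow> complex)" where
  "wderiv f = (SOME g. has_weak_deriv f g)"

definition L2 :: "(real \<Rightarrow> complex) \<Rightarrow> bool" where
  "L2 f \<longleftrightarrow> f \<in> borel_measurable lborel \<and> integrable lborel (\<lambda>x. (cmod (f x))\<^sup>2)"

definition L2norm :: "(real \<Rightarrow> complex) \<Rightarrow> ereal" where
  "L2norm f = (if L2 f then ereal (sqrt (LINT x|lborel. (cmod (f x))\<^sup>2)) else \<infinity>)"

definition H1 :: "(real \<Rightarrow> complex) \<Rightarrow> bool" where
  "H1 u \<longleftrightarrow> L2 u \<and> (\<exists>g. has_weak_deriv u g \<and> L2 g)"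

definition H1norm :: "(real \<Rightarrow> complex) \<Rightarrow> ereal" where
  "H1norm u = L2norm u + L2norm (wderiv u)"

definition X1 :: "(real \<Rightarrow> complex) set" where
  "X1 = {w. w \<in> borel_measurable lborel \<and> (\<exists>M. AE x in lborel. cmod (w x) \<le> M)
            \<and> (\<exists>g. has_weak_deriv w g \<and> L2 g)
            \<and> L2 (\<lambda>x. complex_of_real (1 - (cmod (w x))\<^sup>2))}"

definition dAX :: "real \<Rightarrow> (real \<Rightarrow> complex) \<Rightarrow> (real \<Rightarrow> complex) \<Rightarrow> ereal" where
  "dAX A v1 v2 =
     esssup (restrict_space lborel {-A..A}) (\<lambda>x. ereal (cmod (v1 x - v2 x)))
     + L2norm (\<lambda>x. wderiv v1 x - wderiv v2 x)
     + L2norm (\<lambda>x. complex_of_real (cmod (v1 x) - cmod (v2 x)))"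

definition kink :: "real \<Rightarrow> complex" where
  "kink x = complex_of_real (tanh (x / sqrt 2))"

(* v t x = \<Psi>(x,t).  v is the global solution of (GP) with datum v0:
   v(0) = v0, t \<mapsto> v(t) - v0 \<in> C^0(R, H^1(R)), and (GP) holds in the weak sense
   d/dt <v(t),\<phi>> = i <v(t),\<phi>''> - i <v(t)(|v(t)|^2-1),\<phi>> for all test functions \<phi>. *)
definition GP_solution :: "(real \<Rightarrow> complex) \<Rightarrow> (real \<Rightarrow> real \<Rightarrow> complex) \<Rightarrow> bool" where
  "GP_solution v0 v \<longleftrightarrow>
     v 0 = v0 \<and>
     (\<forall>t. H1 (\<lambda>x. v t x - v0 x)) \<and>
     (\<forall>t. ((\<lambda>s. H1norm (\<lambda>x. (v s x - v0 x) - (v t x - v0 x))) \<longlongrightarrow> 0) (at t)) \<and>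
     (\<forall>\<phi> t. test_fun \<phi> \<longrightarrow>
        ((\<lambda>s. LINT x|lborel. v s x * complex_of_real (\<phi> x)) has_vector_derivative
           (\<i> * (LINT x|lborel. v t x * complex_of_real (deriv (deriv \<phi>) x))
            - \<i> * (LINT x|lborel. v t x * complex_of_real ((cmod (v t x))\<^sup>2 - 1) * complex_of_real (\<phi> x))))
        (at t))"

end

(*
Energy and (renormalised) momentum together trap the solution near the orbit of the kink Q.
The energy is E(Q) plus a quadratic form in Re and Im of the perturbation that is coercive once
the complex moment m = int Q' v is small, so it remains to keep m small. For each time translate
the solution so that |m| is minimal; minimality makes the real part of m (after rotation)
negligible. The imaginary part is seen by the momentum: the phase of 1 + Q (v - Q) = Q v + 1 - Q^2
integrates over the line without crossing a zero, and the momentum equals minus twice Im m modulo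
2 pi up to quadratic errors. Hence |m| <= C (delta + |m|^2), and continuity in time closes the
bootstrap. Since Q is stationary, m at a fixed position changes at a rate bounded by the distance
to the orbit, so the centre moves at most C epsilon (1 + |t|); and a position at which the solution
is epsilon-close to a kink has moment O(epsilon), hence lies within O(epsilon) of the centre.
*)
theory Submission
 imports Defs "HOL-Probability.Sinc_Integral"
begin

section \<open>Square integrable functions\<close>

text \<open>A solution is only weak: \<open>v t - v0\<close> is continuous into H1, so its time
  derivative lies in H^(-1), and neither conservation law follows by multiplying the equation. Both
  come from finite differences. For the momentum they are differences in space: a correlation at
  shift y changes in time at rate O(y^(5/2)), too slowly for its linear coefficient in y to move.
  For the energy they are differences in time, whose uncontrolled terms cancel only after averaging
  over time windows. At infinity only 1 - |v|^2 and the derivative are controlled, in L2, while the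
  phase may drift. Hence closeness carries the weight 1 + |x|, to be paired with the exponentially
  decaying Q'; the momentum is read on finite windows corrected by the phases at their ends, and
  kept as an exponential. The given distance enters through the value at 0, the derivative and the
  modulus. It bounds the energy excess linearly, whereas coercivity returns the square root of that
  excess, so \<delta> is at most of order \<epsilon>^2.\<close>

definition l2 :: "(real => 'a::{real_normed_field,euclidean_space}) => bool" where
 "l2 f \<longleftrightarrow> f \<in> borel_measurable lborel \<and> integrable lborel (%x. (norm (f x))\<^sup>2)"

text \<open>Real-valued, unlike \<open>L2norm\<close>, so that estimates stay in ordinary
  arithmetic. It is the L2 norm for \<open>l2\<close> functions only: a square that is not
  integrable has integral 0.\<close>

definition n2 :: "(real => 'a::{real_normed_field,euclidean_space}) => real" where
 "n2 f = sqrt (LINT x|lborel. (norm (f x))\<^sup>2)"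

lemma n2_nonneg [simp]: "0 \<le> n2 f"
 by (simp add: n2_def)

lemma n2_sq: "(n2 f)\<^sup>2 = (LINT x|lborel. (norm (f x))\<^sup>2)"
 by (simp add: n2_def)

lemma l2_meas' [measurable_dest]: "l2 f ==> f \<in> borel_measurable borel"
 using l2_def measurable_lborel2 by blast

lemma l2_int: "l2 f ==> integrable lborel (%x. (norm (f x))\<^sup>2)"
 by (simp add: l2_def)

lemma l2_bound:
 fixes f :: "real => 'a::{real_normed_field,euclidean_space}" and g :: "real => 'b::{real_normed_field,euclidean_space}"
 assumes "l2 g" "f \<in> borel_measurable borel" "\<And>x. norm (f x) \<le> C * norm (g x)"
 shows "l2 f" "0 \<le> C ==> n2 f \<le> C * n2 g"
proof -
 note [measurable] = assms(2)
 have b: "(norm (f x))\<^sup>2 \<le> C\<^sup>2 * (norm (g x))\<^sup>2" for x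
  using power_mono[OF assms(3)[of x] norm_ge_zero, of 2] by (simp add: power_mult_distrib)
 have i: "integrable lborel (%x. C\<^sup>2 * (norm (g x))\<^sup>2)"
  using l2_int[OF assms(1)] by simp
 have j: "integrable lborel (%x. (norm (f x))\<^sup>2)"
  by (rule Bochner_Integration.integrable_bound[OF i]) (use b in \<open>auto intro!: AE_I2 measurable_compose[OF assms(2)] simp: abs_mult\<close>)
 show "l2 f" using j assms(2) by (simp add: l2_def)
 assume C: "0 \<le> C"
 have "(n2 f)\<^sup>2 \<le> (C * n2 g)\<^sup>2"
  using integral_mono[OF j i] b by (simp add: n2_sq power_mult_distrib)
 then show "n2 f \<le> C * n2 g"
  using C by (simp add: power2_le_iff_abs_le)
qed

lemma l2_add:
 fixes f g :: "real => 'a::{real_normed_field,euclidean_space}"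
 assumes "l2 f" "l2 g" shows "l2 (%x. f x + g x)"
proof -
 note [measurable] = l2_meas'[OF assms(1)] l2_meas'[OF assms(2)]
 have b: "(norm (f x + g x))\<^sup>2 \<le> 2 * (norm (f x))\<^sup>2 + 2 * (norm (g x))\<^sup>2" for x
 proof -
  have "(norm (f x + g x))\<^sup>2 \<le> (norm (f x) + norm (g x))\<^sup>2"
   by (simp add: norm_triangle_ineq power_mono)
  also have "\<dots> \<le> 2 * (norm (f x))\<^sup>2 + 2 * (norm (g x))\<^sup>2"
   using sum_squares_bound[of "norm (f x)" "norm (g x)"] by (simp add: power2_sum)
  finally show ?thesis .
 qed
 have i: "integrable lborel (%x. 2 * (norm (f x))\<^sup>2 + 2 * (norm (g x))\<^sup>2)"
  using l2_int[OF assms(1)] l2_int[OF assms(2)] by simp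
 show ?thesis unfolding l2_def
 proof
  show "integrable lborel (%x. (norm (f x + g x))\<^sup>2)"
   by (rule Bochner_Integration.integrable_bound[OF i]) (use b in auto)
 qed simp
qed

lemma l2_cmult:
 fixes f :: "real => 'a::{real_normed_field,euclidean_space}"
 assumes "l2 f" shows "l2 (%x. c * f x)" and "n2 (%x. c * f x) = norm c * n2 f"
proof -
 note [measurable] = l2_meas'[OF assms(1)]
 show "l2 (%x. c * f x)"
  by (rule l2_bound(1)[OF assms, where C="norm c"]) (simp_all add: norm_mult)
 show "n2 (%x. c * f x) = norm c * n2 f"
  by (simp add: n2_def norm_mult power_mult_distrib real_sqrt_mult)
qed

lemma n2_minus: "n2 (%x. - f x) = n2 f"
 by (simp add: n2_def)

lemma n2_commute: "n2 (%x. f x - g x) = n2 (%x. g x - f x)"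
 by (simp add: n2_def norm_minus_commute)

lemma l2_minus: "l2 f ==> l2 (%x. - f x)"
 by (auto simp: l2_def)

lemma l2_diff:
 fixes f g :: "real => 'a::{real_normed_field,euclidean_space}"
 assumes "l2 f" "l2 g" shows "l2 (%x. f x - g x)"
 using l2_add[OF assms(1) l2_minus[OF assms(2)]] by simp

lemma l2_bdd_mult:
 fixes f :: "real => 'a::{real_normed_field,euclidean_space}"
 assumes "l2 f" "g \<in> borel_measurable borel" "\<And>x. norm (g x) \<le> C"
 shows "l2 (%x. g x * f x)" "n2 (%x. g x * f x) \<le> C * n2 f"
proof -
 note [measurable] = l2_meas'[OF assms(1)] assms(2)
 have C: "0 \<le> C" using assms(3)[of 0] norm_ge_zero[of "g 0"] by linarith
 have b: "norm (g x * f x) \<le> C * norm (f x)" for x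
  using assms(3)[of x] by (simp add: norm_mult mult_right_mono)
 show "l2 (%x. g x * f x)" by (rule l2_bound(1)[OF assms(1) _ b]) simp
 show "n2 (%x. g x * f x) \<le> C * n2 f" by (rule l2_bound(2)[OF assms(1) _ b C]) simp
qed

lemma l2_mult:
 fixes f g :: "real => 'a::{real_normed_field,euclidean_space}"
 assumes "l2 f" "l2 g" shows "integrable lborel (%x. f x * g x)"
proof -
 note [measurable] = l2_meas'[OF assms(1)] l2_meas'[OF assms(2)]
 have i: "integrable lborel (%x. (norm (f x))\<^sup>2 + (norm (g x))\<^sup>2)"
  using l2_int[OF assms(1)] l2_int[OF assms(2)] by simp
 have b: "norm (f x * g x) \<le> (norm (f x))\<^sup>2 + (norm (g x))\<^sup>2" for x
 proof -
  have "0 \<le> norm (f x) * norm (g x)" by simp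
  then show ?thesis using sum_squares_bound[of "norm (f x)" "norm (g x)"] by (simp only: norm_mult)
 qed
 show ?thesis
  by (rule Bochner_Integration.integrable_bound[OF i]) (use b in \<open>auto intro!: AE_I2 order_trans[OF _ abs_ge_self]\<close>)
qed

lemma l2_norm: "l2 f ==> l2 (%x. norm (f x))"
 by (auto simp: l2_def)

lemma l2_mult_norm:
 fixes f :: "real => 'a::{real_normed_field,euclidean_space}" and g :: "real => 'b::{real_normed_field,euclidean_space}"
 assumes "l2 f" "l2 g" shows "integrable lborel (%x. norm (f x) * norm (g x))"
 by (rule l2_mult[OF l2_norm[OF assms(1)] l2_norm[OF assms(2)]])

text \<open>Young's inequality a b \<le> s a^2 / 2 + b^2 / (2 s), integrated with the optimal s = B
  / A. The shift \<open>d\<close> keeps s finite and positive when a norm vanishes, and its cost is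
  absorbed in \<open>e\<close>.\<close>

lemma n2_CS_norm:
 fixes f :: "real => 'a::{real_normed_field,euclidean_space}" and g :: "real => 'b::{real_normed_field,euclidean_space}"
 assumes "l2 f" "l2 g"
 shows "(LINT x|lborel. norm (f x) * norm (g x)) \<le> n2 f * n2 g"
proof (rule field_le_epsilon)
 fix e :: real assume e: "0 < e"
 define A B where "A = n2 f" and "B = n2 g"
 have AB: "0 \<le> A" "0 \<le> B" by (auto simp: A_def B_def)
 define d where "d = e / (A + B + 1)"
 have d: "0 < d" using e AB by (simp add: d_def)
 define s where "s = (B + d) / (A + d)"
 have s: "0 < s" using d AB by (simp add: s_def)
 have pt: "norm (f x) * norm (g x) \<le> s / 2 * (norm (f x))\<^sup>2 + 1 / (2 * s) * (norm (g x))\<^sup>2" for x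
 proof -
  have "0 \<le> (s * norm (f x) - norm (g x))\<^sup>2 / (2 * s)" using s by simp
  also have "\<dots> = s / 2 * (norm (f x))\<^sup>2 + 1 / (2 * s) * (norm (g x))\<^sup>2 - norm (f x) * norm (g x)"
   using s by (simp add: power2_eq_square field_simps)
  finally show ?thesis by simp
 qed
 have "(LINT x|lborel. norm (f x) * norm (g x)) \<le> (LINT x|lborel. s / 2 * (norm (f x))\<^sup>2 + 1 / (2 * s) * (norm (g x))\<^sup>2)"
  by (rule integral_mono) (use pt l2_mult_norm[OF assms] l2_int[OF assms(1)] l2_int[OF assms(2)] in auto)
 also have "\<dots> = s / 2 * A\<^sup>2 + 1 / (2 * s) * B\<^sup>2"
  using l2_int[OF assms(1)] l2_int[OF assms(2)] by (simp add: A_def B_def n2_sq)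
 also have "s / 2 * A\<^sup>2 \<le> (B + d) * A / 2"
 proof -
  have "s * A \<le> B + d" using AB d by (simp add: s_def divide_simps mult_left_mono)
  then show ?thesis using mult_right_mono[of "s * A" "B + d" "A / 2"] AB by (simp add: power2_eq_square)
 qed
 also have "1 / (2 * s) * B\<^sup>2 \<le> (A + d) * B / 2"
 proof -
  have "B / s \<le> A + d" using AB d by (simp add: s_def divide_simps mult_left_mono mult.commute)
  then show ?thesis using mult_right_mono[of "B / s" "A + d" "B / 2"] AB by (simp add: power2_eq_square)
 qed
 also have "(B + d) * A / 2 + (A + d) * B / 2 \<le> A * B + d * (A + B + 1)"
 proof -
  have "0 \<le> A * d" "0 \<le> B * d" using AB d by auto
  then show ?thesis using d by (simp add: algebra_simps add_divide_distrib)
 qed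
 also have "d * (A + B + 1) = e" using AB by (simp add: d_def)
 finally show "(LINT x|lborel. norm (f x) * norm (g x)) \<le> n2 f * n2 g + e"
  by (simp add: A_def B_def)
qed

lemma n2_CS:
 fixes f g :: "real => 'a::{real_normed_field,euclidean_space}"
 assumes "l2 f" "l2 g"
 shows "norm (LINT x|lborel. f x * g x) \<le> n2 f * n2 g"
proof -
 have "norm (LINT x|lborel. f x * g x) \<le> (LINT x|lborel. norm (f x * g x))"
  by (rule integral_norm_bound)
 also have "\<dots> \<le> n2 f * n2 g"
  using n2_CS_norm[OF assms] by (simp add: norm_mult)
 finally show ?thesis .
qed

lemma n2_triangle:
 fixes f g :: "real => 'a::{real_normed_field,euclidean_space}"
 assumes "l2 f" "l2 g" shows "n2 (%x. f x + g x) \<le> n2 f + n2 g"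
proof -
 have pt: "(norm (f x + g x))\<^sup>2 \<le> (norm (f x))\<^sup>2 + (norm (g x))\<^sup>2 + 2 * (norm (f x) * norm (g x))" for x
  using power_mono[OF norm_triangle_ineq[of "f x" "g x"] norm_ge_zero, of 2] by (simp add: power2_sum)
 have "(n2 (%x. f x + g x))\<^sup>2 \<le> (LINT x|lborel. (norm (f x))\<^sup>2 + (norm (g x))\<^sup>2 + 2 * (norm (f x) * norm (g x)))"
  unfolding n2_sq
  by (rule integral_mono) (use pt l2_int[OF l2_add[OF assms]] l2_int[OF assms(1)] l2_int[OF assms(2)] l2_mult_norm[OF assms] in auto)
 also have "\<dots> = (n2 f)\<^sup>2 + (n2 g)\<^sup>2 + 2 * (LINT x|lborel. norm (f x) * norm (g x))"
  using l2_int[OF assms(1)] l2_int[OF assms(2)] l2_mult_norm[OF assms] by (simp add: n2_sq)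
 also have "\<dots> \<le> (n2 f + n2 g)\<^sup>2"
  using n2_CS_norm[OF assms] by (simp add: power2_sum)
 finally show ?thesis by (simp add: power2_le_iff_abs_le)
qed

lemma n2_triangle_diff:
 fixes f g :: "real => 'a::{real_normed_field,euclidean_space}"
 assumes "l2 f" "l2 g" shows "n2 (%x. f x - g x) \<le> n2 f + n2 g"
 using n2_triangle[OF assms(1) l2_minus[OF assms(2)]] by (simp add: n2_minus)

lemma n2_diff_bound:
 fixes f g :: "real => 'a::{real_normed_field,euclidean_space}"
 assumes "l2 f" "l2 g" shows "\<bar>n2 f - n2 g\<bar> \<le> n2 (%x. f x - g x)"
 using n2_triangle[OF l2_diff[OF assms] assms(2)] n2_triangle[OF l2_diff[OF assms(2,1)] assms(1)]
 by (simp add: n2_commute[of g f] abs_le_iff)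

lemma l2_shift:
 fixes f :: "real => 'a::{real_normed_field,euclidean_space}"
 assumes "l2 f" shows "l2 (%x. f (x + a))" "n2 (%x. f (x + a)) = n2 f"
proof -
 note [measurable] = l2_meas'[OF assms(1)]
 show "l2 (%x. f (x + a))"
  using lborel_integrable_real_affine[OF l2_int[OF assms], of 1 a] by (simp add: l2_def add.commute)
 show "n2 (%x. f (x + a)) = n2 f"
  using lborel_integral_real_affine[of 1 "%x. (norm (f x))\<^sup>2" a] by (simp add: n2_def add.commute)
qed

lemma integral_shift:
 fixes f :: "real => 'a::{real_normed_field,euclidean_space}"
 shows "(LINT x|lborel. f (x + a)) = (LINT x|lborel. f x)"
 using lborel_integral_real_affine[of 1 f a] by (simp add: add.commute)

lemma integrable_shift:
 fixes f :: "real => 'a::{real_normed_field,euclidean_space}"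
 shows "integrable lborel f ==> integrable lborel (%x. f (x + a))"
 using lborel_integrable_real_affine[of f 1 a] by (simp add: add.commute)

lemma l2_bounded_linear:
 fixes f :: "real => 'a::{real_normed_field,euclidean_space}" and T :: "'a => 'b::{real_normed_field,euclidean_space}"
 assumes "l2 f" "bounded_linear T" "\<And>z. norm (T z) \<le> norm z"
 shows "l2 (%x. T (f x))" "n2 (%x. T (f x)) \<le> n2 f"
proof -
 note [measurable] = l2_meas'[OF assms(1)]
 have [measurable]: "T \<in> borel_measurable borel"
  by (intro borel_measurable_continuous_onI linear_continuous_on assms(2))
 have b: "norm (T (f x)) \<le> 1 * norm (f x)" for x using assms(3) by simp
 show "l2 (%x. T (f x))" by (rule l2_bound(1)[OF assms(1) _ b]) simp
 show "n2 (%x. T (f x)) \<le> n2 f" using l2_bound(2)[OF assms(1) _ b] by simp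
qed

lemmas l2_cnj = l2_bounded_linear[OF _ bounded_linear_cnj, simplified]
lemmas l2_Re = l2_bounded_linear[OF _ bounded_linear_Re, simplified, OF _ abs_Re_le_cmod]
lemmas l2_Im = l2_bounded_linear[OF _ bounded_linear_Im, simplified, OF _ abs_Im_le_cmod]

lemma l2_of_real: "l2 f ==> l2 (%x. complex_of_real (f x))"
 by (auto simp: l2_def)

lemma n2_of_real: "n2 (%x. complex_of_real (f x)) = n2 f"
 by (simp add: n2_def)

lemma n2_cnj: "n2 (%x. cnj (f x)) = n2 f"
 by (simp add: n2_def)

lemma l2_indicator: "l2 (%x. indicator {a..b} x :: real)" "a \<le> b ==> n2 (%x. indicator {a..b} x :: real) = sqrt (b - a)"
proof -
 have "(norm (indicator {a..b} x :: real))\<^sup>2 = indicator {a..b} x" for x by (auto simp: indicator_def)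
 moreover have "integrable lborel (indicator {a..b} :: real => real)"
  by (intro integrable_real_indicator) (auto simp: emeasure_lborel_Icc_eq)
 ultimately show "l2 (%x. indicator {a..b} x :: real)" "a \<le> b ==> n2 (%x. indicator {a..b} x :: real) = sqrt (b - a)"
  by (simp_all add: l2_def n2_def)
qed

lemma l2_set_integrable:
 fixes f :: "real => 'a::{real_normed_field,euclidean_space}"
 assumes "l2 f" shows "set_integrable lborel {a..b} f"
proof -
 note [measurable] = l2_meas'[OF assms(1)]
 have i: "integrable lborel (%x. norm (indicator {a..b} x :: real) * norm (f x))"
  by (rule l2_mult_norm[OF l2_indicator(1) assms])
 show ?thesis unfolding set_integrable_def
  by (rule Bochner_Integration.integrable_bound[OF i]) auto
qed

lemma n2_set_CS:
 fixes f :: "real => 'a::{real_normed_field,euclidean_space}"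
 assumes "l2 f" "a \<le> b"
 shows "(LINT x:{a..b}|lborel. norm (f x)) \<le> sqrt (b - a) * n2 f"
 using n2_CS_norm[OF l2_indicator(1)[of a b] assms(1)] assms(2)
 by (simp add: l2_indicator set_lebesgue_integral_def)

lemma n2_AE_cong:
 fixes f g :: "real => 'a::{real_normed_field,euclidean_space}"
 assumes "AE x in lborel. f x = g x" "f \<in> borel_measurable borel" "g \<in> borel_measurable borel"
 shows "n2 f = n2 g" "l2 f = l2 g"
proof -
 note [measurable] = assms(2,3)
 have a: "AE x in lborel. (norm (f x))\<^sup>2 = (norm (g x))\<^sup>2" using assms(1) by auto
 show "n2 f = n2 g" unfolding n2_def
  by (intro arg_cong[where f=sqrt] integral_cong_AE a) auto
 show "l2 f = l2 g" unfolding l2_def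
  using integrable_cong_AE[OF _ _ a] assms by auto
qed

section \<open>Absolutely continuous functions\<close>

text \<open>The fundamental theorem of calculus is taken as the definition: \<open>f\<close> is the
  continuous representative and \<open>g\<close> a fixed locally integrable representative of its
  derivative. The product, exponential and shift rules then rest on integrals, not on pointwise
  derivatives.\<close>

definition ac :: "(real => 'a::{real_normed_field,euclidean_space}) => (real => 'a) => bool" where
 "ac f g \<longleftrightarrow> g \<in> borel_measurable borel \<and> (\<forall>a b. set_integrable lborel {a..b} g) \<and>
   (\<forall>a b. a \<le> b --> f b - f a = (LINT x:{a..b}|lborel. g x))"

lemma ac_meas_deriv [measurable_dest]: "ac f g ==> g \<in> borel_measurable borel"
 by (simp add: ac_def)

lemma ac_set_integrable: "ac f g ==> set_integrable lborel {a..b} g"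
 by (simp add: ac_def)

lemma ac_int: "ac f g ==> a \<le> b ==> f b - f a = (LINT x:{a..b}|lborel. g x)"
 by (simp add: ac_def)

lemma ac_isCont:
 fixes f :: "real => 'a::{real_normed_field,euclidean_space}"
 assumes "ac f g" shows "isCont f x"
proof -
 have i: "g integrable_on {x - 1..x + 1}"
  using set_borel_integral_eq_integral(1)[OF ac_set_integrable[OF assms]] .
 have eq: "f y = f (x - 1) + integral {x - 1..y} g" if "y \<in> {x - 1..x + 1}" for y
  using ac_int[OF assms, of "x - 1" y] that set_borel_integral_eq_integral(2)[OF ac_set_integrable[OF assms], of "x - 1" y]
  by (simp add: algebra_simps)
 have "continuous_on {x - 1..x + 1} (%y. f (x - 1) + integral {x - 1..y} g)"
  by (intro continuous_intros indefinite_integral_continuous_1 i)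
 then have "continuous_on {x - 1..x + 1} f"
  by (subst continuous_on_cong[OF refl eq])
 then show ?thesis
  using continuous_on_interior[of "{x - 1..x + 1}" f x] by simp
qed

lemma ac_cont: "ac f g ==> continuous_on S f"
 using ac_isCont continuous_at_imp_continuous_on by blast

lemma ac_meas [measurable_dest]: "ac f g ==> f \<in> borel_measurable borel"
 by (rule borel_measurable_continuous_onI[OF ac_cont])

lemma ac_const: "ac (%x. c) (%x. 0)"
 by (simp add: ac_def set_integrable_def set_lebesgue_integral_def)

lemma ac_add: "ac f f' ==> ac g g' ==> ac (%x. f x + g x) (%x. f' x + g' x)"
 unfolding ac_def by (simp add: set_integral_add add_diff_add borel_measurable_add)

lemma ac_bounded_linear:
 fixes T :: "'a::{real_normed_field,euclidean_space} => 'b::{real_normed_field,euclidean_space}"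
 assumes "ac f g" "bounded_linear T" shows "ac (%x. T (f x)) (%x. T (g x))"
proof -
 interpret T: bounded_linear T by fact
 have [measurable]: "T \<in> borel_measurable borel"
  by (intro borel_measurable_continuous_onI linear_continuous_on assms(2))
 note [measurable] = ac_meas_deriv[OF assms(1)]
 have i: "integrable lborel (%x. indicator {a..b} x *\<^sub>R g x)" for a b
  using ac_set_integrable[OF assms(1)] by (simp add: set_integrable_def)
 have "(%x. T (g x)) \<in> borel_measurable borel" by measurable
 moreover have "set_integrable lborel {a..b} (%x. T (g x))" for a b
  using integrable_bounded_linear[OF assms(2) i[of a b]] by (simp add: set_integrable_def T.scaleR)
 moreover have "T (f b) - T (f a) = (LINT x:{a..b}|lborel. T (g x))" if "a \<le> b" for a b
  using integral_bounded_linear[OF assms(2) i[of a b]] ac_int[OF assms(1) that]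
  by (simp add: set_lebesgue_integral_def T.scaleR T.diff[symmetric])
 ultimately show ?thesis by (simp add: ac_def)
qed

lemmas ac_cnj = ac_bounded_linear[OF _ bounded_linear_cnj]
lemmas ac_Re = ac_bounded_linear[OF _ bounded_linear_Re]
lemmas ac_Im = ac_bounded_linear[OF _ bounded_linear_Im]
lemmas ac_of_real = ac_bounded_linear[OF _ bounded_linear_of_real]
lemmas ac_cmult = ac_bounded_linear[OF _ bounded_linear_mult_right]
lemmas ac_minus = ac_bounded_linear[OF _ bounded_linear_minus[OF bounded_linear_ident]]

lemma ac_diff: "ac f f' ==> ac g g' ==> ac (%x. f x - g x) (%x. f' x - g' x)"
 using ac_add[OF _ ac_minus, of f f' g g'] by simp

lemma ac_C1:
 fixes f :: "real => 'a::{real_normed_field,euclidean_space}"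
 assumes "\<And>x. (f has_vector_derivative g x) (at x)" "continuous_on UNIV g"
 shows "ac f g"
proof -
 have c: "continuous_on {a..b} g" for a b using continuous_on_subset[OF assms(2)] by blast
 have d: "(f has_vector_derivative g x) (at x within S)" for x S
  using assms(1) has_vector_derivative_at_within by blast
 have "g \<in> borel_measurable borel" using assms(2) by (rule borel_measurable_continuous_onI)
 moreover have "set_integrable lborel {a..b} g" for a b
  unfolding set_integrable_def using borel_integrable_compact[OF _ c] by auto
 ultimately show ?thesis
  unfolding ac_def set_lebesgue_integral_def using integral_FTC_Icc[OF _ d c] by auto
qed

lemma ac_DERIV:
 fixes f :: "real => real"
 assumes "\<And>x. (f has_real_derivative g x) (at x)" "continuous_on UNIV g"
 shows "ac f g"
 by (rule ac_C1) (use assms in \<open>simp_all add: has_real_derivative_iff_has_vector_derivative\<close>)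

lemma ac_shift:
 fixes f :: "real => 'a::{real_normed_field,euclidean_space}"
 assumes "ac f g" shows "ac (%x. f (x + c)) (%x. g (x + c))"
proof -
 note [measurable] = ac_meas_deriv[OF assms(1)]
 have e: "(%x. indicat_real {a..b} x *\<^sub>R g (x + c)) = (%x. (%y. indicat_real {a + c..b + c} y *\<^sub>R g y) (x + c))" for a b
  by (auto simp: indicator_def fun_eq_iff)
 have "set_integrable lborel {a..b} (%x. g (x + c))" for a b
  unfolding set_integrable_def e
  using integrable_shift[OF ac_set_integrable[OF assms, unfolded set_integrable_def]] .
 moreover have "(LINT x:{a..b}|lborel. g (x + c)) = (LINT x:{a+c..b+c}|lborel. g x)" for a b
  unfolding set_lebesgue_integral_def e by (rule integral_shift)
 ultimately show ?thesis using assms by (simp add: ac_def)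
qed

lemma set_integrable_mult_cont:
 fixes f g :: "real => 'a::{real_normed_field,euclidean_space}"
 assumes "set_integrable lborel {a..b} f" "continuous_on {a..b} g" "f \<in> borel_measurable borel" "g \<in> borel_measurable borel"
 shows "set_integrable lborel {a..b} (%x. f x * g x)"
proof -
 note [measurable] = assms(3,4)
 have "bounded (g ` {a..b})" using compact_continuous_image[OF assms(2)] compact_imp_bounded by blast
 then obtain B where B: "\<And>x. x \<in> {a..b} ==> norm (g x) \<le> B" unfolding bounded_iff by blast
 have i: "integrable lborel (%x. B * norm (indicator {a..b} x *\<^sub>R f x))"
  using assms(1) unfolding set_integrable_def by (intro integrable_mult_right integrable_norm)
 show ?thesis unfolding set_integrable_def
 proof (rule Bochner_Integration.integrable_bound[OF i])
  show "AE x in lborel. norm (indicator {a..b} x *\<^sub>R (f x * g x)) \<le> norm (B * norm (indicator {a..b} x *\<^sub>R f x))"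
  proof (rule AE_I2)
   fix x
   have "norm (f x) * norm (g x) \<le> \<bar>B\<bar> * norm (f x)" if "x \<in> {a..b}"
    using mult_right_mono[OF B[OF that], of "norm (f x)"] mult_right_mono[OF abs_ge_self[of B], of "norm (f x)"] by (simp add: mult.commute)
   then show "norm (indicator {a..b} x *\<^sub>R (f x * g x)) \<le> norm (B * norm (indicator {a..b} x *\<^sub>R f x))"
    by (auto simp: norm_mult abs_mult indicator_def)
  qed
 qed measurable
qed

text \<open>Fubini for f'(x) g'(y) on the triangle x \<le> y over [a, b]: one order of integration
  gives the integral of (f y - f a) g'(y), the other that of f'(x) (g b - g x). Equating them is
  integration by parts.\<close>

lemma ac_mult:
 fixes f g :: "real => 'a::{real_normed_field,euclidean_space}"
 assumes F: "ac f f'" and G: "ac g g'"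
 shows "ac (%x. f x * g x) (%x. f' x * g x + f x * g' x)"
proof -
 note [measurable] = ac_meas_deriv[OF F] ac_meas_deriv[OF G] ac_meas[OF F] ac_meas[OF G]
 have i1: "set_integrable lborel {a..b} (%x. f' x * g x)" for a b
  by (rule set_integrable_mult_cont[OF ac_set_integrable[OF F] ac_cont[OF G]]) auto
 have i2: "set_integrable lborel {a..b} (%x. f x * g' x)" for a b
  using set_integrable_mult_cont[OF ac_set_integrable[OF G] ac_cont[OF F], of a b] by (simp add: mult.commute)
 have "f b * g b - f a * g a = (LINT x:{a..b}|lborel. f' x * g x + f x * g' x)" if ab: "a \<le> b" for a b
 proof -
  define P where "P x = indicator {a..b} x *\<^sub>R f' x" for x
  define R where "R x = indicator {a..b} x *\<^sub>R g' x" for x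
  have P: "integrable lborel P" and R: "integrable lborel R"
   using ac_set_integrable[OF F] ac_set_integrable[OF G] by (simp_all add: P_def[abs_def] R_def[abs_def] set_integrable_def)
  have [measurable]: "P \<in> borel_measurable borel" "R \<in> borel_measurable borel"
   unfolding P_def R_def by auto
  have "integrable (lborel \<Otimes>\<^sub>M lborel) (%(x,y). norm (P x) * norm (R y))"
   by (rule lborel_pair.Fubini_integrable) (use P R in auto)
  then have PR: "integrable (lborel \<Otimes>\<^sub>M lborel) (%(x,y). if x \<le> y then P x * R y else 0)"
   by (rule Bochner_Integration.integrable_bound) (auto intro!: AE_I2 simp: norm_mult)
  have eq: "(LINT y|lborel. (LINT x|lborel. (if x \<le> y then P x * R y else 0))) = (LINT x|lborel. (LINT y|lborel. (if x \<le> y then P x * R y else 0)))"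
   using lborel_pair.Fubini_integral[OF PR] .
  have l: "(LINT x|lborel. (if x \<le> y then P x * R y else 0)) = R y * (f y - f a)" for y
  proof (cases "y \<in> {a..b}")
   case True
   have "(LINT x|lborel. (if x \<le> y then P x * R y else 0)) = (LINT x|lborel. (indicator {a..y} x *\<^sub>R f' x) * R y)"
    by (rule Bochner_Integration.integral_cong) (use True in \<open>auto simp: P_def indicator_def\<close>)
   also have "\<dots> = (LINT x:{a..y}|lborel. f' x) * R y"
    unfolding set_lebesgue_integral_def by (rule integral_mult_left_zero)
   finally show ?thesis using ac_int[OF F, of a y] True by (simp add: mult.commute)
  next
   case False
   then have "R y = 0" by (auto simp: R_def)
   then show ?thesis by (simp cong: if_cong)
  qed
  have r: "(LINT y|lborel. (if x \<le> y then P x * R y else 0)) = P x * (g b - g x)" for x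
  proof (cases "x \<in> {a..b}")
   case True
   have "(LINT y|lborel. (if x \<le> y then P x * R y else 0)) = (LINT y|lborel. P x * (indicator {x..b} y *\<^sub>R g' y))"
    by (rule Bochner_Integration.integral_cong) (use True in \<open>auto simp: R_def indicator_def\<close>)
   also have "\<dots> = P x * (LINT y:{x..b}|lborel. g' y)"
    unfolding set_lebesgue_integral_def by (rule integral_mult_right_zero)
   finally show ?thesis using ac_int[OF G, of x b] True by simp
  next
   case False
   then have "P x = 0" by (auto simp: P_def)
   then show ?thesis by (simp cong: if_cong)
  qed
  have e: "(LINT y|lborel. R y * (f y - f a)) = (LINT x|lborel. P x * (g b - g x))"
   using eq unfolding l r .
  have j1: "integrable lborel (%x. P x * g x)" and j2: "integrable lborel (%x. f x * R x)"
   using i1[of a b] i2[of a b] by (simp_all add: set_integrable_def P_def R_def)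
  have h1: "(LINT y|lborel. R y * (f y - f a)) = (LINT x|lborel. f x * R x) - f a * (LINT x|lborel. R x)"
   using j2 R by (simp add: right_diff_distrib mult.commute)
  have h2: "(LINT x|lborel. P x * (g b - g x)) = g b * (LINT x|lborel. P x) - (LINT x|lborel. P x * g x)"
   using j1 P by (simp add: right_diff_distrib mult.commute)
  have h3: "(LINT x|lborel. P x) = f b - f a" "(LINT x|lborel. R x) = g b - g a"
   using ac_int[OF F ab] ac_int[OF G ab] by (simp_all add: P_def R_def set_lebesgue_integral_def)
  have h4: "(LINT x:{a..b}|lborel. f' x * g x + f x * g' x) = (LINT x|lborel. P x * g x) + (LINT x|lborel. f x * R x)"
   using set_integral_add(2)[OF i1[of a b] i2[of a b]] by (simp add: P_def R_def set_lebesgue_integral_def)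
  have "(LINT x|lborel. f x * R x) - f a * (g b - g a) = g b * (f b - f a) - (LINT x|lborel. P x * g x)"
   using e unfolding h1 h2 h3 .
  then show ?thesis unfolding h4 by (simp add: algebra_simps)
 qed
 then show ?thesis unfolding ac_def using i1 i2 by (auto intro: set_integral_add)
qed

lemma ac_power:
 fixes f :: "real => 'a::{real_normed_field,euclidean_space}"
 assumes "ac f g"
 shows "ac (%x. f x ^ n) (%x. of_nat n * f x ^ (n - 1) * g x)"
proof (induction n)
 case 0 show ?case using ac_const[of 1] by simp
next
 case (Suc n)
 have "(%x. g x * f x ^ n + f x * (of_nat n * f x ^ (n - 1) * g x)) = (%x. of_nat (Suc n) * f x ^ (Suc n - 1) * g x)"
  by (cases n) (auto simp: algebra_simps fun_eq_iff)
 then show ?case using ac_mult[OF assms Suc.IH] by simp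
qed

lemma ac_scaleR_sum:
 fixes f :: "nat => real => 'a::{real_normed_field,euclidean_space}"
 assumes "\<And>i. ac (f i) (g i)"
 shows "ac (%x. \<Sum>i<n. f i x) (%x. \<Sum>i<n. g i x)"
 by (induction n) (use ac_const[of 0] in \<open>auto intro: ac_add assms\<close>)

text \<open>The partial sum \<open>T (Suc n)\<close> of the series has derivative
  \<open>T n * g\<close>, so the series is differentiated term by term. All partial sums are
  dominated by \<open>exp (norm (f x))\<close>, and the limit passes under the integral.\<close>

lemma ac_exp:
 fixes f :: "real => 'a::{real_normed_field,euclidean_space}"
 assumes A: "ac f g"
 shows "ac (%x. exp (f x)) (%x. exp (f x) * g x)"
proof -
 note [measurable] = ac_meas_deriv[OF A] ac_meas[OF A]
 have mexp [measurable]: "(exp :: 'a => 'a) \<in> borel_measurable borel"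
  by (intro borel_measurable_continuous_onI continuous_on_exp continuous_on_id)
 define T where "T n x = (\<Sum>i<n. f x ^ i /\<^sub>R fact i)" for n x
 have T1: "ac (T (Suc n)) (%x. T n x * g x)" for n
 proof -
  have "ac (%x. f x ^ i /\<^sub>R fact i) (%x. (of_nat i * f x ^ (i - 1) * g x) /\<^sub>R fact i)" for i
   by (rule ac_bounded_linear[OF ac_power[OF A] bounded_linear_scaleR_right])
  then have "ac (T (Suc n)) (%x. \<Sum>i<Suc n. (of_nat i * f x ^ (i - 1) * g x) /\<^sub>R fact i)"
   unfolding T_def by (rule ac_scaleR_sum)
  moreover have "(\<Sum>i<Suc n. (of_nat i * f x ^ (i - 1) * g x) /\<^sub>R fact i) = T n x * g x" for x
  proof -
   have "(\<Sum>i<Suc n. (of_nat i * f x ^ (i - 1) * g x) /\<^sub>R fact i) = (\<Sum>i<n. (of_nat (Suc i) * f x ^ i * g x) /\<^sub>R fact (Suc i))"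
    by (subst sum.lessThan_Suc_shift) simp
   also have "\<dots> = (\<Sum>i<n. (f x ^ i /\<^sub>R fact i) * g x)"
   proof (rule sum.cong[OF refl])
    fix i
    have "(of_nat (Suc i) * f x ^ i * g x) = real (Suc i) *\<^sub>R (f x ^ i * g x)"
     by (simp add: scaleR_conv_of_real)
    then show "(of_nat (Suc i) * f x ^ i * g x) /\<^sub>R fact (Suc i) = (f x ^ i /\<^sub>R fact i) * g x"
     by (simp only: fact_Suc) (simp del: of_nat_Suc)
   qed
   finally show ?thesis by (simp add: T_def sum_distrib_right)
  qed
  ultimately show ?thesis by simp
 qed
 have Tlim: "(%n. T n x) \<longlonglongrightarrow> exp (f x)" for x
  using exp_converges[of "f x"] by (simp add: sums_def T_def)
 have Tb: "norm (T n x) \<le> exp (norm (f x))" for n x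
 proof -
  have "norm (T n x) \<le> (\<Sum>i<n. norm (f x) ^ i /\<^sub>R fact i)"
   unfolding T_def by (rule order_trans[OF norm_sum]) (simp add: norm_power)
  also have "\<dots> \<le> exp (norm (f x))"
   using sum_le_suminf[OF summable_exp_generic[of "norm (f x)"], of "{..<n}"] by (simp add: exp_def)
  finally show ?thesis .
 qed
 have si: "set_integrable lborel {a..b} (%x. exp (f x) * g x)" for a b
  using set_integrable_mult_cont[OF ac_set_integrable[OF A, of a b], of "%x. exp (f x)"] ac_cont[OF A]
  by (simp add: mult.commute continuous_on_exp)
 have "exp (f b) - exp (f a) = (LINT x:{a..b}|lborel. exp (f x) * g x)" if ab: "a \<le> b" for a b
 proof -
  have bnd: "set_integrable lborel {a..b} (%x. norm (g x) * exp (norm (f x)))"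
   by (rule set_integrable_mult_cont) (use ac_set_integrable[OF A, of a b] ac_cont[OF A] in \<open>auto intro!: continuous_intros set_integrable_norm\<close>)
  have "(%n. LINT x:{a..b}|lborel. T n x * g x) \<longlonglongrightarrow> (LINT x:{a..b}|lborel. exp (f x) * g x)"
   unfolding set_lebesgue_integral_def
  proof (rule integral_dominated_convergence[where w="%x. indicator {a..b} x *\<^sub>R (norm (g x) * exp (norm (f x)))"])
   show "integrable lborel (%x. indicator {a..b} x *\<^sub>R (norm (g x) * exp (norm (f x))))"
    using bnd by (simp add: set_integrable_def)
   show "AE x in lborel. (%n. indicat_real {a..b} x *\<^sub>R (T n x * g x)) \<longlonglongrightarrow> indicat_real {a..b} x *\<^sub>R (exp (f x) * g x)"
    by (intro AE_I2 tendsto_intros Tlim)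
   show "AE x in lborel. norm (indicat_real {a..b} x *\<^sub>R (T n x * g x)) \<le> indicat_real {a..b} x *\<^sub>R (norm (g x) * exp (norm (f x)))" for n
    using Tb[of n] by (intro AE_I2) (auto simp: norm_mult indicator_def mult.commute intro!: mult_left_mono)
  qed (auto simp: T_def)
  moreover have "(%n. LINT x:{a..b}|lborel. T n x * g x) = (%n. T (Suc n) b - T (Suc n) a)"
   using ac_int[OF T1 ab] by simp
  moreover have "(%n. T (Suc n) b - T (Suc n) a) \<longlonglongrightarrow> exp (f b) - exp (f a)"
   by (intro tendsto_diff LIMSEQ_Suc Tlim)
  ultimately show ?thesis using LIMSEQ_unique by metis
 qed
 then show ?thesis unfolding ac_def using si by auto
qed

section \<open>Increments, decay at infinity and translations\<close>

lemma ac_norm_le: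
 assumes "ac f g" "a \<le> b"
 shows "norm (f b - f a) \<le> (LINT x:{a..b}|lborel. norm (g x))"
 unfolding ac_int[OF assms] using set_integral_norm_bound[OF ac_set_integrable[OF assms(1)]] .

lemma ac_l2_le:
 assumes "ac f g" "l2 g"
 shows "norm (f b - f a) \<le> sqrt \<bar>b - a\<bar> * n2 g"
proof (cases "a \<le> b")
 case True
 then show ?thesis using order_trans[OF ac_norm_le[OF assms(1) True] n2_set_CS[OF assms(2) True]] by simp
next
 case False
 then show ?thesis using order_trans[OF ac_norm_le[OF assms(1), of b a] n2_set_CS[OF assms(2), of b a]]
  by (simp add: norm_minus_commute abs_minus_commute)
qed

text \<open>The ends are arbitrary sequences because a window [-n, n] becomes [-n - b, n - b] when
  the solution is viewed from the position b.\<close>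

lemma integrable_tendsto_window:
 fixes g :: "real => 'a::{real_normed_field,euclidean_space}"
 assumes "integrable lborel g" "filterlim X at_bot sequentially" "filterlim Y at_top sequentially"
 shows "(%n. LINT x:{X n..Y n}|lborel. g x) \<longlonglongrightarrow> (LINT x|lborel. g x)"
 unfolding set_lebesgue_integral_def
proof (rule integral_dominated_convergence[where w="%x. norm (g x)"])
 show "AE x in lborel. (%n. indicat_real {X n..Y n} x *\<^sub>R g x) \<longlonglongrightarrow> g x"
 proof (rule AE_I2)
  fix x
  have "eventually (%n. X n \<le> x) sequentially" "eventually (%n. x \<le> Y n) sequentially"
   using assms(2,3) by (auto simp: filterlim_at_bot filterlim_at_top)
  then have "eventually (%n. indicat_real {X n..Y n} x *\<^sub>R g x = g x) sequentially"
   by eventually_elim (auto simp: indicator_def)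
  then show "(%n. indicat_real {X n..Y n} x *\<^sub>R g x) \<longlonglongrightarrow> g x" by (rule tendsto_eventually)
 qed
qed (use assms(1) in \<open>auto simp: indicator_def\<close>)

lemma ac_integrable_window:
 fixes g :: "real => 'a::{real_normed_field,euclidean_space}"
 assumes "ac f g" "integrable lborel g" "filterlim X at_bot sequentially" "filterlim Y at_top sequentially"
 shows "(%n. f (Y n) - f (X n)) \<longlonglongrightarrow> (LINT x|lborel. g x)"
proof -
 have "eventually (%n. X n \<le> 0) sequentially" "eventually (%n. 0 \<le> Y n) sequentially"
  using assms(3,4) by (auto simp: filterlim_at_bot filterlim_at_top)
 then have "eventually (%n. (LINT x:{X n..Y n}|lborel. g x) = f (Y n) - f (X n)) sequentially"
  by eventually_elim (use ac_int[OF assms(1)] in auto)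
 then show ?thesis using integrable_tendsto_window[OF assms(2-4)] tendsto_cong by fast
qed

lemma ac_bounded_integral:
 fixes g :: "real => 'a::{real_normed_field,euclidean_space}"
 assumes "ac f g" "integrable lborel g" 
 shows "norm (f b - f a) \<le> (LINT x|lborel. norm (g x))"
proof -
 have *: "norm (f b - f a) \<le> (LINT x|lborel. norm (g x))" if "a \<le> b" for a b
 proof -
  have "(LINT x:{a..b}|lborel. norm (g x)) \<le> (LINT x|lborel. norm (g x))"
   unfolding set_lebesgue_integral_def
  proof (rule integral_mono)
   show "integrable lborel (%x. indicator {a..b} x *\<^sub>R norm (g x))"
    using set_integrable_norm[OF ac_set_integrable[OF assms(1), of a b]] by (simp add: set_integrable_def)
  qed (use assms(2) in \<open>auto simp: indicator_def\<close>)
  then show ?thesis using ac_norm_le[OF assms(1) that] by linarith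
 qed
 show ?thesis using *[of a b] *[of b a] by (cases "a \<le> b") (auto simp: norm_minus_commute)
qed

lemma integral_unit_window_tendsto:
 fixes g :: "real => real"
 assumes g: "integrable lborel g"
 shows "((%y. LINT x:{y..y+1}|lborel. g x) \<longlongrightarrow> 0) at_top" "((%y. LINT x:{y..y+1}|lborel. g x) \<longlongrightarrow> 0) at_bot"
proof -
 have gm [measurable]: "g \<in> borel_measurable borel" using g by auto
 have *: "((%y. LINT x:{y..y+1}|lborel. g x) \<longlongrightarrow> (LINT x|(lborel :: real measure). (0::real))) F"
  if ev: "\<And>x. eventually (%y. x < y \<or> y + 1 < x) F" "filterlim h F sequentially" "F = at_top \<or> F = at_bot" for F :: "real filter" and h :: "nat => real"
 proof -
  have seq: "(%n. LINT x:{X n..X n+1}|lborel. g x) \<longlonglongrightarrow> (LINT x|(lborel :: real measure). (0::real))" if X: "filterlim X F sequentially" for X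
   unfolding set_lebesgue_integral_def
  proof (rule integral_dominated_convergence[where w="%x. norm (g x)" and f="%_. 0 :: real" and s="%n x. indicat_real {X n..X n + 1} x *\<^sub>R g x"])
   show "AE x in lborel. (%n. indicat_real {X n..X n + 1} x *\<^sub>R g x) \<longlonglongrightarrow> 0"
   proof (rule AE_I2)
    fix x
    have "eventually (%n. x < X n \<or> X n + 1 < x) sequentially"
     by (rule eventually_compose_filterlim[OF ev(1)[of x] X])
    then have "eventually (%n. indicat_real {X n..X n + 1} x *\<^sub>R g x = 0) sequentially"
     by eventually_elim (auto simp: indicator_def)
    then show "(%n. indicat_real {X n..X n + 1} x *\<^sub>R g x) \<longlonglongrightarrow> 0" by (rule tendsto_eventually)
   qed
  qed (use g in \<open>auto simp: indicator_def\<close>)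
  have neg: "(f \<longlongrightarrow> l) at_bot" if "\<And>X. filterlim X at_bot sequentially ==> (%n. f (X n)) \<longlonglongrightarrow> l" for f :: "real => real" and l
  proof -
   have "((%x. f (- x)) \<longlongrightarrow> l) at_top"
   proof (rule tendsto_at_topI_sequentially)
    fix X :: "nat => real" assume "filterlim X at_top sequentially"
    then show "(%n. f (- X n)) \<longlonglongrightarrow> l"
     using that[of "%n. - X n"] by (simp add: filterlim_uminus_at_bot)
   qed
   then show ?thesis by (simp add: filterlim_at_bot_mirror)
  qed
  show ?thesis using that(3)
  proof
   assume F: "F = at_top" show ?thesis unfolding F by (rule tendsto_at_topI_sequentially, rule seq) (simp add: F)
  next
   assume F: "F = at_bot" show ?thesis unfolding F by (rule neg, rule seq) (simp add: F)
  qed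
 qed
 have t: "eventually (%y. x < y \<or> y + 1 < x) at_top" for x :: real
  using eventually_gt_at_top[of x] by eventually_elim auto
 have b: "eventually (%y. x < y \<or> y + 1 < x) at_bot" for x :: real
  using eventually_gt_at_bot[of "x - 1"] by eventually_elim auto
 show "((%y. LINT x:{y..y+1}|lborel. g x) \<longlongrightarrow> 0) at_top"
  using *[OF t filterlim_real_sequentially] by simp
 show "((%y. LINT x:{y..y+1}|lborel. g x) \<longlongrightarrow> 0) at_bot"
  using *[OF b, of "%n. - real n"] filterlim_real_sequentially by (simp add: filterlim_uminus_at_bot)
qed

text \<open>For each x in the window \<open>norm (f y)\<close> is at most \<open>norm (f x)\<close>
  plus the integral of \<open>norm (g x)\<close>. Averaging over x, the window having length one,
  removes the choice of x.\<close>

lemma ac_le_unit_window: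
 fixes f :: "real => 'a::{real_normed_field,euclidean_space}"
 assumes "ac f g"
 shows "norm (f y) \<le> (LINT x:{y..y+1}|lborel. norm (f x)) + (LINT x:{y..y+1}|lborel. norm (g x))"
proof -
 have i: "set_integrable lborel {y..y+1} (%x. norm (f x))"
  unfolding set_integrable_def by (intro borel_integrable_compact continuous_on_norm ac_cont[OF assms]) auto
 define J where "J = (LINT x:{y..y+1}|lborel. norm (g x))"
 have b: "norm (f y) \<le> norm (f x) + J" if "x \<in> {y..y+1}" for x
 proof -
  have "norm (f x - f y) \<le> (LINT x:{y..x}|lborel. norm (g x))"
   by (rule ac_norm_le) (use assms that in auto)
  also have "\<dots> \<le> J" unfolding J_def set_lebesgue_integral_def
   by (rule integral_mono) (use that set_integrable_norm[OF ac_set_integrable[OF assms]] in \<open>auto simp: set_integrable_def indicator_def\<close>)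
  finally show ?thesis using norm_triangle_ineq3[of "f x" "f y"] norm_triangle_ineq2[of "f y" "f x"] by (simp add: norm_minus_commute)
 qed
 have c: "set_integrable lborel {y..y+1} (%x. c :: real)" for c
  unfolding set_integrable_def by (intro borel_integrable_compact) auto
 have l1: "(LINT x:{y..y+1}|lborel. c) = (c::real)" for c
  by (simp add: set_lebesgue_integral_def)
 have "(LINT x:{y..y+1}|lborel. norm (f y)) \<le> (LINT x:{y..y+1}|lborel. norm (f x) + J)"
  by (rule set_integral_mono) (use b in \<open>auto intro!: c set_integral_add i\<close>)
 then show ?thesis using set_integral_add(2)[OF i c[of J]] by (simp add: l1 J_def)
qed

lemma ac_integrable_tendsto_0:
 fixes f :: "real => 'a::{real_normed_field,euclidean_space}"
 assumes "ac f g" "integrable lborel f" "integrable lborel g"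
 shows "(f \<longlongrightarrow> 0) at_top" "(f \<longlongrightarrow> 0) at_bot"
proof -
 note l = integral_unit_window_tendsto[OF integrable_norm[OF assms(2)]] integral_unit_window_tendsto[OF integrable_norm[OF assms(3)]]
 show "(f \<longlongrightarrow> 0) at_top"
  by (rule Lim_null_comparison[OF always_eventually tendsto_add_zero[OF l(1) l(3)]]) (simp add: ac_le_unit_window[OF assms(1)])
 show "(f \<longlongrightarrow> 0) at_bot"
  by (rule Lim_null_comparison[OF always_eventually tendsto_add_zero[OF l(2) l(4)]]) (simp add: ac_le_unit_window[OF assms(1)])
qed

text \<open>The square of \<open>f\<close> is integrable and has an integrable derivative, so
  \<open>ac_integrable_tendsto_0\<close> applies to it.\<close>

lemma ac_l2_tendsto_0:
 fixes f :: "real => 'a::{real_normed_field,euclidean_space}"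
 assumes "ac f g" "l2 f" "l2 g"
 shows "(f \<longlongrightarrow> 0) at_top" "(f \<longlongrightarrow> 0) at_bot"
proof -
 have a: "ac (%x. f x * f x) (%x. g x * f x + f x * g x)" by (rule ac_mult[OF assms(1,1)])
 have i: "integrable lborel (%x. f x * f x)" "integrable lborel (%x. g x * f x + f x * g x)"
  by (intro Bochner_Integration.integrable_add l2_mult assms)+
 note t = ac_integrable_tendsto_0[OF a i]
 have n: "(f \<longlongrightarrow> 0) F" if "((%x. f x * f x) \<longlongrightarrow> 0) F" for F
 proof -
  have "((%x. sqrt (norm (f x * f x))) \<longlongrightarrow> sqrt (norm (0::'a))) F" by (intro tendsto_intros that)
  then show ?thesis by (simp add: norm_mult tendsto_norm_zero_iff)
 qed
 show "(f \<longlongrightarrow> 0) at_top" "(f \<longlongrightarrow> 0) at_bot" using t n by auto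
qed

text \<open>Agmon's inequality: the square vanishes at infinity and its derivative is twice the
  product of \<open>f\<close> and \<open>g\<close>. The product form matters, since one of the two
  norms may be much smaller than the other.\<close>

lemma ac_l2_sup:
 fixes f :: "real => 'a::{real_normed_field,euclidean_space}"
 assumes "ac f g" "l2 f" "l2 g"
 shows "(norm (f x))\<^sup>2 \<le> 2 * n2 f * n2 g"
proof -
 have a: "ac (%x. f x * f x) (%x. g x * f x + f x * g x)" by (rule ac_mult[OF assms(1,1)])
 have i: "integrable lborel (%x. g x * f x + f x * g x)"
  by (intro Bochner_Integration.integrable_add l2_mult assms)
 have "(LINT x|lborel. norm (g x * f x + f x * g x)) = (LINT x|lborel. 2 * (norm (f x) * norm (g x)))"
  by (rule Bochner_Integration.integral_cong) (simp_all add: mult.commute norm_mult flip: mult_2)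
 also have "\<dots> \<le> 2 * (n2 f * n2 g)" using n2_CS_norm[OF assms(2,3)] by simp
 finally have b: "norm (f x * f x - f y * f y) \<le> 2 * n2 f * n2 g" for y
  using ac_bounded_integral[OF a i, of x y] by simp
 have "((%y. norm (f x * f x - f y * f y)) \<longlongrightarrow> norm (f x * f x - 0 * 0)) at_top"
  by (intro tendsto_intros ac_l2_tendsto_0[OF assms])
 then have "norm (f x * f x - 0 * 0) \<le> 2 * n2 f * n2 g"
  by (rule tendsto_upperbound) (use b in auto)
 then show ?thesis by (simp add: norm_mult power2_eq_square)
qed

lemma ac_l2_integral_deriv_0:
 fixes f :: "real => 'a::{real_normed_field,euclidean_space}"
 assumes "ac f g" "(f \<longlongrightarrow> 0) at_top" "(f \<longlongrightarrow> 0) at_bot" "integrable lborel g"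
 shows "(LINT x|lborel. g x) = 0"
proof -
 have X: "filterlim (%n. - real n) at_bot sequentially" 
  using filterlim_real_sequentially by (simp add: filterlim_uminus_at_bot)
 have "(%n. f (real n) - f (- real n)) \<longlonglongrightarrow> 0 - 0"
  by (intro tendsto_diff filterlim_compose[OF assms(2) filterlim_real_sequentially] filterlim_compose[OF assms(3) X])
 then show ?thesis
  using ac_integrable_window[OF assms(1,4) X filterlim_real_sequentially] LIMSEQ_unique by fastforce
qed

text \<open>Cauchy-Schwarz on the segment from x to x + y, then Fubini. Only the derivative is taken
  in L2, so the bound serves a solution of modulus near 1, which does not decay. Negative shifts
  reduce to positive ones by translation.\<close>

lemma l2_translation_le:
 fixes f :: "real => 'a::{real_normed_field,euclidean_space}"
 assumes A: "ac f g" and G: "l2 g"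
 shows "l2 (%x. f (x + y) - f x)" "n2 (%x. f (x + y) - f x) \<le> \<bar>y\<bar> * n2 g"
proof -
 note [measurable] = ac_meas[OF A] l2_meas'[OF G]
 have pos: "l2 (%x. f (x + y) - f x) \<and> n2 (%x. f (x + y) - f x) \<le> y * n2 g" if y: "0 \<le> y" for y
 proof -
  have pt: "(norm (f (x + y) - f x))\<^sup>2 \<le> y * (LINT s|lborel. indicator {0..y} s * (norm (g (x + s)))\<^sup>2)" for x
  proof -
   have "norm (f (x + y) - f x) \<le> (LINT s:{x..x+y}|lborel. norm (g s))"
    by (rule ac_norm_le[OF A]) (use y in simp)
   also have "\<dots> = (LINT s|lborel. norm (indicator {x..x+y} s :: real) * norm (indicator {x..x+y} s *\<^sub>R g s))"
    unfolding set_lebesgue_integral_def by (rule Bochner_Integration.integral_cong) (auto simp: indicator_def)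
   also have "\<dots> \<le> n2 (%s. indicator {x..x+y} s :: real) * n2 (%s. indicator {x..x+y} s *\<^sub>R g s)"
    by (rule n2_CS_norm[OF l2_indicator(1)], rule l2_bound(1)[OF G, where C=1]) (auto simp: indicator_def)
   finally have "(norm (f (x + y) - f x))\<^sup>2 \<le> (sqrt y * n2 (%s. indicator {x..x+y} s *\<^sub>R g s))\<^sup>2"
    using y by (intro power_mono) (auto simp: l2_indicator)
   also have "\<dots> = y * (LINT s|lborel. (norm (indicator {x..x+y} s *\<^sub>R g s))\<^sup>2)"
    using y by (simp add: power_mult_distrib n2_sq)
   also have "(LINT s|lborel. (norm (indicator {x..x+y} s *\<^sub>R g s))\<^sup>2) = (LINT s|lborel. (norm (indicator {x..x+y} (s + x) *\<^sub>R g (s + x)))\<^sup>2)"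
    using integral_shift[of "%s. (norm (indicator {x..x+y} s *\<^sub>R g s))\<^sup>2" x] by simp
   also have "\<dots> = (LINT s|lborel. indicator {0..y} s * (norm (g (x + s)))\<^sup>2)"
    by (rule Bochner_Integration.integral_cong) (auto simp: indicator_def add.commute)
   finally show ?thesis .
  qed
  have "integrable (lborel \<Otimes>\<^sub>M lborel) (%(s,x). indicator {0..y} s * (norm (g (x + s)))\<^sup>2)"
  proof (rule lborel_pair.Fubini_integrable)
   show "AE s in lborel. integrable lborel (%x. (%(s,x). indicator {0..y} s * (norm (g (x + s)))\<^sup>2) (s, x))"
    using l2_int[OF l2_shift(1)[OF G]] by (intro AE_I2) simp
   have "(%s. LINT x|lborel. norm ((%(s,x). indicator {0..y} s * (norm (g (x + s)))\<^sup>2) (s, x))) = (%s. (n2 g)\<^sup>2 * indicator {0..y} s)"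
    using l2_shift(2)[OF G] by (auto simp: fun_eq_iff abs_mult simp flip: n2_sq)
   moreover have "integrable lborel (%s. (n2 g)\<^sup>2 * indicator {0..y} s :: real)"
    by (intro integrable_mult_right integrable_real_indicator) (auto simp: emeasure_lborel_Icc_eq)
   ultimately show "integrable lborel (%s. LINT x|lborel. norm ((%(s,x). indicator {0..y} s * (norm (g (x + s)))\<^sup>2) (s, x)))"
    by simp
  qed measurable
  note I = this
  have I1: "integrable lborel (%x. LINT s|lborel. indicator {0..y} s * (norm (g (x + s)))\<^sup>2)"
   using lborel_pair.integrable_snd[OF I] by simp
  have I2: "(LINT x|lborel. (LINT s|lborel. indicator {0..y} s * (norm (g (x + s)))\<^sup>2)) = y * (n2 g)\<^sup>2"
  proof -
   have "(LINT x|lborel. (LINT s|lborel. indicator {0..y} s * (norm (g (x + s)))\<^sup>2)) = (LINT s|lborel. (LINT x|lborel. indicator {0..y} s * (norm (g (x + s)))\<^sup>2))"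
    using lborel_pair.Fubini_integral[OF I] .
   also have "\<dots> = (LINT s|lborel. indicator {0..y} s * (n2 g)\<^sup>2)"
    using l2_shift(2)[OF G] by (simp flip: n2_sq)
   also have "\<dots> = y * (n2 g)\<^sup>2" using y by simp
   finally show ?thesis .
  qed
  have J: "integrable lborel (%x. (norm (f (x + y) - f x))\<^sup>2)"
   by (rule Bochner_Integration.integrable_bound[OF integrable_mult_right[OF I1, of y]]) (use pt order_trans[OF _ abs_ge_self] in \<open>auto intro!: AE_I2\<close>)
  have "(n2 (%x. f (x + y) - f x))\<^sup>2 \<le> (LINT x|lborel. y * (LINT s|lborel. indicator {0..y} s * (norm (g (x + s)))\<^sup>2))"
   unfolding n2_sq by (rule integral_mono[OF J integrable_mult_right[OF I1]]) (use pt in auto)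
  also have "\<dots> = (y * n2 g)\<^sup>2" using I2 by (simp add: power_mult_distrib power2_eq_square)
  finally have "n2 (%x. f (x + y) - f x) \<le> y * n2 g" using y by (simp add: power2_le_iff_abs_le)
  then show ?thesis using J by (simp add: l2_def)
 qed
 have neg: "l2 (%x. f (x + y) - f x) \<and> n2 (%x. f (x + y) - f x) \<le> - y * n2 g" if y: "y \<le> 0" for y
 proof -
  have a: "l2 (%x. f (x + - y) - f x)" "n2 (%x. f (x + - y) - f x) \<le> - y * n2 g" using pos[of "- y"] y by auto
  have "l2 (%x. f x - f (x + y))" "n2 (%x. f x - f (x + y)) = n2 (%x. f (x + - y) - f x)"
   using l2_shift[OF a(1), of y] by simp_all
  then show ?thesis using l2_minus[of "%x. f x - f (x + y)"] n2_commute[of f "%x. f (x + y)"] a(2) by simp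
 qed
 show "l2 (%x. f (x + y) - f x)" "n2 (%x. f (x + y) - f x) \<le> \<bar>y\<bar> * n2 g"
  using pos[of y] neg[of y] by (cases "0 \<le> y"; auto)+
qed

section \<open>Test functions\<close>

definition smooth :: "(real => real) => bool" where
 "smooth f \<longleftrightarrow> (\<forall>n. (deriv ^^ n) f differentiable_on UNIV)"

text \<open>A set of functions that differentiation maps into itself contains all higher derivatives
  of its members. Smoothness is thereby proved without formulas for the n-th derivative.\<close>

lemma smooth_coinduct:
 assumes S: "\<And>f. f \<in> S ==> \<exists>f'\<in>S. \<forall>x. (f has_real_derivative f' x) (at x)" and "f \<in> S"
 shows "smooth f"
proof -
 have "(deriv ^^ n) f \<in> S" for n
 proof (induction n)
  case (Suc n)
  then obtain f' where f': "f' \<in> S" "\<And>x. ((deriv ^^ n) f has_real_derivative f' x) (at x)"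
   using S by blast
  then have "deriv ((deriv ^^ n) f) = f'" by (intro ext DERIV_imp_deriv)
  then show ?case using f'(1) by simp
 qed (use assms(2) in simp)
 then show ?thesis
  unfolding smooth_def differentiable_on_def
  using S by (metis UNIV_I real_differentiable_def)
qed

lemma smooth_DERIV: "smooth f ==> (f has_real_derivative deriv f x) (at x)"
 unfolding smooth_def differentiable_on_def
 by (metis UNIV_I funpow_0 DERIV_deriv_iff_real_differentiable)

lemma smooth_deriv: "smooth f ==> smooth (deriv f)"
 unfolding smooth_def by (metis comp_apply funpow_Suc_right)

lemma smooth_cont: "smooth f ==> continuous_on S f"
 by (meson DERIV_isCont continuous_at_imp_continuous_on smooth_DERIV)

lemma smooth_const: "smooth (%x. c)"
 by (rule smooth_coinduct[where S="range (%c x. c)"]) (auto intro!: exI[of _ 0] bexI[of _ "%x. 0"])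

lemma smooth_antideriv:
 assumes "\<And>x. (F has_real_derivative f x) (at x)" "smooth f"
 shows "smooth F"
proof (rule smooth_coinduct[where S="insert F {f. smooth f}"])
 fix h assume h: "h \<in> insert F {f. smooth f}"
 show "\<exists>f'\<in>insert F {f. smooth f}. \<forall>x. (h has_real_derivative f' x) (at x)"
 proof (cases "h = F")
  case True then show ?thesis using assms by blast
 next
  case False then show ?thesis using h smooth_DERIV smooth_deriv by blast
 qed
qed simp

text \<open>The closure of the smooth functions under sums, products and reciprocals is mapped into
  itself by differentiation, hence consists of smooth functions. This is what makes the quotient in
  \<open>step\<close> smooth.\<close>

inductive_set salg :: "(real => real) set" where
 salg_smooth: "smooth f ==> f \<in> salg"
| salg_add: "f \<in> salg ==> g \<in> salg ==> (%x. f x + g x) \<in> salg"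
| salg_mult: "f \<in> salg ==> g \<in> salg ==> (%x. f x * g x) \<in> salg"
| salg_inverse: "f \<in> salg ==> (\<And>x. f x \<noteq> 0) ==> (%x. inverse (f x)) \<in> salg"

lemma salg_deriv: "f \<in> salg ==> \<exists>f'\<in>salg. \<forall>x. (f has_real_derivative f' x) (at x)"
proof (induction rule: salg.induct)
 case (salg_smooth f)
 then show ?case using smooth_DERIV smooth_deriv salg.salg_smooth by blast
next
 case (salg_add f g)
 then obtain f' g' where fg: "f' \<in> salg" "g' \<in> salg" "\<And>x. (f has_real_derivative f' x) (at x)" "\<And>x. (g has_real_derivative g' x) (at x)" by blast
 show ?case
  by (rule bexI[of _ "%x. f' x + g' x"]) (use fg in \<open>auto intro!: DERIV_add salg.salg_add\<close>)
next
 case (salg_mult f g)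
 then obtain f' g' where fg: "f' \<in> salg" "g' \<in> salg" "\<And>x. (f has_real_derivative f' x) (at x)" "\<And>x. (g has_real_derivative g' x) (at x)" by blast
 show ?case
  by (rule bexI[of _ "%x. f' x * g x + g' x * f x"]) (use fg salg_mult in \<open>auto intro!: DERIV_mult salg.salg_mult salg.salg_add\<close>)
next
 case (salg_inverse f)
 then obtain f' where f: "f' \<in> salg" "\<And>x. (f has_real_derivative f' x) (at x)" by blast
 have i: "(%x. inverse (f x)) \<in> salg" using salg_inverse salg.salg_inverse by blast
 show ?case
 proof (rule bexI[of _ "%x. -1 * (inverse (f x) * (f' x * inverse (f x)))"])
  show "(%x. -1 * (inverse (f x) * (f' x * inverse (f x)))) \<in> salg"
   by (intro salg.salg_mult i f salg.salg_smooth[OF smooth_const])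
  show "\<forall>x. ((%x. inverse (f x)) has_real_derivative -1 * (inverse (f x) * (f' x * inverse (f x)))) (at x)"
   using DERIV_inverse'[OF f(2)] salg_inverse by (simp add: mult.assoc)
 qed
qed

lemma salg_imp_smooth: "f \<in> salg ==> smooth f"
 by (rule smooth_coinduct[where S=salg], rule salg_deriv)

lemma smooth_add: "smooth f ==> smooth g ==> smooth (%x. f x + g x)"
 by (rule salg_imp_smooth[OF salg.salg_add[OF salg.salg_smooth salg.salg_smooth]])

lemma smooth_mult: "smooth f ==> smooth g ==> smooth (%x. f x * g x)"
 by (rule salg_imp_smooth[OF salg.salg_mult[OF salg.salg_smooth salg.salg_smooth]])

lemma smooth_inverse: "smooth f ==> (\<And>x. f x \<noteq> 0) ==> smooth (%x. inverse (f x))"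
 by (rule salg_imp_smooth[OF salg.salg_inverse[OF salg.salg_smooth]])

lemma smooth_cmult: "smooth f ==> smooth (%x. c * f x)"
 by (intro smooth_mult smooth_const)

lemma smooth_id: "smooth (%x. x)"
 by (rule smooth_antideriv[OF DERIV_ident smooth_const])

lemma smooth_affine:
 assumes "smooth f" shows "smooth (%x. f (a * x + b))"
proof (rule smooth_coinduct[where S="{%x. c * f (a * x + b) | c f. smooth f}"])
 fix h assume "h \<in> {%x. c * f (a * x + b) | c f. smooth f}"
 then obtain c f where h: "h = (%x. c * f (a * x + b))" "smooth f" by blast
 have "(h has_real_derivative (c * a) * deriv f (a * x + b)) (at x)" for x
  unfolding h(1) by (auto intro!: derivative_eq_intros DERIV_chain2[OF smooth_DERIV[OF h(2)]])
 then show "\<exists>f'\<in>{%x. c * f (a * x + b) | c f. smooth f}. \<forall>x. (h has_real_derivative f' x) (at x)"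
  using smooth_deriv[OF h(2)] by (intro bexI[of _ "%x. (c * a) * deriv f (a * x + b)"]) auto
next
 show "(%x. f (a * x + b)) \<in> {%x. c * f (a * x + b) | c f. smooth f}"
  using assms by (auto intro!: exI[of _ 1] exI[of _ f])
qed

lemma smooth_real_polynomial: "real_polynomial_function p ==> smooth p" for p :: "real => real"
proof (induction rule: real_polynomial_function.induct)
 case (linear f)
 then obtain c where "f = (%x. x * c)" using real_bounded_linear by blast
 then show ?case using smooth_mult[OF smooth_id smooth_const] by simp
qed (auto intro: smooth_const smooth_add smooth_mult)

section \<open>Flat functions, a smooth step and cutoffs\<close>

definition flat :: "real poly => real => real" where
 "flat p x = (if x > 0 then poly p (1 / x) * exp (- (1 / x)) else 0)"

lemma poly_exp_tendsto_0: "((%x. poly p x * exp (- x)) \<longlongrightarrow> (0::real)) at_top"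
proof -
 have "((%x. \<Sum>i\<le>degree p. coeff p i * (x ^ i / exp x)) \<longlongrightarrow> (\<Sum>i\<le>degree p. coeff p i * 0)) at_top"
  by (intro tendsto_intros tendsto_power_div_exp_0)
 then show ?thesis by (simp add: poly_altdef sum_distrib_right sum_divide_distrib exp_minus field_simps)
qed

text \<open>The functions p(1/x) exp(-1/x), extended by 0, are indexed by polynomials in order to be
  closed under differentiation: with t = 1/x the derivative is t^2 (p(t) - p'(t)) exp(-t). At the
  origin the difference quotient from the right is t p(t) exp(-t) as t grows.\<close>

lemma flat_deriv: "(flat p has_real_derivative flat ([:0,0,1:] * (p - pderiv p)) x) (at x)"
proof -
 consider "x < 0" | "x > 0" | "x = 0" by linarith
 then show ?thesis
 proof cases
  case 1
  have "eventually (%y. flat p y = 0) (nhds x)"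
   using eventually_nhds_in_open[of "{..<0}" x] 1 by (auto elim!: eventually_mono simp: flat_def)
  then have "(flat p has_real_derivative 0) (at x)"
   using DERIV_cong_ev[of x x "flat p" "%y. 0" 0 0] by simp
  then show ?thesis using 1 by (simp add: flat_def)
 next
  case 2
  have e: "eventually (%y. flat p y = poly p (1 / y) * exp (- (1 / y))) (nhds x)"
   using eventually_nhds_in_open[of "{0<..}" x] 2 by (auto elim!: eventually_mono simp: flat_def)
  have "((%y. poly p (1 / y) * exp (- (1 / y))) has_real_derivative
    (poly (pderiv p) (1 / x) * (- (1 / x\<^sup>2))) * exp (- (1 / x)) + (exp (- (1 / x)) * (1 / x\<^sup>2)) * poly p (1 / x)) (at x)"
   using 2 by (auto intro!: derivative_eq_intros DERIV_chain2[OF poly_DERIV] simp: power2_eq_square)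
  also have "(poly (pderiv p) (1 / x) * (- (1 / x\<^sup>2))) * exp (- (1 / x)) + (exp (- (1 / x)) * (1 / x\<^sup>2)) * poly p (1 / x)
    = flat ([:0,0,1:] * (p - pderiv p)) x"
   using 2 by (simp add: flat_def power2_eq_square field_simps)
  finally show ?thesis using DERIV_cong_ev[OF refl e refl] by simp
 next
  case 3
  have r: "((%h. flat p h / h) \<longlongrightarrow> 0) (at_right 0)"
  proof -
   have "((%x. poly (pCons 0 p) x * exp (- x)) \<longlongrightarrow> 0) at_top" by (rule poly_exp_tendsto_0)
   moreover have "eventually (%x. poly (pCons 0 p) x * exp (- x) = flat p (inverse x) / inverse x) at_top"
    using eventually_gt_at_top[of 0] by eventually_elim (simp add: flat_def field_simps)
   ultimately have "((%x. flat p (inverse x) / inverse x) \<longlongrightarrow> 0) at_top" using tendsto_cong by fast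
   then show ?thesis by (simp only: filterlim_at_right_to_top)
  qed
  have l: "((%h. flat p h / h) \<longlongrightarrow> 0) (at_left 0)"
   by (rule tendsto_eventually) (auto simp: eventually_at_left_field flat_def intro!: exI[of _ "-1"])
  have "((%h. flat p h / h) \<longlongrightarrow> 0) (at 0)"
   using filterlim_split_at[OF l r] .
  then show ?thesis using 3 by (simp add: DERIV_def flat_def[of _ 0])
 qed
qed

lemma smooth_flat: "smooth (flat p)"
 by (rule smooth_coinduct[where S="range flat"]) (use flat_deriv in blast)+

definition step :: "real => real" where
 "step x = flat 1 x * inverse (flat 1 x + flat 1 (1 - x))"

lemma step_denom_pos: "0 < flat 1 x + flat 1 (1 - x)"
 by (cases "0 < x"; cases "x < 1") (auto simp: flat_def add_pos_pos)

lemma smooth_step: "smooth step"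
proof -
 have "smooth (%x. flat 1 ((-1) * x + 1))" by (rule smooth_affine[OF smooth_flat])
 then have "smooth (%x. flat 1 x * inverse (flat 1 x + flat 1 (1 - x)))"
  using step_denom_pos by (intro smooth_mult smooth_inverse smooth_add smooth_flat) (auto simp: less_imp_neq[symmetric])
 then show ?thesis by (simp add: step_def[abs_def])
qed

lemma step_le_0: "x \<le> 0 ==> step x = 0"
 by (simp add: step_def flat_def)

lemma step_ge_1: "1 \<le> x ==> step x = 1"
 by (simp add: step_def flat_def)

lemma step_range: "0 \<le> step x" "step x \<le> 1"
proof -
 have n: "0 \<le> flat 1 y" for y by (simp add: flat_def)
 show "0 \<le> step x" unfolding step_def using n[of x] n[of "1 - x"] by simp
 show "step x \<le> 1" unfolding step_def using n[of x] n[of "1 - x"] step_denom_pos[of x] by (simp add: field_simps)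
qed

lemma test_fun_smooth: "test_fun \<phi> \<longleftrightarrow> smooth \<phi> \<and> bounded {x. \<phi> x \<noteq> 0}"
 by (simp add: test_fun_def smooth_def)

definition cutoff :: "real => real => real" where
 "cutoff R x = step (x + (R + 1)) * step ((R + 1) - x)"

lemma cutoff_range: "0 \<le> cutoff R x" "cutoff R x \<le> 1"
 using step_range mult_le_one[of "step (x + (R + 1))" "step ((R + 1) - x)"] by (auto simp: cutoff_def)

lemma cutoff_1: "\<bar>x\<bar> \<le> R ==> cutoff R x = 1"
 by (simp add: cutoff_def step_ge_1)

lemma cutoff_0: "R + 1 \<le> \<bar>x\<bar> ==> cutoff R x = 0"
 by (cases "0 \<le> x") (auto simp: cutoff_def step_le_0)

lemma smooth_cutoff: "smooth (cutoff R)"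
proof -
 have "smooth (%x. step (1 * x + (R + 1)) * step ((-1) * x + (R + 1)))"
  by (intro smooth_mult smooth_affine smooth_step)
 then show ?thesis by (simp add: cutoff_def[abs_def] algebra_simps)
qed

lemma test_funI: "smooth \<phi> ==> (\<And>x. M \<le> \<bar>x\<bar> ==> \<phi> x = 0) ==> test_fun \<phi>"
proof -
 assume a: "smooth \<phi>" "\<And>x. M \<le> \<bar>x\<bar> ==> \<phi> x = 0"
 have "{x. \<phi> x \<noteq> 0} \<subseteq> {-\<bar>M\<bar>..\<bar>M\<bar>}"
 proof
  fix x assume "x \<in> {x. \<phi> x \<noteq> 0}"
  then have "\<not> M \<le> \<bar>x\<bar>" using a(2) by blast
  then show "x \<in> {-\<bar>M\<bar>..\<bar>M\<bar>}" by auto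
 qed
 then show ?thesis using a(1) bounded_subset bounded_closed_interval unfolding test_fun_smooth by blast
qed

lemma test_fun_supp: assumes "test_fun \<phi>" obtains M where "M > 0" "\<And>x. M \<le> \<bar>x\<bar> ==> \<phi> x = 0"
proof -
 obtain B where "\<And>x. \<phi> x \<noteq> 0 ==> \<bar>x\<bar> \<le> B"
  using assms unfolding test_fun_smooth bounded_iff by auto
 then show ?thesis using that[of "\<bar>B\<bar> + 1"] by force
qed

lemma test_fun_cutoff_mult: "smooth f ==> test_fun (%x. f x * cutoff R x)"
 by (rule test_funI[of _ "R + 1"]) (auto intro: smooth_mult smooth_cutoff simp: cutoff_0)

lemma test_fun_deriv: assumes "test_fun \<phi>" shows "test_fun (deriv \<phi>)"
proof -
 obtain M where M: "M > 0" "\<And>x. M \<le> \<bar>x\<bar> ==> \<phi> x = 0" using test_fun_supp[OF assms] by blast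
 show ?thesis
 proof (rule test_funI[of _ "M + 1"])
  show "smooth (deriv \<phi>)" using assms smooth_deriv by (simp add: test_fun_smooth)
  fix x :: real assume x: "M + 1 \<le> \<bar>x\<bar>"
  have "eventually (%y. y \<in> {y. M < \<bar>y\<bar>}) (nhds x)"
   by (rule eventually_nhds_in_open) (use x in \<open>auto intro!: open_Collect_less continuous_intros\<close>)
  then have "eventually (%y. \<phi> y = 0) (nhds x)" by eventually_elim (use M in auto)
  then have "(\<phi> has_real_derivative 0) (at x)"
   using DERIV_cong_ev[of x x \<phi> "%y. 0" 0 0] by simp
  then show "deriv \<phi> x = 0" by (rule DERIV_imp_deriv)
 qed
qed

section \<open>Bounds for test functions and approximation by them\<close>

lemma cont_compact_supp:
 fixes f :: "real => real"
 assumes "continuous_on UNIV f" "\<And>x. M \<le> \<bar>x\<bar> ==> f x = 0"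
 shows "l2 f" "integrable lborel f" "\<exists>B. \<forall>x. \<bar>f x\<bar> \<le> B"
proof -
 have m [measurable]: "f \<in> borel_measurable borel" using assms(1) by (rule borel_measurable_continuous_onI)
 have "bounded (f ` {-M..M})"
  by (intro compact_imp_bounded compact_continuous_image) (use continuous_on_subset[OF assms(1)] in auto)
 then obtain B where B: "\<And>x. x \<in> {-M..M} ==> \<bar>f x\<bar> \<le> B" unfolding bounded_iff by (metis imageI real_norm_def)
 have b: "\<bar>f x\<bar> \<le> \<bar>B\<bar> * indicator {-M..M} x" for x
  using B[of x] assms(2)[of x] by (auto simp: indicator_def)
 show "l2 f" by (rule l2_bound(1)[OF l2_indicator(1)[of "-M" M], where C="\<bar>B\<bar>"]) (use b in \<open>auto simp: m\<close>)
 show "integrable lborel f"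
  by (rule Bochner_Integration.integrable_bound[where f="%x. \<bar>B\<bar> * indicator {-M..M} x :: real"])
    (use b in \<open>auto intro!: AE_I2 integrable_mult_right integrable_real_indicator simp: emeasure_lborel_Icc_eq abs_mult\<close>)
 show "\<exists>B. \<forall>x. \<bar>f x\<bar> \<le> B"
  by (rule exI[of _ "\<bar>B\<bar>"]) (intro allI order_trans[OF b], auto simp: indicator_def)
qed

lemma test_fun_l2: assumes "test_fun \<phi>" shows "l2 \<phi>" "integrable lborel \<phi>" "\<exists>B. \<forall>x. \<bar>\<phi> x\<bar> \<le> B" "continuous_on UNIV \<phi>"
proof -
 obtain M where M: "M > 0" "\<And>x. M \<le> \<bar>x\<bar> ==> \<phi> x = 0" using test_fun_supp[OF assms] by blast
 show c: "continuous_on UNIV \<phi>" using assms by (simp add: test_fun_smooth smooth_cont)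
 show "l2 \<phi>" "integrable lborel \<phi>" "\<exists>B. \<forall>x. \<bar>\<phi> x\<bar> \<le> B" using cont_compact_supp[OF c M(2)] by auto
qed

lemma test_fun_ac: assumes "test_fun \<phi>" shows "ac \<phi> (deriv \<phi>)"
 using assms smooth_DERIV smooth_cont smooth_deriv by (intro ac_DERIV) (auto simp: test_fun_smooth)

text \<open>Measurability supplies continuous functions converging almost everywhere. Clipped to
  [-1, 1], approximated by polynomials on [-(N+1), N+1] and multiplied by a cutoff, they become test
  functions. The bound 2 is 1 for the clipped function plus at most 1 for the polynomial
  error.\<close>

lemma bounded_measurable_test_approx:
 fixes s :: "real => real"
 assumes m: "s \<in> borel_measurable borel" and b: "\<And>x. \<bar>s x\<bar> \<le> 1" and z: "\<And>x. N < \<bar>x\<bar> ==> s x = 0"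
 obtains \<psi> where "\<And>n. test_fun (\<psi> n)" "\<And>n x. \<bar>\<psi> n x\<bar> \<le> 2" "\<And>n x. N + 1 \<le> \<bar>x\<bar> ==> \<psi> n x = 0"
  "AE x in lborel. (%n. \<psi> n x) \<longlonglongrightarrow> s x"
proof -
 have "s measurable_on UNIV"
  by (rule lebesgue_measurable_imp_measurable_on) (auto intro!: measurable_completion simp: m)
 then obtain Z g where Z: "negligible Z" and g: "\<And>n::nat. continuous_on UNIV (g n)"
  and lim: "\<And>x. x \<notin> Z ==> (%n. g n x) \<longlonglongrightarrow> s x"
  unfolding measurable_on_def by auto
 define h where "h n x = max (-1) (min 1 (g n x))" for n x
 have hc: "continuous_on S (h n)" for n S
  unfolding h_def by (intro continuous_on_max continuous_on_min continuous_on_const continuous_on_subset[OF g subset_UNIV])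
 have "\<exists>p. real_polynomial_function p \<and> (\<forall>x\<in>{-(N+1)..N+1}. \<bar>h n x - p x\<bar> < inverse (real (Suc n)))" for n
 proof -
  obtain q where "real_polynomial_function q" "\<And>x. x \<in> {-(N+1)..N+1} ==> \<bar>h n x - q x\<bar> < inverse (real (Suc n))"
   by (rule Stone_Weierstrass_real_polynomial_function[OF compact_Icc hc[of "{-(N+1)..N+1}" n], of "inverse (real (Suc n))"]) auto
  then show ?thesis by blast
 qed
 then obtain p where p: "\<And>n. real_polynomial_function (p n)" "\<And>n x. x \<in> {-(N+1)..N+1} ==> \<bar>h n x - p n x\<bar> < inverse (real (Suc n))"
  by metis
 define \<psi> where "\<psi> n x = p n x * cutoff N x" for n x
 have 1: "test_fun (\<psi> n)" for n unfolding \<psi>_def by (rule test_fun_cutoff_mult[OF smooth_real_polynomial[OF p(1)]])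
 have hb: "\<bar>h n x\<bar> \<le> 1" for n x by (auto simp: h_def)
 have 2: "\<bar>\<psi> n x\<bar> \<le> 2" for n x
 proof (cases "N + 1 \<le> \<bar>x\<bar>")
  case False
  then have "\<bar>h n x - p n x\<bar> < inverse (real (Suc n))" by (intro p(2)) auto
  also have "inverse (real (Suc n)) \<le> 1" by (simp add: inverse_le_1_iff)
  finally have "\<bar>h n x - p n x\<bar> < 1" .
  then have "\<bar>p n x\<bar> \<le> 2" using hb[of n x] by linarith
  then show ?thesis using cutoff_range[of N x] mult_mono[of "\<bar>p n x\<bar>" 2 "cutoff N x" 1] by (auto simp: \<psi>_def abs_mult)
 qed (simp add: \<psi>_def cutoff_0)
 have 3: "N + 1 \<le> \<bar>x\<bar> ==> \<psi> n x = 0" for n x by (simp add: \<psi>_def cutoff_0)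
 have 4: "(%n. \<psi> n x) \<longlonglongrightarrow> s x" if x: "x \<notin> Z" for x
 proof (cases "N + 1 \<le> \<bar>x\<bar>")
  case True
  then show ?thesis using z[of x] 3 by simp
 next
  case False
  have hl: "(%n. h n x) \<longlonglongrightarrow> s x"
  proof -
   have "(%n. h n x) \<longlonglongrightarrow> max (-1) (min 1 (s x))" unfolding h_def by (intro tendsto_intros lim x)
   moreover have "max (-1) (min 1 (s x)) = s x" using b[of x] by linarith
   ultimately show ?thesis by simp
  qed
  have "(%n. h n x - p n x) \<longlonglongrightarrow> 0"
   by (rule Lim_null_comparison[OF _ LIMSEQ_inverse_real_of_nat]) (use p(2)[of x] False in \<open>auto intro!: always_eventually less_imp_le simp: not_le abs_less_iff\<close>)
  from tendsto_diff[OF hl this] have "(%n. p n x) \<longlonglongrightarrow> s x" by simp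
  then have "(%n. \<psi> n x) \<longlonglongrightarrow> s x * cutoff N x" unfolding \<psi>_def by (intro tendsto_intros)
  then show ?thesis using z[of x] cutoff_1[of x N] by (cases "N < \<bar>x\<bar>") auto
 qed
 have "AE x in lebesgue. x \<notin> Z" using Z by (simp add: negligible_iff_null_sets AE_not_in)
 then have "AE x in lborel. x \<notin> Z" by (simp add: AE_completion_iff)
 then have "AE x in lborel. (%n. \<psi> n x) \<longlonglongrightarrow> s x" by eventually_elim (rule 4)
 then show ?thesis by (intro that[of \<psi>] 1 2 3)
qed

lemma n2_dominated:
 fixes f :: "nat => real => 'a::{real_normed_field,euclidean_space}" and w :: "real => real"
 assumes w: "l2 w" and m: "\<And>n. f n \<in> borel_measurable borel"
  and b: "\<And>n x. norm (f n x) \<le> w x" and lim: "AE x in lborel. (%n. f n x) \<longlonglongrightarrow> 0"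
 shows "(%n. n2 (f n)) \<longlonglongrightarrow> 0"
proof -
 note [measurable] = m
 have "(%n. LINT x|lborel. (norm (f n x))\<^sup>2) \<longlonglongrightarrow> (LINT x|(lborel :: real measure). (0 :: real))"
 proof (rule integral_dominated_convergence[where w="%x. (norm (w x))\<^sup>2"])
  show "AE x in lborel. (%n. (norm (f n x))\<^sup>2) \<longlonglongrightarrow> 0"
   using lim
  proof eventually_elim
   fix x assume "(%n. f n x) \<longlonglongrightarrow> 0"
   from tendsto_power[OF tendsto_norm[OF this], of 2] show "(%n. (norm (f n x))\<^sup>2) \<longlonglongrightarrow> 0" by simp
  qed
  show "AE x in lborel. norm ((norm (f n x))\<^sup>2) \<le> (norm (w x))\<^sup>2" for n
   by (intro AE_I2) (use b order_trans[OF b abs_ge_self] in \<open>auto intro!: power_mono\<close>)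
 qed (use l2_int[OF w] in auto)
 then have "(%n. LINT x|lborel. (norm (f n x))\<^sup>2) \<longlonglongrightarrow> 0" by simp
 from tendsto_real_sqrt[OF this] show ?thesis by (simp add: n2_def)
qed

lemma test_fun_add: "test_fun f ==> test_fun g ==> test_fun (%x. f x + g x)"
proof -
 assume a: "test_fun f" "test_fun g"
 obtain M where M: "M > 0" "\<And>x. M \<le> \<bar>x\<bar> ==> f x = 0" using test_fun_supp[OF a(1)] by blast
 obtain N where N: "N > 0" "\<And>x. N \<le> \<bar>x\<bar> ==> g x = 0" using test_fun_supp[OF a(2)] by blast
 show ?thesis by (rule test_funI[of _ "max M N"]) (use a M N in \<open>auto simp: test_fun_smooth intro: smooth_add\<close>)
qed

lemma test_fun_cmult: "test_fun f ==> test_fun (%x. c * f x)"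
proof -
 assume a: "test_fun f"
 obtain M where M: "M > 0" "\<And>x. M \<le> \<bar>x\<bar> ==> f x = 0" using test_fun_supp[OF a] by blast
 show ?thesis by (rule test_funI[of _ M]) (use a M in \<open>auto simp: test_fun_smooth intro: smooth_cmult\<close>)
qed

lemma test_fun_diff: "test_fun f ==> test_fun g ==> test_fun (%x. f x - g x)"
 using test_fun_add[OF _ test_fun_cmult[of g "-1"]] by simp

text \<open>The function is truncated to size and support N, and division by N brings it into the
  scope of \<open>bounded_measurable_test_approx\<close>. Both passages to the limit are dominated
  in L2.\<close>

lemma test_fun_dense_l2:
 fixes f :: "real => real"
 assumes f: "l2 f" and e: "0 < e"
 obtains u where "test_fun u" "n2 (%x. f x - u x) < e"
proof -
 note [measurable] = l2_meas'[OF f]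
 define F where "F n x = (if \<bar>x\<bar> \<le> real n \<and> \<bar>f x\<bar> \<le> real n then f x else 0)" for n x
 have Fm [measurable]: "F n \<in> borel_measurable borel" for n unfolding F_def by measurable
 have Fl: "l2 (F n)" for n by (rule l2_bound(1)[OF f, where C=1]) (auto simp: F_def)
 have "(%n. n2 (%x. f x - F n x)) \<longlonglongrightarrow> 0"
 proof (rule n2_dominated[where w="%x. norm (f x)"])
  show "AE x in lborel. (%n. f x - F n x) \<longlonglongrightarrow> 0"
  proof (rule AE_I2)
   fix x
   have "eventually (%n. \<bar>x\<bar> \<le> real n) sequentially" "eventually (%n. \<bar>f x\<bar> \<le> real n) sequentially"
    using filterlim_real_sequentially by (auto simp: filterlim_at_top)
   then have "eventually (%n. f x - F n x = 0) sequentially" by eventually_elim (auto simp: F_def)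
   then show "(%n. f x - F n x) \<longlonglongrightarrow> 0" by (rule tendsto_eventually)
  qed
 qed (use l2_norm[OF f] in \<open>auto simp: F_def\<close>)
 then have "eventually (%n. n2 (%x. f x - F n x) < e / 2) sequentially"
  using e by (intro order_tendstoD) auto
 then have "eventually (%n. n2 (%x. f x - F n x) < e / 2 \<and> n \<ge> 1) sequentially"
  by (intro eventually_conj eventually_ge_at_top)
 then obtain N where N: "n2 (%x. f x - F N x) < e / 2" "N \<ge> 1"
  using eventually_happens by fastforce
 obtain \<psi> where p: "\<And>n. test_fun (\<psi> n)" "\<And>n x. \<bar>\<psi> n x\<bar> \<le> 2" "\<And>n x. real N + 1 \<le> \<bar>x\<bar> ==> \<psi> n x = 0"
  "AE x in lborel. (%n. \<psi> n x) \<longlonglongrightarrow> F N x / real N"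
  by (rule bounded_measurable_test_approx[of "%x. F N x / real N" "real N"]) (use N(2) in \<open>auto simp: F_def\<close>)
 have pl: "l2 (%x. real N * \<psi> n x)" for n using test_fun_l2(1)[OF test_fun_cmult[OF p(1)]] .
 have "(%n. n2 (%x. F N x - real N * \<psi> n x)) \<longlonglongrightarrow> 0"
 proof (rule n2_dominated[where w="%x. (3 * real N) * indicator {-(real N + 1)..real N + 1} x"])
  show "AE x in lborel. (%n. F N x - real N * \<psi> n x) \<longlonglongrightarrow> 0"
   using p(4)
  proof eventually_elim
   fix x assume "(%n. \<psi> n x) \<longlonglongrightarrow> F N x / real N"
   then have "(%n. F N x - real N * \<psi> n x) \<longlonglongrightarrow> F N x - real N * (F N x / real N)" by (intro tendsto_intros)
   then show "(%n. F N x - real N * \<psi> n x) \<longlonglongrightarrow> 0" using N(2) by simp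
  qed
  show "norm (F N x - real N * \<psi> n x) \<le> 3 * real N * indicator {-(real N + 1)..real N + 1} x" for n x
  proof (cases "real N + 1 < \<bar>x\<bar>")
   case True
   then show ?thesis using p(3)[of x n] by (auto simp: F_def indicator_def)
  next
   case False
   have "\<bar>F N x\<bar> \<le> real N" by (auto simp: F_def)
   moreover have "\<bar>real N * \<psi> n x\<bar> \<le> real N * 2" unfolding abs_mult using p(2)[of n x] by (intro mult_mono) auto
   ultimately show ?thesis using False by (auto simp: indicator_def)
  qed
 qed (use pl l2_meas' in \<open>auto intro!: l2_cmult(1) l2_indicator\<close>)
 then have "eventually (%n. n2 (%x. F N x - real N * \<psi> n x) < e / 2) sequentially"
  using e by (intro order_tendstoD) auto
 then obtain n where n: "n2 (%x. F N x - real N * \<psi> n x) < e / 2"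
  using eventually_happens by fastforce
 have "n2 (%x. (f x - F N x) + (F N x - real N * \<psi> n x)) < e"
  using n2_triangle[OF l2_diff[OF f Fl[of N]] l2_diff[OF Fl[of N] pl[of n]]] n N by linarith
 then show ?thesis using that[OF test_fun_cmult[OF p(1)], of "real N" n] by simp
qed

lemma cont_antideriv:
 fixes f :: "real => real"
 assumes "continuous_on UNIV f"
 obtains F where "\<And>x. (F has_real_derivative f x) (at x)"
proof
 fix x :: real
 define R where "R = \<bar>x\<bar> + 1"
 have "((%u. LBINT y=ereal 0..ereal u. f y) has_vector_derivative f x) (at x within {-R..R})"
  by (rule interval_integral_FTC2) (use continuous_on_subset[OF assms] in \<open>auto simp: R_def\<close>)
 then show "((%u. LBINT y=ereal 0..ereal u. f y) has_real_derivative f x) (at x)"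
 proof -
  have "at x within {-R..R} = at x" by (rule at_within_interior) (auto simp: R_def)
  with \<open>((%u. LBINT y=ereal 0..ereal u. f y) has_vector_derivative f x) (at x within {-R..R})\<close>
  show ?thesis by (simp add: has_real_derivative_iff_has_vector_derivative)
 qed
qed

lemma ac_exists:
 fixes g :: "real => 'a::{real_normed_field,euclidean_space}"
 assumes m: "g \<in> borel_measurable borel" and i: "\<And>a b. set_integrable lborel {a..b} g"
 obtains F where "ac F g"
proof
 let ?F = "%x::real. LBINT y=ereal 0..ereal x. g y"
 have "?F b - ?F a = (LINT x:{a..b}|lborel. g x)" if ab: "a \<le> b" for a b
 proof -
  have il: "interval_lebesgue_integrable lborel (ereal c) (ereal d) g" if "c \<le> d" for c d
  proof -
   have "set_integrable lborel {c<..<d} g" by (rule set_integrable_subset[OF i[of c d]]) auto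
   then show ?thesis using that by (simp add: interval_lebesgue_integrable_def)
  qed
  have "(LBINT y=ereal 0..ereal a. g y) + (LBINT y=ereal a..ereal b. g y) = (LBINT y=ereal 0..ereal b. g y)"
   by (rule interval_integral_sum) (use il[of "min 0 (min a b)" "max 0 (max a b)"] in \<open>simp add: ereal_min[symmetric] ereal_max[symmetric] del: ereal_min ereal_max\<close>)
  moreover have "(LBINT y=ereal a..ereal b. g y) = (LINT x:{a..b}|lborel. g x)"
   using interval_integral_Icc[OF ab] by blast
  ultimately show ?thesis by (simp add: algebra_simps)
 qed
 then show "ac ?F g" using m i by (simp add: ac_def)
qed

text \<open>A primitive that starts at 0 in -M is constant beyond M, and this constant is the
  integral of \<psi>, here zero.\<close>

lemma test_fun_antideriv:
 assumes p: "test_fun \<psi>" and z: "(LINT x|lborel. \<psi> x) = 0" and M: "\<And>x. M \<le> \<bar>x\<bar> ==> \<psi> x = 0" "0 \<le> M"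
 obtains \<Psi> where "test_fun \<Psi>" "deriv \<Psi> = \<psi>" "\<And>x. M \<le> \<bar>x\<bar> ==> \<Psi> x = 0"
proof -
 obtain F where F: "\<And>x. (F has_real_derivative \<psi> x) (at x)" using cont_antideriv[OF test_fun_l2(4)[OF p]] by blast
 define \<Psi> where "\<Psi> x = F x - F (- M)" for x
 have D: "(\<Psi> has_real_derivative \<psi> x) (at x)" for x
  unfolding \<Psi>_def using DERIV_diff[OF F DERIV_const] by simp
 have A: "ac \<Psi> \<psi>" by (rule ac_DERIV[OF D test_fun_l2(4)[OF p]])
 have s0: "(LINT x:{a..b}|lborel. \<psi> x) = 0" if "b \<le> - M \<or> M \<le> a" for a b
 proof -
  have "(LINT x:{a..b}|lborel. \<psi> x) = (LINT x|(lborel::real measure). (0::real))"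
   unfolding set_lebesgue_integral_def by (rule Bochner_Integration.integral_cong) (use that M in \<open>auto simp: indicator_def\<close>)
  then show ?thesis by simp
 qed
 have sM: "(LINT x:{-M..M}|lborel. \<psi> x) = 0"
 proof -
  have "(LINT x:{-M..M}|lborel. \<psi> x) = (LINT x|lborel. \<psi> x)"
   unfolding set_lebesgue_integral_def proof (rule Bochner_Integration.integral_cong[OF refl])
   fix x show "indicat_real {- M..M} x *\<^sub>R \<psi> x = \<psi> x" using M(1)[of x] M(2) by (cases "M \<le> \<bar>x\<bar>") (auto simp: indicator_def)
  qed
  then show ?thesis using z by simp
 qed
 have 0: "\<Psi> x = 0" if "M \<le> \<bar>x\<bar>" for x
 proof (cases "x \<le> 0")
  case True
  then show ?thesis using ac_int[OF A, of x "- M"] s0[of "-M" x] that by (simp add: \<Psi>_def)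
 next
  case False
  then show ?thesis using ac_int[OF A, of "M" x] ac_int[OF A, of "-M" M] s0[of x M] that M(2) sM by (simp add: \<Psi>_def)
 qed
 show ?thesis
 proof (rule that[of \<Psi>])
  show "test_fun \<Psi>" using test_funI[of \<Psi> M] smooth_antideriv[OF D] p 0 by (auto simp: test_fun_smooth)
  show "deriv \<Psi> = \<psi>" using D by (intro ext DERIV_imp_deriv)
 qed (rule 0)
qed

lemma bump_exists:
 obtains \<beta> where "test_fun \<beta>" "(LINT x|lborel. \<beta> x) = 1" "\<And>x. 1 \<le> \<bar>x\<bar> ==> \<beta> x = 0"
proof -
 have t: "test_fun (%x. 1 * cutoff 0 x)" by (rule test_fun_cutoff_mult[OF smooth_const])
 have t': "test_fun (cutoff 0)" using t by simp
 define c where "c = (LINT x|lborel. cutoff 0 x)"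
 have A: "continuous_on UNIV (cutoff 0)" using test_fun_l2(4)[OF t'] .
 have "c \<noteq> 0"
 proof
  assume "c = 0"
  then have c0: "AE x in lborel. cutoff 0 x = 0"
   using integral_nonneg_eq_0_iff_AE[OF test_fun_l2(2)[OF t']] cutoff_range by (auto simp: c_def)
  have "\<exists>e>0. \<forall>x. dist x 0 < e --> cutoff 0 x > 0"
  proof -
   have "cutoff 0 0 = 1" by (rule cutoff_1) simp
   then obtain e where "e > 0" "\<And>x. dist x 0 < e ==> dist (cutoff 0 x) 1 < 1"
    using A unfolding continuous_on_iff by (metis UNIV_I zero_less_one)
   moreover from this have "cutoff 0 x > 0" if "dist x 0 < e" for x using that by (fastforce simp: dist_real_def)
   ultimately show ?thesis by blast
  qed
  then obtain e where e: "e > 0" "\<And>x. dist x 0 < e ==> cutoff 0 x > 0" by blast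
  from c0 have "AE x in lborel. x \<notin> {0<..<e}"
  proof eventually_elim
   fix x assume "cutoff 0 x = 0"
   then show "x \<notin> {0<..<e}" using e(2)[of x] by (auto simp: dist_real_def)
  qed
  then have "{0<..<e} \<in> null_sets lborel" by (simp add: AE_iff_null_sets)
  then show False using e(1) by (simp add: null_sets_def)
 qed
 then show ?thesis
  using that[of "%x. inverse c * cutoff 0 x"] test_fun_cmult[OF t'] by (simp add: c_def cutoff_0)
qed

text \<open>A cutoff is a product of a translate and a reflected translate of one fixed step, so the
  bound does not depend on R.\<close>

lemma cutoff_deriv_bounded: "\<exists>C\<ge>0. \<forall>R\<ge>0. \<forall>x. \<bar>deriv (cutoff R) x\<bar> \<le> C"
proof -
 have D: "(step has_real_derivative deriv step x) (at x)" for x using smooth_DERIV[OF smooth_step] .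
 have "bounded (deriv step ` {0..1})"
  by (intro compact_imp_bounded compact_continuous_image smooth_cont smooth_deriv smooth_step) auto
 then obtain B where B: "\<And>x. x \<in> {0..1} ==> \<bar>deriv step x\<bar> \<le> B" unfolding bounded_iff by (metis imageI real_norm_def)
 have 0: "deriv step x = 0" if "x < 0 \<or> 1 < x" for x
 proof -
  have "eventually (%y. step y = (if x < 0 then 0 else 1)) (nhds x)"
  proof (cases "x < 0")
   case True
   then show ?thesis using eventually_nhds_in_open[of "{..<0}" x] by (auto elim!: eventually_mono simp: step_le_0)
  next
   case False
   then show ?thesis using that eventually_nhds_in_open[of "{1<..}" x] by (auto elim!: eventually_mono simp: step_ge_1)
  qed
  then have "(step has_real_derivative 0) (at x)"
   using DERIV_cong_ev[of x x step "%y. if x < 0 then 0 else 1" 0 0] by simp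
  then show ?thesis by (rule DERIV_imp_deriv)
 qed
 have sb: "\<bar>deriv step x\<bar> \<le> \<bar>B\<bar>" for x using B[of x] 0[of x] by (cases "x \<in> {0..1}") auto
 have "\<bar>deriv (cutoff R) x\<bar> \<le> 2 * \<bar>B\<bar>" for R x
 proof -
  have "(cutoff R has_real_derivative deriv step (x + (R+1)) * step ((R+1) - x) + (- deriv step ((R+1) - x)) * step (x + (R+1))) (at x)"
   unfolding cutoff_def by (auto intro!: derivative_eq_intros DERIV_chain2[OF D])
  then have "deriv (cutoff R) x = deriv step (x + (R+1)) * step ((R+1) - x) + (- deriv step ((R+1) - x)) * step (x + (R+1))"
   by (rule DERIV_imp_deriv)
  moreover have "\<bar>deriv step a * step b\<bar> \<le> \<bar>B\<bar>" for a b
   using mult_mono[OF sb[of a] step_range(2)[of b]] step_range[of b] by (simp add: abs_mult)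
  then have "\<bar>deriv step (x + (R+1)) * step ((R+1) - x)\<bar> \<le> \<bar>B\<bar>" "\<bar>deriv step ((R+1) - x) * step (x + (R+1))\<bar> \<le> \<bar>B\<bar>" by auto
  ultimately show ?thesis by linarith
 qed
 then show ?thesis by (intro exI[of _ "2 * \<bar>B\<bar>"]) auto
qed

text \<open>The derivative is approximated in L2 and integrated back. The primitive has compact
  support only if the approximant has mean zero, so a multiple \<open>c\<close> of a unit bump is
  subtracted; \<open>c\<close> is small because the derivative \<open>G n\<close> of a compactly
  supported function itself has mean zero.\<close>

lemma test_fun_dense_h1:
 fixes f g :: "real => real"
 assumes A: "ac f g" and f: "l2 f" and g: "l2 g" and e: "0 < e"
 obtains u where "test_fun u" "n2 (%x. f x - u x) < e" "n2 (%x. g x - deriv u x) < e"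
proof -
 note [measurable] = l2_meas'[OF f] l2_meas'[OF g]
 obtain C where C: "C \<ge> 0" "\<And>R x. R \<ge> 0 ==> \<bar>deriv (cutoff R) x\<bar> \<le> C" using cutoff_deriv_bounded by blast
 have cm [measurable]: "cutoff R \<in> borel_measurable borel" "deriv (cutoff R) \<in> borel_measurable borel" for R
  by (intro borel_measurable_continuous_onI smooth_cont smooth_cutoff smooth_deriv)+
 have ct: "test_fun (cutoff R)" for R using test_fun_cutoff_mult[OF smooth_const[of 1], of R] by simp
 have cd0: "deriv (cutoff R) x = 0" if "\<bar>x\<bar> < R" for R x
 proof -
  have "eventually (%y. y \<in> {-R<..<R}) (nhds x)"
   by (rule eventually_nhds_in_open) (use that in auto)
  then have "eventually (%y. cutoff R y = 1) (nhds x)" by eventually_elim (auto intro!: cutoff_1)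
  then have "(cutoff R has_real_derivative 0) (at x)"
   using DERIV_cong_ev[of x x "cutoff R" "%y. 1" 0 0] by simp
  then show ?thesis by (rule DERIV_imp_deriv)
 qed
 define F where "F n x = f x * cutoff (real n) x" for n x
 define G where "G n x = g x * cutoff (real n) x + f x * deriv (cutoff (real n)) x" for n x
 have FA: "ac (F n) (G n)" for n
  unfolding F_def G_def by (rule ac_mult[OF A test_fun_ac[OF ct]])
 have F0: "real n + 1 \<le> \<bar>x\<bar> ==> F n x = 0" for n x by (simp add: F_def cutoff_0)
 have cut01: "\<bar>cutoff R x\<bar> \<le> 1" for R x using cutoff_range[of R x] by simp
 have lim1: "(%n. n2 (%x. f x - F n x)) \<longlonglongrightarrow> 0"
 proof (rule n2_dominated[where w="%x. 2 * norm (f x)"])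
  show "norm (f x - F n x) \<le> 2 * norm (f x)" for n x
   using mult_left_mono[OF cut01[of "real n" x], of "\<bar>f x\<bar>"] by (simp add: F_def abs_mult[symmetric])
  show "AE x in lborel. (%n. f x - F n x) \<longlonglongrightarrow> 0"
  proof (rule AE_I2)
   fix x
   have "eventually (%n. \<bar>x\<bar> \<le> real n) sequentially"
    using filterlim_real_sequentially by (auto simp: filterlim_at_top)
   then have "eventually (%n. f x - F n x = 0) sequentially" by eventually_elim (auto simp: F_def cutoff_1)
   then show "(%n. f x - F n x) \<longlonglongrightarrow> 0" by (rule tendsto_eventually)
  qed
 qed (use l2_cmult(1)[OF l2_norm[OF f], of 2] in \<open>auto simp: F_def\<close>)
 have lim2: "(%n. n2 (%x. g x - G n x)) \<longlonglongrightarrow> 0"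
 proof (rule n2_dominated[where w="%x. 2 * norm (g x) + C * norm (f x)"])
  show "norm (g x - G n x) \<le> 2 * norm (g x) + C * norm (f x)" for n x
  proof -
   have "\<bar>g x * cutoff (real n) x\<bar> \<le> \<bar>g x\<bar> * 1" unfolding abs_mult by (intro mult_left_mono cut01) simp
   moreover have "\<bar>f x * deriv (cutoff (real n)) x\<bar> \<le> \<bar>f x\<bar> * C" unfolding abs_mult by (intro mult_left_mono C) auto
   ultimately show ?thesis by (simp add: G_def mult.commute[of C])
  qed
  show "AE x in lborel. (%n. g x - G n x) \<longlonglongrightarrow> 0"
  proof (rule AE_I2)
   fix x
   have "eventually (%n. \<bar>x\<bar> + 1 \<le> real n) sequentially"
    using filterlim_real_sequentially by (auto simp: filterlim_at_top)
   then have "eventually (%n. g x - G n x = 0) sequentially"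
    by eventually_elim (auto simp: G_def cutoff_1 cd0)
   then show "(%n. g x - G n x) \<longlonglongrightarrow> 0" by (rule tendsto_eventually)
  qed
  show "l2 (%x. 2 * norm (g x) + C * norm (f x))"
   by (intro l2_add l2_cmult(1) l2_norm f g)
 qed (auto simp: G_def)
 have "eventually (%n. n2 (%x. f x - F n x) < e / 2) sequentially" "eventually (%n. n2 (%x. g x - G n x) < e / 2) sequentially"
  using e order_tendstoD(2)[OF lim1, of "e / 2"] order_tendstoD(2)[OF lim2, of "e / 2"] by simp_all
 then have "eventually (%n. n2 (%x. f x - F n x) < e / 2 \<and> n2 (%x. g x - G n x) < e / 2) sequentially"
  by (rule eventually_conj)
 then obtain n where n: "n2 (%x. f x - F n x) < e / 2" "n2 (%x. g x - G n x) < e / 2"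
  using eventually_happens by fastforce
 have Fl: "l2 (F n)" by (rule l2_bound(1)[OF f, where C=1]) (use mult_left_mono[OF cut01] ac_meas[OF FA] in \<open>auto simp: F_def abs_mult\<close>)
 have Gl: "l2 (G n)"
  unfolding G_def
  by (intro l2_add) (use l2_bdd_mult(1)[OF g, of "cutoff (real n)" 1] l2_bdd_mult(1)[OF f, of "deriv (cutoff (real n))" C] cut01 C in \<open>auto simp: mult.commute\<close>)
 define M where "M = real n + 2"
 have M: "M \<ge> 2" by (simp add: M_def)
 have G0: "G n x = 0" if "real n + 1 < \<bar>x\<bar>" for x
 proof -
  have "eventually (%y. y \<in> {y. real n + 1 < \<bar>y\<bar>}) (nhds x)"
   by (rule eventually_nhds_in_open) (use that in \<open>auto intro!: open_Collect_less continuous_intros\<close>)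
  then have "eventually (%y. cutoff (real n) y = 0) (nhds x)" by eventually_elim (auto intro!: cutoff_0)
  then have "(cutoff (real n) has_real_derivative 0) (at x)"
   using DERIV_cong_ev[of x x "cutoff (real n)" "%y. 0" 0 0] by simp
  then have "deriv (cutoff (real n)) x = 0" by (rule DERIV_imp_deriv)
  then show ?thesis using that by (simp add: G_def cutoff_0)
 qed
 obtain \<beta> where \<beta>: "test_fun \<beta>" "(LINT x|lborel. \<beta> x) = 1" "\<And>x. 1 \<le> \<bar>x\<bar> ==> \<beta> x = 0" using bump_exists by blast
 \<comment> \<open>\<open>K\<close> is the loss from restoring mean zero: the error itself plus |c|
   times the norm of the bump, with |c| bounded by Cauchy-Schwarz on a window of length 2 M.
   Integrating back costs a further factor 2 M, and \<open>d\<close> is chosen so that the errors K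
   d of the derivative and 2 M K d of the function add up to e / 2.\<close>
 define K where "K = 1 + sqrt (2 * M) * n2 \<beta>"
 have K: "K \<ge> 1" using M by (simp add: K_def)
 define d where "d = e / (2 * K * (1 + 2 * M))"
 have d: "d > 0" using e K M by (simp add: d_def)
 obtain \<psi>0 where \<psi>0: "test_fun \<psi>0" "n2 (%x. G n x - \<psi>0 x) < d" using test_fun_dense_l2[OF Gl d] .
 define \<psi>1 where "\<psi>1 x = \<psi>0 x * cutoff (real n + 1) x" for x
 have t1: "test_fun \<psi>1" unfolding \<psi>1_def using \<psi>0(1) by (intro test_fun_cutoff_mult) (simp add: test_fun_smooth)
 note [measurable] = l2_meas'[OF test_fun_l2(1)[OF \<psi>0(1)]] l2_meas'[OF test_fun_l2(1)[OF t1]] l2_meas'[OF Gl]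
 have z1: "\<psi>1 x = 0" if "M \<le> \<bar>x\<bar>" for x using that by (simp add: \<psi>1_def cutoff_0 M_def)
 have d1: "l2 (%x. G n x - \<psi>1 x)" by (intro l2_diff Gl test_fun_l2(1)[OF t1])
 have n1: "n2 (%x. G n x - \<psi>1 x) \<le> 1 * n2 (%x. G n x - \<psi>0 x)"
 proof (rule l2_bound(2)[OF l2_diff[OF Gl test_fun_l2(1)[OF \<psi>0(1)]]])
  show "norm (G n x - \<psi>1 x) \<le> 1 * norm (G n x - \<psi>0 x)" for x
  proof (cases "real n + 1 < \<bar>x\<bar>")
   case True
   then show ?thesis using mult_left_mono[OF cut01[of "real n + 1" x], of "\<bar>\<psi>0 x\<bar>"] by (simp add: G0 \<psi>1_def abs_mult)
  qed (simp add: \<psi>1_def cutoff_1)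
 qed auto
 define c where "c = (LINT x|lborel. \<psi>1 x)"
 have Gint: "(LINT x:{-M..M}|lborel. G n x) = 0"
  using ac_int[OF FA, of "-M" M n] M F0[of n M] F0[of n "-M"] by (simp add: M_def)
 have cle: "\<bar>c\<bar> \<le> sqrt (2 * M) * n2 (%x. G n x - \<psi>1 x)"
 proof -
  have "c = (LINT x:{-M..M}|lborel. \<psi>1 x)"
   unfolding set_lebesgue_integral_def c_def
  proof (rule Bochner_Integration.integral_cong[OF refl])
   fix x show "\<psi>1 x = indicat_real {- M..M} x *\<^sub>R \<psi>1 x" using z1[of x] by (cases "M \<le> \<bar>x\<bar>") (auto simp: indicator_def)
  qed
  then have "- c = (LINT x:{-M..M}|lborel. G n x - \<psi>1 x)"
   using Gint l2_set_integrable[OF Gl] l2_set_integrable[OF test_fun_l2(1)[OF t1]] by (simp add: set_integral_diff)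
  then have "\<bar>c\<bar> \<le> (LINT x:{-M..M}|lborel. norm (G n x - \<psi>1 x))"
   using set_integral_norm_bound[OF l2_set_integrable[OF d1], of "-M" M] by simp
  then show ?thesis using n2_set_CS[OF d1, of "-M" M] M by simp
 qed
 define \<psi> where "\<psi> x = \<psi>1 x - c * \<beta> x" for x
 have t: "test_fun \<psi>" unfolding \<psi>_def by (intro test_fun_diff test_fun_cmult t1 \<beta>)
 have zi: "(LINT x|lborel. \<psi> x) = 0"
  unfolding \<psi>_def using test_fun_l2(2)[OF t1] test_fun_l2(2)[OF \<beta>(1)] \<beta>(2) by (simp add: c_def)
 have zs: "\<psi> x = 0" if "M \<le> \<bar>x\<bar>" for x using z1[OF that] \<beta>(3)[of x] that M by (simp add: \<psi>_def)
 obtain u where u: "test_fun u" "deriv u = \<psi>" "\<And>x. M \<le> \<bar>x\<bar> ==> u x = 0"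
  using test_fun_antideriv[OF t zi zs] M by (metis order_trans zero_le_numeral)
 have dl: "l2 (%x. G n x - \<psi> x)" by (intro l2_diff Gl test_fun_l2(1)[OF t])
 have b\<psi>: "n2 (%x. G n x - \<psi> x) \<le> K * d"
 proof -
  have "n2 (%x. (G n x - \<psi>1 x) + c * \<beta> x) \<le> n2 (%x. G n x - \<psi>1 x) + n2 (%x. c * \<beta> x)"
   by (intro n2_triangle d1 l2_cmult(1) test_fun_l2(1) \<beta>)
  also have "n2 (%x. c * \<beta> x) = \<bar>c\<bar> * n2 \<beta>" using l2_cmult(2)[OF test_fun_l2(1)[OF \<beta>(1)]] by simp
  also have "\<bar>c\<bar> * n2 \<beta> \<le> (sqrt (2 * M) * n2 (%x. G n x - \<psi>1 x)) * n2 \<beta>" by (intro mult_right_mono cle) simp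
  also have "n2 (%x. G n x - \<psi>1 x) + (sqrt (2 * M) * n2 (%x. G n x - \<psi>1 x)) * n2 \<beta> = K * n2 (%x. G n x - \<psi>1 x)"
   by (simp add: K_def algebra_simps)
  also have "\<dots> \<le> K * d" using n1 \<psi>0(2) K by (intro mult_left_mono) auto
  finally show ?thesis by (simp add: \<psi>_def algebra_simps)
 qed
 have D: "ac (%x. F n x - u x) (%x. G n x - \<psi> x)"
  using ac_diff[OF FA test_fun_ac[OF u(1)]] by (simp add: u(2))
 have pw: "\<bar>F n x - u x\<bar> \<le> sqrt (2 * M) * (K * d)" for x
 proof (cases "M \<le> \<bar>x\<bar>")
  case True
  then show ?thesis using u(3)[of x] F0[of n x] K d M by (simp add: M_def)
 next
  case False
  have "\<bar>F n x - u x\<bar> \<le> sqrt \<bar>x - (-M)\<bar> * n2 (%x. G n x - \<psi> x)"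
   using ac_l2_le[OF D dl, of x "-M"] u(3)[of "-M"] F0[of n "-M"] M by (simp add: M_def)
  also have "\<dots> \<le> sqrt (2 * M) * (K * d)"
   using False by (intro mult_mono b\<psi>) auto
  finally show ?thesis .
 qed
 have "n2 (%x. F n x - u x) \<le> (sqrt (2 * M) * (K * d)) * n2 (%x. indicator {-M..M} x :: real)"
 proof (rule l2_bound(2)[OF l2_indicator(1)])
  show "(%x. F n x - u x) \<in> borel_measurable borel" using ac_meas[OF D] .
  show "norm (F n x - u x) \<le> sqrt (2 * M) * (K * d) * norm (indicat_real {- M..M} x)" for x
   using pw[of x] u(3)[of x] F0[of n x] by (cases "M \<le> \<bar>x\<bar>") (auto simp: M_def indicator_def)
  show "0 \<le> sqrt (2 * M) * (K * d)" using K d M by simp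
 qed
 also have "\<dots> = 2 * M * (K * d)" using M by (simp add: l2_indicator real_sqrt_mult_self algebra_simps)
 finally have b1: "n2 (%x. F n x - u x) \<le> 2 * M * (K * d)" .
 have "K * (e / (2 * K * P)) * P = e / 2" if "P \<noteq> 0" for P using K that by (simp add: field_simps)
 from this[of "1 + 2 * M"] have "K * d * (1 + 2 * M) = e / 2" using M unfolding d_def by linarith
 then have Kd: "K * d + 2 * M * (K * d) = e / 2" by (simp add: algebra_simps)
 have Kd0: "0 \<le> K * d" "0 \<le> 2 * M * (K * d)" using K d M by auto
 have "n2 (%x. (f x - F n x) + (F n x - u x)) < e"
 proof -
  have "2 * M * (K * d) \<le> e / 2" using Kd Kd0 by linarith
  then show ?thesis using n2_triangle[OF l2_diff[OF f Fl] l2_diff[OF Fl test_fun_l2(1)[OF u(1)]]] n(1) b1 by linarith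
 qed
 moreover have "n2 (%x. (g x - G n x) + (G n x - \<psi> x)) < e"
 proof -
  have "K * d \<le> e / 2" using Kd Kd0 by linarith
  then show ?thesis using n2_triangle[OF l2_diff[OF g Gl] dl] n(2) b\<psi> by linarith
 qed
 ultimately show ?thesis using that[OF u(1)] by (simp add: u(2))
qed

section \<open>Weak derivatives\<close>

lemma set_integrable_mult_supp:
 fixes g :: "real => complex" and \<phi> :: "real => real"
 assumes g: "\<And>a b. set_integrable lborel {a..b} g" and gm: "g \<in> borel_measurable borel"
  and c: "continuous_on UNIV \<phi>" and z: "\<And>x. M \<le> \<bar>x\<bar> ==> \<phi> x = 0"
 shows "integrable lborel (%x. g x * complex_of_real (\<phi> x))"
proof -
 have m: "\<phi> \<in> borel_measurable borel" using c by (rule borel_measurable_continuous_onI)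
 have "set_integrable lborel {-M..M} (%x. g x * complex_of_real (\<phi> x))"
  by (rule set_integrable_mult_cont[OF g])
    (use gm m continuous_on_subset[OF c] in \<open>auto intro!: continuous_on_of_real\<close>)
 moreover have "indicator {-M..M} x *\<^sub>R (g x * complex_of_real (\<phi> x)) = g x * complex_of_real (\<phi> x)" for x
  using z[of x] by (cases "M \<le> \<bar>x\<bar>") (auto simp: indicator_def)
 ultimately show ?thesis by (simp add: set_integrable_def)
qed

lemma loc_int_test:
 assumes "loc_int g" "test_fun \<phi>"
 shows "integrable lborel (%x. g x * complex_of_real (\<phi> x))"
proof -
 obtain M where "M > 0" "\<And>x. M \<le> \<bar>x\<bar> ==> \<phi> x = 0" using test_fun_supp[OF assms(2)] by blast
 then show ?thesis
  using assms test_fun_l2(4)[OF assms(2)] by (intro set_integrable_mult_supp[where M=M]) (auto simp: loc_int_def)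
qed

lemma ac_loc_int:
 fixes f g :: "real => complex"
 assumes "ac f g" shows "loc_int f" "loc_int g"
proof -
 have "set_integrable lborel {a..b} f" for a b
  unfolding set_integrable_def by (intro borel_integrable_compact ac_cont[OF assms]) auto
 then show "loc_int f" using ac_meas[OF assms] by (simp add: loc_int_def)
 show "loc_int g" using ac_meas_deriv[OF assms] ac_set_integrable[OF assms] by (simp add: loc_int_def)
qed

lemma ac_test_parts:
 fixes f g :: "real => complex"
 assumes A: "ac f g" and t: "test_fun \<phi>"
 shows "(LINT x|lborel. f x * complex_of_real (deriv \<phi> x)) = - (LINT x|lborel. g x * complex_of_real (\<phi> x))"
proof -
 obtain M where M: "M > 0" "\<And>x. M \<le> \<bar>x\<bar> ==> \<phi> x = 0" using test_fun_supp[OF t] by blast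
 have P: "ac (%x. f x * complex_of_real (\<phi> x)) (%x. g x * complex_of_real (\<phi> x) + f x * complex_of_real (deriv \<phi> x))"
  by (rule ac_mult[OF A ac_of_real[OF test_fun_ac[OF t]]])
 have i1: "integrable lborel (%x. g x * complex_of_real (\<phi> x))"
  by (rule loc_int_test[OF ac_loc_int(2)[OF A] t])
 have i2: "integrable lborel (%x. f x * complex_of_real (deriv \<phi> x))"
  by (rule loc_int_test[OF ac_loc_int(1)[OF A] test_fun_deriv[OF t]])
 have "((%x. f x * complex_of_real (\<phi> x)) \<longlongrightarrow> 0) at_top"
  by (rule tendsto_eventually, rule eventually_mono[OF eventually_ge_at_top[of M]]) (use M in auto)
 moreover have "((%x. f x * complex_of_real (\<phi> x)) \<longlongrightarrow> 0) at_bot"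
  by (rule tendsto_eventually, rule eventually_mono[OF eventually_le_at_bot[of "-M"]]) (use M in auto)
 ultimately have "(LINT x|lborel. g x * complex_of_real (\<phi> x) + f x * complex_of_real (deriv \<phi> x)) = 0"
  using ac_l2_integral_deriv_0[OF P] i1 i2 by auto
 then have "(LINT x|lborel. f x * complex_of_real (deriv \<phi> x)) + (LINT x|lborel. g x * complex_of_real (\<phi> x)) = 0"
  using i1 i2 by (simp add: add.commute)
 then show ?thesis by (simp only: eq_neg_iff_add_eq_0)
qed

lemma ac_has_weak_deriv:
 assumes "ac f g" shows "has_weak_deriv f g"
 using ac_loc_int[OF assms] ac_test_parts[OF assms] by (simp add: has_weak_deriv_def)

text \<open>Testing against approximations of the sign of \<open>g\<close>, cut off to [-N, N],
  gives the integral of |g| over that interval in the limit. Dominated convergence applies because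
  the approximations are bounded with a common support.\<close>

lemma AE_zero_if_test_orthogonal_real:
 fixes g :: "real => real"
 assumes m [measurable]: "g \<in> borel_measurable borel" and i: "\<And>a b. set_integrable lborel {a..b} g"
  and o: "\<And>\<phi>. test_fun \<phi> ==> (LINT x|lborel. g x * \<phi> x) = 0"
 shows "AE x in lborel. g x = 0"
proof -
 have "AE x in lborel. x \<in> {- real N..real N} --> g x = 0" for N
 proof -
  define s where "s x = (if \<bar>x\<bar> \<le> real N then sgn (g x) else 0)" for x
  have sm: "s \<in> borel_measurable borel" unfolding s_def by measurable
  obtain \<psi> where p: "\<And>n. test_fun (\<psi> n)" "\<And>n x. \<bar>\<psi> n x\<bar> \<le> 2" "\<And>n x. real N + 1 \<le> \<bar>x\<bar> ==> \<psi> n x = 0"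
   "AE x in lborel. (%n. \<psi> n x) \<longlonglongrightarrow> s x"
   by (rule bounded_measurable_test_approx[OF sm, of "real N"]) (auto simp: s_def sgn_if)
  have pm [measurable]: "\<psi> n \<in> borel_measurable borel" for n using l2_meas'[OF test_fun_l2(1)[OF p(1)]] .
  have w: "integrable lborel (%x. indicator {-(real N+1)..real N+1} x *\<^sub>R (2 * \<bar>g x\<bar>))"
   using integrable_mult_right[of 2, OF set_integrable_abs[OF i[of "-(real N+1)" "real N+1"], unfolded set_integrable_def]] by (simp add: mult.left_commute)
  note [measurable] = sm
  have lim: "(%n. LINT x|lborel. g x * \<psi> n x) \<longlonglongrightarrow> (LINT x|lborel. g x * s x)" and gs: "integrable lborel (%x. g x * s x)"
  proof -
   have a: "AE x in lborel. (%n. g x * \<psi> n x) \<longlonglongrightarrow> g x * s x"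
    using p(4) by eventually_elim (intro tendsto_intros)
   have b: "AE x in lborel. norm (g x * \<psi> n x) \<le> indicator {-(real N+1)..real N+1} x *\<^sub>R (2 * \<bar>g x\<bar>)" for n
   proof (rule AE_I2)
    fix x show "norm (g x * \<psi> n x) \<le> indicator {-(real N+1)..real N+1} x *\<^sub>R (2 * \<bar>g x\<bar>)"
     using p(3)[of x n] mult_left_mono[OF p(2)[of n x], of "\<bar>g x\<bar>"]
     by (cases "real N + 1 \<le> \<bar>x\<bar>") (auto simp: indicator_def abs_mult mult.commute)
   qed
   show "(%n. LINT x|lborel. g x * \<psi> n x) \<longlonglongrightarrow> (LINT x|lborel. g x * s x)"
    by (rule integral_dominated_convergence[OF _ _ w a b]) auto
   show "integrable lborel (%x. g x * s x)"
    by (rule integrable_dominated_convergence[OF _ _ w a b]) auto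
  qed
  have "(LINT x|lborel. g x * s x) = 0" using lim unfolding o[OF p(1)] by (simp add: LIMSEQ_const_iff)
  moreover have nn: "0 \<le> g x * s x" for x by (simp add: s_def sgn_if)
  ultimately have "AE x in lborel. g x * s x = 0" using integral_nonneg_eq_0_iff_AE[OF gs] by simp
  then show ?thesis by eventually_elim (auto simp: s_def sgn_if split: if_splits)
 qed
 then have "AE x in lborel. \<forall>N::nat. x \<in> {- real N..real N} --> g x = 0" unfolding AE_all_countable by blast
 then show ?thesis
 proof eventually_elim
  fix x :: real assume a: "\<forall>N::nat. x \<in> {- real N..real N} --> g x = 0"
  obtain N where "\<bar>x\<bar> \<le> real N" using real_arch_simple by blast
  then show "g x = 0" using a by (auto simp: abs_le_iff)
 qed
qed

lemma AE_zero_if_test_orthogonal: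
 fixes g :: "real => complex"
 assumes g: "loc_int g" and o: "\<And>\<phi>. test_fun \<phi> ==> (LINT x|lborel. g x * complex_of_real (\<phi> x)) = 0"
 shows "AE x in lborel. g x = 0"
proof -
 have [measurable]: "g \<in> borel_measurable borel" using g by (simp add: loc_int_def)
 have i: "integrable lborel (%x. indicat_real {a..b} x *\<^sub>R g x)" for a b using g by (simp add: loc_int_def set_integrable_def)
 have "AE x in lborel. Re (g x) = 0"
 proof (rule AE_zero_if_test_orthogonal_real)
  show "set_integrable lborel {a..b} (%x. Re (g x))" for a b
   using integrable_Re[OF i[of a b]] by (simp add: set_integrable_def)
  show "(LINT x|lborel. Re (g x) * \<phi> x) = 0" if "test_fun \<phi>" for \<phi>
   using integral_Re[OF loc_int_test[OF g that]] o[OF that] by simp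
 qed measurable
 moreover have "AE x in lborel. Im (g x) = 0"
 proof (rule AE_zero_if_test_orthogonal_real)
  show "set_integrable lborel {a..b} (%x. Im (g x))" for a b
   using integrable_Im[OF i[of a b]] by (simp add: set_integrable_def)
  show "(LINT x|lborel. Im (g x) * \<phi> x) = 0" if "test_fun \<phi>" for \<phi>
   using integral_Im[OF loc_int_test[OF g that]] o[OF that] by simp
 qed measurable
 ultimately show ?thesis by eventually_elim (simp add: complex_eq_iff)
qed

lemma loc_int_diff: "loc_int f ==> loc_int g ==> loc_int (%x. f x - g x)"
 unfolding loc_int_def by (simp add: set_integral_diff(1) borel_measurable_diff)

lemma weak_deriv_unique:
 assumes "has_weak_deriv f g" "has_weak_deriv f h"
 shows "AE x in lborel. g x = h x"
proof -
 have l: "loc_int g" "loc_int h" using assms by (auto simp: has_weak_deriv_def)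
 have "AE x in lborel. g x - h x = 0"
 proof (rule AE_zero_if_test_orthogonal[OF loc_int_diff[OF l]])
  fix \<phi> assume t: "test_fun \<phi>"
  show "(LINT x|lborel. (g x - h x) * complex_of_real (\<phi> x)) = 0"
   using assms t loc_int_test[OF l(1) t] loc_int_test[OF l(2) t] by (auto simp: has_weak_deriv_def left_diff_distrib)
 qed
 then show ?thesis by eventually_elim simp
qed

text \<open>\<open>wderiv\<close> is an arbitrary choice among weak derivatives, so it is accessible
  only up to null sets.\<close>

lemma wderiv_AE:
 assumes "has_weak_deriv f g"
 shows "AE x in lborel. wderiv f x = g x" "wderiv f \<in> borel_measurable borel"
proof -
 have w: "has_weak_deriv f (wderiv f)" unfolding wderiv_def using someI[of "has_weak_deriv f" g] assms by simp
 show "AE x in lborel. wderiv f x = g x" by (rule weak_deriv_unique[OF w assms])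
 show "wderiv f \<in> borel_measurable borel" using w by (simp add: has_weak_deriv_def loc_int_def)
qed

text \<open>The du Bois-Reymond argument: \<open>f\<close> minus a primitive of \<open>g\<close>
  annihilates the derivatives of all test functions, and a test function minus its integral times a
  unit bump is such a derivative. Hence the difference is almost everywhere the constant
  \<open>c\<close>.\<close>

lemma weak_deriv_ac_representative:
 assumes W: "has_weak_deriv f g"
 obtains F where "ac F g" "AE x in lborel. f x = F x"
proof -
 have f: "loc_int f" and g: "loc_int g" using W by (auto simp: has_weak_deriv_def)
 obtain F where F: "ac F g" using ac_exists[of g] g by (auto simp: loc_int_def)
 define h where "h x = f x - F x" for x
 have h: "loc_int h" unfolding h_def by (rule loc_int_diff[OF f ac_loc_int(1)[OF F]])
 have hd: "(LINT x|lborel. h x * complex_of_real (deriv \<phi> x)) = 0" if t: "test_fun \<phi>" for \<phi>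
  using W ac_test_parts[OF F t] t loc_int_test[OF f test_fun_deriv[OF t]] loc_int_test[OF ac_loc_int(1)[OF F] test_fun_deriv[OF t]]
  by (simp add: has_weak_deriv_def h_def left_diff_distrib)
 obtain \<beta> where \<beta>: "test_fun \<beta>" "(LINT x|lborel. \<beta> x) = 1" "\<And>x. 1 \<le> \<bar>x\<bar> ==> \<beta> x = 0" using bump_exists by blast
 define c where "c = (LINT x|lborel. h x * complex_of_real (\<beta> x))"
 have "AE x in lborel. h x - c = 0"
 proof (rule AE_zero_if_test_orthogonal)
  have cl: "loc_int (%x. c)" using ac_loc_int(1)[OF ac_const] .
  show "loc_int (%x. h x - c)" by (rule loc_int_diff[OF h cl])
  fix \<psi> assume t: "test_fun \<psi>"
  obtain M where M: "M > 0" "\<And>x. M \<le> \<bar>x\<bar> ==> \<psi> x = 0" using test_fun_supp[OF t] by blast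
  define a where "a = (LINT x|lborel. \<psi> x)"
  have t2: "test_fun (%x. \<psi> x - a * \<beta> x)" by (intro test_fun_diff test_fun_cmult t \<beta>)
  have z2: "(LINT x|lborel. \<psi> x - a * \<beta> x) = 0"
   using test_fun_l2(2)[OF t] test_fun_l2(2)[OF \<beta>(1)] \<beta>(2) by (simp add: a_def)
  obtain \<Psi> where P: "test_fun \<Psi>" "deriv \<Psi> = (%x. \<psi> x - a * \<beta> x)"
  proof (rule test_fun_antideriv[OF t2 z2])
   show "\<psi> x - a * \<beta> x = 0" if "max M 1 \<le> \<bar>x\<bar>" for x using M(2)[of x] \<beta>(3)[of x] that by simp
  qed auto
  have "(LINT x|lborel. h x * complex_of_real (\<psi> x)) - of_real a * c = (LINT x|lborel. h x * complex_of_real (\<psi> x) - of_real a * (h x * complex_of_real (\<beta> x)))"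
   using loc_int_test[OF h t] loc_int_test[OF h \<beta>(1)] by (simp add: c_def)
  also have "\<dots> = (LINT x|lborel. h x * complex_of_real (deriv \<Psi> x))"
   by (rule Bochner_Integration.integral_cong) (simp_all add: P(2) algebra_simps)
  also have "\<dots> = 0" by (rule hd[OF P(1)])
  finally have e: "(LINT x|lborel. h x * complex_of_real (\<psi> x)) = of_real a * c" by simp
  have "(LINT x|lborel. c * complex_of_real (\<psi> x)) = c * complex_of_real a"
   by (simp add: a_def integral_complex_of_real)
  then show "(LINT x|lborel. (h x - c) * complex_of_real (\<psi> x)) = 0"
   using e loc_int_test[OF h t] loc_int_test[OF cl t] by (auto simp: left_diff_distrib)
 qed
 then have "AE x in lborel. f x = F x + c" by eventually_elim (simp add: h_def algebra_simps)
 moreover have "ac (%x. F x + c) g" using ac_add[OF F ac_const[of c]] by simp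
 ultimately show ?thesis using that by blast
qed

lemma L2_l2: "L2 f \<longleftrightarrow> l2 f" by (simp add: L2_def l2_def)

lemma L2norm_n2: "l2 f ==> L2norm f = ereal (n2 f)" by (simp add: L2norm_def L2_l2 n2_def)

lemma L2norm_nonneg: "0 \<le> L2norm f" by (simp add: L2norm_def)

lemma L2norm_finite: "L2norm f < \<infinity> ==> l2 f" by (auto simp: L2norm_def L2_l2 split: if_splits)

lemma l2_AE_cong: "AE x in lborel. f x = g x ==> l2 f ==> g \<in> borel_measurable borel ==> l2 g"
 using n2_AE_cong(2)[of f g] l2_meas' by blast

section \<open>Flows in the energy space\<close>

text \<open>The solution is rewritten with absolutely continuous representatives \<open>V t\<close>
  and fixed representatives \<open>G t\<close> of their derivatives; continuity into H1 becomes
  continuity of two real L2 distances. Since 1 - |V t|^2 is in L2, \<open>V t\<close> is not, and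
  only differences between two times are.\<close>

locale gp_flow =
 fixes V G :: "real => real => complex"
 assumes V_ac: "\<And>t. ac (V t) (G t)"
  and G_l2: "\<And>t. l2 (G t)"
  and V_0_bdd: "\<exists>B. \<forall>x. cmod (V 0 x) \<le> B"
  and eta_0_l2: "l2 (%x. 1 - (cmod (V 0 x))\<^sup>2)"
  and diff_l2: "\<And>s t. l2 (%x. V s x - V t x)"
  and V_cont: "\<And>t. ((%s. n2 (%x. V s x - V t x)) \<longlongrightarrow> 0) (at t)"
  and G_cont: "\<And>t. ((%s. n2 (%x. G s x - G t x)) \<longlongrightarrow> 0) (at t)"
  and weak_eq: "\<And>\<phi> t. test_fun \<phi> ==> ((%s. LINT x|lborel. V s x * complex_of_real (\<phi> x)) has_vector_derivative
      (\<i> * (LINT x|lborel. V t x * complex_of_real (deriv (deriv \<phi>) x))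
      - \<i> * (LINT x|lborel. V t x * complex_of_real ((cmod (V t x))\<^sup>2 - 1) * complex_of_real (\<phi> x)))) (at t)"
begin

definition eta :: "real => real => real" where "eta t x = 1 - (cmod (V t x))\<^sup>2"

definition nV :: "real => real => real" where "nV s t = n2 (%x. V s x - V t x)"

definition nG :: "real => real => real" where "nG s t = n2 (%x. G s x - G t x)"

lemma V_meas [measurable]: "V t \<in> borel_measurable borel" using ac_meas[OF V_ac] .

lemma G_meas [measurable]: "G t \<in> borel_measurable borel" using l2_meas'[OF G_l2] .

lemma eta_meas [measurable]: "eta t \<in> borel_measurable borel" unfolding eta_def[abs_def] by measurable

lemma Gd_l2: "l2 (%x. G s x - G t x)" by (intro l2_diff G_l2)

lemma Vd_ac: "ac (%x. V s x - V t x) (%x. G s x - G t x)" by (intro ac_diff V_ac)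

lemma nV_sym: "nV s t = nV t s" and nG_sym: "nG s t = nG t s"
 unfolding nV_def nG_def by (rule n2_commute)+

lemma nV_nonneg [simp]: "0 \<le> nV s t" and nG_nonneg [simp]: "0 \<le> nG s t"
 by (simp_all add: nV_def nG_def)

lemma nV_self [simp]: "nV t t = 0" and nG_self [simp]: "nG t t = 0"
 by (simp_all add: nV_def nG_def n2_def)

lemma nV_triangle: "nV r t \<le> nV r s + nV s t"
 using n2_triangle[OF diff_l2[of r s] diff_l2[of s t]] by (simp add: nV_def)

lemma nG_triangle: "nG r t \<le> nG r s + nG s t"
 using n2_triangle[OF Gd_l2[of r s] Gd_l2[of s t]] by (simp add: nG_def)

lemma V_diff_sup: "(cmod (V s x - V t x))\<^sup>2 \<le> 2 * nV s t * nG s t"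
 using ac_l2_sup[OF Vd_ac diff_l2 Gd_l2] by (simp add: nV_def nG_def)

lemma V_diff_sup_le: "cmod (V s x - V t x) \<le> nV s t + nG s t"
proof -
 have "(cmod (V s x - V t x))\<^sup>2 \<le> (nV s t + nG s t)\<^sup>2"
  by (rule order_trans[OF V_diff_sup]) (simp add: power2_sum)
 then show ?thesis by (simp add: power2_le_iff_abs_le)
qed

lemma nV_tendsto: "((%s. nV s t) \<longlongrightarrow> 0) (at t)" and nG_tendsto: "((%s. nG s t) \<longlongrightarrow> 0) (at t)"
 using V_cont[of t] G_cont[of t] by (simp_all add: nV_def nG_def)

lemma nV_cont: "continuous_on S (%s. nV s r)" and nG_cont: "continuous_on S (%s. nG s r)"
proof -
 have *: "continuous_on S f" if "\<And>s t. \<bar>f s - f t\<bar> \<le> g s t" "\<And>t. ((%s. g s t) \<longlongrightarrow> 0) (at t)" for f :: "real => real" and g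
 proof -
  have "isCont f t" for t
   unfolding isCont_def
   by (rule LIM_zero_cancel, rule Lim_null_comparison[OF always_eventually that(2)[of t]]) (use that(1) in auto)
  then show ?thesis by (simp add: continuous_at_imp_continuous_on)
 qed
 show "continuous_on S (%s. nV s r)"
 proof (rule *[OF _ nV_tendsto])
  fix s t show "\<bar>nV s r - nV t r\<bar> \<le> nV s t"
   using nV_triangle[of s r t] nV_triangle[of t r s] nV_sym[of t s] by linarith
 qed
 show "continuous_on S (%s. nG s r)"
 proof (rule *[OF _ nG_tendsto])
  fix s t show "\<bar>nG s r - nG t r\<bar> \<le> nG s t"
   using nG_triangle[of s r t] nG_triangle[of t r s] nG_sym[of t s] by linarith
 qed
qed

lemma eta_diff_bound:
 assumes "\<And>x. cmod (V s x) \<le> M" "\<And>x. cmod (V t x) \<le> M"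
 shows "\<bar>eta s x - eta t x\<bar> \<le> 2 * M * cmod (V s x - V t x)"
proof -
 have "\<bar>eta s x - eta t x\<bar> = \<bar>cmod (V t x) - cmod (V s x)\<bar> * (cmod (V t x) + cmod (V s x))"
 proof -
  have "eta s x - eta t x = (cmod (V t x) - cmod (V s x)) * (cmod (V t x) + cmod (V s x))"
   by (simp add: eta_def power2_eq_square algebra_simps)
  then show ?thesis by (simp add: abs_mult)
 qed
 also have "\<dots> \<le> cmod (V s x - V t x) * (2 * M)"
  using norm_triangle_ineq3[of "V t x" "V s x"] assms(1)[of x] assms(2)[of x]
  by (intro mult_mono) (auto simp: norm_minus_commute)
 finally show ?thesis by (simp add: mult.commute)
qed

lemma V_bdd: "\<exists>M\<ge>1. \<forall>t\<in>{-T..T}. \<forall>x. cmod (V t x) \<le> M"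
proof -
 obtain B where B: "\<And>x. cmod (V 0 x) \<le> B" using V_0_bdd by blast
 have "compact ((%t. nV t 0 + nG t 0) ` {-T..T})"
  by (intro compact_continuous_image continuous_on_add nV_cont nG_cont) auto
 then have "bounded ((%t. nV t 0 + nG t 0) ` {-T..T})" by (rule compact_imp_bounded)
 then obtain K where K: "\<And>t. t \<in> {-T..T} ==> \<bar>nV t 0 + nG t 0\<bar> \<le> K" unfolding bounded_iff by (metis imageI real_norm_def)
 have "cmod (V t x) \<le> \<bar>B\<bar> + \<bar>K\<bar> + 1" if "t \<in> {-T..T}" for t x
  using norm_triangle_ineq2[of "V t x" "V 0 x"] V_diff_sup_le[of t x 0] B[of x] K[OF that] by linarith
 then show ?thesis by (intro exI[of _ "\<bar>B\<bar> + \<bar>K\<bar> + 1"]) auto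
qed

lemma V_bdd1: "\<exists>M\<ge>1. \<forall>x. cmod (V t x) \<le> M"
 using V_bdd[of "\<bar>t\<bar>"] by force

lemma eta_l2: "l2 (eta t)"
proof -
 obtain M where M: "M \<ge> 1" "\<And>s x. s \<in> {-\<bar>t\<bar>..\<bar>t\<bar>} ==> cmod (V s x) \<le> M" using V_bdd[of "\<bar>t\<bar>"] by blast
 have Mt: "cmod (V t x) \<le> M" for x by (intro M(2)) auto
 have "l2 (%x. eta t x - eta 0 x)"
  by (rule l2_bound(1)[OF diff_l2[of t 0], where C="2 * M"]) (use M Mt in \<open>auto intro!: eta_diff_bound\<close>)
 from l2_add[OF this, of "eta 0"] show ?thesis using eta_0_l2 by (simp add: eta_def[abs_def])
qed

lemma eta_diff_n2:
 assumes "\<And>x. cmod (V s x) \<le> M" "\<And>x. cmod (V t x) \<le> M"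
 shows "n2 (%x. eta s x - eta t x) \<le> 2 * M * nV s t"
proof -
 have M: "0 \<le> M" using assms(1)[of 0] norm_ge_zero[of "V s 0"] by linarith
 show ?thesis unfolding nV_def
  by (rule l2_bound(2)[OF diff_l2[of s t]]) (use eta_diff_bound[OF assms] M in auto)
qed

lemma local_bounds:
 "\<exists>M\<ge>1. \<forall>t\<in>{-T..T}. (\<forall>x. cmod (V t x) \<le> M) \<and> n2 (G t) \<le> M \<and> n2 (eta t) \<le> M"
proof -
 obtain M where M: "M \<ge> 1" "\<And>t x. t \<in> {-\<bar>T\<bar>..\<bar>T\<bar>} ==> cmod (V t x) \<le> M" using V_bdd[of "\<bar>T\<bar>"] by blast
 have "compact ((%t. nV t 0) ` {-T..T})" "compact ((%t. nG t 0) ` {-T..T})"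
  by (intro compact_continuous_image nV_cont nG_cont; simp)+
 then have "bounded ((%t. nV t 0) ` {-T..T})" "bounded ((%t. nG t 0) ` {-T..T})" by (auto intro: compact_imp_bounded)
 then obtain K L where K: "\<And>t. t \<in> {-T..T} ==> \<bar>nV t 0\<bar> \<le> K" and L: "\<And>t. t \<in> {-T..T} ==> \<bar>nG t 0\<bar> \<le> L"
  unfolding bounded_iff by (metis imageI real_norm_def)
 define N where "N = M + n2 (G 0) + L + n2 (eta 0) + 2 * M * K + \<bar>L\<bar> + \<bar>2 * M * K\<bar>"
 have "(\<forall>x. cmod (V t x) \<le> N) \<and> n2 (G t) \<le> N \<and> n2 (eta t) \<le> N" if t: "t \<in> {-T..T}" for t
 proof (intro conjI allI)
  have t': "t \<in> {-\<bar>T\<bar>..\<bar>T\<bar>}" "0 \<in> {-\<bar>T\<bar>..\<bar>T\<bar>}" using t by auto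
  have p: "0 \<le> n2 (G 0)" "0 \<le> n2 (eta 0)" by auto
  show "cmod (V t x) \<le> N" for x using M(2)[OF t'(1), of x] p abs_ge_minus_self[of L] abs_ge_minus_self[of "2 * M * K"] unfolding N_def by linarith
  have "n2 (G t) \<le> n2 (G 0) + nG t 0"
   using n2_triangle[OF G_l2[of 0] Gd_l2[of t 0]] by (simp add: nG_def)
  then show "n2 (G t) \<le> N" using L[OF t] p M(1) unfolding N_def by linarith
  have "n2 (eta t) \<le> n2 (eta 0) + n2 (%x. eta t x - eta 0 x)"
   using n2_triangle[OF eta_l2[of 0] l2_diff[OF eta_l2[of t] eta_l2[of 0]]] by simp
  also have "n2 (%x. eta t x - eta 0 x) \<le> 2 * M * nV t 0" by (rule eta_diff_n2) (use M t' in auto)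
  also have "2 * M * nV t 0 \<le> 2 * M * K" using K[OF t] M(1) by (intro mult_left_mono) auto
  finally show "n2 (eta t) \<le> N" using p M(1) unfolding N_def by linarith
 qed
 moreover have "N \<ge> 1" 
  using M(1) n2_nonneg[of "G 0"] n2_nonneg[of "eta 0"] abs_ge_minus_self[of L] abs_ge_minus_self[of "2 * M * K"]
  unfolding N_def by linarith
 ultimately show ?thesis by blast
qed

text \<open>Heine-Cantor for the path of pairs (V t, G t). Its metric exists only as the functions
  \<open>nV\<close> and \<open>nG\<close> of two times, hence the argument by sequences.\<close>

lemma uniform_time_cont:
 assumes "0 < e"
 shows "\<exists>d>0. \<forall>s\<in>{-T..T}. \<forall>t\<in>{-T..T}. \<bar>s - t\<bar> < d --> nV s t < e \<and> nG s t < e"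
proof (rule ccontr)
 assume "\<not> ?thesis"
 then have "\<forall>n. \<exists>s\<in>{-T..T}. \<exists>t\<in>{-T..T}. \<bar>s - t\<bar> < inverse (real (Suc n)) \<and> \<not> (nV s t < e \<and> nG s t < e)"
  by (metis inverse_positive_iff_positive of_nat_0_less_iff zero_less_Suc)
 then obtain s t where st: "\<And>n. s n \<in> {-T..T}" "\<And>n. t n \<in> {-T..T}" "\<And>n. \<bar>s n - t n\<bar> < inverse (real (Suc n))" "\<And>n. \<not> (nV (s n) (t n) < e \<and> nG (s n) (t n) < e)"
  by metis
 obtain l r where l: "strict_mono r" "(s \<circ> r) \<longlonglongrightarrow> l"
  using compact_Icc[of "-T" T] st(1) unfolding compact_def by metis
 have "(%n. s n - t n) \<longlonglongrightarrow> 0"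
  by (rule Lim_null_comparison[OF _ LIMSEQ_inverse_real_of_nat]) (use st(3) in \<open>auto intro!: always_eventually less_imp_le\<close>)
 then have d: "((%n. s n - t n) \<circ> r) \<longlonglongrightarrow> 0" using l(1) LIMSEQ_subseq_LIMSEQ by blast
 have l2: "(t \<circ> r) \<longlonglongrightarrow> l"
  using tendsto_diff[OF l(2) d] by (simp add: o_def)
 have c: "isCont (%s. nV s l) l" "isCont (%s. nG s l) l"
  using nV_cont[of UNIV l] nG_cont[of UNIV l] by (auto simp: continuous_on_eq_continuous_at)
 have a: "(%n. nV ((s \<circ> r) n) l + nV ((t \<circ> r) n) l) \<longlonglongrightarrow> nV l l + nV l l" "(%n. nG ((s \<circ> r) n) l + nG ((t \<circ> r) n) l) \<longlonglongrightarrow> nG l l + nG l l"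
  by (intro tendsto_add isCont_tendsto_compose[OF c(1)] isCont_tendsto_compose[OF c(2)] l(2) l2)+
 have "eventually (%n. nV ((s \<circ> r) n) l + nV ((t \<circ> r) n) l < e \<and> nG ((s \<circ> r) n) l + nG ((t \<circ> r) n) l < e) sequentially"
  using order_tendstoD(2)[OF a(1), of e] order_tendstoD(2)[OF a(2), of e] assms by (auto intro: eventually_conj)
 then obtain n where "nV (s (r n)) l + nV (t (r n)) l < e" "nG (s (r n)) l + nG (t (r n)) l < e"
  using eventually_happens by fastforce
 then show False using st(4)[of "r n"] nV_triangle[of "s (r n)" "t (r n)" l] nG_triangle[of "s (r n)" "t (r n)" l] nV_sym[of "t (r n)" l] nG_sym[of "t (r n)" l] by linarith
qed

text \<open>The pairing, bilinear and without conjugation, of the distribution V_xx + (1 - |V|^2) V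
  with \<phi>, whose derivative is passed as \<phi>'. The equation reads V_t = i (V_xx + (1 - |V|^2)
  V), hence the factor i in front of \<open>Lam\<close> from here on.\<close>

definition Lam :: "real => (real => complex) => (real => complex) => complex" where
 "Lam t \<phi> \<phi>' = (LINT x|lborel. of_real (eta t x) * V t x * \<phi> x) - (LINT x|lborel. G t x * \<phi>' x)"

lemma etaV_l2: "l2 (%x. of_real (eta t x) * V t x)"
proof -
 obtain M where M: "M \<ge> 1" "\<And>x. cmod (V t x) \<le> M" using V_bdd1 by blast
 have "l2 (%x. V t x * of_real (eta t x))" by (rule l2_bdd_mult(1)[OF l2_of_real[OF eta_l2] V_meas M(2)])
 then show ?thesis by (simp add: mult.commute)
qed

lemma etaV_n2:
 assumes "\<And>x. cmod (V t x) \<le> M" shows "n2 (%x. of_real (eta t x) * V t x) \<le> M * n2 (eta t)"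
 using l2_bdd_mult(2)[OF l2_of_real[OF eta_l2[of t]] V_meas assms] by (simp add: mult.commute n2_of_real)

lemma Lam_bound:
 assumes "l2 \<phi>" "l2 \<phi>'" "\<And>x. cmod (V t x) \<le> M" "n2 (G t) \<le> M" "n2 (eta t) \<le> M" "1 \<le> M"
 shows "cmod (Lam t \<phi> \<phi>') \<le> M\<^sup>2 * (n2 \<phi> + n2 \<phi>')"
proof -
 have "cmod (Lam t \<phi> \<phi>') \<le> cmod (LINT x|lborel. (of_real (eta t x) * V t x) * \<phi> x) + cmod (LINT x|lborel. G t x * \<phi>' x)"
  unfolding Lam_def by (simp add: norm_triangle_ineq4)
 also have "cmod (LINT x|lborel. (of_real (eta t x) * V t x) * \<phi> x) \<le> (M * M) * n2 \<phi>"
  by (rule order_trans[OF n2_CS[OF etaV_l2 assms(1)]])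
    (use order_trans[OF etaV_n2[OF assms(3)] mult_left_mono[OF assms(5), of M]] assms(6) in \<open>auto intro!: mult_right_mono\<close>)
 also have "cmod (LINT x|lborel. G t x * \<phi>' x) \<le> M * n2 \<phi>'"
  by (rule order_trans[OF n2_CS[OF G_l2 assms(2)]]) (use assms(4) in \<open>auto intro!: mult_right_mono\<close>)
 also have "M * n2 \<phi>' \<le> (M * M) * n2 \<phi>'"
  using assms(6) by (intro mult_right_mono) (auto simp: mult_le_cancel_left1)
 finally show ?thesis by (simp add: power2_eq_square algebra_simps)
qed

lemma Lam_diff:
 assumes "l2 \<phi>" "l2 \<phi>'" "l2 \<psi>" "l2 \<psi>'"
 shows "Lam t (%x. \<phi> x - \<psi> x) (%x. \<phi>' x - \<psi>' x) = Lam t \<phi> \<phi>' - Lam t \<psi> \<psi>'"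
 using l2_mult[OF etaV_l2[of t] assms(1)] l2_mult[OF etaV_l2[of t] assms(3)] l2_mult[OF G_l2[of t] assms(2)] l2_mult[OF G_l2[of t] assms(4)]
 by (simp add: Lam_def right_diff_distrib)

end

section \<open>The equation tested against H1 functions\<close>

context gp_flow
begin

text \<open>3 M^2 + 1 bounds the Lipschitz constant of z -> (1 - |z|^2) z on the disc of radius M: 2
  M^2 from the first factor, M^2 + 1 from the second.\<close>

lemma Lam_time_diff:
 assumes "\<And>x. cmod (V s x) \<le> M" "\<And>x. cmod (V t x) \<le> M" "l2 \<phi>" "l2 \<phi>'"
 shows "cmod (Lam s \<phi> \<phi>' - Lam t \<phi> \<phi>') \<le> (3 * M\<^sup>2 + 1) * nV s t * n2 \<phi> + nG s t * n2 \<phi>'"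
proof -
 have M0: "0 \<le> M" using assms(1)[of 0] norm_ge_zero[of "V s 0"] by linarith
 have pt: "cmod (of_real (eta s x) * V s x - of_real (eta t x) * V t x) \<le> (3 * M\<^sup>2 + 1) * cmod (V s x - V t x)" for x
 proof -
  have "of_real (eta s x) * V s x - of_real (eta t x) * V t x = of_real (eta s x - eta t x) * V s x + of_real (eta t x) * (V s x - V t x)"
   by (simp add: algebra_simps)
  then have "cmod (of_real (eta s x) * V s x - of_real (eta t x) * V t x) \<le> \<bar>eta s x - eta t x\<bar> * cmod (V s x) + \<bar>eta t x\<bar> * cmod (V s x - V t x)"
   using norm_triangle_ineq[of "of_real (eta s x - eta t x) * V s x" "of_real (eta t x) * (V s x - V t x)"]
   by (simp only: norm_mult norm_of_real)
  also have "\<dots> \<le> (2 * M * cmod (V s x - V t x)) * M + (M\<^sup>2 + 1) * cmod (V s x - V t x)"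
  proof (rule add_mono)
   show "\<bar>eta s x - eta t x\<bar> * cmod (V s x) \<le> (2 * M * cmod (V s x - V t x)) * M"
    by (intro mult_mono eta_diff_bound assms) (use M0 in auto)
   have "\<bar>eta t x\<bar> \<le> M\<^sup>2 + 1"
    using power_mono[OF assms(2)[of x] norm_ge_zero, of 2] zero_le_power2[of "cmod (V t x)"] unfolding eta_def by linarith
   then show "\<bar>eta t x\<bar> * cmod (V s x - V t x) \<le> (M\<^sup>2 + 1) * cmod (V s x - V t x)"
    by (rule mult_right_mono) simp
  qed
  also have "\<dots> = (3 * M\<^sup>2 + 1) * cmod (V s x - V t x)" by (simp add: power2_eq_square algebra_simps)
  finally show ?thesis .
 qed
 have l: "l2 (%x. of_real (eta s x) * V s x - of_real (eta t x) * V t x)" by (intro l2_diff etaV_l2)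
 have n: "n2 (%x. of_real (eta s x) * V s x - of_real (eta t x) * V t x) \<le> (3 * M\<^sup>2 + 1) * nV s t"
  unfolding nV_def by (rule l2_bound(2)[OF diff_l2 _ pt]) auto
 have "Lam s \<phi> \<phi>' - Lam t \<phi> \<phi>' = (LINT x|lborel. (of_real (eta s x) * V s x - of_real (eta t x) * V t x) * \<phi> x) - (LINT x|lborel. (G s x - G t x) * \<phi>' x)"
  using l2_mult[OF etaV_l2[of s] assms(3)] l2_mult[OF etaV_l2[of t] assms(3)] l2_mult[OF G_l2[of s] assms(4)] l2_mult[OF G_l2[of t] assms(4)]
  by (simp add: Lam_def left_diff_distrib)
 then have "cmod (Lam s \<phi> \<phi>' - Lam t \<phi> \<phi>') \<le> cmod (LINT x|lborel. (of_real (eta s x) * V s x - of_real (eta t x) * V t x) * \<phi> x) + cmod (LINT x|lborel. (G s x - G t x) * \<phi>' x)"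
  by (simp add: norm_triangle_ineq4)
 also have "cmod (LINT x|lborel. (of_real (eta s x) * V s x - of_real (eta t x) * V t x) * \<phi> x) \<le> (3 * M\<^sup>2 + 1) * nV s t * n2 \<phi>"
  by (rule order_trans[OF n2_CS[OF l assms(3)] mult_right_mono[OF n]]) simp
 also have "cmod (LINT x|lborel. (G s x - G t x) * \<phi>' x) \<le> nG s t * n2 \<phi>'"
  unfolding nG_def by (rule n2_CS[OF Gd_l2 assms(4)])
 finally show ?thesis by simp
qed

lemma Lam_cont:
 assumes "l2 \<phi>" "l2 \<phi>'"
 shows "continuous_on S (%t. Lam t \<phi> \<phi>')"
proof -
 have "isCont (%t. Lam t \<phi> \<phi>') t" for t
 proof -
  obtain M where M: "M \<ge> 1" "\<And>s x. s \<in> {-(\<bar>t\<bar>+1)..\<bar>t\<bar>+1} ==> cmod (V s x) \<le> M" using V_bdd[of "\<bar>t\<bar>+1"] by blast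
  have "eventually (%s. s \<in> {t-1<..<t+1}) (at t)"
   by (rule eventually_at_in_open') auto
  then have ev: "eventually (%s. norm (Lam s \<phi> \<phi>' - Lam t \<phi> \<phi>') \<le> (3 * M\<^sup>2 + 1) * nV s t * n2 \<phi> + nG s t * n2 \<phi>') (at t)"
   by eventually_elim (intro Lam_time_diff assms M(2), auto)
  have "((%s. (3 * M\<^sup>2 + 1) * nV s t * n2 \<phi> + nG s t * n2 \<phi>') \<longlongrightarrow> (3 * M\<^sup>2 + 1) * 0 * n2 \<phi> + 0 * n2 \<phi>') (at t)"
   by (intro tendsto_intros nV_tendsto nG_tendsto)
  then have "((%s. (3 * M\<^sup>2 + 1) * nV s t * n2 \<phi> + nG s t * n2 \<phi>') \<longlongrightarrow> 0) (at t)" by simp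
  from LIM_zero_cancel[OF Lim_null_comparison[OF ev this]] show ?thesis unfolding isCont_def .
 qed
 then show ?thesis by (simp add: continuous_at_imp_continuous_on)
qed

lemma weak_eq_test:
 assumes t: "test_fun u"
 shows "((%s. LINT x|lborel. (V s x - V r x) * complex_of_real (u x)) has_vector_derivative \<i> * Lam t (%x. of_real (u x)) (%x. of_real (deriv u x))) (at t)"
proof -
 have i: "integrable lborel (%x. V s x * complex_of_real (u x))" for s by (rule loc_int_test[OF ac_loc_int(1)[OF V_ac] t])
 have e: "(%s. LINT x|lborel. (V s x - V r x) * complex_of_real (u x)) = (%s. (LINT x|lborel. V s x * complex_of_real (u x)) - (LINT x|lborel. V r x * complex_of_real (u x)))"
  using i by (simp add: left_diff_distrib)
 have p: "(LINT x|lborel. V t x * complex_of_real (deriv (deriv u) x)) = - (LINT x|lborel. G t x * complex_of_real (deriv u x))"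
  by (rule ac_test_parts[OF V_ac test_fun_deriv[OF t]])
 have q: "(LINT x|lborel. V t x * complex_of_real ((cmod (V t x))\<^sup>2 - 1) * complex_of_real (u x)) = - (LINT x|lborel. of_real (eta t x) * V t x * of_real (u x))"
  by (simp only: integral_minus[symmetric]) (simp add: eta_def algebra_simps)
 have "((%s. (LINT x|lborel. V s x * complex_of_real (u x)) - (LINT x|lborel. V r x * complex_of_real (u x))) has_vector_derivative
    (\<i> * (LINT x|lborel. V t x * complex_of_real (deriv (deriv u) x))
      - \<i> * (LINT x|lborel. V t x * complex_of_real ((cmod (V t x))\<^sup>2 - 1) * complex_of_real (u x))) - 0) (at t)"
  by (intro has_vector_derivative_diff weak_eq t has_vector_derivative_const)
 then show ?thesis unfolding e p q by (simp add: Lam_def algebra_simps)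
qed

text \<open>Both sides are bounded by the H1 norm of the function tested with, uniformly on a
  compact time interval, so the identity extends by density. The test functions of the weak form are
  real, and so is \<open>f\<close>.\<close>

lemma weak_eq_H1_integral_real:
 fixes f g :: "real => real"
 assumes A: "ac f g" and f: "l2 f" and g: "l2 g" and ab: "a \<le> b"
 shows "(LINT x|lborel. (V b x - V a x) * of_real (f x)) = integral {a..b} (%\<tau>. \<i> * Lam \<tau> (%x. of_real (f x)) (%x. of_real (g x)))"
proof -
 define T where "T = \<bar>a\<bar> + \<bar>b\<bar>"
 have T: "{a..b} \<subseteq> {-T..T}" by (auto simp: T_def)
 obtain M where M: "M \<ge> 1" "\<And>t x. t \<in> {-T..T} ==> cmod (V t x) \<le> M" "\<And>t. t \<in> {-T..T} ==> n2 (G t) \<le> M" "\<And>t. t \<in> {-T..T} ==> n2 (eta t) \<le> M"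
  using local_bounds[of T] by blast
 let ?L = "LINT x|lborel. (V b x - V a x) * of_real (f x)"
 let ?I = "%f g. integral {a..b} (%\<tau>. \<i> * Lam \<tau> (%x. of_real (f x :: real)) (%x. of_real (g x :: real)))"
 define C where "C = nV b a + 2 * M\<^sup>2 * (b - a)"
 have C: "0 \<le> C" using ab by (simp add: C_def)
 have est: "cmod (?L - ?I f g) \<le> e * C" if e: "0 < e" for e
 proof -
  obtain u where u: "test_fun u" "n2 (%x. f x - u x) < e" "n2 (%x. g x - deriv u x) < e"
   using test_fun_dense_h1[OF A f g e] by blast
  have ul: "l2 u" "l2 (deriv u)" using test_fun_l2(1) u(1) test_fun_deriv by auto
  have cu: "continuous_on {a..b} (%\<tau>. \<i> * Lam \<tau> (%x. of_real (u x)) (%x. of_real (deriv u x)))"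
   and cf: "continuous_on {a..b} (%\<tau>. \<i> * Lam \<tau> (%x. of_real (f x)) (%x. of_real (g x)))"
   by (intro continuous_intros Lam_cont l2_of_real ul f g)+
  have hi: "((%\<tau>. \<i> * Lam \<tau> (%x. of_real (u x)) (%x. of_real (deriv u x))) has_integral
    (LINT x|lborel. (V b x - V a x) * of_real (u x)) - (LINT x|lborel. (V a x - V a x) * of_real (u x))) {a..b}"
   by (rule fundamental_theorem_of_calculus[OF ab has_vector_derivative_at_within[OF weak_eq_test[OF u(1)]]])
  have eu: "?I u (deriv u) = (LINT x|lborel. (V b x - V a x) * of_real (u x))"
   unfolding integral_unique[OF hi] by simp
  have d: "l2 (%x. complex_of_real (f x - u x))" "l2 (%x. complex_of_real (g x - deriv u x))"
   by (intro l2_of_real l2_diff f g ul)+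
  have 1: "?L - (LINT x|lborel. (V b x - V a x) * of_real (u x)) = (LINT x|lborel. (V b x - V a x) * of_real (f x - u x))"
   using l2_mult[OF diff_l2[of b a] l2_of_real[OF f]] l2_mult[OF diff_l2[of b a] l2_of_real[OF ul(1)]]
   by (simp add: right_diff_distrib)
  have 2: "cmod (LINT x|lborel. (V b x - V a x) * of_real (f x - u x)) \<le> nV b a * e"
  proof -
   have "cmod (LINT x|lborel. (V b x - V a x) * of_real (f x - u x)) \<le> nV b a * n2 (%x. complex_of_real (f x - u x))"
    unfolding nV_def by (rule n2_CS[OF diff_l2 d(1)])
   also have "n2 (%x. complex_of_real (f x - u x)) \<le> e" unfolding n2_of_real using u(2) by simp
   finally show ?thesis by (simp add: mult_left_mono)
  qed
  have 3: "?I f g - ?I u (deriv u) = integral {a..b} (%\<tau>. \<i> * Lam \<tau> (%x. of_real (f x - u x)) (%x. of_real (g x - deriv u x)))"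
   using integral_diff[OF integrable_continuous_real[OF cf] integrable_continuous_real[OF cu]]
    Lam_diff[OF l2_of_real[OF f] l2_of_real[OF g] l2_of_real[OF ul(1)] l2_of_real[OF ul(2)]]
   by (simp add: right_diff_distrib)
  have 4: "cmod (integral {a..b} (%\<tau>. \<i> * Lam \<tau> (%x. of_real (f x - u x)) (%x. of_real (g x - deriv u x)))) \<le> (M\<^sup>2 * (e + e)) * (b - a)"
  proof (rule integral_bound[OF ab])
   show "continuous_on {a..b} (%\<tau>. \<i> * Lam \<tau> (%x. of_real (f x - u x)) (%x. of_real (g x - deriv u x)))"
    by (intro continuous_intros Lam_cont d)
   fix \<tau> assume "\<tau> \<in> {a..b}"
   then have \<tau>: "\<tau> \<in> {-T..T}" using T by blast
   have "cmod (Lam \<tau> (%x. of_real (f x - u x)) (%x. of_real (g x - deriv u x))) \<le> M\<^sup>2 * (n2 (%x. complex_of_real (f x - u x)) + n2 (%x. complex_of_real (g x - deriv u x)))"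
    by (rule Lam_bound[OF d]) (use M \<tau> in auto)
   also have "\<dots> \<le> M\<^sup>2 * (e + e)" unfolding n2_of_real using u by (intro mult_left_mono) auto
   finally show "cmod (\<i> * Lam \<tau> (%x. of_real (f x - u x)) (%x. of_real (g x - deriv u x))) \<le> M\<^sup>2 * (e + e)" by (simp add: norm_mult)
  qed
  have dd: "?L - ?I f g = (?L - (LINT x|lborel. (V b x - V a x) * of_real (u x))) - (?I f g - ?I u (deriv u))" unfolding eu by simp
  have "cmod (?L - ?I f g) \<le> nV b a * e + (M\<^sup>2 * (e + e)) * (b - a)"
   unfolding dd 1 3 by (rule order_trans[OF norm_triangle_ineq4 add_mono[OF 2 4]])
  also have "\<dots> = e * C" by (simp add: C_def algebra_simps)
  finally show ?thesis .
 qed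
 have "cmod (?L - ?I f g) \<le> 0"
 proof (rule field_le_epsilon)
  fix e :: real assume e: "0 < e"
  have "cmod (?L - ?I f g) \<le> (e / (C + 1)) * C" using est[of "e / (C + 1)"] e C by simp
  also have "\<dots> \<le> e" using e C by (simp add: field_simps)
  finally show "cmod (?L - ?I f g) \<le> 0 + e" by simp
 qed
 then show ?thesis by simp
qed

lemma weak_eq_H1_integral:
 assumes A: "ac \<phi> \<phi>'" and f: "l2 \<phi>" and g: "l2 \<phi>'" and ab: "a \<le> b"
 shows "(LINT x|lborel. (V b x - V a x) * \<phi> x) = integral {a..b} (%\<tau>. \<i> * Lam \<tau> \<phi> \<phi>')"
proof -
 let ?r = "%x. complex_of_real (Re (\<phi> x))" and ?i = "%x. complex_of_real (Im (\<phi> x))"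
 let ?r' = "%x. complex_of_real (Re (\<phi>' x))" and ?i' = "%x. complex_of_real (Im (\<phi>' x))"
 have l: "l2 ?r" "l2 ?i" "l2 ?r'" "l2 ?i'" by (intro l2_of_real l2_Re l2_Im f g)+
 have L: "Lam t \<phi> \<phi>' = Lam t ?r ?r' + \<i> * Lam t ?i ?i'" for t
 proof -
  have "(LINT x|lborel. of_real (eta t x) * V t x * \<phi> x) = (LINT x|lborel. (of_real (eta t x) * V t x) * ?r x + \<i> * ((of_real (eta t x) * V t x) * ?i x))"
   by (rule Bochner_Integration.integral_cong) (simp_all add: complex_eq_iff)
  moreover have "(LINT x|lborel. G t x * \<phi>' x) = (LINT x|lborel. G t x * ?r' x + \<i> * (G t x * ?i' x))"
   by (rule Bochner_Integration.integral_cong) (simp_all add: complex_eq_iff)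
  ultimately show ?thesis
   using l2_mult[OF etaV_l2[of t] l(1)] l2_mult[OF etaV_l2[of t] l(2)] l2_mult[OF G_l2[of t] l(3)] l2_mult[OF G_l2[of t] l(4)]
   by (simp add: Lam_def algebra_simps)
 qed
 have "(LINT x|lborel. (V b x - V a x) * \<phi> x) = (LINT x|lborel. (V b x - V a x) * ?r x + \<i> * ((V b x - V a x) * ?i x))"
  by (rule Bochner_Integration.integral_cong) (simp_all add: complex_eq_iff)
 also have "\<dots> = (LINT x|lborel. (V b x - V a x) * ?r x) + \<i> * (LINT x|lborel. (V b x - V a x) * ?i x)"
  using l2_mult[OF diff_l2[of b a] l(1)] l2_mult[OF diff_l2[of b a] l(2)] by simp
 also have "(LINT x|lborel. (V b x - V a x) * ?r x) = integral {a..b} (%\<tau>. \<i> * Lam \<tau> ?r ?r')"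
  by (rule weak_eq_H1_integral_real[OF ac_Re[OF A] l2_Re(1)[OF f] l2_Re(1)[OF g] ab])
 also have "(LINT x|lborel. (V b x - V a x) * ?i x) = integral {a..b} (%\<tau>. \<i> * Lam \<tau> ?i ?i')"
  by (rule weak_eq_H1_integral_real[OF ac_Im[OF A] l2_Im(1)[OF f] l2_Im(1)[OF g] ab])
 also have "integral {a..b} (%\<tau>. \<i> * Lam \<tau> ?r ?r') + \<i> * integral {a..b} (%\<tau>. \<i> * Lam \<tau> ?i ?i')
   = integral {a..b} (%\<tau>. \<i> * Lam \<tau> ?r ?r' + \<i> * (\<i> * Lam \<tau> ?i ?i'))"
  by (subst integral_mult_right[symmetric], subst integral_add[symmetric])
    (auto intro!: integrable_continuous_real continuous_intros Lam_cont l)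
 also have "\<dots> = integral {a..b} (%\<tau>. \<i> * Lam \<tau> \<phi> \<phi>')"
  unfolding L by (simp add: algebra_simps)
 finally show ?thesis .
qed

text \<open>The integrated identity is differentiated, its integrand being continuous in time.
  Subtracting the reference time \<open>r\<close> makes the pairing integrable: \<open>V s\<close>
  alone is merely bounded and \<phi> merely in L2.\<close>

lemma weak_eq_H1:
 assumes A: "ac \<phi> \<phi>'" and f: "l2 \<phi>" and g: "l2 \<phi>'"
 shows "((%s. LINT x|lborel. (V s x - V r x) * \<phi> x) has_vector_derivative \<i> * Lam t \<phi> \<phi>') (at t)"
proof -
 have c: "continuous_on {t-1..t+1} (%\<tau>. \<i> * Lam \<tau> \<phi> \<phi>')" by (intro continuous_intros Lam_cont f g)
 have d: "((%s. (LINT x|lborel. (V (t-1) x - V r x) * \<phi> x) + integral {t-1..s} (%\<tau>. \<i> * Lam \<tau> \<phi> \<phi>')) has_vector_derivative 0 + \<i> * Lam t \<phi> \<phi>') (at t within {t-1..t+1})"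
  by (intro has_vector_derivative_add has_vector_derivative_const integral_has_vector_derivative[OF c]) simp
 have e: "(LINT x|lborel. (V s x - V r x) * \<phi> x) = (LINT x|lborel. (V (t-1) x - V r x) * \<phi> x) + integral {t-1..s} (%\<tau>. \<i> * Lam \<tau> \<phi> \<phi>')" if "s \<in> {t-1..t+1}" for s
 proof -
  have "(LINT x|lborel. (V s x - V r x) * \<phi> x) - (LINT x|lborel. (V (t-1) x - V r x) * \<phi> x) = (LINT x|lborel. (V s x - V (t-1) x) * \<phi> x)"
   unfolding Bochner_Integration.integral_diff[OF l2_mult[OF diff_l2 f] l2_mult[OF diff_l2 f], symmetric]
   by (rule Bochner_Integration.integral_cong) (simp_all add: algebra_simps)
  then show ?thesis using weak_eq_H1_integral[OF A f g, of "t-1" s] that by (simp add: algebra_simps)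
 qed
 have "((%s. LINT x|lborel. (V s x - V r x) * \<phi> x) has_vector_derivative 0 + \<i> * Lam t \<phi> \<phi>') (at t within {t-1..t+1})"
  by (rule has_vector_derivative_transform[OF _ e d]) auto
 moreover have "at t within {t-1..t+1} = at t" by (rule at_within_interior) auto
 ultimately show ?thesis by simp
qed

text \<open>The integrated equation is tested with the conjugate of \<open>V b - V a\<close> itself,
  and the pairing is bounded by the H1 norm of this difference. As that norm tends to 0 with b - a,
  the squared L2 distance is o(b - a); quadratic terms in a time difference therefore drop out of
  time derivatives.\<close>

lemma nV_sq_le:
 assumes "a \<in> {-T..T}" "b \<in> {-T..T}"
  and M: "M \<ge> 1" "\<And>t x. t \<in> {-T..T} ==> cmod (V t x) \<le> M" "\<And>t. t \<in> {-T..T} ==> n2 (G t) \<le> M" "\<And>t. t \<in> {-T..T} ==> n2 (eta t) \<le> M"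
 shows "(nV b a)\<^sup>2 \<le> M\<^sup>2 * (nV b a + nG b a) * \<bar>b - a\<bar>"
proof -
 have *: "(nV b a)\<^sup>2 \<le> M\<^sup>2 * (nV b a + nG b a) * \<bar>b - a\<bar>" if ab: "a \<le> b" "a \<in> {-T..T}" "b \<in> {-T..T}" for a b
 proof -
  have c: "ac (%x. cnj (V b x - V a x)) (%x. cnj (G b x - G a x))" by (rule ac_cnj[OF Vd_ac])
  have l: "l2 (%x. cnj (V b x - V a x))" "l2 (%x. cnj (G b x - G a x))" by (intro l2_cnj(1) diff_l2 Gd_l2)+
  have "complex_of_real ((nV b a)\<^sup>2) = (LINT x|lborel. (V b x - V a x) * cnj (V b x - V a x))"
   unfolding nV_def n2_sq by (simp only: complex_norm_square[symmetric] integral_complex_of_real)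
  also have "\<dots> = integral {a..b} (%\<tau>. \<i> * Lam \<tau> (%x. cnj (V b x - V a x)) (%x. cnj (G b x - G a x)))"
   by (rule weak_eq_H1_integral[OF c l ab(1)])
  finally have fin: "complex_of_real ((nV b a)\<^sup>2) = integral {a..b} (%\<tau>. \<i> * Lam \<tau> (%x. cnj (V b x - V a x)) (%x. cnj (G b x - G a x)))" .
  have e: "(nV b a)\<^sup>2 = cmod (integral {a..b} (%\<tau>. \<i> * Lam \<tau> (%x. cnj (V b x - V a x)) (%x. cnj (G b x - G a x))))"
   unfolding fin[symmetric] norm_of_real by simp
  have bd: "cmod (integral {a..b} (%\<tau>. \<i> * Lam \<tau> (%x. cnj (V b x - V a x)) (%x. cnj (G b x - G a x)))) \<le> (M\<^sup>2 * (nV b a + nG b a)) * (b - a)"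
  proof (rule integral_bound[OF ab(1)])
   fix \<tau> assume "\<tau> \<in> {a..b}"
   then have \<tau>: "\<tau> \<in> {-T..T}" using ab by auto
   show "cmod (\<i> * Lam \<tau> (%x. cnj (V b x - V a x)) (%x. cnj (G b x - G a x))) \<le> M\<^sup>2 * (nV b a + nG b a)"
    using Lam_bound[OF l, of \<tau> M] M \<tau> by (simp only: n2_cnj nV_def nG_def norm_mult norm_ii mult_1)
  qed (intro continuous_intros Lam_cont l)
  show ?thesis using order_trans[OF eq_refl[OF e] bd] ab(1) by simp
 qed
 show ?thesis
 proof (cases "a \<le> b")
  case True then show ?thesis using *[OF True assms(1,2)] by simp
 next
  case False then show ?thesis using *[of b a] assms(1,2) by (simp add: nV_sym[of a b] nG_sym[of a b] abs_minus_commute)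
 qed
qed

end

text \<open>f(x + y) - f(x) is the integral of f'(x + r) over r in [0, y]. Moving the shift r onto
  \<open>u\<close> by translation, the remainder is a translation difference of \<open>u\<close>, of
  order r in L2, so that no second derivative of \<open>f\<close> enters.\<close>

lemma translation_pairing_expansion:
 fixes u u' f f' :: "real => complex"
 assumes U: "ac u u'" "l2 u" "l2 u'" and F: "ac f f'" "l2 f'" and y: "0 \<le> y"
 shows "cmod ((LINT x|lborel. u x * (f (x + y) - f x)) - y *\<^sub>R (LINT x|lborel. u x * f' x)) \<le> y\<^sup>2 * n2 u' * n2 f'"
proof -
 note [measurable] = l2_meas'[OF U(2)] l2_meas'[OF F(2)]
 have sh: "l2 (%x. f' (x + r))" "n2 (%x. f' (x + r)) = n2 f'" for r by (rule l2_shift[OF F(2)])+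
 let ?P = "%(r,x). indicator {0..y} r *\<^sub>R (u x * f' (x + r))"
 have P: "integrable (lborel \<Otimes>\<^sub>M lborel) ?P"
 proof (rule lborel_pair.Fubini_integrable)
  show "AE r in lborel. integrable lborel (%x. ?P (r, x))"
   by (intro AE_I2) (simp add: l2_mult[OF U(2) sh(1)])
  show "integrable lborel (%r. LINT x|lborel. norm (?P (r, x)))"
  proof (rule Bochner_Integration.integrable_bound[where f="%r. (n2 u * n2 f') * indicator {0..y} r :: real"])
   show "integrable lborel (%r. (n2 u * n2 f') * indicator {0..y} r :: real)"
    by (intro integrable_mult_right integrable_real_indicator) (auto simp: emeasure_lborel_Icc_eq)
   show "AE r in lborel. norm (LINT x|lborel. norm (?P (r, x))) \<le> norm ((n2 u * n2 f') * indicator {0..y} r :: real)"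
   proof (rule AE_I2)
    fix r
    have "(LINT x|lborel. norm (u x) * norm (f' (x + r))) \<le> n2 u * n2 f'"
     using n2_CS_norm[OF U(2) sh(1)[of r]] sh(2) by simp
    then show "norm (LINT x|lborel. norm (?P (r, x))) \<le> norm ((n2 u * n2 f') * indicator {0..y} r :: real)"
     by (auto simp: indicator_def norm_mult abs_mult intro: order_trans[OF _ abs_ge_self])
   qed
  qed measurable
 qed measurable
 have 1: "(LINT x|lborel. (LINT r|lborel. indicator {0..y} r *\<^sub>R (u x * f' (x + r)))) = (LINT x|lborel. u x * (f (x + y) - f x))"
 proof (rule Bochner_Integration.integral_cong[OF refl])
  fix x
  have "(LINT r|lborel. indicator {0..y} r *\<^sub>R (u x * f' (x + r))) = (LINT r|lborel. u x * (indicator {0..y} r *\<^sub>R f' (r + x)))"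
   by (rule Bochner_Integration.integral_cong) (simp_all add: add.commute)
  also have "\<dots> = u x * (LINT r:{0..y}|lborel. f' (r + x))"
   unfolding set_lebesgue_integral_def by (rule integral_mult_right_zero)
  also have "(LINT r:{0..y}|lborel. f' (r + x)) = f (y + x) - f (0 + x)"
   using ac_int[OF ac_shift[OF F(1), of x] y] by simp
  finally show "(LINT r|lborel. indicator {0..y} r *\<^sub>R (u x * f' (x + r))) = u x * (f (x + y) - f x)"
   by (simp add: add.commute)
 qed
 define C where "C r = (LINT x|lborel. u x * f' (x + r))" for r
 have 2: "(LINT x|lborel. (LINT r|lborel. indicator {0..y} r *\<^sub>R (u x * f' (x + r)))) = (LINT r|lborel. indicator {0..y} r *\<^sub>R C r)"
  using lborel_pair.Fubini_integral[OF P] by (simp add: C_def)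
 have Ci: "integrable lborel (%r. indicator {0..y} r *\<^sub>R C r)"
  using lborel_pair.integrable_fst'[OF P] by (simp add: C_def)
 have Cd: "cmod (C r - C 0) \<le> y * (n2 u' * n2 f')" if r: "r \<in> {0..y}" for r
 proof -
  have "C r = (LINT x|lborel. u (x + - r) * f' x)"
   unfolding C_def using integral_shift[of "%x. u x * f' (x + r)" "-r"] by simp
  then have "C r - C 0 = (LINT x|lborel. (u (x + - r) - u x) * f' x)"
   using l2_mult[OF l2_shift(1)[OF U(2), of "-r"] F(2)] l2_mult[OF U(2) F(2)] by (simp add: C_def left_diff_distrib)
  also have "cmod \<dots> \<le> n2 (%x. u (x + - r) - u x) * n2 f'"
   by (rule n2_CS[OF l2_translation_le(1)[OF U(1,3)] F(2)])
  also have "\<dots> \<le> (\<bar>- r\<bar> * n2 u') * n2 f'" by (intro mult_right_mono l2_translation_le(2)[OF U(1,3)]) simp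
  also have "\<dots> \<le> y * (n2 u' * n2 f')" using r by (auto intro!: mult_right_mono simp: mult.assoc)
  finally show ?thesis .
 qed
 have ic: "integrable lborel (%r. indicator {0..y} r *\<^sub>R C 0)"
  by (intro integrable_scaleR_left integrable_real_indicator) (auto simp: emeasure_lborel_Icc_eq)
 have "(LINT x|lborel. u x * (f (x + y) - f x)) - y *\<^sub>R (LINT x|lborel. u x * f' x) = (LINT r|lborel. indicator {0..y} r *\<^sub>R C r) - (LINT r|lborel. indicator {0..y} r *\<^sub>R C 0)"
  using 1 2 y by (simp add: C_def)
 also have "\<dots> = (LINT r|lborel. indicator {0..y} r *\<^sub>R (C r - C 0))"
  using Ci ic by (simp add: scaleR_diff_right)
 also have "cmod \<dots> \<le> (LINT r|lborel. indicator {0..y} r *\<^sub>R (y * (n2 u' * n2 f')))"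
 proof (rule Bochner_Integration.integral_norm_bound_integral)
  show "integrable lborel (%r. indicator {0..y} r *\<^sub>R (C r - C 0))" using Ci ic by (simp add: scaleR_diff_right)
  show "integrable lborel (%r. indicator {0..y} r *\<^sub>R (y * (n2 u' * n2 f')))"
   by (intro integrable_scaleR_left integrable_real_indicator) (auto simp: emeasure_lborel_Icc_eq)
  show "cmod (indicator {0..y} r *\<^sub>R (C r - C 0)) \<le> indicator {0..y} r *\<^sub>R (y * (n2 u' * n2 f'))" for r
   using Cd[of r] by (auto simp: indicator_def)
 qed
 also have "\<dots> = y\<^sup>2 * n2 u' * n2 f'" using y by (simp add: power2_eq_square)
 finally show ?thesis .
qed

section \<open>Conservation of the momentum\<close>

context gp_flow
begin

lemma V_sym_diff:
 "ac (%x. V t (x + y) - V t (x + - y)) (%x. G t (x + y) - G t (x + - y))"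
 "l2 (%x. V t (x + y) - V t (x + - y))" "l2 (%x. G t (x + y) - G t (x + - y))"
proof -
 show "ac (%x. V t (x + y) - V t (x + - y)) (%x. G t (x + y) - G t (x + - y))"
  by (intro ac_diff ac_shift V_ac)
 show "l2 (%x. G t (x + y) - G t (x + - y))" by (intro l2_diff l2_shift G_l2)
 have "(%x. V t (x + y) - V t (x + - y)) = (%x. V t ((x + - y) + 2 * y) - V t (x + - y))" by (auto simp: algebra_simps)
 then show "l2 (%x. V t (x + y) - V t (x + - y))"
  using l2_shift(1)[OF l2_translation_le(1)[OF V_ac G_l2, of t "2 * y"], of "- y"] by simp
qed

text \<open>Formally the change between the times 0 and s of the imaginary part of the integral of
  \<open>cnj (V x) * V (x + y)\<close>, a correlation whose derivative at y = 0 is the momentum. The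
  correlation need not converge, so its change is expanded in V s - V 0 and translated until both
  factors of each product are in L2.\<close>

definition mom :: "real => real => real" where
 "mom y s = Im (LINT x|lborel. cnj (V s x - V 0 x) * (V 0 (x + y) - V 0 (x + - y)))
   + Im (LINT x|lborel. cnj (V s x - V 0 x) * (V s (x + y) - V 0 (x + y)))"

text \<open>Up to sign the gradient of \<open>mom y\<close> at time t, that is, the H1 function
  against which the equation has to be tested.\<close>

definition symd :: "real => real => real => complex" where
 "symd t y x = cnj (V t (x + y) - V t (x + - y))"

definition symd' :: "real => real => real => complex" where
 "symd' t y x = cnj (G t (x + y) - G t (x + - y))"

lemma symd: "ac (symd t y) (symd' t y)" "l2 (symd t y)" "l2 (symd' t y)"
 unfolding symd_def[abs_def] symd'_def[abs_def]
 by (intro ac_cnj l2_cnj(1) V_sym_diff)+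

text \<open>A quadratic functional has an exact second-order expansion about time t. Translation and
  conjugation exchange the shifts y and -y, and on imaginary parts conjugation is a change of sign;
  this collects the cross terms into the symmetric difference.\<close>

lemma mom_expand:
 "mom y s = mom y t - Im (LINT x|lborel. (V s x - V t x) * symd t y x) + Im (LINT x|lborel. cnj (V s x - V t x) * (V s (x + y) - V t (x + y)))"
proof -
 define d where "d x = V s x - V t x" for x
 define w where "w x = V t x - V 0 x" for x
 define D where "D x = V 0 (x + y) - V 0 (x + - y)" for x
 have dl: "l2 d" and wl: "l2 w" and Dl: "l2 D" unfolding d_def w_def D_def by (rule diff_l2 V_sym_diff)+
 note c = l2_cnj(1)[OF dl] l2_cnj(1)[OF wl]
 have sl: "l2 (%x. d (x + a))" "l2 (%x. w (x + a))" for a by (rule l2_shift(1)[OF dl] l2_shift(1)[OF wl])+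
 note i = l2_mult[OF c(1) Dl] l2_mult[OF c(2) Dl] l2_mult[OF c(1) sl(1)] l2_mult[OF c(1) sl(2)] l2_mult[OF c(2) sl(1)] l2_mult[OF c(2) sl(2)]
 have e: "V s x - V 0 x = w x + d x" "V s (x + y) - V 0 (x + y) = w (x + y) + d (x + y)" for x by (simp_all add: w_def d_def)
 have 1: "mom y s = Im (LINT x|lborel. cnj (w x) * D x) + Im (LINT x|lborel. cnj (d x) * D x)
   + Im (LINT x|lborel. cnj (w x) * w (x + y)) + Im (LINT x|lborel. cnj (w x) * d (x + y)) + Im (LINT x|lborel. cnj (d x) * w (x + y)) + Im (LINT x|lborel. cnj (d x) * d (x + y))"
  unfolding mom_def e D_def[symmetric] using i by (simp add: distrib_left distrib_right)
 have 2: "mom y t = Im (LINT x|lborel. cnj (w x) * D x) + Im (LINT x|lborel. cnj (w x) * w (x + y))"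
  unfolding mom_def D_def w_def by simp
 have "(LINT x|lborel. cnj (w x) * d (x + y)) = (LINT x|lborel. cnj (w (x + - y)) * d x)"
  using integral_shift[of "%x. cnj (w x) * d (x + y)" "- y"] by simp
 also have "\<dots> = cnj (LINT x|lborel. cnj (d x) * w (x + - y))"
  unfolding Bochner_Integration.integral_cnj[symmetric] by (rule Bochner_Integration.integral_cong) (simp_all add: mult.commute)
 finally have 3: "Im (LINT x|lborel. cnj (w x) * d (x + y)) = - Im (LINT x|lborel. cnj (d x) * w (x + - y))" by simp
 have "(LINT x|lborel. (V s x - V t x) * symd t y x) = (LINT x|lborel. cnj (cnj (d x) * D x + cnj (d x) * w (x + y) - cnj (d x) * w (x + - y)))"
  by (rule Bochner_Integration.integral_cong) (simp_all add: d_def w_def D_def symd_def algebra_simps)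
 also have "\<dots> = cnj ((LINT x|lborel. cnj (d x) * D x) + (LINT x|lborel. cnj (d x) * w (x + y)) - (LINT x|lborel. cnj (d x) * w (x + - y)))"
  unfolding Bochner_Integration.integral_cnj by (rule arg_cong[where f=cnj]) (use i(1) l2_mult[OF c(1) sl(2), of y] l2_mult[OF c(1) sl(2), of "- y"] in simp)
 finally have 4: "Im (LINT x|lborel. (V s x - V t x) * symd t y x) = - Im (LINT x|lborel. cnj (d x) * D x) - Im (LINT x|lborel. cnj (d x) * w (x + y)) + Im (LINT x|lborel. cnj (d x) * w (x + - y))"
  by simp
 have 5: "(LINT x|lborel. cnj (V s x - V t x) * (V s (x + y) - V t (x + y))) = (LINT x|lborel. cnj (d x) * d (x + y))" by (simp add: d_def)
 show ?thesis unfolding 1 2 4 5 3 by simp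
qed

text \<open>The linear term of \<open>mom_expand\<close> is differentiated by the weak equation. The
  quadratic remainder is at most \<open>(nV s t)\<^sup>2\<close>, which is o(s - t) by
  \<open>nV_sq_le\<close>.\<close>

lemma mom_deriv: "(mom y has_real_derivative - Re (Lam t (symd t y) (symd' t y))) (at t)"
proof -
 define R where "R s = Im (LINT x|lborel. cnj (V s x - V t x) * (V s (x + y) - V t (x + y)))" for s
 obtain M where M: "M \<ge> 1" "\<And>s x. s \<in> {-(\<bar>t\<bar>+1)..\<bar>t\<bar>+1} ==> cmod (V s x) \<le> M" "\<And>s. s \<in> {-(\<bar>t\<bar>+1)..\<bar>t\<bar>+1} ==> n2 (G s) \<le> M" "\<And>s. s \<in> {-(\<bar>t\<bar>+1)..\<bar>t\<bar>+1} ==> n2 (eta s) \<le> M"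
  using local_bounds[of "\<bar>t\<bar>+1"] by blast
 have Rb: "\<bar>R s\<bar> \<le> (nV s t)\<^sup>2" for s
 proof -
  have "\<bar>R s\<bar> \<le> cmod (LINT x|lborel. cnj (V s x - V t x) * (V s (x + y) - V t (x + y)))" unfolding R_def by (rule abs_Im_le_cmod)
  also have "\<dots> \<le> n2 (%x. cnj (V s x - V t x)) * n2 (%x. V s (x + y) - V t (x + y))"
   by (rule n2_CS[OF l2_cnj(1)[OF diff_l2] l2_shift(1)[OF diff_l2]])
  also have "\<dots> = (nV s t)\<^sup>2" using l2_shift(2)[OF diff_l2[of s t], of y] by (simp only: n2_cnj nV_def power2_eq_square)
  finally show ?thesis .
 qed
 have "eventually (%s. s \<in> {t-1<..<t+1}) (at t)" by (rule eventually_at_in_open') auto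
 then have ev: "eventually (%s. norm ((R s - R t) / (s - t)) \<le> M\<^sup>2 * (nV s t + nG s t)) (at t)"
  using eventually_neq_at_within[of t t UNIV]
 proof eventually_elim
  case (elim s)
  have "(nV s t)\<^sup>2 \<le> M\<^sup>2 * (nV s t + nG s t) * \<bar>s - t\<bar>"
   by (rule nV_sq_le[where T="\<bar>t\<bar>+1"]) (use elim M in auto)
  then have "\<bar>R s\<bar> \<le> M\<^sup>2 * (nV s t + nG s t) * \<bar>s - t\<bar>" using Rb[of s] by simp
  moreover have "R t = 0" by (simp add: R_def)
  ultimately show ?case using elim by (simp add: abs_divide divide_simps)
 qed
 have "((%s. M\<^sup>2 * (nV s t + nG s t)) \<longlongrightarrow> M\<^sup>2 * (0 + 0)) (at t)" by (intro tendsto_intros nV_tendsto nG_tendsto)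
 then have "((%s. M\<^sup>2 * (nV s t + nG s t)) \<longlongrightarrow> 0) (at t)" by simp
 from Lim_null_comparison[OF ev this] have R': "(R has_real_derivative 0) (at t)"
  by (simp add: has_field_derivative_iff)
 have "((%s. Im (LINT x|lborel. (V s x - V t x) * symd t y x)) has_vector_derivative Im (\<i> * Lam t (symd t y) (symd' t y))) (at t)"
  using bounded_linear.has_vector_derivative[OF bounded_linear_Im weak_eq_H1[OF symd, of t t y t]] .
 then have H: "((%s. Im (LINT x|lborel. (V s x - V t x) * symd t y x)) has_real_derivative Re (Lam t (symd t y) (symd' t y))) (at t)"
  by (simp add: has_real_derivative_iff_has_vector_derivative)
 have "((%s. mom y t - Im (LINT x|lborel. (V s x - V t x) * symd t y x) + R s) has_real_derivative 0 - Re (Lam t (symd t y) (symd' t y)) + 0) (at t)"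
  by (intro DERIV_add DERIV_diff DERIV_const H R')
 moreover have "mom y = (%s. mom y t - Im (LINT x|lborel. (V s x - V t x) * symd t y x) + R s)"
  unfolding R_def using mom_expand by blast
 ultimately show ?thesis by simp
qed

lemma eta_bdd: assumes "\<And>x. cmod (V t x) \<le> M" shows "\<bar>eta t x\<bar> \<le> M\<^sup>2 + 1"
 using power_mono[OF assms[of x] norm_ge_zero, of 2] zero_le_power2[of "cmod (V t x)"] unfolding eta_def by linarith

text \<open>In the real part of \<open>Lam\<close> the derivative terms cancel by translation, and
  so do the products of \<open>eta\<close> with its shifts. What remains pairs the increment of
  \<open>eta\<close>, of order y^(1/2) by Hoelder continuity, with \<open>q\<close>, whose integral
  is O(y^2). The total power 5/2 beats the linear term of \<open>mom_expansion\<close>.\<close>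

lemma mom_deriv_bound:
 assumes M: "\<And>x. cmod (V t x) \<le> M" "n2 (G t) \<le> M" and y: "0 \<le> y"
 shows "\<bar>Re (Lam t (symd t y) (symd' t y))\<bar> \<le> M ^ 4 * (y\<^sup>2 * sqrt y)"
proof -
 have M0: "0 \<le> M" using M(1)[of 0] norm_ge_zero[of "V t 0"] by linarith
 have "(LINT x|lborel. G t x * symd' t y x) = (LINT x|lborel. G t x * cnj (G t (x + y))) - (LINT x|lborel. G t x * cnj (G t (x + - y)))"
  using l2_mult[OF G_l2 l2_cnj(1)[OF l2_shift(1)[OF G_l2, of t y]], of t] l2_mult[OF G_l2 l2_cnj(1)[OF l2_shift(1)[OF G_l2, of t "-y"]], of t]
  by (simp add: symd'_def right_diff_distrib)
 also have "(LINT x|lborel. G t x * cnj (G t (x + - y))) = (LINT x|lborel. G t (x + y) * cnj (G t x))"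
  using integral_shift[of "%x. G t x * cnj (G t (x + - y))" y] by simp
 also have "\<dots> = cnj (LINT x|lborel. G t x * cnj (G t (x + y)))"
  unfolding Bochner_Integration.integral_cnj[symmetric] by (rule Bochner_Integration.integral_cong) (simp_all add: mult.commute)
 finally have g0: "Re (LINT x|lborel. G t x * symd' t y x) = 0" by simp
 define q where "q x = (cmod (V t (x + y) - V t x))\<^sup>2" for x
 have qi: "integrable lborel q" unfolding q_def by (rule l2_int[OF l2_translation_le(1)[OF V_ac G_l2]])
 have qI: "(LINT x|lborel. q x) \<le> (y * M)\<^sup>2"
 proof -
  have "n2 (%x. V t (x + y) - V t x) \<le> y * M"
   using order_trans[OF l2_translation_le(2)[OF V_ac G_l2, of t y] mult_left_mono[OF M(2), of "\<bar>y\<bar>"]] y by simp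
  from power_mono[OF this n2_nonneg, of 2] show ?thesis by (simp add: n2_sq q_def)
 qed
 have [measurable]: "q \<in> borel_measurable borel" using qi by auto
 have eb: "\<bar>eta t x\<bar> \<le> M\<^sup>2 + 1" for x by (rule eta_bdd[OF M(1)])
 have eqi: "integrable lborel (%x. eta t (x + a) * q (x + b))" for a b
 proof (rule Bochner_Integration.integrable_bound[OF integrable_mult_right[OF integrable_shift[OF qi, of b], of "M\<^sup>2 + 1"]])
  show "AE x in lborel. norm (eta t (x + a) * q (x + b)) \<le> norm ((M\<^sup>2 + 1) * q (x + b))"
   using eb by (intro AE_I2) (auto simp: abs_mult intro!: mult_right_mono order_trans[OF eb])
 qed measurable
 have eei: "integrable lborel (%x. eta t x * eta t (x + a))" for a by (rule l2_mult[OF eta_l2 l2_shift(1)[OF eta_l2]])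
 have pol: "Re (a * cnj b) = 1 - ((1 - (cmod a)\<^sup>2) + (1 - (cmod b)\<^sup>2)) / 2 - (cmod (b - a))\<^sup>2 / 2" for a b
  by (simp add: cmod_power2, simp add: power2_eq_square field_simps)
 have pt: "Re (of_real (eta t x) * V t x * symd t y x) = (- 1/2) * (eta t x * eta t (x + y)) + (1/2) * (eta t x * eta t (x + - y)) - (1/2) * (eta t x * q x) + (1/2) * (eta t x * q (x + - y))" for x
 proof -
  have "Re (of_real (eta t x) * V t x * symd t y x) = eta t x * (Re (V t x * cnj (V t (x + y))) - Re (V t x * cnj (V t (x + - y))))"
   by (simp add: symd_def algebra_simps)
  also have "Re (V t x * cnj (V t (x + y))) = 1 - (eta t x + eta t (x + y)) / 2 - q x / 2"
   unfolding pol by (simp add: eta_def q_def)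
  also have "Re (V t x * cnj (V t (x + - y))) = 1 - (eta t x + eta t (x + - y)) / 2 - q (x + - y) / 2"
   unfolding pol by (simp add: eta_def q_def norm_minus_commute)
  also have "eta t x * ((1 - (eta t x + eta t (x + y)) / 2 - q x / 2) - (1 - (eta t x + eta t (x + - y)) / 2 - q (x + - y) / 2))
    = (- 1/2) * (eta t x * eta t (x + y)) + (1/2) * (eta t x * eta t (x + - y)) - (1/2) * (eta t x * q x) + (1/2) * (eta t x * q (x + - y))"
   by (simp add: field_simps)
  finally show ?thesis .
 qed
 have il: "integrable lborel (%x. of_real (eta t x) * V t x * symd t y x)" by (rule l2_mult[OF etaV_l2 symd(2)])
 have "Re (LINT x|lborel. of_real (eta t x) * V t x * symd t y x) = (LINT x|lborel. Re (of_real (eta t x) * V t x * symd t y x))"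
  using integral_Re[OF il] by simp
 also have "\<dots> = (- 1/2) * (LINT x|lborel. eta t x * eta t (x + y)) + (1/2) * (LINT x|lborel. eta t x * eta t (x + - y)) - (1/2) * (LINT x|lborel. eta t x * q x) + (1/2) * (LINT x|lborel. eta t x * q (x + - y))"
  unfolding pt using eei[of y] eei[of "- y"] eqi[of 0 0] eqi[of 0 "- y"] by simp
 also have "(LINT x|lborel. eta t x * eta t (x + - y)) = (LINT x|lborel. eta t x * eta t (x + y))"
  using integral_shift[of "%x. eta t x * eta t (x + - y)" y] by (simp add: mult.commute)
 also have "(LINT x|lborel. eta t x * q (x + - y)) = (LINT x|lborel. eta t (x + y) * q x)"
  using integral_shift[of "%x. eta t x * q (x + - y)" y] by simp
 finally have "Re (LINT x|lborel. of_real (eta t x) * V t x * symd t y x) = (1/2) * (LINT x|lborel. eta t (x + y) * q x) - (1/2) * (LINT x|lborel. eta t x * q x)"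
  by simp
 also have "\<dots> = (1/2) * (LINT x|lborel. (eta t (x + y) - eta t x) * q x)"
  using eqi[of y 0] eqi[of 0 0] by (simp add: left_diff_distrib right_diff_distrib)
 finally have e1: "Re (Lam t (symd t y) (symd' t y)) = (1/2) * (LINT x|lborel. (eta t (x + y) - eta t x) * q x)"
  using g0 by (simp add: Lam_def)
 have vd: "cmod (V t (x + y) - V t x) \<le> sqrt y * M" for x
  using order_trans[OF ac_l2_le[OF V_ac G_l2, of t "x + y" x]] mult_left_mono[OF M(2), of "sqrt y"] y by simp
 have ed: "\<bar>eta t (x + y) - eta t x\<bar> \<le> 2 * M * (sqrt y * M)" for x
 proof -
  have "\<bar>eta t (x + y) - eta t x\<bar> = \<bar>cmod (V t x) - cmod (V t (x + y))\<bar> * (cmod (V t x) + cmod (V t (x + y)))"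
  proof -
   have "eta t (x + y) - eta t x = (cmod (V t x) - cmod (V t (x + y))) * (cmod (V t x) + cmod (V t (x + y)))"
    by (simp add: eta_def power2_eq_square algebra_simps)
   then show ?thesis by (simp add: abs_mult)
  qed
  also have "\<dots> \<le> cmod (V t (x + y) - V t x) * (2 * M)"
   using norm_triangle_ineq3[of "V t x" "V t (x + y)"] M(1)[of x] M(1)[of "x + y"] by (intro mult_mono) (auto simp: norm_minus_commute)
  also have "\<dots> \<le> (sqrt y * M) * (2 * M)"
   using vd[of x] M0 by (intro mult_right_mono) auto
  finally show ?thesis by (simp add: mult_ac)
 qed
 have "\<bar>LINT x|lborel. (eta t (x + y) - eta t x) * q x\<bar> \<le> (LINT x|lborel. (2 * M * (sqrt y * M)) * q x)"
 proof (rule Bochner_Integration.integral_norm_bound_integral[where f="%x. (eta t (x + y) - eta t x) * q x", simplified real_norm_def])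
  show "integrable lborel (%x. (eta t (x + y) - eta t x) * q x)" using eqi[of y 0] eqi[of 0 0] by (simp add: left_diff_distrib)
  show "integrable lborel (%x. (2 * M * (sqrt y * M)) * q x)" using qi by simp
  show "\<bar>(eta t (x + y) - eta t x) * q x\<bar> \<le> (2 * M * (sqrt y * M)) * q x" for x
   using mult_right_mono[OF ed[of x], of "q x"] by (simp add: abs_mult q_def)
 qed
 also have "\<dots> \<le> (2 * M * (sqrt y * M)) * (y * M)\<^sup>2"
  unfolding integral_mult_right_zero using qI M0 y by (intro mult_left_mono) auto
 also have "\<dots> = 2 * (M ^ 4 * (y\<^sup>2 * sqrt y))" by (simp add: power2_eq_square power4_eq_xxxx mult_ac)
 finally show ?thesis unfolding e1 by (simp add: abs_mult)
qed

end

context gp_flow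
begin

lemma mom_bound: "\<exists>C. \<forall>y\<ge>0. \<bar>mom y t\<bar> \<le> C * (y\<^sup>2 * sqrt y)"
proof -
 obtain M where M: "M \<ge> 1" "\<And>s x. s \<in> {-\<bar>t\<bar>..\<bar>t\<bar>} ==> cmod (V s x) \<le> M" "\<And>s. s \<in> {-\<bar>t\<bar>..\<bar>t\<bar>} ==> n2 (G s) \<le> M"
  using local_bounds[of "\<bar>t\<bar>"] by blast
 have "\<bar>mom y t\<bar> \<le> (M ^ 4 * \<bar>t\<bar>) * (y\<^sup>2 * sqrt y)" if y: "0 \<le> y" for y
 proof -
  have "norm (mom y t - mom y 0) \<le> M ^ 4 * (y\<^sup>2 * sqrt y) * norm (t - 0)"
  proof (rule field_differentiable_bound[where S="{-\<bar>t\<bar>..\<bar>t\<bar>}" and f'="%s. - Re (Lam s (symd s y) (symd' s y))"])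
   fix s assume s: "s \<in> {-\<bar>t\<bar>..\<bar>t\<bar>}"
   show "(mom y has_field_derivative - Re (Lam s (symd s y) (symd' s y))) (at s within {-\<bar>t\<bar>..\<bar>t\<bar>})"
    by (rule has_field_derivative_at_within[OF mom_deriv])
   show "norm (- Re (Lam s (symd s y) (symd' s y))) \<le> M ^ 4 * (y\<^sup>2 * sqrt y)"
    using mom_deriv_bound[OF M(2)[OF s] M(3)[OF s] y] by simp
  qed auto
  moreover have "mom y 0 = 0" by (simp add: mom_def)
  ultimately show ?thesis by (simp add: mult_ac)
 qed
 then show ?thesis by blast
qed

text \<open>Both pairings are expanded to first order by
  \<open>translation_pairing_expansion\<close>. The term of order zero in the second one is the
  integral of |V t - V 0|^2, which is real and drops out.\<close>

lemma mom_expansion: "\<exists>K. \<forall>y\<in>{0..1}. \<bar>mom y t - y * (2 * Im (LINT x|lborel. cnj (V t x - V 0 x) * G 0 x) + Im (LINT x|lborel. cnj (V t x - V 0 x) * (G t x - G 0 x)))\<bar> \<le> K * y\<^sup>2"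
proof -
 define w where "w x = cnj (V t x - V 0 x)" for x
 define w' where "w' x = cnj (G t x - G 0 x)" for x
 have w: "ac w w'" "l2 w" "l2 w'" unfolding w_def[abs_def] w'_def[abs_def]
  by (intro ac_cnj Vd_ac l2_cnj(1) diff_l2 Gd_l2)+
 let ?A = "n2 w'" let ?B = "n2 (G 0)"
 define c0 where "c0 = (LINT x|lborel. w x * G 0 x)"
 define c1 where "c1 = (LINT x|lborel. w x * (G t x - G 0 x))"
 have "\<bar>mom y t - y * (2 * Im c0 + Im c1)\<bar> \<le> (3 * ?A * ?B + ?A * nG t 0) * y\<^sup>2" if y: "0 \<le> y" "y \<le> 1" for y
 proof -
  define d where "d x = V 0 (x + y) - V 0 x" for x
  have dl: "l2 d" "n2 d \<le> y * ?B" unfolding d_def[abs_def] using l2_translation_le[OF V_ac G_l2, of 0 y] y by auto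
  define p1 where "p1 = (LINT x|lborel. w x * d x)"
  have e1: "cmod (p1 - y *\<^sub>R c0) \<le> y\<^sup>2 * ?A * ?B"
   unfolding p1_def c0_def d_def by (rule translation_pairing_expansion[OF w V_ac G_l2 y(1)])
  have ws: "l2 (%x. w (x + y) - w x)" "n2 (%x. w (x + y) - w x) \<le> y * ?A"
   using l2_translation_le[OF w(1,3), of y] y by auto
  have e2: "cmod (LINT x|lborel. (w (x + y) - w x) * d x) \<le> y\<^sup>2 * ?A * ?B"
  proof -
   have "cmod (LINT x|lborel. (w (x + y) - w x) * d x) \<le> n2 (%x. w (x + y) - w x) * n2 d" by (rule n2_CS[OF ws(1) dl(1)])
   also have "\<dots> \<le> (y * ?A) * (y * ?B)" using ws(2) dl(2) y by (intro mult_mono) auto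
   finally show ?thesis by (simp add: power2_eq_square mult_ac)
  qed
  have i: "integrable lborel (%x. w x * d x)" "integrable lborel (%x. w (x + y) * d x)" "integrable lborel (%x. w x * d (x + - y))"
   by (intro l2_mult w dl l2_shift(1)[OF w(2)] l2_shift(1)[OF dl(1)])+
  have p2: "(LINT x|lborel. w x * d (x + - y)) = p1 + (LINT x|lborel. (w (x + y) - w x) * d x)"
   using integral_shift[of "%x. w x * d (x + - y)" y] i by (simp add: p1_def left_diff_distrib)
  have m1: "(LINT x|lborel. w x * (V 0 (x + y) - V 0 (x + - y))) = p1 + (LINT x|lborel. w x * d (x + - y))"
  proof -
   have "(LINT x|lborel. w x * (V 0 (x + y) - V 0 (x + - y))) = (LINT x|lborel. w x * d x + w x * d (x + - y))"
    by (rule Bochner_Integration.integral_cong) (simp_all add: d_def algebra_simps)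
   then show ?thesis using i by (simp add: p1_def)
  qed
  define u where "u x = V t x - V 0 x" for x
  have u: "ac u (%x. G t x - G 0 x)" "l2 u" unfolding u_def[abs_def] by (rule Vd_ac diff_l2)+
  have us: "l2 (%x. u (x + y) - u x)" by (rule l2_translation_le(1)[OF u(1) Gd_l2])
  define p3 where "p3 = (LINT x|lborel. w x * (u (x + y) - u x))"
  have e3: "cmod (p3 - y *\<^sub>R c1) \<le> y\<^sup>2 * ?A * nG t 0"
   unfolding p3_def c1_def nG_def by (rule translation_pairing_expansion[OF w u(1) Gd_l2 y(1)])
  have m2: "Im (LINT x|lborel. w x * u (x + y)) = Im p3"
  proof -
   have "(LINT x|lborel. w x * u (x + y)) = (LINT x|lborel. w x * (u (x + y) - u x) + w x * u x)"
    by (rule Bochner_Integration.integral_cong) (simp_all add: algebra_simps)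
   also have "\<dots> = p3 + (LINT x|lborel. w x * u x)" using l2_mult[OF w(2) us] l2_mult[OF w(2) u(2)] by (simp add: p3_def)
   also have "(LINT x|lborel. w x * u x) = (LINT x|lborel. complex_of_real ((cmod (u x))\<^sup>2))"
    by (rule Bochner_Integration.integral_cong[OF refl]) (simp only: w_def u_def complex_norm_square mult.commute)
   also have "\<dots> = complex_of_real (LINT x|lborel. (cmod (u x))\<^sup>2)" by (rule integral_complex_of_real)
   finally show ?thesis by simp
  qed
  have "mom y t = Im (LINT x|lborel. w x * (V 0 (x + y) - V 0 (x + - y))) + Im (LINT x|lborel. w x * u (x + y))"
   by (simp add: mom_def w_def u_def)
  then have "mom y t - y * (2 * Im c0 + Im c1) = 2 * Im (p1 - y *\<^sub>R c0) + Im (LINT x|lborel. (w (x + y) - w x) * d x) + Im (p3 - y *\<^sub>R c1)"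
   unfolding m1 m2 p2 by (simp add: algebra_simps)
  moreover have "\<bar>Im (p1 - y *\<^sub>R c0)\<bar> \<le> y\<^sup>2 * ?A * ?B" "\<bar>Im (LINT x|lborel. (w (x + y) - w x) * d x)\<bar> \<le> y\<^sup>2 * ?A * ?B" "\<bar>Im (p3 - y *\<^sub>R c1)\<bar> \<le> y\<^sup>2 * ?A * nG t 0"
   using order_trans[OF abs_Im_le_cmod e1] order_trans[OF abs_Im_le_cmod e2] order_trans[OF abs_Im_le_cmod e3] by auto
  ultimately have "\<bar>mom y t - y * (2 * Im c0 + Im c1)\<bar> \<le> 3 * (y\<^sup>2 * ?A * ?B) + y\<^sup>2 * ?A * nG t 0" by linarith
  then show ?thesis by (simp add: algebra_simps)
 qed
 then show ?thesis unfolding c0_def c1_def w_def by (intro exI[of _ "3 * ?A * ?B + ?A * nG t 0"]) auto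
qed

text \<open>The expression is the linear coefficient of \<open>mom y t\<close> in y, while
  \<open>mom y t\<close> is O(y^(5/2)); dividing by y and letting y tend to 0 leaves nothing. It is
  the renormalised change of the momentum since time 0.\<close>

lemma momentum_pairing_zero:
 "2 * Im (LINT x|lborel. cnj (V t x - V 0 x) * G 0 x) + Im (LINT x|lborel. cnj (V t x - V 0 x) * (G t x - G 0 x)) = 0" (is "?I = 0")
proof -
 obtain C where C: "\<And>y. 0 \<le> y ==> \<bar>mom y t\<bar> \<le> C * (y\<^sup>2 * sqrt y)" using mom_bound by blast
 obtain K where K: "\<And>y. y \<in> {0..1} ==> \<bar>mom y t - y * ?I\<bar> \<le> K * y\<^sup>2" using mom_expansion by blast
 have b: "\<bar>?I\<bar> \<le> (\<bar>C\<bar> + \<bar>K\<bar>) * y" if y: "0 < y" "y \<le> 1" for y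
 proof -
  have "C * (y\<^sup>2 * sqrt y) \<le> \<bar>C\<bar> * (y\<^sup>2 * 1)" using y by (intro mult_mono) auto
  moreover have "K * y\<^sup>2 \<le> \<bar>K\<bar> * y\<^sup>2" by (intro mult_right_mono) auto
  ultimately have "\<bar>y * ?I\<bar> \<le> (\<bar>C\<bar> + \<bar>K\<bar>) * y\<^sup>2"
  proof -
   have "\<bar>mom y t\<bar> \<le> C * (y\<^sup>2 * sqrt y)" "\<bar>mom y t - y * ?I\<bar> \<le> K * y\<^sup>2" using C[of y] K[of y] y by auto
   then show ?thesis using \<open>C * (y\<^sup>2 * sqrt y) \<le> \<bar>C\<bar> * (y\<^sup>2 * 1)\<close> \<open>K * y\<^sup>2 \<le> \<bar>K\<bar> * y\<^sup>2\<close>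
    unfolding distrib_right by linarith
  qed
  then have "y * \<bar>?I\<bar> \<le> y * ((\<bar>C\<bar> + \<bar>K\<bar>) * y)" using y by (simp add: abs_mult power2_eq_square mult_ac)
  then show ?thesis using y by simp
 qed
 have "((%y. (\<bar>C\<bar> + \<bar>K\<bar>) * y) \<longlongrightarrow> (\<bar>C\<bar> + \<bar>K\<bar>) * 0) (at_right 0)" by (intro tendsto_intros)
 moreover have "eventually (%y. \<bar>?I\<bar> \<le> (\<bar>C\<bar> + \<bar>K\<bar>) * y) (at_right (0::real))"
  unfolding eventually_at_right_field using b by (intro exI[of _ 1]) auto
 ultimately have "\<bar>?I\<bar> \<le> (\<bar>C\<bar> + \<bar>K\<bar>) * 0" by (rule tendsto_lowerbound) simp
 then show ?thesis by simp
qed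

definition nu :: "real => real => real" where "nu t x = Im (cnj (V t x) * G t x)"

text \<open>The two densities differ by the derivative of Im (cnj (V 0) * w), a function vanishing
  at both ends, plus an integrable function whose integral is the pairing of
  \<open>momentum_pairing_zero\<close>. That derivative need not be integrable, hence the
  windows.\<close>

theorem momentum_conserved:
 assumes X: "filterlim X at_bot sequentially" and Y: "filterlim Y at_top sequentially"
 shows "(%n. LINT x:{X n..Y n}|lborel. nu t x - nu 0 x) \<longlonglongrightarrow> 0"
proof -
 define w where "w x = V t x - V 0 x" for x
 define w' where "w' x = G t x - G 0 x" for x
 have w: "ac w w'" "l2 w" "l2 w'" unfolding w_def[abs_def] w'_def[abs_def] by (rule Vd_ac diff_l2 Gd_l2)+
 define F where "F x = Im (cnj (V 0 x) * w x)" for x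
 define f where "f x = Im (cnj (G 0 x) * w x + cnj (V 0 x) * w' x)" for x
 have F: "ac F f" unfolding F_def[abs_def] f_def[abs_def] by (intro ac_Im ac_mult ac_cnj V_ac w)
 define g where "g x = 2 * Im (cnj (w x) * G 0 x) + Im (cnj (w x) * w' x)" for x
 have ig: "integrable lborel (%x. Im (cnj (w x) * G 0 x))" "integrable lborel (%x. Im (cnj (w x) * w' x))"
  by (intro integrable_Im l2_mult l2_cnj(1) w G_l2)+
 have gi: "integrable lborel g" unfolding g_def by (intro Bochner_Integration.integrable_add integrable_mult_right ig)
 have "(LINT x|lborel. g x) = 2 * (LINT x|lborel. Im (cnj (w x) * G 0 x)) + (LINT x|lborel. Im (cnj (w x) * w' x))"
  unfolding g_def Bochner_Integration.integral_add[OF integrable_mult_right[OF ig(1)] ig(2)]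
  by (rule arg_cong2[where f="(+)"]) (rule integral_mult_right_zero, rule refl)
 also have "\<dots> = 2 * Im (LINT x|lborel. cnj (w x) * G 0 x) + Im (LINT x|lborel. cnj (w x) * w' x)"
  by (subst (1 2) integral_Im) (intro l2_mult l2_cnj(1) w G_l2 refl)+
 finally have g0: "(LINT x|lborel. g x) = 0" using momentum_pairing_zero[of t] by (simp add: w_def w'_def)
 have pt: "nu t x - nu 0 x = f x + g x" for x
 proof -
  have "V t x = V 0 x + w x" "G t x = G 0 x + w' x" by (simp_all add: w_def w'_def)
  then show ?thesis by (simp add: nu_def f_def g_def algebra_simps)
 qed
 have ev: "eventually (%n. X n \<le> 0) sequentially" "eventually (%n. 0 \<le> Y n) sequentially"
  using X Y by (auto simp: filterlim_at_bot filterlim_at_top)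
 have e: "eventually (%n. (F (Y n) - F (X n)) + (LINT x:{X n..Y n}|lborel. g x) = (LINT x:{X n..Y n}|lborel. nu t x - nu 0 x)) sequentially"
  using ev
 proof eventually_elim
  case (elim n)
  have "set_integrable lborel {X n..Y n} g"
   unfolding set_integrable_def using integrable_mult_indicator[OF _ gi, of "{X n..Y n}"] by simp
  then show ?case unfolding pt using set_integral_add(2)[OF ac_set_integrable[OF F]] ac_int[OF F, of "X n" "Y n"] elim by simp
 qed
 obtain M where M: "\<And>x. cmod (V 0 x) \<le> M" using V_bdd1 by blast
 have F0: "(F \<longlongrightarrow> 0) net" if "(w \<longlongrightarrow> 0) net" for net
 proof (rule Lim_null_comparison)
  show "eventually (%x. norm (F x) \<le> M * cmod (w x)) net"
  proof (rule always_eventually, rule allI)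
   fix x
   have "\<bar>F x\<bar> \<le> cmod (cnj (V 0 x) * w x)" unfolding F_def by (rule abs_Im_le_cmod)
   then show "norm (F x) \<le> M * cmod (w x)" using mult_right_mono[OF M, of "cmod (w x)" x] by (simp add: norm_mult)
  qed
  show "((%x. M * cmod (w x)) \<longlongrightarrow> 0) net" using tendsto_mult_left[OF tendsto_norm[OF that], of M] by simp
 qed
 have "(%n. (F (Y n) - F (X n)) + (LINT x:{X n..Y n}|lborel. g x)) \<longlonglongrightarrow> (0 - 0) + 0"
  using integrable_tendsto_window[OF gi X Y] g0
  by (intro tendsto_add tendsto_diff filterlim_compose[OF F0[OF ac_l2_tendsto_0(1)[OF w]] Y] filterlim_compose[OF F0[OF ac_l2_tendsto_0(2)[OF w]] X]) simp
 then show ?thesis using tendsto_cong[OF e] by simp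
qed

end

section \<open>Conservation of the energy\<close>

lemma potential_expansion:
 fixes a b c :: complex
 assumes "cmod a \<le> M" "cmod b \<le> M" "cmod c \<le> M" "1 \<le> M"
 shows "\<bar>Re (of_real (1 - (cmod c)\<^sup>2) * c * cnj (b - a)) + ((1 - (cmod b)\<^sup>2)\<^sup>2 - (1 - (cmod a)\<^sup>2)\<^sup>2) / 4\<bar>
   \<le> 2 * M\<^sup>2 * (cmod (b - a) * (cmod (a - c) + cmod (b - c)))"
proof -
 let ?e = "%z. 1 - (cmod z)\<^sup>2"
 \<comment> \<open>Secant against tangent for the potential (1 - |z|^2)^2 / 4. Minus the secant from
   a to b is the pairing of (a + b) (e a + e b) / 4 with b - a; the tangent at c has e c times c in
   its place. \<open>Z\<close> is the difference of these two vectors, arranged so that every term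
   contains an increment from c.\<close>
 define Z where "Z = ((a - c) + (b - c)) * of_real ((?e a + ?e b) / 4) + c * of_real (((?e a - ?e c) + (?e b - ?e c)) / 2)"
 have eq: "Re (of_real (?e c) * c * cnj (b - a)) + ((?e b)\<^sup>2 - (?e a)\<^sup>2) / 4 = - Re (Z * cnj (b - a))"
 proof -
  have z: "of_real (?e c) * c = (a + b) * of_real ((?e a + ?e b) / 4) - Z"
   by (simp add: Z_def field_simps)
  have "Re ((a + b) * of_real s * cnj (b - a)) = s * ((cmod b)\<^sup>2 - (cmod a)\<^sup>2)" for s
   unfolding cmod_power2 by (simp add: power2_eq_square algebra_simps)
  from this[of "(?e a + ?e b) / 4"] show ?thesis
   unfolding z by (simp add: left_diff_distrib power2_eq_square field_simps)
 qed
 have "\<bar>Re (of_real (?e c) * c * cnj (b - a)) + ((?e b)\<^sup>2 - (?e a)\<^sup>2) / 4\<bar> \<le> cmod Z * cmod (b - a)"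
  unfolding eq abs_minus_cancel using abs_Re_le_cmod[of "Z * cnj (b - a)"] by (simp only: norm_mult complex_mod_cnj)
 also have "cmod Z \<le> 2 * M\<^sup>2 * (cmod (a - c) + cmod (b - c))"
 proof -
  have e: "\<bar>?e z\<bar> \<le> 1 + M\<^sup>2" if "cmod z \<le> M" for z
   using power_mono[OF that norm_ge_zero, of 2] zero_le_power2[of "cmod z"] by linarith
  have d: "\<bar>?e z - ?e c\<bar> \<le> 2 * M * cmod (z - c)" if "cmod z \<le> M" for z
  proof -
   have "?e z - ?e c = (cmod c - cmod z) * (cmod c + cmod z)" by (simp add: power2_eq_square algebra_simps)
   then have "\<bar>?e z - ?e c\<bar> = \<bar>cmod c - cmod z\<bar> * (cmod c + cmod z)" by (simp add: abs_mult)
   also have "\<dots> \<le> cmod (z - c) * (2 * M)"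
    using norm_triangle_ineq3[of c z] that assms(3) by (intro mult_mono) (auto simp: norm_minus_commute)
   finally show ?thesis by (simp add: mult_ac)
  qed
  let ?s = "cmod (a - c) + cmod (b - c)"
  have "cmod Z \<le> cmod ((a - c) + (b - c)) * \<bar>(?e a + ?e b) / 4\<bar> + cmod c * \<bar>((?e a - ?e c) + (?e b - ?e c)) / 2\<bar>"
   unfolding Z_def using norm_triangle_ineq[of "((a - c) + (b - c)) * of_real ((?e a + ?e b) / 4)" "c * of_real (((?e a - ?e c) + (?e b - ?e c)) / 2)"]
   by (simp only: norm_mult norm_of_real)
  also have "\<dots> \<le> ?s * ((1 + M\<^sup>2) / 2) + M * (M * ?s)"
  proof (intro add_mono mult_mono)
   show "cmod ((a - c) + (b - c)) \<le> ?s" by (rule norm_triangle_ineq)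
   show "\<bar>(?e a + ?e b) / 4\<bar> \<le> (1 + M\<^sup>2) / 2" 
   proof -
    have "\<bar>(x + y) / 4\<bar> \<le> m / 2" if "\<bar>x\<bar> \<le> m" "\<bar>y\<bar> \<le> m" for x y m :: real using that by (simp add: abs_le_iff)
    from this[OF e[OF assms(1)] e[OF assms(2)]] show ?thesis .
   qed
   show "\<bar>((?e a - ?e c) + (?e b - ?e c)) / 2\<bar> \<le> M * ?s" using d[OF assms(1)] d[OF assms(2)] by (simp add: distrib_left) 
  qed (use assms in auto)
  also have "\<dots> = ((1 + M\<^sup>2) / 2 + M\<^sup>2) * ?s" by (simp add: power2_eq_square algebra_simps)
  also have "\<dots> \<le> (2 * M\<^sup>2) * ?s" using one_le_power[OF assms(4), of 2] by (intro mult_right_mono) auto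
  finally show ?thesis .
 qed
 finally show ?thesis by (simp add: mult_ac mult_right_mono)
qed

context gp_flow
begin

definition en :: "real => real" where "en t = (n2 (G t))\<^sup>2 / 2 + (n2 (eta t))\<^sup>2 / 4"

text \<open>The gradient counterpart of \<open>potential_expansion\<close>, obtained by expanding |G
  b - G c|^2 and |G a - G c|^2; here the error is known exactly.\<close>

lemma G_polarization:
 "Re (LINT x|lborel. G c x * cnj (G b x - G a x)) = ((n2 (G b))\<^sup>2 - (n2 (G a))\<^sup>2) / 2 - ((nG b c)\<^sup>2 - (nG a c)\<^sup>2) / 2"
proof -
 have il: "integrable lborel (%x. G c x * cnj (G b x - G a x))" by (intro l2_mult l2_cnj(1) Gd_l2 G_l2)
 note i = l2_int[OF G_l2[of b]] l2_int[OF G_l2[of a]] l2_int[OF Gd_l2[of b c]] l2_int[OF Gd_l2[of a c]]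
 have pt: "Re (z * cnj (y - x)) = ((cmod y)\<^sup>2 - (cmod x)\<^sup>2) / 2 - ((cmod (y - z))\<^sup>2 - (cmod (x - z))\<^sup>2) / 2" for x y z
  by (simp add: cmod_power2, simp add: power2_eq_square field_simps)
 have "Re (LINT x|lborel. G c x * cnj (G b x - G a x)) = (LINT x|lborel. Re (G c x * cnj (G b x - G a x)))"
  using integral_Re[OF il] by simp
 also have "\<dots> = (LINT x|lborel. ((cmod (G b x))\<^sup>2 - (cmod (G a x))\<^sup>2) / 2 - ((cmod (G b x - G c x))\<^sup>2 - (cmod (G a x - G c x))\<^sup>2) / 2)"
  unfolding pt ..
 also have "\<dots> = ((n2 (G b))\<^sup>2 - (n2 (G a))\<^sup>2) / 2 - ((nG b c)\<^sup>2 - (nG a c)\<^sup>2) / 2"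
  unfolding nG_def n2_sq using i by simp
 finally show ?thesis .
qed

text \<open>The integrated equation, tested with the conjugate of \<open>V b - V a\<close>, has a
  real left side, so the time integral of Re Lam vanishes. Up to O(w (b - a)), Re Lam is minus the
  energy increment plus half the difference of \<open>(nG b \<tau>)\<^sup>2\<close> and
  \<open>(nG a \<tau>)\<^sup>2\<close>. As \<open>G\<close> is merely continuous in time, these
  squares need not be o(b - a); they are kept for the averaging in
  \<open>energy_window_bound\<close>.\<close>

lemma energy_increment:
 assumes M: "M \<ge> 1" "\<And>t x. t \<in> {-T..T} ==> cmod (V t x) \<le> M" "\<And>t. t \<in> {-T..T} ==> n2 (G t) \<le> M" "\<And>t. t \<in> {-T..T} ==> n2 (eta t) \<le> M"
  and ab: "a \<le> b" "{a..b} \<subseteq> {-T..T}" and w: "\<And>r s. r \<in> {a..b} ==> s \<in> {a..b} ==> nV r s \<le> w \<and> nG r s \<le> w"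
 shows "\<bar>(b - a) * (en b - en a) - integral {a..b} (%\<tau>. (nG b \<tau>)\<^sup>2 - (nG a \<tau>)\<^sup>2) / 2\<bar> \<le> 8 * M ^ 4 * w * (b - a)\<^sup>2"
proof -
 have inT: "r \<in> {-T..T}" if "r \<in> {a..b}" for r using that ab(2) by blast
 have aT: "a \<in> {a..b}" "b \<in> {a..b}" using ab(1) by auto
 have w0: "0 \<le> w" using w[OF aT(1) aT(1)] by simp
 let ?\<phi> = "%x. cnj (V b x - V a x)" and ?\<phi>' = "%x. cnj (G b x - G a x)"
 have c: "ac ?\<phi> ?\<phi>'" by (rule ac_cnj[OF Vd_ac])
 have l: "l2 ?\<phi>" "l2 ?\<phi>'" by (intro l2_cnj(1) diff_l2 Gd_l2)+
 have "(LINT x|lborel. (V b x - V a x) * ?\<phi> x) = complex_of_real ((nV b a)\<^sup>2)"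
  unfolding nV_def n2_sq by (simp only: complex_norm_square[symmetric] integral_complex_of_real)
 then have z: "Im (integral {a..b} (%\<tau>. \<i> * Lam \<tau> ?\<phi> ?\<phi>')) = 0"
  using weak_eq_H1_integral[OF c l ab(1)] by (metis Im_complex_of_real)
 have ci: "continuous_on {a..b} (%\<tau>. \<i> * Lam \<tau> ?\<phi> ?\<phi>')" by (intro continuous_intros Lam_cont l)
 have cR: "continuous_on {a..b} (%\<tau>. Re (Lam \<tau> ?\<phi> ?\<phi>'))" by (intro continuous_intros Lam_cont l)
 have "integral {a..b} (%\<tau>. Im (\<i> * Lam \<tau> ?\<phi> ?\<phi>')) = Im (integral {a..b} (%\<tau>. \<i> * Lam \<tau> ?\<phi> ?\<phi>'))"
  using integral_linear[OF integrable_continuous_real[OF ci] bounded_linear_Im] by (simp add: o_def)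
 then have z1: "integral {a..b} (%\<tau>. Re (Lam \<tau> ?\<phi> ?\<phi>')) = 0" unfolding z by simp
 let ?D = "%\<tau>. ((nG b \<tau>)\<^sup>2 - (nG a \<tau>)\<^sup>2) / 2"
 have cD: "continuous_on {a..b} ?D" unfolding nG_sym[of b] nG_sym[of a] by (intro continuous_intros nG_cont) auto
 have nb: "nV r s * nV b a \<le> 2 * M\<^sup>2 * w * (b - a)" if "r \<in> {a..b}" "s \<in> {a..b}" for r s
 proof -
  have q: "(nV r s)\<^sup>2 \<le> 2 * M\<^sup>2 * w * (b - a)" if "r \<in> {a..b}" "s \<in> {a..b}" for r s
  proof -
   have "(nV r s)\<^sup>2 \<le> M\<^sup>2 * (nV r s + nG r s) * \<bar>r - s\<bar>"
    by (rule nV_sq_le[where T=T]) (use inT that M in auto)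
   also have "\<dots> \<le> M\<^sup>2 * (2 * w) * (b - a)"
    using w[OF that] that w0 by (intro mult_mono) (auto simp: abs_le_iff)
   finally show ?thesis by (simp add: mult_ac)
  qed
  have "2 * (nV r s * nV b a) \<le> (nV r s)\<^sup>2 + (nV b a)\<^sup>2" using sum_squares_bound[of "nV r s" "nV b a"] by (simp add: mult.assoc)
  then show ?thesis using q[OF that] q[OF aT(2,1)] by linarith
 qed
 have R: "\<bar>Re (Lam \<tau> ?\<phi> ?\<phi>') + (en b - en a) - ?D \<tau>\<bar> \<le> 8 * M ^ 4 * w * (b - a)" if \<tau>: "\<tau> \<in> {a..b}" for \<tau>
 proof -
  have il: "integrable lborel (%x. of_real (eta \<tau> x) * V \<tau> x * ?\<phi> x)" by (rule l2_mult[OF etaV_l2 l(1)])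
  note ie = l2_int[OF eta_l2[of b]] l2_int[OF eta_l2[of a]]
  have "Re (LINT x|lborel. of_real (eta \<tau> x) * V \<tau> x * ?\<phi> x) + ((n2 (eta b))\<^sup>2 - (n2 (eta a))\<^sup>2) / 4
    = (LINT x|lborel. Re (of_real (eta \<tau> x) * V \<tau> x * ?\<phi> x)) + (LINT x|lborel. ((eta b x)\<^sup>2 - (eta a x)\<^sup>2) / 4)"
   unfolding n2_sq integral_Re[OF il] using ie by simp
  also have "\<dots> = (LINT x|lborel. Re (of_real (eta \<tau> x) * V \<tau> x * ?\<phi> x) + ((eta b x)\<^sup>2 - (eta a x)\<^sup>2) / 4)"
   by (rule Bochner_Integration.integral_add[symmetric, OF integrable_Re[OF il]]) (use ie in simp)
  finally have e1: "Re (LINT x|lborel. of_real (eta \<tau> x) * V \<tau> x * ?\<phi> x) + ((n2 (eta b))\<^sup>2 - (n2 (eta a))\<^sup>2) / 4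
    = (LINT x|lborel. Re (of_real (eta \<tau> x) * V \<tau> x * ?\<phi> x) + ((eta b x)\<^sup>2 - (eta a x)\<^sup>2) / 4)" .
  have e2: "Re (Lam \<tau> ?\<phi> ?\<phi>') + (en b - en a) - ?D \<tau> = (LINT x|lborel. Re (of_real (eta \<tau> x) * V \<tau> x * ?\<phi> x) + ((eta b x)\<^sup>2 - (eta a x)\<^sup>2) / 4)"
   unfolding e1[symmetric] Lam_def minus_complex.sel G_polarization en_def by (simp add: field_simps)
  note ip = l2_mult_norm[OF diff_l2[of b a] diff_l2[of a \<tau>]] l2_mult_norm[OF diff_l2[of b a] diff_l2[of b \<tau>]]
  have "norm (LINT x|lborel. Re (of_real (eta \<tau> x) * V \<tau> x * ?\<phi> x) + ((eta b x)\<^sup>2 - (eta a x)\<^sup>2) / 4)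
    \<le> (LINT x|lborel. 2 * M\<^sup>2 * (cmod (V b x - V a x) * cmod (V a x - V \<tau> x) + cmod (V b x - V a x) * cmod (V b x - V \<tau> x)))"
  proof (rule Bochner_Integration.integral_norm_bound_integral)
   show "integrable lborel (%x. Re (of_real (eta \<tau> x) * V \<tau> x * ?\<phi> x) + ((eta b x)\<^sup>2 - (eta a x)\<^sup>2) / 4)"
    by (rule Bochner_Integration.integrable_add[OF integrable_Re[OF il]]) (use ie in simp)
   show "integrable lborel (%x. 2 * M\<^sup>2 * (cmod (V b x - V a x) * cmod (V a x - V \<tau> x) + cmod (V b x - V a x) * cmod (V b x - V \<tau> x)))"
    using ip by (intro integrable_mult_right Bochner_Integration.integrable_add)
   fix x
   show "norm (Re (of_real (eta \<tau> x) * V \<tau> x * ?\<phi> x) + ((eta b x)\<^sup>2 - (eta a x)\<^sup>2) / 4)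
     \<le> 2 * M\<^sup>2 * (cmod (V b x - V a x) * cmod (V a x - V \<tau> x) + cmod (V b x - V a x) * cmod (V b x - V \<tau> x))"
    using potential_expansion[of "V a x" M "V b x" "V \<tau> x"] M inT aT \<tau> unfolding eta_def distrib_left real_norm_def by blast
  qed
  also have "\<dots> = 2 * M\<^sup>2 * ((LINT x|lborel. cmod (V b x - V a x) * cmod (V a x - V \<tau> x)) + (LINT x|lborel. cmod (V b x - V a x) * cmod (V b x - V \<tau> x)))"
   using ip by simp
  also have "\<dots> \<le> 2 * M\<^sup>2 * (nV b a * nV a \<tau> + nV b a * nV b \<tau>)"
   unfolding nV_def by (intro mult_left_mono add_mono n2_CS_norm diff_l2) auto
  also have "\<dots> \<le> 2 * M\<^sup>2 * (2 * M\<^sup>2 * w * (b - a) + 2 * M\<^sup>2 * w * (b - a))"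
   using nb[OF aT(1) \<tau>] nb[OF aT(2) \<tau>] by (intro mult_left_mono add_mono) (auto simp: mult.commute)
  also have "\<dots> = 8 * M ^ 4 * w * (b - a)" by (simp add: power2_eq_square power4_eq_xxxx algebra_simps)
  finally show ?thesis unfolding e2 by simp
 qed
 have cc: "continuous_on {a..b} (%\<tau>. Re (Lam \<tau> ?\<phi> ?\<phi>') + (en b - en a) - ?D \<tau>)" by (intro continuous_intros cR cD)
 have "integral {a..b} (%\<tau>. Re (Lam \<tau> ?\<phi> ?\<phi>') + (en b - en a) - ?D \<tau>) = (b - a) * (en b - en a) - integral {a..b} ?D"
 proof -
  have hc: "((%\<tau>. en b - en a) has_integral (b - a) * (en b - en a)) {a..b}"
   using has_integral_const_real[of "en b - en a" a b] ab(1) by simp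
  have "((%\<tau>. Re (Lam \<tau> ?\<phi> ?\<phi>') + (en b - en a) - ?D \<tau>) has_integral (integral {a..b} (%\<tau>. Re (Lam \<tau> ?\<phi> ?\<phi>')) + (b - a) * (en b - en a)) - integral {a..b} ?D) {a..b}"
   by (rule has_integral_diff[OF has_integral_add[OF integrable_integral[OF integrable_continuous_real[OF cR]] hc] integrable_integral[OF integrable_continuous_real[OF cD]]])
  from integral_unique[OF this] show ?thesis unfolding z1 by simp
 qed
 moreover have "norm (integral {a..b} (%\<tau>. Re (Lam \<tau> ?\<phi> ?\<phi>') + (en b - en a) - ?D \<tau>)) \<le> (8 * M ^ 4 * w * (b - a)) * (b - a)"
  by (rule integral_bound[OF ab(1) cc]) (use R in auto)
 ultimately show ?thesis by (simp add: power2_eq_square mult.assoc)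
qed

end

lemma integral_shifted_window_diff:
 fixes f :: "real => real"
 assumes c: "continuous_on UNIV f" and pq: "p \<le> q" "0 \<le> c" and B: "\<And>x. x \<in> {p..p+c} \<union> {q..q+c} ==> \<bar>f x\<bar> \<le> B"
 shows "\<bar>integral {p+c..q+c} f - integral {p..q} f\<bar> \<le> 2 * B * c"
  and "integral {p+c..q+c} f - integral {p..q} f = integral {q..q+c} f - integral {p..p+c} f"
proof -
 have cc: "continuous_on {a..b} f" for a b using continuous_on_subset[OF c] by blast
 have i: "f integrable_on {a..b}" for a b by (rule integrable_continuous_real[OF cc])
 show e: "integral {p+c..q+c} f - integral {p..q} f = integral {q..q+c} f - integral {p..p+c} f"
  using Henstock_Kurzweil_Integration.integral_combine[OF _ _ i, of p q "q+c"] Henstock_Kurzweil_Integration.integral_combine[OF _ _ i, of p "p+c" "q+c"] pq by simp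
 have "norm (integral {q..q+c} f) \<le> B * (q + c - q)" "norm (integral {p..p+c} f) \<le> B * (p + c - p)"
  by (rule integral_bound[OF _ cc]; use pq B in auto)+
 then show "\<bar>integral {p+c..q+c} f - integral {p..q} f\<bar> \<le> 2 * B * c" unfolding e by simp
qed

context gp_flow
begin

lemma nG2_cont: "continuous_on S (%p. (nG (fst p) (snd p))\<^sup>2)"
proof -
 have "isCont (%p. nG (fst p) (snd p)) (a, b)" for a b
  unfolding isCont_def fst_conv snd_conv
 proof (rule LIM_zero_cancel, rule Lim_null_comparison)
  show "eventually (%p. norm (nG (fst p) (snd p) - nG a b) \<le> nG (fst p) a + nG (snd p) b) (at (a, b))"
  proof (rule always_eventually, rule allI)
   fix p
   show "norm (nG (fst p) (snd p) - nG a b) \<le> nG (fst p) a + nG (snd p) b"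
    using nG_triangle[of "fst p" "snd p" a] nG_triangle[of a "snd p" b] nG_triangle[of a b "fst p"] nG_triangle[of "fst p" b "snd p"]
     nG_sym[of "fst p" a] nG_sym[of "snd p" b] by (simp add: abs_le_iff)
  qed
  have c: "isCont (%s. nG s r) x" for r x using nG_cont[of UNIV r] by (simp add: continuous_on_eq_continuous_at)
  have "((%p. nG (fst p) a + nG (snd p) b) \<longlongrightarrow> nG a a + nG b b) (at (a, b))"
  proof (intro tendsto_add isCont_tendsto_compose[OF c])
   show "(fst \<longlongrightarrow> a) (at (a, b))" "(snd \<longlongrightarrow> b) (at (a, b))"
    using tendsto_fst[OF tendsto_ident_at, of "(a,b)" UNIV] tendsto_snd[OF tendsto_ident_at, of "(a,b)" UNIV] by auto
  qed
  then show "((%p. nG (fst p) a + nG (snd p) b) \<longlongrightarrow> 0) (at (a, b))" by simp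
 qed
 then have "continuous_on S (%p. nG (fst p) (snd p))" by (intro continuous_at_imp_continuous_on) auto
 then show ?thesis by (intro continuous_intros)
qed

lemma en_cont: "continuous_on S en"
proof -
 have *: "isCont f t" if "\<And>s. s \<in> {t-1<..<t+1} ==> \<bar>f s - f t\<bar> \<le> g s" "(g \<longlongrightarrow> 0) (at t)" for f g :: "real => real" and t
 proof -
  have "eventually (%s. s \<in> {t-1<..<t+1}) (at t)" by (rule eventually_at_in_open') auto
  then have "eventually (%s. norm (f s - f t) \<le> g s) (at t)" by eventually_elim (use that(1) in auto)
  from LIM_zero_cancel[OF Lim_null_comparison[OF this that(2)]] show ?thesis unfolding isCont_def .
 qed
 have "isCont (%s. n2 (G s)) t" for t
  by (rule *[OF _ nG_tendsto]) (unfold nG_def, rule n2_diff_bound[OF G_l2 G_l2])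
 moreover have "isCont (%s. n2 (eta s)) t" for t
 proof -
  obtain M where M: "M \<ge> 1" "\<And>s x. s \<in> {-(\<bar>t\<bar>+1)..\<bar>t\<bar>+1} ==> cmod (V s x) \<le> M" using V_bdd[of "\<bar>t\<bar>+1"] by blast
  show ?thesis
  proof (rule *)
   show "\<bar>n2 (eta s) - n2 (eta t)\<bar> \<le> 2 * M * nV s t" if "s \<in> {t-1<..<t+1}" for s
    by (rule order_trans[OF n2_diff_bound[OF eta_l2 eta_l2] eta_diff_n2]) (use that in \<open>auto intro!: M(2)\<close>)
   show "((%s. 2 * M * nV s t) \<longlongrightarrow> 0) (at t)" using tendsto_mult_left[OF nV_tendsto, of "2 * M"] by simp
  qed
 qed
 ultimately have "isCont en t" for t unfolding en_def[abs_def] by (intro continuous_intros) auto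
 then show ?thesis by (simp add: continuous_at_imp_continuous_on)
qed

text \<open>Increments over steps of length h are averaged over their starting points s in [p, q].
  With D the square of \<open>nG\<close>, which is symmetric, the integrals of D(s + h, s + r) and
  D(s, s + r) over s become translates of each other once r is replaced by h - r in the first. They
  differ only near the ends of [p, q], so the leftover squares cost w^2 h instead of w^2.\<close>

lemma energy_window_bound:
 assumes M: "M \<ge> 1" "\<And>t x. t \<in> {-T..T} ==> cmod (V t x) \<le> M" "\<And>t. t \<in> {-T..T} ==> n2 (G t) \<le> M" "\<And>t. t \<in> {-T..T} ==> n2 (eta t) \<le> M"
  and pq: "p \<le> q" "0 < h" "-T \<le> p" "q + h \<le> T"
  and w: "\<And>r s. r \<in> {p..q+h} ==> s \<in> {p..q+h} ==> \<bar>r - s\<bar> \<le> h ==> nV r s \<le> w \<and> nG r s \<le> w"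
 shows "\<bar>integral {q..q+h} en - integral {p..p+h} en\<bar> \<le> h * (8 * M ^ 4 * w * (q - p) + w\<^sup>2)"
proof -
 let ?D = "%a b. (nG a b)\<^sup>2"
 have w0: "0 \<le> w" using w[of p p] pq by simp
 have Db: "\<bar>?D a b\<bar> \<le> w\<^sup>2" if "a \<in> {p..q+h}" "b \<in> {p..q+h}" "\<bar>a - b\<bar> \<le> h" for a b
  using w[OF that] by (auto intro!: power_mono)
 define f where "f s r = ?D (s+h) (s+r) - ?D s (s+r)" for s r
 have Dc: "continuous_on S (%x. ?D (g x) (k x))" if "continuous_on S g" "continuous_on S k" for S :: "'b::topological_space set" and g k
  using continuous_on_compose2[OF nG2_cont[of UNIV] continuous_on_Pair[OF that]] by simp
 have fc: "continuous_on S (%(s,r). f s r)" for S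
  unfolding f_def split_def by (intro continuous_intros Dc)
 define J where "J s = integral {0..h} (f s)" for s
 have Jc: "continuous_on {p..q} J"
  using integral_continuous_on_param[of "{p..q}" 0 h f] fc by (simp add: J_def[abs_def])
 have J: "\<bar>h * (en (s+h) - en s) - J s / 2\<bar> \<le> 8 * M ^ 4 * w * h\<^sup>2" if s: "s \<in> {p..q}" for s
 proof -
  have "integral {s..s+h} (%\<tau>. (nG (s+h) \<tau>)\<^sup>2 - (nG s \<tau>)\<^sup>2) = integral {0..h} (%r. (nG (s+h) (r+s))\<^sup>2 - (nG s (r+s))\<^sup>2)"
   using integral_shift_real_ivl[of s s "s+h" "%\<tau>. (nG (s+h) \<tau>)\<^sup>2 - (nG s \<tau>)\<^sup>2"] by simp
  also have "\<dots> = J s" unfolding J_def f_def by (simp add: add.commute)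
  finally have e: "integral {s..s+h} (%\<tau>. (nG (s+h) \<tau>)\<^sup>2 - (nG s \<tau>)\<^sup>2) = J s" .
  have "\<bar>(s + h - s) * (en (s+h) - en s) - integral {s..s+h} (%\<tau>. (nG (s+h) \<tau>)\<^sup>2 - (nG s \<tau>)\<^sup>2) / 2\<bar> \<le> 8 * M ^ 4 * w * (s + h - s)\<^sup>2"
  proof (rule energy_increment[OF M])
   show "nV r r' \<le> w \<and> nG r r' \<le> w" if "r \<in> {s..s+h}" "r' \<in> {s..s+h}" for r r'
    by (rule w) (use that s pq in auto)
  qed (use s pq in auto)
  moreover have "integral {s..s+h} (%\<tau>. ((nG (s+h) \<tau>)\<^sup>2 - (nG s \<tau>)\<^sup>2) / 2) = integral {s..s+h} (%\<tau>. (nG (s+h) \<tau>)\<^sup>2 - (nG s \<tau>)\<^sup>2) / 2"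
   by (rule integral_divide)
  ultimately show ?thesis unfolding e by simp
 qed
 have ensc: "continuous_on {p..q} (%s. en (s+h))" by (rule continuous_on_compose2[OF en_cont[of UNIV]]) (auto intro!: continuous_intros)
 have enc: "continuous_on {p..q} en" by (rule en_cont)
 have swap: "integral {p..q} J = integral {0..h} (%r. integral {p..q} (%s. f s r))"
  using integral_swap_continuous[of p 0 q h f] fc by (simp add: J_def[abs_def])
 define A where "A r = integral {p..q} (%s. ?D (s+h) (s+r))" for r
 define B where "B r = integral {p..q} (%s. ?D s (s+r))" for r
 have AB: "integral {p..q} (%s. f s r) = A r - B r" for r
  unfolding f_def A_def B_def by (rule Henstock_Kurzweil_Integration.integral_diff; intro integrable_continuous_real Dc continuous_intros)
 have Ac: "continuous_on S A" and Bc: "continuous_on S B" for S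
  unfolding A_def[abs_def] B_def[abs_def]
  using integral_continuous_on_param[of S p q "%r s. ?D (s+h) (s+r)"] integral_continuous_on_param[of S p q "%r s. ?D s (s+r)"]
  by (simp_all add: split_def Dc continuous_intros)
 have Aflip: "integral {0..h} A = integral {0..h} (%r. A (h - r))"
 proof -
  have "integral {0..h} (%r. A (h - r)) = integral {-h..0} (%r. A (h + r))"
   using Henstock_Kurzweil_Integration.integral_reflect_real[of 0 "- h" "%r. A (h + r)"] by simp
  also have "\<dots> = integral {0..h} A" using integral_shift_real_ivl[of 0 h h A] by (simp add: add.commute)
  finally show ?thesis by simp
 qed
 have Ab: "\<bar>A (h - r) - B r\<bar> \<le> 2 * w\<^sup>2 * h" if r: "r \<in> {0..h}" for r
 proof -
  let ?g = "%s. ?D s (s+r)"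
  have "A (h - r) = integral {p..q} (%s. ?g (s + (h - r)))"
   unfolding A_def by (rule Henstock_Kurzweil_Integration.integral_cong) (simp add: nG_sym[of _ "_ + h"] algebra_simps)
  also have "\<dots> = integral {p+(h-r)..q+(h-r)} ?g"
   using integral_shift_real_ivl[of "p+(h-r)" "h-r" "q+(h-r)" ?g] by simp
  finally have "A (h - r) - B r = integral {p+(h-r)..q+(h-r)} ?g - integral {p..q} ?g" by (simp add: B_def)
  also have "\<bar>\<dots>\<bar> \<le> 2 * w\<^sup>2 * (h - r)"
   by (rule integral_shifted_window_diff(1)[OF Dc]) (use r pq in \<open>auto intro!: Db[unfolded abs_power2] continuous_intros\<close>)
  also have "\<dots> \<le> 2 * w\<^sup>2 * h" using r by (intro mult_left_mono) auto
  finally show ?thesis .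
 qed
 have c: "continuous_on {0..h} (%r. A (h - r))"
  by (rule continuous_on_compose2[OF Ac[of UNIV]]) (auto intro!: continuous_on_diff continuous_on_const continuous_on_id)
 have "integral {p..q} J = integral {0..h} (%r. A (h - r) - B r)"
 proof -
  show ?thesis unfolding swap AB
   using Henstock_Kurzweil_Integration.integral_diff[OF integrable_continuous_real[OF Ac[of "{0..h}"]] integrable_continuous_real[OF Bc[of "{0..h}"]]]
    Henstock_Kurzweil_Integration.integral_diff[OF integrable_continuous_real[OF c] integrable_continuous_real[OF Bc[of "{0..h}"]]] Aflip by simp
 qed
 also have "norm \<dots> \<le> 2 * w\<^sup>2 * h * (h - 0)"
  by (rule integral_bound[OF _ continuous_on_diff[OF c Bc]]) (use pq Ab in auto)
 finally have Jb: "\<bar>integral {p..q} J\<bar> \<le> 2 * w\<^sup>2 * h\<^sup>2" by (simp add: power2_eq_square mult.assoc)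
 have "integral {p..q} (%s. h * (en (s+h) - en s) - J s / 2) = h * (integral {p..q} (%s. en (s+h)) - integral {p..q} en) - integral {p..q} J / 2"
  using Henstock_Kurzweil_Integration.integral_diff[OF integrable_continuous_real[of p q "%s. h * (en (s+h) - en s)"] integrable_continuous_real[of p q "%s. J s / 2"]]
   Henstock_Kurzweil_Integration.integral_diff[OF integrable_continuous_real[OF ensc] integrable_continuous_real[OF enc]] ensc enc Jc
  by (simp add: continuous_intros)
 moreover have "norm (integral {p..q} (%s. h * (en (s+h) - en s) - J s / 2)) \<le> 8 * M ^ 4 * w * h\<^sup>2 * (q - p)"
  by (rule integral_bound[OF pq(1)]) (use J in \<open>auto intro!: continuous_intros ensc enc Jc\<close>)
 moreover have "integral {p..q} (%s. en (s+h)) - integral {p..q} en = integral {q..q+h} en - integral {p..p+h} en"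
 proof -
  have B0: "\<exists>B. \<forall>x\<in>{p..p+h} \<union> {q..q+h}. \<bar>en x\<bar> \<le> B"
  proof -
   have "bounded (en ` ({p..p+h} \<union> {q..q+h}))" by (intro compact_imp_bounded compact_continuous_image en_cont compact_Un compact_Icc)
   then show ?thesis unfolding bounded_iff by (metis imageI real_norm_def)
  qed
  then obtain B where "\<And>x. x \<in> {p..p+h} \<union> {q..q+h} ==> \<bar>en x\<bar> \<le> B" by blast
  from integral_shifted_window_diff(2)[OF en_cont pq(1) less_imp_le[OF pq(2)] this]
  show ?thesis using integral_shift_real_ivl[of "p+h" h "q+h" en] by simp
 qed
 ultimately have "\<bar>h * (integral {q..q+h} en - integral {p..p+h} en)\<bar> \<le> 8 * M ^ 4 * w * h\<^sup>2 * (q - p) + w\<^sup>2 * h\<^sup>2"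
  using Jb by (simp add: abs_le_iff)
 also have "\<dots> = h * (h * (8 * M ^ 4 * w * (q - p) + w\<^sup>2))" by (simp add: power2_eq_square algebra_simps)
 finally have "h * \<bar>integral {q..q+h} en - integral {p..p+h} en\<bar> \<le> h * (h * (8 * M ^ 4 * w * (q - p) + w\<^sup>2))"
  by (simp only: abs_mult abs_of_pos[OF pq(2)])
 then show ?thesis using pq(2) by simp
qed

text \<open>With h so small that times at distance h are e-close in both norms, the window means
  approximate the energies at p and q, and the window bound divided by h is O(e).\<close>

lemma energy_conserved_le:
 assumes "p \<le> q" shows "en p = en q"
proof -
 define T where "T = \<bar>p\<bar> + \<bar>q\<bar> + 1"
 obtain M where M: "M \<ge> 1" "\<And>t x. t \<in> {-T..T} ==> cmod (V t x) \<le> M" "\<And>t. t \<in> {-T..T} ==> n2 (G t) \<le> M" "\<And>t. t \<in> {-T..T} ==> n2 (eta t) \<le> M"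
  using local_bounds[of T] by blast
 \<comment> \<open>The 1 stands for w^2 \<le> e, the 2 for the errors of the two window
   means.\<close>
 define K where "K = 8 * M ^ 4 * (q - p) + 1 + 2"
 have K: "0 < K" 
 proof -
  have "0 \<le> 8 * M ^ 4 * (q - p)" using M(1) assms by simp
  then show ?thesis unfolding K_def by linarith
 qed
 have est: "\<bar>en q - en p\<bar> \<le> K * e" if e: "0 < e" "e \<le> 1" for e
 proof -
  obtain d where d: "0 < d" "\<And>s t. s \<in> {-T..T} ==> t \<in> {-T..T} ==> \<bar>s - t\<bar> < d ==> nV s t < e \<and> nG s t < e"
   using uniform_time_cont[OF e(1), of T] by blast
  have ex: "\<exists>d>0. \<forall>x. \<bar>x - r\<bar> < d --> \<bar>en x - en r\<bar> < e" for r
   using en_cont[of UNIV] e(1) unfolding continuous_on_iff dist_real_def by (metis UNIV_I)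
  obtain d1 where d1: "0 < d1" "\<And>x. \<bar>x - p\<bar> < d1 ==> \<bar>en x - en p\<bar> < e" using ex by blast
  obtain d2 where d2: "0 < d2" "\<And>x. \<bar>x - q\<bar> < d2 ==> \<bar>en x - en q\<bar> < e" using ex by blast
  define h where "h = min (1/2) (min d (min d1 d2) / 2)"
  have h: "0 < h" "h \<le> 1/2" "h < d" "h < d1" "h < d2" using d d1 d2 by (auto simp: h_def)
  have "\<bar>integral {q..q+h} en - integral {p..p+h} en\<bar> \<le> h * (8 * M ^ 4 * e * (q - p) + e\<^sup>2)"
  proof (rule energy_window_bound[OF M assms h(1)])
   show "nV r s \<le> e \<and> nG r s \<le> e" if "r \<in> {p..q+h}" "s \<in> {p..q+h}" "\<bar>r - s\<bar> \<le> h" for r s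
   proof -
    have "nV r s < e \<and> nG r s < e" by (rule d(2)) (use that h in \<open>auto simp: T_def\<close>)
    then show ?thesis by simp
   qed
  qed (use h in \<open>auto simp: T_def\<close>)
  also have "\<dots> \<le> h * (8 * M ^ 4 * e * (q - p) + e)" using e h(1) by (simp add: power2_eq_square mult_left_le)
  finally have 1: "\<bar>integral {q..q+h} en - integral {p..p+h} en\<bar> \<le> h * (8 * M ^ 4 * e * (q - p) + e)" .
  have av: "\<bar>integral {r..r+h} en - h * en r\<bar> \<le> h * e" if "\<And>x. x \<in> {r..r+h} ==> \<bar>en x - en r\<bar> \<le> e" for r
  proof -
   have "integral {r..r+h} (%x. en x - en r) = integral {r..r+h} en - h * en r"
    using Henstock_Kurzweil_Integration.integral_diff[OF integrable_continuous_real[OF en_cont] integrable_continuous_real[OF continuous_on_const], of r "r+h" "en r"] h(1) by simp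
   moreover have "norm (integral {r..r+h} (%x. en x - en r)) \<le> e * (r + h - r)"
    by (rule integral_bound) (use h(1) that in \<open>auto intro!: continuous_on_diff continuous_on_const en_cont\<close>)
   ultimately show ?thesis by (simp add: mult.commute)
  qed
  have 2: "\<bar>integral {q..q+h} en - h * en q\<bar> \<le> h * e" 
  proof (rule av)
   show "\<bar>en x - en q\<bar> \<le> e" if "x \<in> {q..q+h}" for x using d2(2)[of x] that h(5) by (auto simp: abs_less_iff)
  qed
  have 3: "\<bar>integral {p..p+h} en - h * en p\<bar> \<le> h * e" 
  proof (rule av)
   show "\<bar>en x - en p\<bar> \<le> e" if "x \<in> {p..p+h}" for x using d1(2)[of x] that h(4) by (auto simp: abs_less_iff)
  qed
  have "\<bar>h * en q - h * en p\<bar> \<le> h * (8 * M ^ 4 * e * (q - p) + e) + h * e + h * e" using 1 2 3 by linarith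
  moreover have "\<bar>h * en q - h * en p\<bar> = h * \<bar>en q - en p\<bar>"
   by (simp only: right_diff_distrib[symmetric] abs_mult abs_of_pos[OF h(1)])
  moreover have "h * (8 * M ^ 4 * e * (q - p) + e) + h * e + h * e = h * (K * e)" by (simp add: K_def algebra_simps)
  ultimately have "h * \<bar>en q - en p\<bar> \<le> h * (K * e)" by linarith
  then show ?thesis using h(1) by simp
 qed
 have "\<bar>en q - en p\<bar> \<le> 0"
 proof (rule field_le_epsilon)
  fix e :: real assume e: "0 < e"
  have "\<bar>en q - en p\<bar> \<le> K * min 1 (e / K)" by (rule est) (use e K in auto)
  also have "\<dots> \<le> K * (e / K)" using K by (intro mult_left_mono) auto
  finally show "\<bar>en q - en p\<bar> \<le> 0 + e" using K by simp
 qed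
 then show ?thesis by simp
qed

theorem energy_conserved: "en t = en 0"
 using energy_conserved_le[of t 0] energy_conserved_le[of 0 t] by (cases "t \<le> 0") auto

end

section \<open>The kink\<close>

definition kQ :: "real => real" where "kQ x = tanh (x / sqrt 2)"

text \<open>The derivative of the kink Q, written by means of the first-order equation of the
  kink.\<close>

definition kk :: "real => real" where "kk x = (1 - (kQ x)\<^sup>2) / sqrt 2"

lemma kQ_bounds: "\<bar>kQ x\<bar> < 1" "-1 < kQ x" "kQ x < 1"
 using tanh_real_lt_1[of "x / sqrt 2"] tanh_real_gt_neg1[of "x / sqrt 2"] by (auto simp: kQ_def abs_less_iff)

lemma kQ_sq: "(kQ x)\<^sup>2 < 1" using kQ_bounds(1)[of x] by (simp add: abs_square_less_1)

lemma kk_pos: "0 < kk x" using kQ_sq[of x] by (simp add: kk_def)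

lemma kk_eq: "1 - (kQ x)\<^sup>2 = sqrt 2 * kk x" by (simp add: kk_def)

lemma kk_le_1: "kk x \<le> 1"
proof -
 have "1 - (kQ x)\<^sup>2 \<le> 1" by simp
 also have "1 \<le> sqrt 2" by simp
 finally show ?thesis by (simp add: kk_def)
qed

lemma kQ_minus: "kQ (- x) = - kQ x" by (simp add: kQ_def)

lemma kk_minus: "kk (- x) = kk x" by (simp add: kk_def kQ_minus)

lemma kQ_0: "kQ 0 = 0" by (simp add: kQ_def)

lemma kQ_DERIV: "(kQ has_real_derivative kk x) (at x)"
proof -
 have "cosh (x / sqrt 2) \<noteq> (0::real)" using cosh_real_pos[of "x / sqrt 2"] by simp
 moreover have "((%x. x / sqrt 2) has_real_derivative 1 / sqrt 2) (at x)" by (rule DERIV_cdivide[OF DERIV_ident])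
 ultimately have "((%x. tanh (x / sqrt 2)) has_real_derivative (1 - (tanh (x / sqrt 2))\<^sup>2) * (1 / sqrt 2)) (at x)"
  by (intro has_field_derivative_tanh)
 then show ?thesis by (simp add: kQ_def[abs_def] kk_def)
qed

lemma kk_DERIV: "(kk has_real_derivative - sqrt 2 * kQ x * kk x) (at x)"
proof -
 have "((%x. (1 - (kQ x)\<^sup>2) / sqrt 2) has_real_derivative (0 - 2 * kQ x * kk x) / sqrt 2) (at x)"
  using DERIV_cdivide[OF DERIV_diff[OF DERIV_const[of 1] DERIV_power[OF kQ_DERIV[of x], of 2]], of "sqrt 2"] by (simp add: mult_ac)
 moreover have "(0 - 2 * kQ x * kk x) / sqrt 2 = - sqrt 2 * kQ x * kk x"
  by (simp add: real_div_sqrt field_simps)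
 ultimately show ?thesis by (simp add: kk_def[abs_def])
qed

lemma kQ_cont: "continuous_on S kQ" and kk_cont: "continuous_on S kk"
 using kQ_DERIV kk_DERIV by (meson DERIV_isCont continuous_at_imp_continuous_on)+

lemma kQ_meas [measurable]: "kQ \<in> borel_measurable borel" and kk_meas [measurable]: "kk \<in> borel_measurable borel"
 by (intro borel_measurable_continuous_onI kQ_cont kk_cont)+

lemma kQ_ac: "ac kQ kk" by (rule ac_DERIV[OF kQ_DERIV kk_cont])

lemma kk_ac: "ac kk (%x. - sqrt 2 * kQ x * kk x)"
 by (rule ac_DERIV[OF kk_DERIV]) (intro continuous_intros kQ_cont kk_cont)

lemma kQ_mono: "x \<le> y ==> kQ x \<le> kQ y"
 by (rule DERIV_nonneg_imp_nondecreasing[of x y kQ]) (use kQ_DERIV kk_pos less_imp_le in blast)+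

lemma kQ_nonneg: "0 \<le> x ==> 0 \<le> kQ x"
 using kQ_mono[of 0 x] by (simp add: kQ_0)

lemma kQ_abs: "kQ \<bar>x\<bar> = \<bar>kQ x\<bar>"
 using kQ_nonneg[of x] kQ_nonneg[of "- x"] by (cases "0 \<le> x") (auto simp: kQ_minus abs_if)

lemma kk_antimono: "\<bar>x\<bar> \<le> \<bar>y\<bar> ==> kk y \<le> kk x"
proof -
 assume "\<bar>x\<bar> \<le> \<bar>y\<bar>"
 then have "\<bar>kQ x\<bar> \<le> \<bar>kQ y\<bar>" using kQ_mono by (simp flip: kQ_abs)
 then show ?thesis by (simp add: kk_def divide_right_mono abs_le_square_iff)
qed

lemma one_minus_kQ: "0 \<le> x ==> 1 - kQ x \<le> sqrt 2 * kk x"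
proof -
 assume "0 \<le> x"
 then have "1 * (1 - kQ x) \<le> (1 + kQ x) * (1 - kQ x)" using kQ_nonneg[of x] kQ_bounds[of x] by (intro mult_right_mono) auto
 also have "\<dots> = 1 - (kQ x)\<^sup>2" by (simp add: power2_eq_square algebra_simps)
 finally show ?thesis unfolding kk_eq by simp
qed

text \<open>\<open>kk x\<close> is at most 4 exp(-|x|) and (1 + |x|)^4 at most 256 exp |x|, so 1024
  = 4 * 256. Two of the four powers are spent on the integrable majorant 1 / (1 + x^2).\<close>

lemma kk_weight: "kk x * (1 + \<bar>x\<bar>)\<^sup>2 \<le> 1024 * inverse (1 + x\<^sup>2)"
proof -
 have *: "kk x \<le> 4 * exp (- x)" if x: "0 \<le> x" for x
 proof -
  define z where "z = exp (- 2 * (x / sqrt 2))"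
  have z: "0 < z" by (simp add: z_def)
  have "sqrt 2 * kk x = 1 - ((1 - z) / (1 + z))\<^sup>2" by (simp add: kk_def kQ_def tanh_real_altdef z_def)
  also have "\<dots> = 4 * z / (1 + z)\<^sup>2"
   using z by (simp add: power_divide divide_simps power2_eq_square) (simp add: algebra_simps)
  also have "\<dots> \<le> 4 * z / 1" using z by (intro divide_left_mono) (auto simp: one_le_power)
  finally have "sqrt 2 * kk x \<le> 4 * z" by simp
  moreover have "1 * kk x \<le> sqrt 2 * kk x" using kk_pos[of x] by (intro mult_right_mono) auto
  moreover have "z \<le> exp (- x)"
  proof -
   have "2 * (x / sqrt 2) = sqrt 2 * x" by (simp add: field_simps)
   moreover have "1 * x \<le> sqrt 2 * x" using x by (intro mult_right_mono) auto
   ultimately show ?thesis by (simp add: z_def)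
  qed
  ultimately show ?thesis by linarith
 qed
 have k: "kk x \<le> 4 * exp (- \<bar>x\<bar>)" using *[of "\<bar>x\<bar>"] kk_antimono[of "\<bar>x\<bar>" x] by simp
 have e: "(1 + \<bar>x\<bar>) ^ 4 \<le> 256 * exp \<bar>x\<bar>"
 proof -
  have "(1 + \<bar>x\<bar>) ^ 4 \<le> (4 * (1 + \<bar>x\<bar> / 4)) ^ 4" by (intro power_mono) auto
  also have "\<dots> = 256 * (1 + \<bar>x\<bar> / 4) ^ 4" by (simp only: power_mult_distrib) simp
  also have "(1 + \<bar>x\<bar> / 4) ^ 4 \<le> (exp (\<bar>x\<bar> / 4)) ^ 4" by (intro power_mono exp_ge_add_one_self) auto
  also have "(exp (\<bar>x\<bar> / 4)) ^ 4 = exp \<bar>x\<bar>" by (simp flip: exp_of_nat_mult)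
  finally show ?thesis by simp
 qed
 have q: "1 + x\<^sup>2 \<le> (1 + \<bar>x\<bar>)\<^sup>2" by (simp add: power2_sum)
 have "(kk x * (1 + \<bar>x\<bar>)\<^sup>2) * (1 + x\<^sup>2) \<le> (4 * exp (- \<bar>x\<bar>) * (1 + \<bar>x\<bar>)\<^sup>2) * (1 + \<bar>x\<bar>)\<^sup>2"
  using k q kk_pos[of x] by (intro mult_mono) (auto simp: less_imp_le)
 also have "\<dots> = 4 * exp (- \<bar>x\<bar>) * (1 + \<bar>x\<bar>) ^ 4" by (simp add: power2_eq_square power4_eq_xxxx mult_ac)
 also have "\<dots> \<le> 4 * exp (- \<bar>x\<bar>) * (256 * exp \<bar>x\<bar>)" using e by (intro mult_left_mono) auto
 also have "\<dots> = 1024" by (simp add: exp_minus)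
 finally have f: "(kk x * (1 + \<bar>x\<bar>)\<^sup>2) * (1 + x\<^sup>2) \<le> 1024" .
 have "0 < 1 + x\<^sup>2" using zero_le_power2[of x] by linarith
 then show ?thesis using f by (simp only: divide_inverse[symmetric] pos_le_divide_eq)
qed

lemma kk_weight_integrable: "integrable lborel (%x. kk x * (1 + \<bar>x\<bar>)\<^sup>2)"
proof -
 have "integrable lborel (%x. inverse (1 + x\<^sup>2) :: real)"
  using integrable_inverse_1_plus_square by (simp add: set_integrable_def)
 then have i: "integrable lborel (%x. 1024 * inverse (1 + x\<^sup>2) :: real)" by simp
 show ?thesis
 proof (rule Bochner_Integration.integrable_bound[OF i])
  show "AE x in lborel. norm (kk x * (1 + \<bar>x\<bar>)\<^sup>2) \<le> norm (1024 * inverse (1 + x\<^sup>2))"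
  proof (rule AE_I2)
   fix x :: real
   have "0 \<le> kk x * (1 + \<bar>x\<bar>)\<^sup>2" using kk_pos[of x] by (simp add: less_imp_le)
   then show "norm (kk x * (1 + \<bar>x\<bar>)\<^sup>2) \<le> norm (1024 * inverse (1 + x\<^sup>2))"
    using kk_weight[of x] by simp
  qed
 qed measurable
qed

lemma kk_times_integrable:
 fixes f :: "real => 'a::{real_normed_field,euclidean_space}"
 assumes "f \<in> borel_measurable borel" "\<And>x. norm (f x) \<le> C * (1 + \<bar>x\<bar>)\<^sup>2"
 shows "integrable lborel (%x. kk x *\<^sub>R f x)"
  and "norm (LINT x|lborel. kk x *\<^sub>R f x) \<le> C * (LINT x|lborel. kk x * (1 + \<bar>x\<bar>)\<^sup>2)"
proof -
 note [measurable] = assms(1)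
 have i: "integrable lborel (%x. C * (kk x * (1 + \<bar>x\<bar>)\<^sup>2))" using kk_weight_integrable by simp
 have b: "norm (kk x *\<^sub>R f x) \<le> C * (kk x * (1 + \<bar>x\<bar>)\<^sup>2)" for x
  using mult_left_mono[OF assms(2)[of x], of "kk x"] kk_pos[of x] by (simp add: mult_ac)
 show "integrable lborel (%x. kk x *\<^sub>R f x)"
  by (rule Bochner_Integration.integrable_bound[OF i]) (use b order_trans[OF b abs_ge_self] in \<open>auto intro!: AE_I2\<close>)
 then have "norm (LINT x|lborel. kk x *\<^sub>R f x) \<le> (LINT x|lborel. C * (kk x * (1 + \<bar>x\<bar>)\<^sup>2))"
  by (rule Bochner_Integration.integral_norm_bound_integral) (use i b in auto)
 then show "norm (LINT x|lborel. kk x *\<^sub>R f x) \<le> C * (LINT x|lborel. kk x * (1 + \<bar>x\<bar>)\<^sup>2)" by simp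
qed

text \<open>The constant of all weighted estimates. The weight is squared so that it also bounds the
  L2 norm of \<open>kk x * (1 + \<bar>x\<bar>)\<close>, as \<open>kk\<close> is at most 1.\<close>

definition kW :: real where "kW = (LINT x|lborel. kk x * (1 + \<bar>x\<bar>)\<^sup>2)"

lemma kW_nonneg: "0 \<le> kW"
 unfolding kW_def by (rule integral_nonneg_AE) (use kk_pos in \<open>auto intro!: AE_I2 simp: less_imp_le\<close>)

lemma kk_integrable: "integrable lborel kk"
 using kk_times_integrable(1)[of "%x. 1 :: real" 1] by (simp add: one_le_power)

lemma kk_wt_l2: "l2 (%x. kk x * (1 + \<bar>x\<bar>))" "n2 (%x. kk x * (1 + \<bar>x\<bar>)) \<le> sqrt kW"
proof -
 have b: "(norm (kk x * (1 + \<bar>x\<bar>)))\<^sup>2 \<le> kk x * (1 + \<bar>x\<bar>)\<^sup>2" for x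
 proof -
  have "(kk x)\<^sup>2 \<le> kk x" using kk_pos[of x] kk_le_1[of x] by (simp add: power2_eq_square mult_left_le less_imp_le)
  then show ?thesis using mult_right_mono[of "(kk x)\<^sup>2" "kk x" "(1 + \<bar>x\<bar>)\<^sup>2"] by (simp add: power_mult_distrib)
 qed
 have i: "integrable lborel (%x. (norm (kk x * (1 + \<bar>x\<bar>)))\<^sup>2)"
  by (rule Bochner_Integration.integrable_bound[OF kk_weight_integrable])
    (use b order_trans[OF b abs_ge_self] in \<open>auto intro!: AE_I2\<close>)
 then show "l2 (%x. kk x * (1 + \<bar>x\<bar>))" by (simp add: l2_def)
 have "(n2 (%x. kk x * (1 + \<bar>x\<bar>)))\<^sup>2 \<le> kW"
  unfolding n2_sq kW_def by (rule integral_mono[OF i kk_weight_integrable]) (use b in auto)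
 then show "n2 (%x. kk x * (1 + \<bar>x\<bar>)) \<le> sqrt kW" by (simp add: real_le_rsqrt)
qed

lemma kk_l2: "l2 kk" "n2 kk \<le> sqrt kW"
proof -
 have b: "norm (kk x) \<le> 1 * norm (kk x * (1 + \<bar>x\<bar>))" for x
  using kk_pos[of x] by (simp add: abs_mult mult_left_le less_imp_le)
 show "l2 kk" by (rule l2_bound(1)[OF kk_wt_l2(1) _ b]) simp
 show "n2 kk \<le> sqrt kW" using order_trans[OF l2_bound(2)[OF kk_wt_l2(1) _ b]] kk_wt_l2(2) by simp
qed

lemma kQ_limits: "(kQ \<longlongrightarrow> 1) at_top" "(kQ \<longlongrightarrow> -1) at_bot"
proof -
 have "filterlim (%x::real. x / sqrt 2) at_top at_top"
  using filterlim_tendsto_pos_mult_at_top[OF tendsto_const[of "1 / sqrt 2"] _ filterlim_ident] by simp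
 from filterlim_compose[OF tanh_real_at_top this] show t: "(kQ \<longlongrightarrow> 1) at_top" by (simp add: kQ_def[abs_def])
 have "((%x. - kQ x) \<longlongrightarrow> -1) at_top" by (intro tendsto_minus t)
 then show "(kQ \<longlongrightarrow> -1) at_bot" by (simp add: filterlim_at_bot_mirror kQ_minus)
qed

lemma filterlim_minus_real: "filterlim (%n. - real n) at_bot sequentially"
 using filterlim_real_sequentially by (simp add: filterlim_uminus_at_bot)

lemma kk_tendsto_0: "(kk \<longlongrightarrow> 0) at_top" "(kk \<longlongrightarrow> 0) at_bot"
proof -
 have "((%x. (1 - (kQ x)\<^sup>2) / sqrt 2) \<longlongrightarrow> (1 - 1\<^sup>2) / sqrt 2) at_top" "((%x. (1 - (kQ x)\<^sup>2) / sqrt 2) \<longlongrightarrow> (1 - (-1)\<^sup>2) / sqrt 2) at_bot"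
  by (intro tendsto_intros kQ_limits; simp)+
 then show "(kk \<longlongrightarrow> 0) at_top" "(kk \<longlongrightarrow> 0) at_bot" by (simp_all add: kk_def[abs_def])
qed

lemma kk_integral: "(LINT x|lborel. kk x) = 2"
proof -
 have "(%n. kQ (real n) - kQ (- real n)) \<longlonglongrightarrow> (LINT x|lborel. kk x)"
  by (rule ac_integrable_window[OF kQ_ac kk_integrable filterlim_minus_real filterlim_real_sequentially])
 moreover have "(%n. kQ (real n) - kQ (- real n)) \<longlonglongrightarrow> 1 - (-1)"
  by (intro tendsto_diff filterlim_compose[OF kQ_limits(1) filterlim_real_sequentially] filterlim_compose[OF kQ_limits(2) filterlim_minus_real])
 ultimately show ?thesis using LIMSEQ_unique by fastforce
qed

text \<open>Integrate the derivative of \<open>kQ * kk\<close>, a function vanishing at both ends.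
  The identity expresses that the kink is critical for the energy: it cancels the constant terms in
  \<open>energy_expansion\<close>.\<close>

lemma kk_kQ_identity: "(n2 kk)\<^sup>2 = sqrt 2 * (LINT x|lborel. kk x * (kQ x)\<^sup>2)"
proof -
 have A: "ac (%x. kQ x * kk x) (%x. kk x * kk x + kQ x * (- sqrt 2 * kQ x * kk x))" by (rule ac_mult[OF kQ_ac kk_ac])
 have i2: "integrable lborel (%x. kk x * (kQ x)\<^sup>2)"
  using kk_times_integrable(1)[of "%x. (kQ x)\<^sup>2" 1] kQ_sq order_trans[OF less_imp_le[OF kQ_sq] one_le_power] by simp
 have i1: "integrable lborel (%x. kk x * kk x)" by (rule l2_mult[OF kk_l2(1) kk_l2(1)])
 have e: "(%x. kk x * kk x + kQ x * (- sqrt 2 * kQ x * kk x)) = (%x. kk x * kk x - sqrt 2 * (kk x * (kQ x)\<^sup>2))"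
  by (simp add: fun_eq_iff power2_eq_square)
 have "(LINT x|lborel. kk x * kk x + kQ x * (- sqrt 2 * kQ x * kk x)) = 0"
 proof (rule ac_l2_integral_deriv_0[OF A])
  show "((%x. kQ x * kk x) \<longlongrightarrow> 0) at_top" using tendsto_mult[OF kQ_limits(1) kk_tendsto_0(1)] by simp
  show "((%x. kQ x * kk x) \<longlongrightarrow> 0) at_bot" using tendsto_mult[OF kQ_limits(2) kk_tendsto_0(2)] by simp
  show "integrable lborel (%x. kk x * kk x + kQ x * (- sqrt 2 * kQ x * kk x))" unfolding e using i1 i2 by simp
 qed
 then show ?thesis unfolding e n2_sq using i1 i2 by (simp add: power2_eq_square)
qed

section \<open>Coercivity of the energy around the kink\<close>

text \<open>The primitive is normalised at minus infinity: its values at -n converge because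
  \<open>f\<close> is integrable on the left half line, and their limit is subtracted.\<close>

lemma indicator_window_limit:
 fixes f :: "real => complex"
 assumes f: "integrable lborel f" and i: "\<And>a b. set_integrable lborel {a..b} f"
 obtains U where "ac U f" "(%n. U (- real n)) \<longlonglongrightarrow> 0"
proof -
 have [measurable]: "f \<in> borel_measurable borel" using f by auto
 obtain U0 where U0: "ac U0 f" using ac_exists[of f] i by auto
 let ?g = "%x. indicator {..0::real} x *\<^sub>R f x"
 have gi: "integrable lborel ?g" by (rule integrable_mult_indicator[OF _ f]) auto
 have e: "U0 (- real n) = U0 0 - (LINT x:{- real n..real n}|lborel. ?g x)" for n
 proof -
  have "(LINT x:{- real n..real n}|lborel. ?g x) = (LINT x:{- real n..0}|lborel. f x)"
   unfolding set_lebesgue_integral_def by (rule Bochner_Integration.integral_cong) (auto simp: indicator_def)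
  then show ?thesis using ac_int[OF U0, of "- real n" 0] by (simp add: algebra_simps)
 qed
 define L where "L = U0 0 - (LINT x|lborel. ?g x)"
 have "(%n. U0 (- real n)) \<longlonglongrightarrow> L"
  unfolding e L_def by (intro tendsto_diff tendsto_const integrable_tendsto_window[OF gi filterlim_minus_real filterlim_real_sequentially])
 then have "(%n. U0 (- real n) - L) \<longlonglongrightarrow> 0" by (rule LIM_zero)
 moreover have "ac (%x. U0 x - L) f" using ac_diff[OF U0 ac_const[of L]] by simp
 ultimately show ?thesis using that by blast
qed

text \<open>The pointwise sum of squares behind \<open>static_identity\<close>, in real coordinates:
  ur, ui for h; r ar, r ai for v minus its weighted mean; gr, gi for g; with k for
  \<open>kk\<close>, q for \<open>kQ\<close> and r for sqrt 2. The relation r^2 = 2 enters through a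
  multiple of r^2 - 2.\<close>

lemma static_polynomial_identity:
 fixes k q r ur ui ar ai gr gi :: real
 assumes "r * r = 2"
 shows "- (4 * (k * (r * ar) * (r * ar))) - 4 * (k * (r * ai) * (r * ai)) - (4 * (r * k * ur * gr) + 4 * (r * k * ui * gi)) -
   (4 * (r * (k * k - q * (r * q * k)) * (ur * ur + ui * ui)) +
   4 * (r * (q * k) * (2 * (ur * (r * q * ur + ar)) + (ui * (r * q * ui + ai) - (- (r * q * ui) - ai) * ui)))) =
   r * (gr\<^sup>2 + gi\<^sup>2) - 2 * (k * ((r * ar)\<^sup>2 + (r * ai)\<^sup>2)) -
   (r * ((gr + 2 * k * ur)\<^sup>2 + (gi + 2 * k * ui)\<^sup>2) + 4 * (k * ((r * q * ur + ar)\<^sup>2 + (r * q * ui + ai)\<^sup>2)))"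
  (is "?L = ?R")
proof -
 have "?L = ?R + (r * r - 2) * (- 2 * k * (ar\<^sup>2 + ai\<^sup>2))"
  by (simp add: power2_eq_square algebra_simps)
 then show ?thesis unfolding assms by simp
qed

locale energy_fn =
 fixes v g :: "real => complex"
 assumes v_ac: "ac v g" and g_l2: "l2 g" and v_bdd: "\<exists>B. \<forall>x. cmod (v x) \<le> B"
begin

definition mm :: complex where "mm = (LINT x|lborel. kk x *\<^sub>R v x)"

lemma v_meas [measurable]: "v \<in> borel_measurable borel" using ac_meas[OF v_ac] .

lemma g_meas [measurable]: "g \<in> borel_measurable borel" using l2_meas'[OF g_l2] .

lemma v_bound: obtains B where "1 \<le> B" "\<And>x. cmod (v x) \<le> B"
proof -
 obtain B where "\<And>x. cmod (v x) \<le> B" using v_bdd by blast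
 then show ?thesis using that[of "max 1 B"] by (simp add: le_max_iff_disj)
qed

lemma kk_bdd_integrable:
 fixes f :: "real => 'a::{real_normed_field,euclidean_space}"
 assumes "f \<in> borel_measurable borel" "\<And>x. norm (f x) \<le> C"
 shows "integrable lborel (%x. kk x *\<^sub>R f x)"
proof (rule kk_times_integrable(1)[OF assms(1), of C])
 fix x
 have "0 \<le> C" using assms(2)[of 0] norm_ge_zero[of "f 0"] by linarith
 then have "C * 1 \<le> C * (1 + \<bar>x\<bar>)\<^sup>2" by (intro mult_left_mono) (auto simp: one_le_power)
 then show "norm (f x) \<le> C * (1 + \<bar>x\<bar>)\<^sup>2" using assms(2)[of x] by linarith
qed

lemma kk_v_integrable: "integrable lborel (%x. kk x *\<^sub>R v x)"
proof -
 obtain B where B: "\<And>x. cmod (v x) \<le> B" using v_bdd by blast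
 show ?thesis by (rule kk_bdd_integrable[OF v_meas B])
qed

text \<open>The witness \<open>h\<close> is the primitive of \<open>kk * (v - mm / 2)\<close>, which vanishes at both ends, divided by \<open>sqrt 2 * kk\<close>; in terms of it the quadratic form of the energy plus the squared moment is a sum of squares.\<close>

theorem static_identity:
 obtains h h' where "ac h h'" "l2 (%x. g x + (2 * kk x) *\<^sub>R h x)" "l2 (%x. sqrt (kk x) *\<^sub>R h' x)"
  "sqrt 2 * (n2 g)\<^sup>2 - 2 * (LINT x|lborel. kk x * (cmod (v x))\<^sup>2) + (cmod mm)\<^sup>2
   = sqrt 2 * (n2 (%x. g x + (2 * kk x) *\<^sub>R h x))\<^sup>2 + 4 * (n2 (%x. sqrt (kk x) *\<^sub>R h' x))\<^sup>2"
proof -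
 obtain B where B: "1 \<le> B" "\<And>x. cmod (v x) \<le> B" using v_bound by blast
 \<comment> \<open>Half of the moment is the mean of v for the weight \<open>kk\<close>, which has
   mass 2. Once it is subtracted, \<open>f\<close> has integral 0 and its primitive \<open>U\<close>
   vanishes at both ends.\<close>
 define c where "c = mm / 2"
 define Z where "Z x = v x - c" for x
 have Za: "ac Z g" unfolding Z_def[abs_def] using ac_diff[OF v_ac ac_const[of c]] by simp
 define D where "D = B + cmod c"
 have D: "cmod (Z x) \<le> D" for x unfolding Z_def D_def using norm_triangle_ineq4[of "v x" c] B(2)[of x] by linarith
 have D0: "0 \<le> D" using B by (simp add: D_def)
 note [measurable] = ac_meas[OF Za]
 define f where "f x = kk x *\<^sub>R Z x" for x
 have fm [measurable]: "f \<in> borel_measurable borel" unfolding f_def by measurable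
 have fi: "integrable lborel f" unfolding f_def by (rule kk_bdd_integrable[OF _ D]) measurable
 have f0: "(LINT x|lborel. f x) = 0"
 proof -
  have "(LINT x|lborel. f x) = mm - (LINT x|lborel. kk x *\<^sub>R c)"
   unfolding f_def Z_def mm_def scaleR_diff_right
   by (rule Bochner_Integration.integral_diff[OF kk_v_integrable]) (rule integrable_scaleR_left[OF kk_integrable])
  also have "(LINT x|lborel. kk x *\<^sub>R c) = 2 *\<^sub>R c" using kk_integrable by (simp add: kk_integral)
  finally show ?thesis by (simp add: c_def scaleR_conv_of_real)
 qed
 have fs: "set_integrable lborel {a..b} f" for a b
  unfolding set_integrable_def by (rule integrable_mult_indicator[OF _ fi]) auto
 obtain U where U: "ac U f" "(%n. U (- real n)) \<longlonglongrightarrow> 0" using indicator_window_limit[OF fi fs] by blast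
 have U1: "(%n. U (real n)) \<longlonglongrightarrow> 0"
 proof -
  have "(%n. (U (real n) - U (- real n)) + U (- real n)) \<longlonglongrightarrow> 0 + 0"
   using ac_integrable_window[OF U(1) fi filterlim_minus_real filterlim_real_sequentially] f0 by (intro tendsto_add U(2)) simp
  then show ?thesis by simp
 qed
 have incr: "cmod (U b - U a) \<le> D * (kQ b - kQ a)" if "a \<le> b" for a b
 proof -
  have "cmod (U b - U a) \<le> (LINT x:{a..b}|lborel. norm (f x))" by (rule ac_norm_le[OF U(1) that])
  also have "\<dots> \<le> (LINT x:{a..b}|lborel. D * kk x)"
  proof (rule set_integral_mono)
   show "set_integrable lborel {a..b} (%x. norm (f x))" by (rule set_integrable_norm[OF fs])
   show "set_integrable lborel {a..b} (%x. D * kk x)" using ac_set_integrable[OF kQ_ac] by simp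
   show "norm (f x) \<le> D * kk x" for x
    using mult_right_mono[OF D[of x], of "kk x"] kk_pos[of x] by (simp add: f_def mult.commute)
  qed
  also have "\<dots> = D * (kQ b - kQ a)" using ac_int[OF kQ_ac that] by simp
  finally show ?thesis .
 qed
 \<comment> \<open>\<open>U\<close> is estimated from the nearer end of the line, where 1 - |Q| is
   at most sqrt 2 times \<open>kk\<close>. So the quotient \<open>h\<close> stays bounded although
   its denominator decays.\<close>
 have Ub: "cmod (U x) \<le> D * (sqrt 2 * kk x)" for x
 proof (cases "x \<le> 0")
  case True
  have l: "(%n. cmod (U x - U (- real n))) \<longlonglongrightarrow> cmod (U x - 0)" by (intro tendsto_intros U(2))
  have r: "(%n. D * (kQ x - kQ (- real n))) \<longlonglongrightarrow> D * (kQ x - (-1))"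
   by (intro tendsto_intros filterlim_compose[OF kQ_limits(2) filterlim_minus_real])
  have "eventually (%n. - real n \<le> x) sequentially" using filterlim_minus_real by (simp add: filterlim_at_bot)
  then have "eventually (%n. cmod (U x - U (- real n)) \<le> D * (kQ x - kQ (- real n))) sequentially"
   by eventually_elim (rule incr)
  from tendsto_le[OF _ r l this] have "cmod (U x) \<le> D * (1 + kQ x)" by (simp add: add.commute)
  also have "\<dots> \<le> D * (sqrt 2 * kk x)" using one_minus_kQ[of "- x"] True D0 by (intro mult_left_mono) (auto simp: kQ_minus kk_minus)
  finally show ?thesis .
 next
  case False
  have l: "(%n. cmod (U (real n) - U x)) \<longlonglongrightarrow> cmod (0 - U x)" by (intro tendsto_intros U1)
  have r: "(%n. D * (kQ (real n) - kQ x)) \<longlonglongrightarrow> D * (1 - kQ x)"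
   by (intro tendsto_intros filterlim_compose[OF kQ_limits(1) filterlim_real_sequentially])
  have "eventually (%n. x \<le> real n) sequentially" using filterlim_real_sequentially by (simp add: filterlim_at_top)
  then have "eventually (%n. cmod (U (real n) - U x) \<le> D * (kQ (real n) - kQ x)) sequentially"
   by eventually_elim (rule incr)
  from tendsto_le[OF _ r l this] have "cmod (U x) \<le> D * (1 - kQ x)" by simp
  also have "\<dots> \<le> D * (sqrt 2 * kk x)" using one_minus_kQ[of x] False D0 by (intro mult_left_mono) auto
  finally show ?thesis .
 qed
 define p where "p x = inverse (sqrt 2 * kk x)" for x
 have pk: "p x * (sqrt 2 * kk x) = 1" for x
  unfolding p_def using kk_pos[of x] by (intro left_inverse) simp
 have pD: "(p has_real_derivative sqrt 2 * kQ x * p x) (at x)" for x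
 proof -
  have d: "(p has_real_derivative - (inverse (sqrt 2 * kk x) * (sqrt 2 * (- sqrt 2 * kQ x * kk x)) * inverse (sqrt 2 * kk x))) (at x)"
   unfolding p_def using kk_pos[of x] by (intro DERIV_inverse' DERIV_cmult kk_DERIV) auto
  have e: "- (inverse (sqrt 2 * kk x) * (sqrt 2 * (- sqrt 2 * kQ x * kk x)) * inverse (sqrt 2 * kk x)) = sqrt 2 * kQ x * p x"
   unfolding p_def[symmetric] using pk[of x] by algebra
  show ?thesis using d unfolding e .
 qed
 have pc: "continuous_on UNIV p" using pD by (meson DERIV_isCont continuous_at_imp_continuous_on)
 have pa: "ac p (%x. sqrt 2 * kQ x * p x)" by (rule ac_DERIV[OF pD]) (intro continuous_intros pc kQ_cont)
 define h where "h x = complex_of_real (p x) * U x" for x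
 define h' where "h' x = complex_of_real (sqrt 2 * kQ x * p x) * U x + complex_of_real (p x) * f x" for x
 have ha: "ac h h'" unfolding h_def[abs_def] h'_def[abs_def] by (rule ac_mult[OF ac_of_real[OF pa] U(1)])
 note [measurable] = ac_meas[OF ha] ac_meas_deriv[OF ha] ac_meas[OF U(1)]
 have Uh: "U x = complex_of_real (sqrt 2 * kk x) * h x" for x
 proof -
  have "complex_of_real (sqrt 2 * kk x) * h x = complex_of_real (p x * (sqrt 2 * kk x)) * U x" by (simp add: h_def mult_ac)
  then show ?thesis unfolding pk by simp
 qed
 have h'e: "h' x = complex_of_real (sqrt 2 * kQ x) * h x + Z x / complex_of_real (sqrt 2)" for x
 proof -
  have "p x * kk x = 1 / sqrt 2" using pk[of x] by (simp add: field_simps)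
  then have "complex_of_real (p x) * f x = Z x / complex_of_real (sqrt 2)"
   by (simp add: f_def scaleR_conv_of_real flip: of_real_mult mult.assoc) 
  then show ?thesis by (simp add: h'_def h_def mult_ac)
 qed
 have hb: "cmod (h x) \<le> D" for x
 proof -
  have "cmod (U x) = (sqrt 2 * kk x) * cmod (h x)" using Uh[of x] kk_pos[of x] by (simp add: norm_mult)
  then have "(sqrt 2 * kk x) * cmod (h x) \<le> (sqrt 2 * kk x) * D" using Ub[of x] by (simp add: mult_ac)
  then show ?thesis using kk_pos[of x] by simp
 qed
 have h'b: "cmod (h' x) \<le> 3 * D" for x
 proof -
  have "cmod (h' x) \<le> sqrt 2 * \<bar>kQ x\<bar> * cmod (h x) + cmod (Z x) / sqrt 2"
   unfolding h'e using norm_triangle_ineq[of "complex_of_real (sqrt 2 * kQ x) * h x" "Z x / complex_of_real (sqrt 2)"]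
   by (simp add: norm_mult norm_divide abs_mult)
  also have "\<dots> \<le> 2 * 1 * D + D / 1"
   using hb[of x] D[of x] D0 kQ_bounds(1)[of x] sqrt2_less_2 by (intro add_mono mult_mono frac_le) auto
  finally show ?thesis by simp
 qed
 have l1: "l2 (%x. (2 * kk x) *\<^sub>R h x)"
  by (rule l2_bound(1)[OF kk_l2(1), where C="2 * D"])
    (use hb kk_pos in \<open>auto simp: abs_mult mult_ac less_imp_le intro!: mult_left_mono\<close>)
 have L1: "l2 (%x. g x + (2 * kk x) *\<^sub>R h x)" by (intro l2_add g_l2 l1)
 have i4: "integrable lborel (%x. kk x *\<^sub>R (cmod (h' x))\<^sup>2)"
  by (rule kk_bdd_integrable[where C="(3 * D)\<^sup>2"]) (use power_mono[OF h'b norm_ge_zero, of _ 2] in simp_all)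
 have sqk: "(norm (sqrt (kk x) *\<^sub>R h' x))\<^sup>2 = kk x *\<^sub>R (cmod (h' x))\<^sup>2" for x
  using kk_pos[of x] by (simp add: power_mult_distrib less_imp_le)
 have L2: "l2 (%x. sqrt (kk x) *\<^sub>R h' x)" using i4 by (simp add: l2_def sqk del: norm_scaleR real_scaleR_def) measurable
 have i2: "integrable lborel (%x. kk x *\<^sub>R (cmod (Z x))\<^sup>2)"
  by (rule kk_bdd_integrable[where C="D\<^sup>2"]) (use D in \<open>auto intro!: power_mono\<close>)
 \<comment> \<open>\<open>F\<close> is found so that its derivative is exactly the difference of the
   two integrands of the identity. Since \<open>U\<close> and \<open>kk\<close> vanish at infinity
   while \<open>Z\<close> and \<open>h\<close> are bounded, so does \<open>F\<close>, and the
   difference integrates to 0.\<close>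
 define F where "F x = Re (- 4 * (cnj (U x) * Z x) - 4 * (complex_of_real (sqrt 2 * (kQ x * kk x)) * (cnj (h x) * h x)))" for x
 define F' where "F' x = Re (- 4 * (cnj (f x) * Z x + cnj (U x) * g x)
   - 4 * (complex_of_real (sqrt 2 * (kk x * kk x + kQ x * (- sqrt 2 * kQ x * kk x))) * (cnj (h x) * h x)
    + complex_of_real (sqrt 2 * (kQ x * kk x)) * (cnj (h' x) * h x + cnj (h x) * h' x)))" for x
 have FA: "ac F F'"
  unfolding F_def[abs_def] F'_def[abs_def]
  by (intro ac_Re ac_diff ac_cmult ac_mult ac_cnj ac_of_real U(1) Za ha kQ_ac kk_ac)
 have pt: "F' x = (sqrt 2 * (cmod (g x))\<^sup>2 - 2 * (kk x *\<^sub>R (cmod (Z x))\<^sup>2)) - (sqrt 2 * (cmod (g x + (2 * kk x) *\<^sub>R h x))\<^sup>2 + 4 * (kk x *\<^sub>R (cmod (h' x))\<^sup>2))" for x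
 proof -
  define r where "r = sqrt (2::real)"
  have r2: "r * r = 2" unfolding r_def by simp
  have rinv: "1 / r = r / 2" unfolding r_def by (simp add: real_div_sqrt)
  obtain ur ui where hh: "h x = Complex ur ui" by (cases "h x")
  obtain gr gi where gg: "g x = Complex gr gi" by (cases "g x")
  define ar ai where "ar = Re (Z x) * (r / 2)" and "ai = Im (Z x) * (r / 2)"
  have half: "z = r * (z * (r / 2))" for z :: real
  proof -
   have "r * (z * (r / 2)) = (r * r) * (z / 2)" by simp
   then show ?thesis unfolding r2 by simp
  qed
  have zz: "Re (Z x) = r * ar" "Im (Z x) = r * ai" unfolding ar_def ai_def by (rule half)+
  have zd: "Re (Z x) / r = ar" "Im (Z x) / r = ai" unfolding ar_def ai_def rinv[symmetric] by simp_all
  have h'r: "Re (h' x) = r * kQ x * ur + ar" "Im (h' x) = r * kQ x * ui + ai"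
   unfolding h'e hh r_def[symmetric] by (simp_all add: zd)
  have Ur: "Re (U x) = r * kk x * ur" "Im (U x) = r * kk x * ui" unfolding Uh hh r_def[symmetric] by simp_all
  have fr: "Re (f x) = kk x * (r * ar)" "Im (f x) = kk x * (r * ai)" by (simp_all add: f_def zz)
  have "F' x = (r * (cmod (g x))\<^sup>2 - 2 * (kk x *\<^sub>R (cmod (Z x))\<^sup>2)) - (r * (cmod (g x + (2 * kk x) *\<^sub>R h x))\<^sup>2 + 4 * (kk x *\<^sub>R (cmod (h' x))\<^sup>2))"
   unfolding F'_def cmod_power2 r_def[symmetric]
   by (simp add: h'r Ur fr hh zz gg) (rule static_polynomial_identity[OF r2])
  then show ?thesis unfolding r_def .
 qed
 have F'i: "integrable lborel F'"
  unfolding pt[abs_def] using l2_int[OF g_l2] l2_int[OF L1] i2 i4 by simp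
 have Fl: "(%n. F (X n)) \<longlonglongrightarrow> 0" if X: "(%n. U (X n)) \<longlonglongrightarrow> 0" "(%n. kk (X n)) \<longlonglongrightarrow> 0" for X
 proof (rule Lim_null_comparison)
  show "eventually (%n. norm (F (X n)) \<le> 4 * (cmod (U (X n)) * D) + 4 * (2 * (1 * kk (X n)) * (D * D))) sequentially"
  proof (rule always_eventually, rule allI)
   fix n
   let ?x = "X n"
   have "\<bar>F ?x\<bar> \<le> cmod (- 4 * (cnj (U ?x) * Z ?x) - 4 * (complex_of_real (sqrt 2 * (kQ ?x * kk ?x)) * (cnj (h ?x) * h ?x)))"
    unfolding F_def by (rule abs_Re_le_cmod)
   also have "\<dots> \<le> 4 * (cmod (U ?x) * cmod (Z ?x)) + 4 * (sqrt 2 * (\<bar>kQ ?x\<bar> * kk ?x) * (cmod (h ?x) * cmod (h ?x)))"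
    by (rule order_trans[OF norm_triangle_ineq4]) (simp add: norm_mult abs_mult kk_pos less_imp_le abs_of_pos)
   also have "\<dots> \<le> 4 * (cmod (U ?x) * D) + 4 * (2 * (1 * kk ?x) * (D * D))"
    using D[of ?x] hb[of ?x] kQ_bounds(1)[of ?x] kk_pos[of ?x] sqrt2_less_2 D0
    by (intro add_mono mult_left_mono mult_mono) auto
   finally show "norm (F ?x) \<le> 4 * (cmod (U ?x) * D) + 4 * (2 * (1 * kk ?x) * (D * D))" by simp
  qed
  have "(%n. 4 * (cmod (U (X n)) * D) + 4 * (2 * (1 * kk (X n)) * (D * D))) \<longlonglongrightarrow> 4 * (cmod 0 * D) + 4 * (2 * (1 * 0) * (D * D))"
   by (intro tendsto_intros X)
  then show "(%n. 4 * (cmod (U (X n)) * D) + 4 * (2 * (1 * kk (X n)) * (D * D))) \<longlonglongrightarrow> 0" by simp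
 qed
 have "(%n. F (real n) - F (- real n)) \<longlonglongrightarrow> 0 - 0"
  by (intro tendsto_diff Fl U U1 filterlim_compose[OF kk_tendsto_0(1) filterlim_real_sequentially] filterlim_compose[OF kk_tendsto_0(2) filterlim_minus_real])
 then have "(LINT x|lborel. F' x) = 0"
  using ac_integrable_window[OF FA F'i filterlim_minus_real filterlim_real_sequentially] LIMSEQ_unique by fastforce
 then have I: "sqrt 2 * (n2 g)\<^sup>2 - 2 * (LINT x|lborel. kk x *\<^sub>R (cmod (Z x))\<^sup>2) = sqrt 2 * (n2 (%x. g x + (2 * kk x) *\<^sub>R h x))\<^sup>2 + 4 * (n2 (%x. sqrt (kk x) *\<^sub>R h' x))\<^sup>2"
  unfolding pt n2_sq sqk using l2_int[OF g_l2] l2_int[OF L1] i2 i4 by simp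
 have i1: "integrable lborel (%x. kk x *\<^sub>R (cmod (v x))\<^sup>2)"
  by (rule kk_bdd_integrable[where C="B\<^sup>2"]) (use B in \<open>auto intro!: power_mono\<close>)
 \<comment> \<open>Back from Z to v: with c = mm / 2 the cross term is |mm|^2 and the constant term
   |mm|^2 / 2, which leaves -|mm|^2 / 2.\<close>
 have "(LINT x|lborel. kk x *\<^sub>R (cmod (Z x))\<^sup>2) = (LINT x|lborel. kk x *\<^sub>R (cmod (v x))\<^sup>2 - 2 * Re (cnj c * (kk x *\<^sub>R v x)) + (cmod c)\<^sup>2 * kk x)"
  by (rule Bochner_Integration.integral_cong[OF refl]) (simp add: Z_def cmod_power2, simp add: power2_eq_square algebra_simps)
 also have "\<dots> = (LINT x|lborel. kk x *\<^sub>R (cmod (v x))\<^sup>2) - 2 * Re (cnj c * mm) + (cmod c)\<^sup>2 * 2"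
 proof -
  have ic: "integrable lborel (%x. cnj c * (kk x *\<^sub>R v x))" by (rule integrable_mult_right[OF kk_v_integrable])
  note iR = integrable_Re[OF ic]
  have R: "(LINT x|lborel. Re (cnj c * (kk x *\<^sub>R v x))) = Re (cnj c * mm)"
   unfolding integral_Re[OF ic] mm_def by (simp only: integral_mult_right_zero)
  show ?thesis
   unfolding Bochner_Integration.integral_add[OF Bochner_Integration.integrable_diff[OF i1 integrable_mult_right[OF iR]] integrable_mult_right[OF kk_integrable]]
    Bochner_Integration.integral_diff[OF i1 integrable_mult_right[OF iR]] integral_mult_right_zero R kk_integral ..
 qed
 also have "2 * Re (cnj c * mm) = (cmod mm)\<^sup>2"
  unfolding c_def cmod_power2 by (simp add: power2_eq_square)
 also have "(cmod c)\<^sup>2 * 2 = (cmod mm)\<^sup>2 / 2" by (simp add: c_def norm_divide power_divide)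
 finally have J: "2 * (LINT x|lborel. kk x *\<^sub>R (cmod (Z x))\<^sup>2) = 2 * (LINT x|lborel. kk x * (cmod (v x))\<^sup>2) - (cmod mm)\<^sup>2" by simp
 show ?thesis by (rule that[OF ha L1 L2]) (use I J in linarith)
qed

end

text \<open>The energy of the kink.\<close>

definition E0 :: real where "E0 = (n2 kk)\<^sup>2 / 2 + (n2 (%x. 1 - (kQ x)\<^sup>2))\<^sup>2 / 4"

definition dens :: "(real => complex) => real => real" where "dens v x = (cmod (v x))\<^sup>2 - (kQ x)\<^sup>2"

text \<open>The weight \<open>1 + \<bar>x\<bar>\<close> is needed because a phase drift at infinity costs no energy: only the derivative and the modulus are controlled globally.\<close>

definition close :: "real => (real => complex) => (real => complex) => bool" where
 "close \<tau> v g \<longleftrightarrow> (\<forall>x. cmod (v x - of_real (kQ x)) \<le> \<tau> * (1 + \<bar>x\<bar>)) \<and> n2 (%x. g x - of_real (kk x)) \<le> \<tau> \<and> n2 (dens v) \<le> \<tau>"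

lemma kk_kQ_integral: "(LINT x|lborel. kk x * kQ x) = 0"
proof -
 have "(LINT x|lborel. kk x * kQ x) = (LINT x|lborel. kk (0 + (-1) * x) * kQ (0 + (-1) * x))"
  using lborel_integral_real_affine[of "-1" "%x. kk x * kQ x" 0] by simp
 also have "\<dots> = - (LINT x|lborel. kk x * kQ x)" by (simp add: kk_minus kQ_minus)
 finally show ?thesis by simp
qed

lemma one_minus_kQ_l2: "l2 (%x. 1 - (kQ x)\<^sup>2)"
 unfolding kk_eq by (rule l2_cmult(1)[OF kk_l2(1)])

lemma sqrt_le_one_plus: "0 \<le> x ==> sqrt x \<le> 1 + x"
 by (rule real_le_lsqrt) (auto simp: power2_sum)

lemma real_quad_bound:
 fixes L a :: real
 assumes "0 \<le> L" "a = \<bar>L\<^sup>2 - 1\<bar>" shows "\<bar>L - 1\<bar> \<le> a" "L \<le> 1 + a"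
proof -
 have "L\<^sup>2 - 1 = (L - 1) * (L + 1)" by (simp add: power2_eq_square algebra_simps)
 then have "a = \<bar>L - 1\<bar> * (L + 1)" using assms by (simp add: abs_mult)
 moreover have "\<bar>L - 1\<bar> * 1 \<le> \<bar>L - 1\<bar> * (L + 1)" using assms(1) by (intro mult_left_mono) auto
 ultimately show "\<bar>L - 1\<bar> \<le> a" by simp
 then show "L \<le> 1 + a" by linarith
qed

locale energy_fn_eta = energy_fn +
 assumes eta_l2: "l2 (%x. 1 - (cmod (v x))\<^sup>2)"
begin

definition en :: real where "en = (n2 g)\<^sup>2 / 2 + (n2 (%x. 1 - (cmod (v x))\<^sup>2))\<^sup>2 / 4"

lemma dens_l2: "l2 (dens v)"
proof -
 have "dens v = (%x. (1 - (kQ x)\<^sup>2) - (1 - (cmod (v x))\<^sup>2))" by (simp add: dens_def fun_eq_iff)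
 then show ?thesis using l2_diff[OF one_minus_kQ_l2 eta_l2] by simp
qed

text \<open>Insert 1 - |v|^2 = (1 - Q^2) - dens and expand the square. The cross term is a multiple
  of kk (|v|^2 - Q^2), and \<open>kk_kQ_identity\<close> cancels its Q^2 part against the gradient
  energy of the kink. What is left is a quadratic form in (v, g) plus the square of the density
  defect.\<close>

lemma energy_expansion: "en - E0 = ((n2 g)\<^sup>2 - sqrt 2 * (LINT x|lborel. kk x * (cmod (v x))\<^sup>2)) / 2 + (n2 (dens v))\<^sup>2 / 4"
proof -
 obtain B where B: "1 \<le> B" "\<And>x. cmod (v x) \<le> B" using v_bound by blast
 have i1: "integrable lborel (%x. kk x * (cmod (v x))\<^sup>2)"
  using kk_bdd_integrable[of "%x. (cmod (v x))\<^sup>2" "B\<^sup>2"] power_mono[OF B(2) norm_ge_zero, of _ 2] by simp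
 have i2: "integrable lborel (%x. kk x * (kQ x)\<^sup>2)"
  using kk_bdd_integrable[of "%x. (kQ x)\<^sup>2" 1] less_imp_le[OF kQ_sq] by simp
 note i3 = l2_int[OF one_minus_kQ_l2] l2_int[OF dens_l2]
 have "(n2 (%x. 1 - (cmod (v x))\<^sup>2))\<^sup>2 = (LINT x|lborel. ((norm (1 - (kQ x)\<^sup>2))\<^sup>2 - (2 * sqrt 2) * (kk x * (cmod (v x))\<^sup>2 - kk x * (kQ x)\<^sup>2)) + (norm (dens v x))\<^sup>2)"
  unfolding n2_sq
 proof (rule Bochner_Integration.integral_cong[OF refl])
  fix x
  have "1 - (cmod (v x))\<^sup>2 = (1 - (kQ x)\<^sup>2) - dens v x" by (simp add: dens_def)
  moreover have "a = b - d ==> a\<^sup>2 = b\<^sup>2 - 2 * b * d + d\<^sup>2" for a b d :: real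
   by (simp add: power2_diff)
  ultimately have "(1 - (cmod (v x))\<^sup>2)\<^sup>2 = (1 - (kQ x)\<^sup>2)\<^sup>2 - 2 * (1 - (kQ x)\<^sup>2) * dens v x + (dens v x)\<^sup>2"
   by blast
  also have "2 * (1 - (kQ x)\<^sup>2) * dens v x = (2 * sqrt 2) * (kk x * (cmod (v x))\<^sup>2 - kk x * (kQ x)\<^sup>2)"
   unfolding kk_eq dens_def by (simp add: algebra_simps)
  finally show "(norm (1 - (cmod (v x))\<^sup>2))\<^sup>2 = ((norm (1 - (kQ x)\<^sup>2))\<^sup>2 - (2 * sqrt 2) * (kk x * (cmod (v x))\<^sup>2 - kk x * (kQ x)\<^sup>2)) + (norm (dens v x))\<^sup>2"
   by simp
 qed
 also have "\<dots> = ((n2 (%x. 1 - (kQ x)\<^sup>2))\<^sup>2 - (2 * sqrt 2) * ((LINT x|lborel. kk x * (cmod (v x))\<^sup>2) - (LINT x|lborel. kk x * (kQ x)\<^sup>2))) + (n2 (dens v))\<^sup>2"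
  unfolding n2_sq Bochner_Integration.integral_add[OF Bochner_Integration.integrable_diff[OF i3(1) integrable_mult_right[OF Bochner_Integration.integrable_diff[OF i1 i2]]] i3(2)]
   Bochner_Integration.integral_diff[OF i3(1) integrable_mult_right[OF Bochner_Integration.integrable_diff[OF i1 i2]]]
   integral_mult_right_zero Bochner_Integration.integral_diff[OF i1 i2] ..
 finally have e: "(n2 (%x. 1 - (cmod (v x))\<^sup>2))\<^sup>2 = ((n2 (%x. 1 - (kQ x)\<^sup>2))\<^sup>2 - (2 * sqrt 2) * ((LINT x|lborel. kk x * (cmod (v x))\<^sup>2) - (LINT x|lborel. kk x * (kQ x)\<^sup>2))) + (n2 (dens v))\<^sup>2" .
 show ?thesis unfolding en_def E0_def e kk_kQ_identity by (simp add: field_simps)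
qed

text \<open>By \<open>static_identity\<close> the quadratic form is a sum of two squares minus
  |mm|^2, so both squares are of order \<mu> + \<beta>^2. The second makes \<open>h\<close> nearly
  constant in a weighted sense, and then the first says that \<open>g\<close> is nearly the multiple
  -2 h(0) of \<open>kk\<close>. One complex multiple thus stays undetermined.\<close>

lemma coercivity:
 assumes E: "en \<le> E0 + \<mu>" and m: "cmod mm \<le> \<beta>" and p: "0 \<le> \<mu>"
 shows "\<exists>l. n2 (%x. g x - l * of_real (kk x)) \<le> 2 * (1 + sqrt kW) * (sqrt \<mu> + \<beta>)" and "n2 (dens v) \<le> 2 * (sqrt \<mu> + \<beta>)"
proof -
 have b0: "0 \<le> \<beta>" using m norm_ge_zero[of mm] by linarith
 define s where "s = sqrt \<mu> + \<beta>"
 have s0: "0 \<le> s" using p b0 by (simp add: s_def)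
 have s2: "\<mu> + \<beta>\<^sup>2 \<le> s\<^sup>2" using p b0 by (simp add: s_def power2_sum)
 obtain h h' where h: "ac h h'" "l2 (%x. g x + (2 * kk x) *\<^sub>R h x)" "l2 (%x. sqrt (kk x) *\<^sub>R h' x)"
  "sqrt 2 * (n2 g)\<^sup>2 - 2 * (LINT x|lborel. kk x * (cmod (v x))\<^sup>2) + (cmod mm)\<^sup>2
   = sqrt 2 * (n2 (%x. g x + (2 * kk x) *\<^sub>R h x))\<^sup>2 + 4 * (n2 (%x. sqrt (kk x) *\<^sub>R h' x))\<^sup>2" using static_identity by blast
 note [measurable] = ac_meas[OF h(1)]
 define A where "A = n2 (%x. g x + (2 * kk x) *\<^sub>R h x)"
 define J where "J = n2 (%x. sqrt (kk x) *\<^sub>R h' x)"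
 have AJ: "0 \<le> A" "0 \<le> J" by (simp_all add: A_def J_def)
 define I where "I = (LINT x|lborel. kk x * (cmod (v x))\<^sup>2)"
 have m2: "(cmod mm)\<^sup>2 \<le> \<beta>\<^sup>2" using m by (intro power_mono) auto
 define r where "r = sqrt (2::real)"
 have r: "1 \<le> r" "r * r = 2" "r \<le> 2" using sqrt2_less_2 unfolding r_def by auto
 have e1: "r * (n2 g)\<^sup>2 - 2 * I + (cmod mm)\<^sup>2 = r * A\<^sup>2 + 4 * J\<^sup>2" using h(4) by (simp add: r_def A_def J_def I_def)
 have e2: "((n2 g)\<^sup>2 - r * I) / 2 + (n2 (dens v))\<^sup>2 / 4 \<le> \<mu>" using energy_expansion E by (simp add: r_def I_def)
 have "r * ((n2 g)\<^sup>2 - r * I) = r * (n2 g)\<^sup>2 - 2 * I" using r(2) by (simp add: right_diff_distrib flip: mult.assoc)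
 then have e3: "r * ((n2 g)\<^sup>2 - r * I) = r * A\<^sup>2 + 4 * J\<^sup>2 - (cmod mm)\<^sup>2" using e1 by simp
 have "r * (((n2 g)\<^sup>2 - r * I) / 2 + (n2 (dens v))\<^sup>2 / 4) \<le> r * \<mu>" using e2 r by (intro mult_left_mono) auto
 then have "(r * ((n2 g)\<^sup>2 - r * I)) / 2 + r * (n2 (dens v))\<^sup>2 / 4 \<le> r * \<mu>" by (simp add: distrib_left)
 moreover have "2 * x + y \<le> 4 * z" if "x / 2 + y / 4 \<le> z" for x y z :: real using that by simp
 ultimately have e4: "2 * (r * A\<^sup>2 + 4 * J\<^sup>2 - (cmod mm)\<^sup>2) + r * (n2 (dens v))\<^sup>2 \<le> 4 * (r * \<mu>)"
  unfolding e3 by blast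
 then have e4: "2 * (r * A\<^sup>2) + 8 * J\<^sup>2 - 2 * (cmod mm)\<^sup>2 + r * (n2 (dens v))\<^sup>2 \<le> 4 * (r * \<mu>)" by argo
 note n1 = mult_right_mono[OF r(1) zero_le_power2[of "n2 (dens v)"]] mult_right_mono[OF r(1) zero_le_power2[of A]] mult_right_mono[OF r(3) p]
 have n0: "0 \<le> r * (n2 (dens v))\<^sup>2" "0 \<le> J\<^sup>2" "0 \<le> A\<^sup>2" "0 \<le> r * A\<^sup>2" "0 \<le> \<beta>\<^sup>2" using r by auto
 have b1: "A\<^sup>2 \<le> 4 * s\<^sup>2" using e4 n1 n0 m2 s2 p by linarith
 have b2: "4 * J\<^sup>2 \<le> 4 * s\<^sup>2" using e4 n1 n0 m2 s2 p by linarith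
 have "r * (n2 (dens v))\<^sup>2 \<le> 4 * (r * \<mu>) + 2 * \<beta>\<^sup>2" using e4 n0 m2 by linarith
 also have "\<dots> \<le> 4 * (r * (\<mu> + \<beta>\<^sup>2))" using mult_right_mono[OF r(1), of "\<beta>\<^sup>2"] n0(5) unfolding distrib_left by argo
 also have "\<dots> \<le> 4 * (r * s\<^sup>2)" using s2 r by (intro mult_left_mono) auto
 finally have "(n2 (dens v))\<^sup>2 \<le> (2 * s)\<^sup>2" using r(1) by (simp add: power_mult_distrib)
 then show "n2 (dens v) \<le> 2 * (sqrt \<mu> + \<beta>)" unfolding s_def[symmetric] by (rule power2_le_imp_le) (use s0 in simp)
 have A1: "A \<le> 2 * s" using b1 s0 power2_le_iff_abs_le[of "2 * s" A] by (simp add: power_mult_distrib)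
 have J1: "J \<le> s" using b2 s0 power2_le_iff_abs_le[of s J] by simp
 define H where "H x = h x - h 0" for x
 have Hm [measurable]: "H \<in> borel_measurable borel" unfolding H_def by measurable
 \<comment> \<open>\<open>kk\<close> decreases in |x|, so \<open>sqrt (kk x)\<close> may be moved
   under the integral between 0 and x and replaced by the larger weight at y.\<close>
 have Hb: "sqrt (kk x) * cmod (H x) \<le> sqrt \<bar>x\<bar> * J" for x
 proof -
  define a where "a = min 0 x"
  define b where "b = max 0 x"
  have ab: "a \<le> b" "b - a = \<bar>x\<bar>" by (auto simp: a_def b_def)
  have "cmod (H x) = cmod (h b - h a)" by (cases "0 \<le> x") (auto simp: H_def a_def b_def norm_minus_commute)
  also have "\<dots> \<le> (LINT y:{a..b}|lborel. norm (h' y))" by (rule ac_norm_le[OF h(1) ab(1)])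
  finally have "sqrt (kk x) * cmod (H x) \<le> sqrt (kk x) * (LINT y:{a..b}|lborel. norm (h' y))"
   by (intro mult_left_mono) (auto intro!: less_imp_le kk_pos)
  also have "\<dots> = (LINT y:{a..b}|lborel. sqrt (kk x) * norm (h' y))" by simp
  also have "\<dots> \<le> (LINT y:{a..b}|lborel. norm (sqrt (kk y) *\<^sub>R h' y))"
  proof (rule set_integral_mono)
   show "set_integrable lborel {a..b} (%y. sqrt (kk x) * norm (h' y))"
    by (intro set_integrable_mult_right set_integrable_norm ac_set_integrable[OF h(1)])
   show "set_integrable lborel {a..b} (%y. norm (sqrt (kk y) *\<^sub>R h' y))"
    by (intro set_integrable_norm l2_set_integrable h(3))
   fix y assume "y \<in> {a..b}"
   then have "\<bar>y\<bar> \<le> \<bar>x\<bar>" by (auto simp: a_def b_def)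
   then have "sqrt (kk x) \<le> sqrt (kk y)" using kk_antimono by simp
   then show "sqrt (kk x) * norm (h' y) \<le> norm (sqrt (kk y) *\<^sub>R h' y)"
    using kk_pos[of y] by (auto intro!: mult_right_mono simp: less_imp_le)
  qed
  also have "\<dots> \<le> sqrt (b - a) * J" unfolding J_def by (rule n2_set_CS[OF h(3) ab(1)])
  finally show ?thesis unfolding ab(2) .
 qed
 have kH: "l2 (%x. (2 * kk x) *\<^sub>R H x)" "n2 (%x. (2 * kk x) *\<^sub>R H x) \<le> (2 * J) * sqrt kW"
 proof -
  have b: "(norm ((2 * kk x) *\<^sub>R H x))\<^sup>2 \<le> (2 * J)\<^sup>2 * (kk x * (1 + \<bar>x\<bar>)\<^sup>2)" for x
  proof -
   have "(sqrt (kk x) * cmod (H x))\<^sup>2 \<le> (sqrt \<bar>x\<bar> * J)\<^sup>2" using Hb[of x] kk_pos[of x] by (intro power_mono) (auto simp: less_imp_le)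
   then have q: "kk x * (cmod (H x))\<^sup>2 \<le> \<bar>x\<bar> * J\<^sup>2" using kk_pos[of x] by (simp add: power_mult_distrib less_imp_le)
   have "\<bar>x\<bar> \<le> (1 + \<bar>x\<bar>)\<^sup>2" by (simp add: power2_sum)
   then have "\<bar>x\<bar> * J\<^sup>2 \<le> (1 + \<bar>x\<bar>)\<^sup>2 * J\<^sup>2" by (intro mult_right_mono) auto
   then have "kk x * (kk x * (cmod (H x))\<^sup>2) \<le> kk x * ((1 + \<bar>x\<bar>)\<^sup>2 * J\<^sup>2)"
    using q kk_pos[of x] by (intro mult_left_mono) (auto simp: less_imp_le)
   moreover have "(norm ((2 * kk x) *\<^sub>R H x))\<^sup>2 = 4 * (kk x * (kk x * (cmod (H x))\<^sup>2))"
    by (simp add: power_mult_distrib power2_eq_square)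
   moreover have "(2 * J)\<^sup>2 * (kk x * (1 + \<bar>x\<bar>)\<^sup>2) = 4 * (kk x * ((1 + \<bar>x\<bar>)\<^sup>2 * J\<^sup>2))"
    by (simp add: power_mult_distrib)
   ultimately show ?thesis by linarith
  qed
  have iw: "integrable lborel (%x. (2 * J)\<^sup>2 * (kk x * (1 + \<bar>x\<bar>)\<^sup>2))" using kk_weight_integrable by (rule integrable_mult_right)
  have j: "integrable lborel (%x. (norm ((2 * kk x) *\<^sub>R H x))\<^sup>2)"
   by (rule Bochner_Integration.integrable_bound[OF iw]) (use b order_trans[OF b abs_ge_self] in \<open>auto intro!: AE_I2\<close>)
  then show "l2 (%x. (2 * kk x) *\<^sub>R H x)" unfolding l2_def by simp
  have "(n2 (%x. (2 * kk x) *\<^sub>R H x))\<^sup>2 \<le> (2 * J)\<^sup>2 * kW"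
   unfolding n2_sq kW_def integral_mult_right_zero[symmetric] by (rule integral_mono[OF j iw]) (rule b)
  then have "(n2 (%x. (2 * kk x) *\<^sub>R H x))\<^sup>2 \<le> ((2 * J) * sqrt kW)\<^sup>2" using kW_nonneg by (simp only: power_mult_distrib real_sqrt_pow2)
  then show "n2 (%x. (2 * kk x) *\<^sub>R H x) \<le> (2 * J) * sqrt kW"
   by (rule power2_le_imp_le) (use AJ kW_nonneg in auto)
 qed
 have "n2 (%x. g x - (- 2 * h 0) * of_real (kk x)) = n2 (%x. (g x + (2 * kk x) *\<^sub>R h x) - (2 * kk x) *\<^sub>R H x)"
  by (rule arg_cong[where f=n2]) (simp add: fun_eq_iff H_def scaleR_conv_of_real algebra_simps)
 also have "\<dots> \<le> A + (2 * J) * sqrt kW" unfolding A_def using n2_triangle_diff[OF h(2) kH(1)] kH(2) by linarith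
 also have "\<dots> \<le> 2 * s + (2 * s) * sqrt kW" using A1 J1 kW_nonneg by (intro add_mono mult_right_mono) auto
 also have "\<dots> = 2 * (1 + sqrt kW) * s" by (simp add: algebra_simps)
 finally show "\<exists>l. n2 (%x. g x - l * of_real (kk x)) \<le> 2 * (1 + sqrt kW) * (sqrt \<mu> + \<beta>)" unfolding s_def by blast
qed

end

text \<open>By \<open>coercivity\<close> v differs from a multiple \<open>l\<close> of the kink by a
  slowly growing error. The moment controls this error at 0, the kink having moment zero. The
  modulus on [1, 2], where the kink stays away from 0, forces |l| to be near 1, and the phase of
  \<open>l\<close> is rotated away.\<close>

theorem close_if_energy_and_moment_small:
 "\<exists>C\<ge>1. \<forall>v g \<mu> \<beta>. energy_fn_eta v g --> energy_fn_eta.en v g \<le> E0 + \<mu> --> cmod (energy_fn.mm v) \<le> \<beta> --> 0 \<le> \<mu> -->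
   C * (sqrt \<mu> + \<beta>) \<le> 1 --> (\<exists>u. cmod u = 1 \<and> close (C * (sqrt \<mu> + \<beta>)) (%x. u * v x) (%x. u * g x))"
proof -
 define c1 where "c1 = 2 * (1 + sqrt kW)"
 define c2 where "c2 = 1 + kW * c1"
 define c3 where "c3 = c1 + c2"
 \<comment> \<open>\<open>q\<close> bounds Q^2 from below on [1, 2]. In \<open>c4\<close> the number
   34 is 2 (2 + 15): the estimate of \<open>a * q\<close> contains 6 a c3 s, and the summand 12 c3 /
   q of \<open>C\<close> makes this at most a q / 2.\<close>
 define q where "q = (kQ 1)\<^sup>2"
 define c4 where "c4 = 34 * c3 / q"
 define C where "C = c1 + c3 + c4 + c4 * sqrt kW + 2 + 12 * c3 / q"
 have kQ1: "0 < kQ 1"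
 proof -
  have "kQ 1 \<noteq> 0" by (simp add: kQ_def)
  then show ?thesis using kQ_nonneg[of 1] by simp
 qed
 have q: "0 < q" "q \<le> 1" using kQ1 kQ_sq[of 1] by (auto simp: q_def)
 have c: "2 \<le> c1" "1 \<le> c2" "3 \<le> c3" using kW_nonneg unfolding c1_def c2_def c3_def by (auto simp: field_simps)
 have c4: "0 < c4" using c q by (simp add: c4_def)
 have c3q: "0 \<le> 12 * c3 / q" using c q by simp
 have ckW: "0 \<le> c4 * sqrt kW" using c4 kW_nonneg by simp
 have C1: "1 \<le> C" using c c4 c3q ckW unfolding C_def by linarith
 have "\<exists>u. cmod u = 1 \<and> close (C * (sqrt \<mu> + \<beta>)) (%x. u * v x) (%x. u * g x)"
  if L: "energy_fn_eta v g" and E: "energy_fn_eta.en v g \<le> E0 + \<mu>" and m: "cmod (energy_fn.mm v) \<le> \<beta>" and p: "0 \<le> \<mu>" and sm: "C * (sqrt \<mu> + \<beta>) \<le> 1" for v g \<mu> \<beta>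
 proof -
  interpret energy_fn_eta v g by fact
  define s where "s = sqrt \<mu> + \<beta>"
  have b0: "0 \<le> \<beta>" using m norm_ge_zero[of mm] by linarith
  have s0: "0 \<le> s" using p b0 by (simp add: s_def)
  have sC: "C * s \<le> 1" using sm by (simp add: s_def)
  have Cs: "y * s \<le> 1" if "y \<le> C" for y using mult_right_mono[OF that s0] sC by linarith
  obtain l where l: "n2 (%x. g x - l * of_real (kk x)) \<le> c1 * s" using coercivity(1)[OF E m p] unfolding c1_def s_def by blast
  have nd: "n2 (dens v) \<le> 2 * s" using coercivity(2)[OF E m p] unfolding s_def .
  define w where "w x = v x - l * of_real (kQ x)" for x
  have wa: "ac w (%x. g x - l * of_real (kk x))" unfolding w_def[abs_def] by (intro ac_diff v_ac ac_cmult ac_of_real kQ_ac)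
  have wl: "l2 (%x. g x - l * of_real (kk x))" by (intro l2_diff g_l2 l2_cmult(1) l2_of_real kk_l2)
  have w1: "cmod (w x - w 0) \<le> c1 * s * (1 + \<bar>x\<bar>)" for x
  proof -
   have "cmod (w x - w 0) \<le> sqrt \<bar>x - 0\<bar> * n2 (%x. g x - l * of_real (kk x))" by (rule ac_l2_le[OF wa wl])
   also have "\<dots> \<le> (1 + \<bar>x\<bar>) * (c1 * s)" using l sqrt_le_one_plus[of "\<bar>x\<bar>"] by (intro mult_mono) auto
   finally show ?thesis by (simp add: mult.commute)
  qed
  have wm [measurable]: "w \<in> borel_measurable borel" using ac_meas[OF wa] .
  have "cmod (w 0) \<le> c2 * s"
  proof -
   have b: "norm (w x - w 0) \<le> (c1 * s) * (1 + \<bar>x\<bar>)\<^sup>2" for x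
   proof (rule order_trans[OF w1])
    have "(1 + \<bar>x\<bar>) \<le> (1 + \<bar>x\<bar>)\<^sup>2" by (rule self_le_power) auto
    then show "c1 * s * (1 + \<bar>x\<bar>) \<le> (c1 * s) * (1 + \<bar>x\<bar>)\<^sup>2" using c s0 by (intro mult_left_mono) auto
   qed
   have dm: "(%x. w x - w 0) \<in> borel_measurable borel" by measurable
   note i1 = kk_times_integrable[OF dm b]
   have i2: "integrable lborel (%x. complex_of_real (kk x * kQ x))"
   proof -
    have "integrable lborel (%x. kk x * kQ x)" using kk_bdd_integrable[of kQ 1] kQ_bounds(1) by (simp add: less_imp_le)
    from integrable_of_real[OF this] show ?thesis .
   qed
   have i2': "integrable lborel (%x. l * complex_of_real (kk x * kQ x))" using i2 by (rule integrable_mult_right)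
   have i3: "integrable lborel (%x. kk x *\<^sub>R w 0)" by (rule integrable_scaleR_left[OF kk_integrable])
   have "mm = (LINT x|lborel. l * complex_of_real (kk x * kQ x) + (kk x *\<^sub>R (w x - w 0) + kk x *\<^sub>R w 0))"
    unfolding mm_def by (rule Bochner_Integration.integral_cong[OF refl]) (simp add: w_def scaleR_conv_of_real algebra_simps)
   also have "\<dots> = (LINT x|lborel. l * complex_of_real (kk x * kQ x)) + ((LINT x|lborel. kk x *\<^sub>R (w x - w 0)) + (LINT x|lborel. kk x *\<^sub>R w 0))"
    unfolding Bochner_Integration.integral_add[OF i2' Bochner_Integration.integrable_add[OF i1(1) i3]] Bochner_Integration.integral_add[OF i1(1) i3] ..
   also have "(LINT x|lborel. l * complex_of_real (kk x * kQ x)) = 0"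
    unfolding integral_mult_right_zero integral_complex_of_real kk_kQ_integral by simp
   also have "(LINT x|lborel. kk x *\<^sub>R w 0) = 2 *\<^sub>R w 0" using kk_integrable by (simp add: kk_integral)
   finally have "2 *\<^sub>R w 0 = mm - (LINT x|lborel. kk x *\<^sub>R (w x - w 0))" by simp
   then have "2 * cmod (w 0) \<le> cmod mm + cmod (LINT x|lborel. kk x *\<^sub>R (w x - w 0))"
    using norm_triangle_ineq4[of mm "LINT x|lborel. kk x *\<^sub>R (w x - w 0)"] by (metis norm_scaleR abs_numeral)
   also have "\<dots> \<le> s + (c1 * s) * kW" 
   proof (rule add_mono)
    show "cmod mm \<le> s" using m real_sqrt_ge_zero[OF p] unfolding s_def by linarith
   qed (use i1(2) in \<open>simp add: kW_def\<close>)
   also have "\<dots> = c2 * s" by (simp add: c2_def algebra_simps)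
   finally show ?thesis using norm_ge_zero[of "w 0"] by linarith
  qed
  then have wb: "cmod (w x) \<le> c3 * s * (1 + \<bar>x\<bar>)" for x
  proof -
   have "cmod (w x) \<le> cmod (w x - w 0) + cmod (w 0)" using norm_triangle_ineq[of "w x - w 0" "w 0"] by simp
   also have "\<dots> \<le> c1 * s * (1 + \<bar>x\<bar>) + c2 * s * (1 + \<bar>x\<bar>)"
   proof -
    have "(c2 * s) * 1 \<le> (c2 * s) * (1 + \<bar>x\<bar>)" by (rule mult_left_mono) (use c s0 in auto)
    then show ?thesis using w1[of x] \<open>cmod (w 0) \<le> c2 * s\<close> by linarith
   qed
   also have "\<dots> = c3 * s * (1 + \<bar>x\<bar>)" by (simp add: c3_def algebra_simps)
   finally show ?thesis .
  qed
  define L where "L = cmod l"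
  define a where "a = \<bar>L\<^sup>2 - 1\<bar>"
  have L0: "0 \<le> L" by (simp add: L_def)
  note La = real_quad_bound[OF L0 a_def]
  have c3s: "c3 * s \<le> 1" by (rule Cs) (use c c4 c3q ckW in \<open>unfold C_def, linarith\<close>)
  have pt: "a * q \<le> \<bar>dens v x\<bar> + (6 * L * (c3 * s) + 9 * (c3 * s))" if x: "x \<in> {1..2}" for x
  proof -
   have wx: "cmod (w x) \<le> 3 * (c3 * s)"
   proof -
    have "c3 * s * (1 + \<bar>x\<bar>) \<le> c3 * s * 3" using x c s0 by (intro mult_left_mono) auto
    then show ?thesis using wb[of x] by simp
   qed
   have Q: "0 \<le> kQ x" "kQ x \<le> 1" "q \<le> (kQ x)\<^sup>2"
    using x kQ_nonneg[of x] kQ_bounds[of x] kQ_mono[of 1 x] kQ1 by (auto simp: q_def intro!: power_mono)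
   have "v x = l * of_real (kQ x) + w x" by (simp add: w_def)
   define X where "X = Re (cnj (l * of_real (kQ x)) * w x)"
   have "(cmod (v x))\<^sup>2 = L\<^sup>2 * (kQ x)\<^sup>2 + 2 * X + (cmod (w x))\<^sup>2"
    unfolding L_def X_def \<open>v x = l * of_real (kQ x) + w x\<close> by (simp add: cmod_power2, simp add: power2_eq_square algebra_simps)
   then have eX: "(L\<^sup>2 - 1) * (kQ x)\<^sup>2 = dens v x - 2 * X - (cmod (w x))\<^sup>2"
    unfolding dens_def by (simp add: algebra_simps)
   have "a * (kQ x)\<^sup>2 = \<bar>dens v x - 2 * X - (cmod (w x))\<^sup>2\<bar>"
    unfolding eX[symmetric] abs_mult a_def by simp
   then have "a * (kQ x)\<^sup>2 \<le> \<bar>dens v x\<bar> + 2 * \<bar>X\<bar> + (cmod (w x))\<^sup>2"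
    using zero_le_power2[of "cmod (w x)"] by linarith
   moreover have "\<bar>X\<bar> \<le> L * (3 * (c3 * s))"
   proof -
    have "\<bar>X\<bar> \<le> cmod (cnj (l * of_real (kQ x)) * w x)" unfolding X_def by (rule abs_Re_le_cmod)
    also have "\<dots> = (L * \<bar>kQ x\<bar>) * cmod (w x)" by (simp add: norm_mult L_def)
    also have "\<dots> \<le> (L * 1) * (3 * (c3 * s))" using wx Q L0 by (intro mult_mono) auto
    finally show ?thesis by simp
   qed
   moreover have "(cmod (w x))\<^sup>2 \<le> 9 * (c3 * s)"
   proof -
    have "(cmod (w x))\<^sup>2 \<le> (3 * (c3 * s)) * (3 * (c3 * s))" unfolding power2_eq_square using wx c s0 by (intro mult_mono) auto
    also have "\<dots> \<le> (3 * (c3 * s)) * (3 * 1)" using c3s c s0 by (intro mult_left_mono) auto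
    finally show ?thesis by simp
   qed
   moreover have "a * q \<le> a * (kQ x)\<^sup>2" using Q by (intro mult_left_mono) (auto simp: a_def)
   ultimately show ?thesis by linarith
  qed
  have aq: "a * q \<le> 2 * s + (6 * L * (c3 * s) + 9 * (c3 * s))"
  proof -
   let ?K = "6 * L * (c3 * s) + 9 * (c3 * s)"
   have ic: "set_integrable lborel {1..2::real} (%x::real. k :: real)" for k
    unfolding set_integrable_def by (intro borel_integrable_compact) auto
   have il: "(LINT x:{1..2::real}|lborel. (k::real)) = k" for k by (simp add: set_lebesgue_integral_def)
   have id: "set_integrable lborel {1..2::real} (%x. norm (dens v x))" by (intro set_integrable_norm l2_set_integrable dens_l2)
   have "(LINT x:{1..2::real}|lborel. a * q) \<le> (LINT x:{1..2::real}|lborel. norm (dens v x) + ?K)"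
    by (rule set_integral_mono[OF ic set_integral_add(1)[OF id ic]]) (use pt in auto)
   also have "\<dots> = (LINT x:{1..2::real}|lborel. norm (dens v x)) + ?K" unfolding set_integral_add(2)[OF id ic] il ..
   also have "(LINT x:{1..2}|lborel. norm (dens v x)) \<le> 2 * s" using n2_set_CS[OF dens_l2, of 1 2] nd by simp
   finally show ?thesis unfolding il by simp
  qed
  have ab: "a \<le> c4 * s"
  proof -
   have "L * (c3 * s) \<le> (1 + a) * (c3 * s)" using La(2) c s0 by (intro mult_right_mono) auto
   then have "a * q \<le> 2 * s + 15 * (c3 * s) + 6 * (a * (c3 * s))" using aq by (simp add: distrib_right)
   moreover have "a * (12 * (c3 * s)) \<le> a * q"
   proof (rule mult_left_mono)
    have "12 * c3 / q * s \<le> 1" by (rule Cs) (use c c4 ckW in \<open>unfold C_def, linarith\<close>)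
    then show "12 * (c3 * s) \<le> q" using q by (simp add: field_simps)
   qed (simp add: a_def)
   moreover have "2 * s \<le> 2 * (c3 * s)" using c s0 mult_right_mono[of 1 c3 s] by simp
   ultimately have "a * q \<le> 34 * (c3 * s)" by linarith
   then show ?thesis using q by (simp add: c4_def field_simps)
  qed
  have L1: "\<bar>L - 1\<bar> \<le> c4 * s" using La(1) ab by linarith
  have "c4 * s < 1"
  proof (cases "s = 0")
   case False
   then have "c4 * s < C * s" using s0 c c4 c3q ckW by (intro mult_strict_right_mono) (auto simp: C_def)
   then show ?thesis using sC by linarith
  qed simp
  then have Lp: "0 < L" using L1 by linarith
  define u where "u = cnj l / of_real L"
  have u1: "cmod u = 1" using Lp by (simp add: u_def norm_divide L_def)
  have ul: "u * l = of_real L"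
  proof -
   have "u * l = of_real (L\<^sup>2) / of_real L" unfolding u_def L_def complex_norm_square by (simp add: mult.commute)
   then show ?thesis using Lp by (simp add: power2_eq_square)
  qed
  have A: "cmod (u * v x - of_real (kQ x)) \<le> C * s * (1 + \<bar>x\<bar>)" for x
  proof -
   have "u * v x - of_real (kQ x) = of_real ((L - 1) * kQ x) + u * w x"
    unfolding w_def right_diff_distrib mult.assoc[symmetric] ul by (simp add: algebra_simps)
   then have "cmod (u * v x - of_real (kQ x)) \<le> \<bar>L - 1\<bar> * \<bar>kQ x\<bar> + cmod (w x)"
 using norm_triangle_ineq[of "of_real ((L - 1) * kQ x)" "u * w x"] u1 by (simp only: norm_mult norm_of_real abs_mult mult_1 mult_1_right)
   also have "\<dots> \<le> (c4 * s) * 1 + c3 * s * (1 + \<bar>x\<bar>)"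
    using L1 wb[of x] kQ_bounds(1)[of x] by (intro add_mono mult_mono) auto
   also have "\<dots> \<le> (c4 * s) * (1 + \<bar>x\<bar>) + c3 * s * (1 + \<bar>x\<bar>)"
    using c4 s0 by (intro add_right_mono mult_left_mono) auto
   also have "\<dots> = (c4 + c3) * s * (1 + \<bar>x\<bar>)" by (simp add: algebra_simps)
   also have "\<dots> \<le> C * s * (1 + \<bar>x\<bar>)"
    using s0 c c3q ckW by (intro mult_right_mono) (auto simp: C_def)
   finally show ?thesis .
  qed
  have B: "n2 (%x. u * g x - of_real (kk x)) \<le> C * s"
  proof -
   have "(%x. u * g x - of_real (kk x)) = (%x. u * (g x - l * of_real (kk x)) + of_real (L - 1) * of_real (kk x))"
    unfolding right_diff_distrib mult.assoc[symmetric] ul by (simp add: fun_eq_iff algebra_simps)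
   then have "n2 (%x. u * g x - of_real (kk x)) \<le> n2 (%x. u * (g x - l * of_real (kk x))) + n2 (%x. complex_of_real (L - 1) * of_real (kk x))"
    using n2_triangle[OF l2_cmult(1)[OF wl, of u] l2_cmult(1)[OF l2_of_real[OF kk_l2(1)], of "of_real (L - 1)"]] by simp
   also have "\<dots> = n2 (%x. g x - l * of_real (kk x)) + \<bar>L - 1\<bar> * n2 kk"
    using l2_cmult(2)[OF wl, of u] l2_cmult(2)[OF l2_of_real[OF kk_l2(1)], of "of_real (L - 1)"] u1 by (simp only: n2_of_real norm_of_real mult_1)
   also have "\<dots> \<le> c1 * s + (c4 * s) * sqrt kW"
    using l L1 kk_l2(2) by (intro add_mono mult_mono) auto
   also have "\<dots> = (c1 + c4 * sqrt kW) * s" by (simp add: algebra_simps)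
   also have "\<dots> \<le> C * s" using s0 c c4 c3q by (intro mult_right_mono) (auto simp: C_def)
   finally show ?thesis .
  qed
  have "dens (%x. u * v x) = dens v" by (simp add: dens_def fun_eq_iff norm_mult u1)
  moreover have "2 * s \<le> C * s" using s0 c c4 c3q ckW by (intro mult_right_mono) (auto simp: C_def)
  ultimately have D: "n2 (dens (%x. u * v x)) \<le> C * s" using nd by simp
  show ?thesis using A B D u1 unfolding close_def s_def by blast
 qed
 then show ?thesis using C1 by blast
qed

section \<open>The renormalised momentum near the kink\<close>

lemma cmod_exp_i_minus_1: "cmod (exp (\<i> * complex_of_real b) - 1) \<le> \<bar>b\<bar>"
proof -
 have a: "ac (%t::real. t) (%t. 1)" by (rule ac_DERIV[OF DERIV_ident]) (rule continuous_on_const)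
 have e: "ac (%t. exp (\<i> * complex_of_real t)) (%t. exp (\<i> * complex_of_real t) * (\<i> * complex_of_real 1))"
  by (rule ac_exp[OF ac_cmult[OF ac_of_real[OF a]]])
 have *: "cmod (exp (\<i> * complex_of_real y) - exp (\<i> * complex_of_real x)) \<le> y - x" if "x \<le> y" for x y
 proof -
  have "cmod (exp (\<i> * complex_of_real y) - exp (\<i> * complex_of_real x)) \<le> (LINT t:{x..y}|lborel. cmod (exp (\<i> * complex_of_real t) * (\<i> * complex_of_real 1)))"
   by (rule ac_norm_le[OF e that])
  also have "\<dots> = (LINT t:{x..y}|lborel. (1::real))" by (simp add: norm_mult)
  also have "\<dots> = y - x" using that by (simp add: set_lebesgue_integral_def)
  finally show ?thesis .
 qed
 show ?thesis using *[of 0 b] *[of b 0] by (cases "0 \<le> b") (auto simp: norm_minus_commute)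
qed

lemma cnj_measurable [measurable]: "f \<in> borel_measurable M ==> (%x. cnj (f x)) \<in> borel_measurable M"
 by (rule measurable_compose[OF _ borel_measurable_continuous_onI[OF continuous_on_cnj[OF continuous_on_id]]])

text \<open>With F a primitive of z'/z, the product \<open>z x * exp (- F x)\<close> has derivative
  0. The imaginary part of F is the phase integral, so no continuous branch of the argument has to
  be chosen.\<close>

lemma phase_of_nonvanishing:
 fixes z z' :: "real => complex"
 assumes A: "ac z z'" and c: "0 < c" "\<And>x. c \<le> cmod (z x)" and ab: "a \<le> b"
 shows "exp (\<i> * of_real (LINT x:{a..b}|lborel. Im (cnj (z x) * z' x) / (cmod (z x))\<^sup>2)) * sgn (z a) = sgn (z b)"
proof -
 note [measurable] = ac_meas[OF A] ac_meas_deriv[OF A]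
 have nz: "z x \<noteq> 0" for x using c(2)[of x] c(1) by auto
 define f where "f x = z' x / z x" for x
 have fm [measurable]: "f \<in> borel_measurable borel" unfolding f_def by measurable
 have fs: "set_integrable lborel {p..q} f" for p q
 proof -
  have "set_integrable lborel {p..q} (%x. z' x * inverse (z x))"
   by (rule set_integrable_mult_cont[OF ac_set_integrable[OF A]]) (use nz ac_cont[OF A] in \<open>auto intro!: continuous_on_inverse\<close>)
  then show ?thesis by (simp add: f_def[abs_def] divide_inverse)
 qed
 obtain F where F: "ac F f" using ac_exists[OF fm fs] by blast
 have "ac (%x. z x * exp (- F x)) (%x. z' x * exp (- F x) + z x * (exp (- F x) * - f x))"
  by (intro ac_mult A ac_exp ac_minus F)
 moreover have "z' x * exp (- F x) + z x * (exp (- F x) * - f x) = 0" for x using nz[of x] by (simp add: f_def)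
 ultimately have "z b * exp (- F b) - z a * exp (- F a) = (LINT x:{a..b}|lborel. 0)" using ac_int[OF _ ab] by fastforce
 then have "z b * exp (- F b) = z a * exp (- F a)" by (simp add: set_lebesgue_integral_def)
 then have e: "z b = z a * exp (F b - F a)" by (simp add: exp_minus exp_diff field_simps)
 have "Im (F b - F a) = Im (LINT x:{a..b}|lborel. f x)" using ac_int[OF F ab] by simp
 also have "\<dots> = (LINT x:{a..b}|lborel. Im (f x))"
  using integral_Im[of lborel "%x. indicator {a..b} x *\<^sub>R f x"] fs[of a b] by (simp add: set_integrable_def set_lebesgue_integral_def)
 also have "\<dots> = (LINT x:{a..b}|lborel. Im (cnj (z x) * z' x) / (cmod (z x))\<^sup>2)"
  by (simp add: f_def Im_divide cmod_power2 mult.commute)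
 finally have i: "(LINT x:{a..b}|lborel. Im (cnj (z x) * z' x) / (cmod (z x))\<^sup>2) = Im (F b - F a)" by simp
 have "sgn (exp w) = exp (\<i> * of_real (Im w))" for w :: complex
 proof -
  have "exp w = of_real (exp (Re w)) * exp (\<i> * of_real (Im w))"
   by (metis complex_eq exp_add exp_of_real)
  moreover have "cmod (exp w) = exp (Re w)" by simp
  ultimately show ?thesis by (simp add: sgn_eq)
 qed
 then show ?thesis unfolding i e by (simp add: sgn_mult mult.commute)
qed

text \<open>The density defect and its derivative are in L2, so \<open>ac_l2_sup\<close> applies,
  but the derivative is bounded only in terms of the supremum B of |v|. The resulting inequality B^2
  \<le> 2 + B + s bounds B, and a second application with this bound makes the defect of order
  \<tau>.\<close>

lemma close_sup_bounds:
 "\<exists>c\<ge>1. \<forall>v g \<tau>. energy_fn_eta v g --> close \<tau> v g --> 0 \<le> \<tau> --> \<tau> \<le> 1 --> (\<forall>x. \<bar>dens v x\<bar> \<le> c * \<tau> \<and> cmod (v x) \<le> c)"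
proof -
 define s where "s = sqrt kW"
 have s0: "0 \<le> s" using kW_nonneg by (simp add: s_def)
 define K where "K = 3 + s"
 define c where "c = K + 2 * (K + s)"
 have "\<bar>dens v x\<bar> \<le> c * \<tau> \<and> cmod (v x) \<le> c" if L: "energy_fn_eta v g" and cl: "close \<tau> v g" and t: "0 \<le> \<tau>" "\<tau> \<le> 1" for v g \<tau> x
 proof -
  interpret energy_fn_eta v g by fact
  have cw: "cmod (v x - of_real (kQ x)) \<le> \<tau> * (1 + \<bar>x\<bar>)" for x using cl by (simp add: close_def)
  have gl: "l2 (%x. g x - of_real (kk x))" by (intro l2_diff g_l2 l2_of_real kk_l2)
  define d where "d x = 2 * (Re (cnj (v x) * (g x - of_real (kk x))) + kk x * Re (v x - of_real (kQ x)))" for x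
  have da: "ac (dens v) d"
  proof -
   have "ac (%x. Re (cnj (v x) * v x) - kQ x * kQ x) (%x. Re (cnj (g x) * v x + cnj (v x) * g x) - (kk x * kQ x + kQ x * kk x))"
    by (intro ac_diff ac_Re ac_mult ac_cnj v_ac kQ_ac)
   moreover have "Re (cnj (v x) * v x) - kQ x * kQ x = dens v x" for x
    unfolding dens_def cmod_power2 by (simp add: power2_eq_square)
   moreover have "Re (cnj (g x) * v x + cnj (v x) * g x) - (kk x * kQ x + kQ x * kk x) = d x" for x
    by (simp add: d_def algebra_simps)
   ultimately show ?thesis by simp
  qed
  have d1l: "l2 (%x. kk x * Re (v x - of_real (kQ x)))" and d1n: "n2 (%x. kk x * Re (v x - of_real (kQ x))) \<le> \<tau> * s"
  proof -
   have b: "norm (kk x * Re (v x - of_real (kQ x))) \<le> \<tau> * norm (kk x * (1 + \<bar>x\<bar>))" for x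
    using mult_left_mono[OF order_trans[OF abs_Re_le_cmod cw], of "kk x" x] kk_pos[of x] by (simp add: abs_mult less_imp_le mult_ac)
   show "l2 (%x. kk x * Re (v x - of_real (kQ x)))" by (rule l2_bound(1)[OF kk_wt_l2(1) _ b]) measurable
   have "n2 (%x. kk x * Re (v x - of_real (kQ x))) \<le> \<tau> * n2 (%x. kk x * (1 + \<bar>x\<bar>))"
    by (rule l2_bound(2)[OF kk_wt_l2(1) _ b t(1)]) measurable
   also have "\<dots> \<le> \<tau> * s" unfolding s_def using kk_wt_l2(2) t by (intro mult_left_mono)
   finally show "n2 (%x. kk x * Re (v x - of_real (kQ x))) \<le> \<tau> * s" .
  qed
  have r2: "(dens v x)\<^sup>2 \<le> 4 * (\<tau>\<^sup>2 * (B + s))" if B: "\<And>x. cmod (v x) \<le> B" for B x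
  proof -
   have B0: "0 \<le> B" using B[of 0] norm_ge_zero[of "v 0"] by linarith
   have cm: "(%x. cnj (v x)) \<in> borel_measurable borel" by (rule cnj_measurable[OF v_meas])
   have cB: "norm (cnj (v x)) \<le> B" for x using B[of x] by simp
   note p = l2_bdd_mult[OF gl cm cB]
   have pl: "l2 (%x. cnj (v x) * (g x - of_real (kk x)))" "n2 (%x. cnj (v x) * (g x - of_real (kk x))) \<le> B * \<tau>"
    using p(1) order_trans[OF p(2) mult_left_mono[of _ \<tau> B]] cl B0 by (auto simp: close_def)
   have dl: "l2 d" unfolding d_def[abs_def] by (intro l2_cmult(1) l2_add l2_Re(1) pl(1) d1l)
   have "n2 d = 2 * n2 (%x. Re (cnj (v x) * (g x - of_real (kk x))) + kk x * Re (v x - of_real (kQ x)))"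
    unfolding d_def[abs_def] using l2_cmult(2)[OF l2_add[OF l2_Re(1)[OF pl(1)] d1l], of 2] by simp
   also have "\<dots> \<le> 2 * (B * \<tau> + \<tau> * s)"
    using n2_triangle[OF l2_Re(1)[OF pl(1)] d1l] l2_Re(2)[OF pl(1)] pl(2) d1n by simp
   finally have dn: "n2 d \<le> 2 * (\<tau> * (B + s))" by (simp add: algebra_simps)
   have "(norm (dens v x))\<^sup>2 \<le> 2 * n2 (dens v) * n2 d" by (rule ac_l2_sup[OF da dens_l2 dl])
   also have "\<dots> \<le> 2 * \<tau> * (2 * (\<tau> * (B + s)))"
    using cl dn t by (intro mult_mono) (auto simp: close_def)
   finally show ?thesis by (simp add: power2_eq_square mult_ac)
  qed
  define B where "B = (SUP x. cmod (v x))"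
  have bdd: "bdd_above (range (%x. cmod (v x)))" using v_bdd by (auto simp: bdd_above_def)
  have vB: "cmod (v x) \<le> B" for x unfolding B_def by (rule cSUP_upper[OF _ bdd]) simp
  have B0: "0 \<le> B" using vB[of 0] norm_ge_zero[of "v 0"] by linarith
  have BK: "B \<le> K"
  proof (rule ccontr)
   assume n: "\<not> B \<le> K"
   have "(cmod (v x))\<^sup>2 \<le> 1 + (1 + B + s)" for x
   proof -
    have "(dens v x)\<^sup>2 \<le> 4 * (1 * (B + s))" using r2[OF vB, of x] mult_right_mono[of "\<tau>\<^sup>2" 1 "B + s"] t B0 s0 by (simp add: power_le_one)
    also have "\<dots> \<le> (1 + (B + s))\<^sup>2" using zero_le_power2[of "1 - (B + s)"] by (simp add: power2_diff power2_sum)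
    finally have "\<bar>dens v x\<bar> \<le> 1 + (B + s)" using B0 s0 by (simp add: abs_le_square_iff[symmetric])
    then show ?thesis using kQ_sq[of x] unfolding dens_def by linarith
   qed
   then have "(cmod (v x))\<^sup>2 \<le> 2 + B + s" for x by (simp add: add.assoc)
   then have "cmod (v x) \<le> sqrt (2 + B + s)" for x by (intro real_le_rsqrt)
   then have "B \<le> sqrt (2 + B + s)" unfolding B_def by (intro cSUP_least) auto
   then have "B\<^sup>2 \<le> 2 + B + s" using B0 s0 power_mono[of B "sqrt (2 + B + s)" 2] by simp
   moreover have "B * (3 + s) \<le> B * B" using n B0 unfolding K_def by (intro mult_left_mono) auto
   moreover have "1 * s \<le> B * s" using n s0 unfolding K_def by (intro mult_right_mono) auto
   ultimately show False using n s0 unfolding K_def by (simp add: power2_eq_square distrib_left)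
  qed
  have vK: "cmod (v x) \<le> K" for x using vB[of x] BK by linarith
  have "(dens v x)\<^sup>2 \<le> (2 * \<tau> * (K + s))\<^sup>2"
  proof -
   have "1 * (K + s) \<le> (K + s) * (K + s)" using s0 unfolding K_def by (intro mult_right_mono) auto
   then have "4 * \<tau>\<^sup>2 * (K + s) \<le> 4 * \<tau>\<^sup>2 * ((K + s) * (K + s))" by (intro mult_left_mono) auto
   moreover have "4 * \<tau>\<^sup>2 * ((K + s) * (K + s)) = (2 * \<tau> * (K + s))\<^sup>2" by (simp add: power2_eq_square)
   ultimately show ?thesis using r2[OF vK, of x] by (simp only: mult.assoc)
  qed
  then have "\<bar>dens v x\<bar> \<le> 2 * \<tau> * (K + s)" using t s0 by (intro abs_le_square_iff[THEN iffD2, of "dens v x" "2 * \<tau> * (K + s)", simplified abs_of_nonneg, THEN order_trans]) (auto simp: K_def)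
  also have "\<dots> \<le> c * \<tau>" using t s0 unfolding c_def K_def by (simp add: algebra_simps)
  finally show ?thesis using vK[of x] s0 unfolding c_def K_def by auto
 qed
 moreover have "1 \<le> c" using s0 by (simp add: c_def K_def)
 ultimately show ?thesis by blast
qed

text \<open>\<open>sgn z\<close> and z differ by at most ||z| - 1|, and for \<open>a\<close> this is
  traded for the same quantity of \<open>b\<close> plus |a - b|. The right side refers to the
  modulus of \<open>b\<close> alone, known to be near 1 where the estimate is used.\<close>

lemma sgn_diff_le:
 fixes a b :: complex
 shows "cmod (sgn a - sgn b) \<le> 2 * cmod (a - b) + 2 * \<bar>(cmod b)\<^sup>2 - 1\<bar>"
proof -
 have s: "cmod (sgn z - z) \<le> \<bar>cmod z - 1\<bar>" for z :: complex
 proof (cases "z = 0")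
  case False
  have "sgn z - z = sgn z * of_real (1 - cmod z)" using False by (simp add: sgn_eq right_diff_distrib)
  then have "cmod (sgn z - z) = cmod (sgn z) * \<bar>1 - cmod z\<bar>" by (simp only: norm_mult norm_of_real)
  then show ?thesis using False by (simp add: norm_sgn abs_minus_commute)
 qed simp
 have b: "\<bar>cmod b - 1\<bar> \<le> \<bar>(cmod b)\<^sup>2 - 1\<bar>" using real_quad_bound(1)[of "cmod b" "\<bar>(cmod b)\<^sup>2 - 1\<bar>"] by simp
 have "\<bar>cmod a - 1\<bar> \<le> cmod (a - b) + \<bar>cmod b - 1\<bar>" using norm_triangle_ineq3[of a b] by linarith
 moreover have "cmod (sgn a - sgn b) \<le> cmod (sgn a - a) + cmod (a - b) + cmod (sgn b - b)"
  using norm_triangle_ineq[of "sgn a - a" "a - sgn b"] norm_triangle_ineq[of "a - b" "b - sgn b"] norm_minus_commute[of b "sgn b"] by simp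
 ultimately have "cmod (sgn a - sgn b) \<le> (cmod (a - b) + \<bar>(cmod b)\<^sup>2 - 1\<bar>) + cmod (a - b) + \<bar>(cmod b)\<^sup>2 - 1\<bar>"
  using s[of a] s[of b] b by linarith
 then show ?thesis by simp
qed

lemma (in energy_fn_eta) eta_tendsto_0:
 "((%x. 1 - (cmod (v x))\<^sup>2) \<longlongrightarrow> 0) at_top" "((%x. 1 - (cmod (v x))\<^sup>2) \<longlongrightarrow> 0) at_bot"
proof -
 obtain c where vc: "\<And>x. cmod (v x) \<le> c" using v_bdd by blast
 have eta_ac: "ac (%x. 1 - (cmod (v x))\<^sup>2) (%x. 0 - Re (cnj (g x) * v x + cnj (v x) * g x))"
 proof -
  have "ac (%x. 1 - Re (cnj (v x) * v x)) (%x. 0 - Re (cnj (g x) * v x + cnj (v x) * g x))"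
   by (intro ac_diff ac_const ac_Re ac_mult ac_cnj v_ac)
  moreover have "Re (cnj (v x) * v x) = (cmod (v x))\<^sup>2" for x unfolding cmod_power2 by (simp add: power2_eq_square)
  ultimately show ?thesis by simp
 qed
 have eta'_l2: "l2 (%x. 0 - Re (cnj (g x) * v x + cnj (v x) * g x))"
 proof (rule l2_bound(1)[OF g_l2, where C = "2 * c"])
  show "(%x. 0 - Re (cnj (g x) * v x + cnj (v x) * g x)) \<in> borel_measurable borel" by measurable
  fix x
  have "\<bar>Re (cnj (g x) * v x + cnj (v x) * g x)\<bar> \<le> cmod (cnj (g x) * v x) + cmod (cnj (v x) * g x)"
   by (rule order_trans[OF abs_Re_le_cmod norm_triangle_ineq])
  also have "\<dots> = 2 * (cmod (v x) * cmod (g x))" by (simp only: norm_mult complex_mod_cnj) simp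
  also have "\<dots> \<le> 2 * (c * cmod (g x))" using vc[of x] by (intro mult_left_mono mult_right_mono) auto
  finally show "norm (0 - Re (cnj (g x) * v x + cnj (v x) * g x)) \<le> 2 * c * norm (g x)" by (simp only: diff_0 norm_minus_cancel real_norm_def mult.assoc)
 qed
 show "((%x. 1 - (cmod (v x))\<^sup>2) \<longlongrightarrow> 0) at_top" "((%x. 1 - (cmod (v x))\<^sup>2) \<longlongrightarrow> 0) at_bot"
  by (rule ac_l2_tendsto_0[OF eta_ac eta_l2 eta'_l2])+
qed

text \<open>Multiplying \<open>v\<close> by the kink and adding \<open>1 - kQ\<^sup>2\<close> removes the zero of \<open>v\<close> near the origin, so the phase of the product can be integrated over the whole line.\<close>

theorem renormalised_momentum:
 "\<exists>C\<ge>1. \<exists>\<tau>0>0. \<tau>0 \<le> 1 \<and> (\<forall>v g \<tau> X Y e. energy_fn_eta v g --> close \<tau> v g --> 0 \<le> \<tau> --> \<tau> \<le> \<tau>0 -->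
   filterlim X at_bot sequentially --> filterlim Y at_top sequentially --> 0 < e -->
   (\<forall>\<^sub>F n in sequentially. cmod (exp (\<i> * of_real (LINT x:{X n..Y n}|lborel. Im (cnj (v x) * g x))) * sgn (v (X n)) * cnj (sgn (v (Y n)))
     + exp (\<i> * of_real (- (2 * Im (energy_fn.mm v))))) \<le> C * \<tau>\<^sup>2 + e))"
proof -
 obtain c where c1: "1 \<le> c" and cb: "\<And>v g \<tau>. energy_fn_eta v g ==> close \<tau> v g ==> 0 \<le> \<tau> ==> \<tau> \<le> 1 ==> (\<forall>x. \<bar>dens v x\<bar> \<le> c * \<tau> \<and> cmod (v x) \<le> c)"
  using close_sup_bounds by blast
 define s where "s = sqrt kW"
 have s0: "0 \<le> s" using kW_nonneg by (simp add: s_def)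
 have r2: "sqrt 2 \<le> 2" "0 < sqrt 2" by (auto intro: real_le_lsqrt)
 define K1 where "K1 = 1 + 2 * (c + 1) * s"
 have K10: "0 \<le> K1" using s0 c1 by (simp add: K1_def)
 define C0 where "C0 = 2 * s + 2 * (c + 1) * ((1 + s) * K1)"
 have C00: "0 \<le> C0" using s0 c1 K10 by (simp add: C0_def)
 \<comment> \<open>Chosen to make |\<sigma>| at most 1 / 2, which keeps \<open>z\<close> away from
   0; 2048 is twice the constant of \<open>kk_weight\<close>.\<close>
 define \<tau>0 where "\<tau>0 = 1 / (2 * (c + 2048))"
 have t0: "0 < \<tau>0" "\<tau>0 \<le> 1" using c1 by (auto simp: \<tau>0_def field_simps)
 have main: "\<forall>\<^sub>F n in sequentially. cmod (exp (\<i> * of_real (LINT x:{X n..Y n}|lborel. Im (cnj (v x) * g x))) * sgn (v (X n)) * cnj (sgn (v (Y n)))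
     + exp (\<i> * of_real (- (2 * Im (energy_fn.mm v))))) \<le> (1 + C0) * \<tau>\<^sup>2 + e"
  if L: "energy_fn_eta v g" and cl: "close \<tau> v g" and t: "0 \<le> \<tau>" "\<tau> \<le> \<tau>0"
   and XY: "filterlim X at_bot sequentially" "filterlim Y at_top sequentially" and e: "0 < e" for v g \<tau> X Y e
 proof -
  interpret energy_fn_eta v g by fact
  have t1: "\<tau> \<le> 1" using t t0 by linarith
  have db: "\<bar>dens v x\<bar> \<le> c * \<tau>" and vc: "cmod (v x) \<le> c" for x using cb[OF L cl t(1) t1] by auto
  define w where "w x = v x - of_real (kQ x)" for x
  define h where "h x = g x - of_real (kk x)" for x
  have wm [measurable]: "w \<in> borel_measurable borel" unfolding w_def[abs_def] by measurable
  have wt: "cmod (w x) \<le> \<tau> * (1 + \<bar>x\<bar>)" for x using cl by (simp add: close_def w_def)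
  have wc: "cmod (w x) \<le> c + 1" for x
   using norm_triangle_ineq4[of "v x" "of_real (kQ x)"] vc[of x] kQ_bounds(1)[of x] by (simp add: w_def)
  have hl: "l2 h" unfolding h_def[abs_def] by (intro l2_diff g_l2 l2_of_real kk_l2)
  have hn: "n2 h \<le> \<tau>" using cl by (simp add: close_def h_def[abs_def])
  define z where "z x = of_real (kQ x) * v x + of_real (1 - kQ x * kQ x)" for x
  define z' where "z' x = (of_real (kk x) * v x + of_real (kQ x) * g x) + of_real (0 - (kk x * kQ x + kQ x * kk x))" for x
  have za: "ac z z'" unfolding z_def[abs_def] z'_def[abs_def]
   by (rule ac_add[OF ac_mult[OF ac_of_real[OF kQ_ac] v_ac] ac_of_real[OF ac_diff[OF ac_const ac_mult[OF kQ_ac kQ_ac]]]])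
  note [measurable] = ac_meas[OF za] ac_meas_deriv[OF za] l2_meas'[OF hl]
  have z'w: "z' x = of_real (kk x) * w x + of_real (kQ x) * h x" for x by (simp add: z'_def w_def h_def algebra_simps)
  \<comment> \<open>As z = 1 + Q w, its squared modulus is 1 + 2 Q Re w + Q^2 |w|^2. Written through
    \<open>dens\<close> the error is of order \<tau> in L2, although \<open>w\<close> itself may
    grow.\<close>
  define \<sigma> where "\<sigma> x = dens v x - (1 - (kQ x)\<^sup>2) * (cmod (w x))\<^sup>2" for x
  have zn: "(cmod (z x))\<^sup>2 = 1 + \<sigma> x" for x
   unfolding cmod_power2 \<sigma>_def dens_def z_def w_def by (simp add: power2_eq_square algebra_simps)
  have sb: "\<bar>\<sigma> x\<bar> \<le> 1 / 2" for x
  proof -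
   have "kk x * (cmod (w x))\<^sup>2 \<le> kk x * (\<tau> * (1 + \<bar>x\<bar>))\<^sup>2"
    using power_mono[OF wt[of x] norm_ge_zero, of 2] kk_pos[of x] by (intro mult_left_mono) auto
   also have "\<dots> = \<tau>\<^sup>2 * (kk x * (1 + \<bar>x\<bar>)\<^sup>2)" by (simp only: power_mult_distrib mult_ac)
   also have "\<dots> \<le> \<tau>\<^sup>2 * 1024"
   proof -
    have "inverse (1 + x\<^sup>2) \<le> 1" by (simp add: field_simps add_pos_nonneg)
    then show ?thesis using kk_weight[of x] by (intro mult_left_mono) auto
   qed
   also have "\<dots> \<le> \<tau> * 1024" using t t1 by (simp add: power2_eq_square mult_left_le)
   finally have a: "kk x * (cmod (w x))\<^sup>2 \<le> \<tau> * 1024" .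
   have "sqrt 2 * (kk x * (cmod (w x))\<^sup>2) \<le> 2 * (\<tau> * 1024)"
    by (rule mult_mono[OF r2(1) a]) (use kk_pos[of x] in auto)
   moreover have "0 \<le> sqrt 2 * (kk x * (cmod (w x))\<^sup>2)" using kk_pos[of x] by simp
   ultimately have "\<bar>\<sigma> x\<bar> \<le> c * \<tau> + 2 * (\<tau> * 1024)"
    using db[of x] unfolding \<sigma>_def kk_eq by (simp add: mult.assoc)
   also have "\<dots> = (c + 2048) * \<tau>" by (simp add: algebra_simps)
   also have "\<dots> \<le> (c + 2048) * \<tau>0" using t c1 by (intro mult_left_mono) auto
   also have "\<dots> = 1 / 2" using c1 by (simp add: \<tau>0_def)
   finally show ?thesis .
  qed
  have zl2: "1 / 2 \<le> (cmod (z x))\<^sup>2" for x using sb[of x] zn[of x] by linarith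
  have zl: "1 / 2 \<le> cmod (z x)" for x
   by (rule power2_le_imp_le) (use zl2[of x] in \<open>auto simp: power2_eq_square\<close>)
  have zu: "cmod (z x) \<le> c + 1" for x
  proof -
   have "cmod (z x) \<le> \<bar>kQ x\<bar> * cmod (v x) + \<bar>1 - kQ x * kQ x\<bar>"
    using norm_triangle_ineq[of "of_real (kQ x) * v x" "of_real (1 - kQ x * kQ x)"] unfolding z_def norm_mult norm_of_real .
   also have "\<dots> \<le> 1 * c + 1"
    using kQ_bounds(1)[of x] vc[of x] kQ_sq[of x] by (intro add_mono mult_mono) (auto simp: power2_eq_square abs_if)
   finally show ?thesis by simp
  qed
  have kwb: "norm (of_real (kk x) * w x) \<le> \<tau> * norm (kk x * (1 + \<bar>x\<bar>))" for x
   using mult_left_mono[OF wt[of x], of "kk x"] kk_pos[of x] by (simp add: norm_mult abs_mult mult_ac)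
  have kwl: "l2 (%x. of_real (kk x) * w x)" by (rule l2_bound(1)[OF kk_wt_l2(1) _ kwb]) measurable
  have kwn: "n2 (%x. of_real (kk x) * w x) \<le> \<tau> * s"
  proof -
   have "n2 (%x. of_real (kk x) * w x) \<le> \<tau> * n2 (%x. kk x * (1 + \<bar>x\<bar>))"
    by (rule l2_bound(2)[OF kk_wt_l2(1) _ kwb t(1)]) measurable
   also have "\<dots> \<le> \<tau> * s" unfolding s_def using kk_wt_l2(2) t by (intro mult_left_mono)
   finally show ?thesis .
  qed
  have Qb: "norm (complex_of_real (kQ x)) \<le> 1" for x using kQ_bounds(1)[of x] by simp
  have Qm: "(%x. complex_of_real (kQ x)) \<in> borel_measurable borel" by measurable
  note Qh = l2_bdd_mult[OF hl Qm Qb]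
  have z'l: "l2 z'" unfolding z'w[abs_def] by (intro l2_add kwl Qh)
  have z'n: "n2 z' \<le> \<tau> * (1 + s)"
   using n2_triangle[OF kwl Qh(1)] kwn Qh(2) hn unfolding z'w[abs_def, symmetric] by (simp add: algebra_simps)
  have qb: "norm ((1 - (kQ x)\<^sup>2) * (cmod (w x))\<^sup>2) \<le> (2 * (c + 1) * \<tau>) * norm (kk x * (1 + \<bar>x\<bar>))" for x
  proof -
   have "norm ((1 - (kQ x)\<^sup>2) * (cmod (w x))\<^sup>2) = sqrt 2 * (kk x * (cmod (w x) * cmod (w x)))"
    unfolding kk_eq using kk_pos[of x] by (simp add: abs_mult power2_eq_square)
   also have "\<dots> \<le> 2 * (kk x * ((c + 1) * (\<tau> * (1 + \<bar>x\<bar>))))"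
    using r2 kk_pos[of x] wc[of x] wt[of x] c1 by (intro mult_mono) auto
   also have "\<dots> = (2 * (c + 1) * \<tau>) * norm (kk x * (1 + \<bar>x\<bar>))" using kk_pos[of x] by (simp add: abs_mult algebra_simps)
   finally show ?thesis .
  qed
  have ct0: "0 \<le> 2 * (c + 1) * \<tau>" using c1 t by simp
  have ql: "l2 (%x. (1 - (kQ x)\<^sup>2) * (cmod (w x))\<^sup>2)" by (rule l2_bound(1)[OF kk_wt_l2(1) _ qb]) measurable
  have qn: "n2 (%x. (1 - (kQ x)\<^sup>2) * (cmod (w x))\<^sup>2) \<le> (2 * (c + 1) * \<tau>) * s"
  proof -
   have "n2 (%x. (1 - (kQ x)\<^sup>2) * (cmod (w x))\<^sup>2) \<le> (2 * (c + 1) * \<tau>) * n2 (%x. kk x * (1 + \<bar>x\<bar>))"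
    by (rule l2_bound(2)[OF kk_wt_l2(1) _ qb ct0]) measurable
   also have "\<dots> \<le> (2 * (c + 1) * \<tau>) * s" unfolding s_def using kk_wt_l2(2) ct0 by (intro mult_left_mono)
   finally show ?thesis .
  qed
  have sl: "l2 \<sigma>" unfolding \<sigma>_def[abs_def] by (intro l2_diff dens_l2 ql)
  have sn: "n2 \<sigma> \<le> K1 * \<tau>"
  proof -
   have "n2 \<sigma> \<le> n2 (dens v) + n2 (%x. (1 - (kQ x)\<^sup>2) * (cmod (w x))\<^sup>2)"
    unfolding \<sigma>_def[abs_def] by (rule n2_triangle_diff[OF dens_l2 ql])
   also have "\<dots> \<le> \<tau> + (2 * (c + 1) * \<tau>) * s" using cl qn unfolding close_def by linarith
   finally show ?thesis by (simp add: K1_def algebra_simps)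
  qed
  define P where "P x = Im (cnj (z x) * z' x)" for x
  define N where "N x = Im (cnj (w x) * h x)" for x
  \<comment> \<open>\<open>D\<close> collects the quadratic terms: the phase density of
    \<open>z\<close> is that of \<open>v\<close> plus \<open>kv\<close>, up to \<open>D\<close>. The
    integral of \<open>kv\<close> is 2 Im mm, which is where the moment meets the momentum.\<close>
  define D where "D x = (1 - (kQ x)\<^sup>2) * N x + P x * \<sigma> x / (cmod (z x))\<^sup>2" for x
  define kv where "kv x = 2 * (kk x * Im (v x))" for x
  have [measurable]: "\<sigma> \<in> borel_measurable borel" by (rule l2_meas'[OF sl])
  have Dm [measurable]: "D \<in> borel_measurable borel" unfolding D_def[abs_def] P_def N_def by measurable
  have nuP: "Im (cnj (v x) * g x) = P x - kv x + (1 - (kQ x)\<^sup>2) * N x" for x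
   unfolding P_def N_def kv_def z_def z'_def w_def h_def by (simp add: power2_eq_square algebra_simps)
  have eqP: "P x / (cmod (z x))\<^sup>2 = (Im (cnj (v x) * g x) + kv x) - D x" for x
  proof -
   have "P x / (cmod (z x))\<^sup>2 + P x * \<sigma> x / (cmod (z x))\<^sup>2 = P x * (cmod (z x))\<^sup>2 / (cmod (z x))\<^sup>2"
    unfolding zn by (simp add: add_divide_distrib distrib_left)
   also have "\<dots> = P x" using zl[of x] by auto
   finally show ?thesis unfolding nuP D_def by simp
  qed
  define R where "R x = 2 * (norm (of_real (kk x) * w x) * norm (h x)) + 2 * (c + 1) * (norm (z' x) * norm (\<sigma> x))" for x
  have Ri: "integrable lborel R" unfolding R_def[abs_def]
   by (intro Bochner_Integration.integrable_add integrable_mult_right l2_mult_norm kwl hl z'l sl)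
  have RI: "(LINT x|lborel. R x) \<le> C0 * \<tau>\<^sup>2"
  proof -
   have "(LINT x|lborel. R x) = 2 * (LINT x|lborel. norm (of_real (kk x) * w x) * norm (h x)) + 2 * (c + 1) * (LINT x|lborel. norm (z' x) * norm (\<sigma> x))"
    unfolding R_def[abs_def] using l2_mult_norm[OF kwl hl] l2_mult_norm[OF z'l sl] by simp
   also have "\<dots> \<le> 2 * ((\<tau> * s) * \<tau>) + 2 * (c + 1) * ((\<tau> * (1 + s)) * (K1 * \<tau>))"
   proof (intro add_mono mult_left_mono)
    show "(LINT x|lborel. norm (of_real (kk x) * w x) * norm (h x)) \<le> (\<tau> * s) * \<tau>"
     by (rule order_trans[OF n2_CS_norm[OF kwl hl] mult_mono[OF kwn hn]]) (use t s0 in auto)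
    show "(LINT x|lborel. norm (z' x) * norm (\<sigma> x)) \<le> (\<tau> * (1 + s)) * (K1 * \<tau>)"
     by (rule order_trans[OF n2_CS_norm[OF z'l sl] mult_mono[OF z'n sn]]) (use t s0 in auto)
   qed (use c1 in auto)
   also have "\<dots> = C0 * \<tau>\<^sup>2" by (simp add: C0_def power2_eq_square algebra_simps)
   finally show ?thesis .
  qed
  have DR: "\<bar>D x\<bar> \<le> R x" for x
  proof -
   have "\<bar>N x\<bar> \<le> cmod (w x) * cmod (h x)"
    unfolding N_def using abs_Im_le_cmod[of "cnj (w x) * h x"] unfolding norm_mult complex_mod_cnj .
   then have "sqrt 2 * kk x * \<bar>N x\<bar> \<le> 2 * kk x * (cmod (w x) * cmod (h x))"
    using r2 kk_pos[of x] by (intro mult_mono) auto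
   then have 1: "\<bar>(1 - (kQ x)\<^sup>2) * N x\<bar> \<le> 2 * (norm (of_real (kk x) * w x) * norm (h x))"
    unfolding kk_eq using kk_pos[of x] by (simp add: abs_mult norm_mult mult_ac)
   have p: "\<bar>P x\<bar> \<le> (c + 1) * cmod (z' x)"
    unfolding P_def using order_trans[OF abs_Im_le_cmod[of "cnj (z x) * z' x"]] mult_right_mono[OF zu[of x] norm_ge_zero[of "z' x"]]
    unfolding norm_mult complex_mod_cnj by blast
   have "\<bar>P x * \<sigma> x / (cmod (z x))\<^sup>2\<bar> = \<bar>P x\<bar> * \<bar>\<sigma> x\<bar> / (cmod (z x))\<^sup>2" by (simp add: abs_mult)
   also have "\<dots> \<le> ((c + 1) * cmod (z' x)) * \<bar>\<sigma> x\<bar> / (1 / 2)"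
    using p zl2[of x] c1 by (intro frac_le mult_right_mono) auto
   finally have 2: "\<bar>P x * \<sigma> x / (cmod (z x))\<^sup>2\<bar> \<le> 2 * (c + 1) * (norm (z' x) * norm (\<sigma> x))" by (simp add: algebra_simps)
   show ?thesis unfolding D_def R_def using 1 2 abs_triangle_ineq[of "(1 - (kQ x)\<^sup>2) * N x" "P x * \<sigma> x / (cmod (z x))\<^sup>2"] by linarith
  qed
  have Di: "integrable lborel D"
   by (rule Bochner_Integration.integrable_bound[OF Ri]) (use DR in \<open>auto intro!: AE_I2 intro: order_trans[OF DR abs_ge_self]\<close>)
  have si: "set_integrable lborel {a..b} f" if "integrable lborel f" for a b and f :: "real => real"
   unfolding set_integrable_def by (rule integrable_mult_indicator) (use that in auto)
  have kvi: "integrable lborel kv"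
   using integrable_Im[OF kk_v_integrable] unfolding kv_def[abs_def] by (intro integrable_mult_right) simp
  have kvI: "(LINT x|lborel. kv x) = 2 * Im mm"
   using integral_Im[OF kk_v_integrable] unfolding kv_def[abs_def] mm_def by simp
  have nul: "l2 (%x. Im (cnj (v x) * g x))"
  proof -
   have "l2 (%x. cnj (v x) * g x)" by (rule l2_bdd_mult(1)[OF g_l2, of _ c]) (use vc in auto)
   then show ?thesis by (rule l2_Im(1))
  qed
  have win: "cmod (exp (\<i> * of_real (LINT x:{a..b}|lborel. Im (cnj (v x) * g x))) * sgn (z a) * cnj (sgn (z b))
    - exp (\<i> * of_real (- (LINT x:{a..b}|lborel. kv x)))) \<le> C0 * \<tau>\<^sup>2" if ab: "a \<le> b" for a b
  proof -
   define NN where "NN = (LINT x:{a..b}|lborel. Im (cnj (v x) * g x))"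
   define PZ where "PZ = (LINT x:{a..b}|lborel. P x / (cmod (z x))\<^sup>2)"
   define J where "J = (LINT x:{a..b}|lborel. kv x)"
   define DD where "DD = (LINT x:{a..b}|lborel. D x)"
   note i1 = l2_set_integrable[OF nul, of a b] and i2 = si[OF kvi, of a b] and i3 = si[OF Di, of a b]
   have "PZ = NN + J - DD"
    unfolding PZ_def NN_def J_def DD_def eqP set_integral_diff(2)[OF set_integral_add(1)[OF i1 i2] i3] set_integral_add(2)[OF i1 i2] ..
   then have NNe: "NN = PZ + (DD - J)" by simp
   have ph: "exp (\<i> * of_real PZ) * sgn (z a) = sgn (z b)"
    unfolding PZ_def P_def by (rule phase_of_nonvanishing[OF za _ zl ab]) simp
   have "z b \<noteq> 0" using zl[of b] by auto
   then have "cmod (sgn (z b)) = 1" by (simp add: norm_sgn)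
   then have sb1: "sgn (z b) * cnj (sgn (z b)) = 1" using complex_norm_square[of "sgn (z b)"] by simp
   have "exp (\<i> * of_real NN) = exp (\<i> * of_real PZ) * exp (\<i> * of_real DD) * exp (\<i> * of_real (- J))"
    unfolding NNe exp_add[symmetric] by (simp add: algebra_simps)
   then have "exp (\<i> * of_real NN) * sgn (z a) * cnj (sgn (z b)) = (exp (\<i> * of_real PZ) * sgn (z a)) * cnj (sgn (z b)) * (exp (\<i> * of_real DD) * exp (\<i> * of_real (- J)))"
    by (simp only: mult_ac)
   also have "\<dots> = exp (\<i> * of_real DD) * exp (\<i> * of_real (- J))" unfolding ph sb1 by simp
   finally have "exp (\<i> * of_real NN) * sgn (z a) * cnj (sgn (z b)) - exp (\<i> * of_real (- J)) = (exp (\<i> * of_real DD) - 1) * exp (\<i> * of_real (- J))"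
    by (simp only: left_diff_distrib mult_1)
   then have "cmod (exp (\<i> * of_real NN) * sgn (z a) * cnj (sgn (z b)) - exp (\<i> * of_real (- J))) = cmod (exp (\<i> * of_real DD) - 1) * 1"
    by (simp only: norm_mult norm_exp_i_times)
   also have "\<dots> \<le> \<bar>DD\<bar>" using cmod_exp_i_minus_1[of DD] by simp
   also have "\<dots> \<le> (LINT x|lborel. R x)"
   proof -
    have "norm (LINT x|lborel. indicator {a..b} x *\<^sub>R D x) \<le> (LINT x|lborel. R x)"
    proof (rule Bochner_Integration.integral_norm_bound_integral[OF _ Ri])
     show "integrable lborel (%x. indicator {a..b} x *\<^sub>R D x)" using i3 unfolding set_integrable_def .
     show "norm (indicator {a..b} x *\<^sub>R D x) \<le> R x" for x
      using DR[of x] order_trans[OF abs_ge_zero DR[of x]] by (simp add: indicator_def)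
    qed
    then show ?thesis unfolding DD_def set_lebesgue_integral_def by simp
   qed
   also note RI
   finally show ?thesis unfolding NN_def J_def .
  qed
  note etlim = eta_tendsto_0
  have vsq: "\<bar>(cmod (v x))\<^sup>2 - 1\<bar> = \<bar>1 - (cmod (v x))\<^sup>2\<bar>" for x by simp
  \<comment> \<open>As Q tends to 1 on the right and to -1 on the left, \<open>sgn (z x)\<close>
    approaches \<open>sgn (v x)\<close> at the right end and its negative at the left end. This is
    the source of the plus sign in the statement.\<close>
  define f1 where "f1 x = 2 * (c * \<bar>kQ x - 1\<bar> + \<bar>1 - kQ x * kQ x\<bar>) + 2 * \<bar>1 - (cmod (v x))\<^sup>2\<bar>" for x
  define f2 where "f2 x = 2 * (c * \<bar>kQ x + 1\<bar> + \<bar>1 - kQ x * kQ x\<bar>) + 2 * \<bar>1 - (cmod (v x))\<^sup>2\<bar>" for x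
  have f1b: "cmod (sgn (z x) - sgn (v x)) \<le> f1 x" for x
  proof -
   have "z x - v x = of_real (kQ x - 1) * v x + of_real (1 - kQ x * kQ x)" by (simp add: z_def algebra_simps)
   then have "cmod (z x - v x) \<le> \<bar>kQ x - 1\<bar> * cmod (v x) + \<bar>1 - kQ x * kQ x\<bar>"
    using norm_triangle_ineq[of "of_real (kQ x - 1) * v x" "of_real (1 - kQ x * kQ x)"] by (simp only: norm_mult norm_of_real)
   moreover have "\<bar>kQ x - 1\<bar> * cmod (v x) \<le> c * \<bar>kQ x - 1\<bar>" using mult_left_mono[OF vc[of x], of "\<bar>kQ x - 1\<bar>"] by (simp add: mult.commute)
   ultimately have "cmod (z x - v x) \<le> c * \<bar>kQ x - 1\<bar> + \<bar>1 - kQ x * kQ x\<bar>" by linarith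
   then show ?thesis using sgn_diff_le[of "z x" "v x"] unfolding f1_def vsq by argo
  qed
  have f2b: "cmod (sgn (z x) + sgn (v x)) \<le> f2 x" for x
  proof -
   have "z x - (- v x) = of_real (kQ x + 1) * v x + of_real (1 - kQ x * kQ x)" by (simp add: z_def algebra_simps)
   then have "cmod (z x - (- v x)) \<le> \<bar>kQ x + 1\<bar> * cmod (v x) + \<bar>1 - kQ x * kQ x\<bar>"
    using norm_triangle_ineq[of "of_real (kQ x + 1) * v x" "of_real (1 - kQ x * kQ x)"] by (simp only: norm_mult norm_of_real)
   moreover have "\<bar>kQ x + 1\<bar> * cmod (v x) \<le> c * \<bar>kQ x + 1\<bar>" using mult_left_mono[OF vc[of x], of "\<bar>kQ x + 1\<bar>"] by (simp add: mult.commute)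
   ultimately have "cmod (z x - (- v x)) \<le> c * \<bar>kQ x + 1\<bar> + \<bar>1 - kQ x * kQ x\<bar>" by linarith
   then show ?thesis using sgn_diff_le[of "z x" "- v x"] unfolding f2_def norm_minus_cancel vsq by (simp add: sgn_minus)
  qed
  have "(f1 \<longlongrightarrow> 2 * (c * \<bar>1 - 1\<bar> + \<bar>1 - 1 * 1\<bar>) + 2 * \<bar>0\<bar>) at_top"
   unfolding f1_def[abs_def] by (intro tendsto_intros kQ_limits etlim)
  then have l1: "(f1 \<longlongrightarrow> 0) at_top" by simp
  have "(f2 \<longlongrightarrow> 2 * (c * \<bar>-1 + 1\<bar> + \<bar>1 - (-1) * (-1)\<bar>) + 2 * \<bar>0\<bar>) at_bot"
   unfolding f2_def[abs_def] by (intro tendsto_intros kQ_limits etlim)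
  then have l2': "(f2 \<longlongrightarrow> 0) at_bot" by simp
  have l3: "(%n. LINT x:{X n..Y n}|lborel. kv x) \<longlonglongrightarrow> 2 * Im mm"
   using integrable_tendsto_window[OF kvi XY] unfolding kvI .
  have l4: "(%n. exp (\<i> * of_real (- (LINT x:{X n..Y n}|lborel. kv x))) - exp (\<i> * of_real (- (2 * Im mm)))) \<longlonglongrightarrow> 0"
   by (rule LIM_zero) (intro tendsto_intros l3)
  have "(%n. f2 (X n) + f1 (Y n) + cmod (exp (\<i> * of_real (- (LINT x:{X n..Y n}|lborel. kv x))) - exp (\<i> * of_real (- (2 * Im mm))))) \<longlonglongrightarrow> 0 + 0 + 0"
   by (intro tendsto_add filterlim_compose[OF l2' XY(1)] filterlim_compose[OF l1 XY(2)] tendsto_norm_zero l4)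
  then have ev1: "\<forall>\<^sub>F n in sequentially. f2 (X n) + f1 (Y n) + cmod (exp (\<i> * of_real (- (LINT x:{X n..Y n}|lborel. kv x))) - exp (\<i> * of_real (- (2 * Im mm)))) < e"
   using order_tendstoD(2)[OF _ e] by simp
  have ev2: "\<forall>\<^sub>F n in sequentially. X n \<le> 0" using XY(1) by (simp add: filterlim_at_bot)
  have ev3: "\<forall>\<^sub>F n in sequentially. 0 \<le> Y n" using XY(2) by (simp add: filterlim_at_top)
  from ev1 ev2 ev3 show ?thesis
  proof eventually_elim
   case (elim n)
   define T where "T = exp (\<i> * of_real (LINT x:{X n..Y n}|lborel. Im (cnj (v x) * g x)))"
   define a where "a = sgn (z (X n))"
   define b where "b = sgn (z (Y n))"
   define a' where "a' = sgn (v (X n))"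
   define b' where "b' = sgn (v (Y n))"
   define E where "E = exp (\<i> * of_real (- (LINT x:{X n..Y n}|lborel. kv x)))"
   define F where "F = exp (\<i> * of_real (- (2 * Im mm)))"
   have T1: "cmod T = 1" unfolding T_def by (rule norm_exp_i_times)
   have n1: "cmod a \<le> 1" "cmod b' \<le> 1" unfolding a_def b'_def by (auto simp: norm_sgn)
   have "T * a' * cnj b' + F = T * (a + a') * cnj b' + T * a * cnj (b - b') - (T * a * cnj b - E) - (E - F)"
    by (simp add: algebra_simps)
   note eq = this
   have "cmod (T * a' * cnj b' + F) \<le> cmod (T * (a + a') * cnj b') + cmod (T * a * cnj (b - b')) + cmod (T * a * cnj b - E) + cmod (E - F)"
    using norm_triangle_ineq4[of "T * (a + a') * cnj b' + T * a * cnj (b - b') - (T * a * cnj b - E)" "E - F"]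
     norm_triangle_ineq4[of "T * (a + a') * cnj b' + T * a * cnj (b - b')" "T * a * cnj b - E"]
     norm_triangle_ineq[of "T * (a + a') * cnj b'" "T * a * cnj (b - b')"] unfolding eq by linarith
   also have "cmod (T * (a + a') * cnj b') \<le> f2 (X n)"
   proof -
    have "cmod (T * (a + a') * cnj b') = cmod (a + a') * cmod b'" by (simp only: norm_mult T1 complex_mod_cnj mult_1)
    also have "\<dots> \<le> cmod (a + a')" using n1 by (simp add: mult_left_le)
    finally show ?thesis using f2b[of "X n"] unfolding a_def a'_def by linarith
   qed
   also have "cmod (T * a * cnj (b - b')) \<le> f1 (Y n)"
   proof -
    have "cmod (T * a * cnj (b - b')) = cmod a * cmod (b - b')" by (simp only: norm_mult T1 complex_mod_cnj mult_1)
    also have "\<dots> \<le> cmod (b - b')" using n1 by (simp add: mult_left_le_one_le)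
    finally show ?thesis using f1b[of "Y n"] unfolding b_def b'_def by linarith
   qed
   also have "cmod (T * a * cnj b - E) \<le> C0 * \<tau>\<^sup>2"
    using win[of "X n" "Y n"] elim(2,3) unfolding T_def a_def b_def E_def by simp
   finally have "cmod (T * a' * cnj b' + F) \<le> C0 * \<tau>\<^sup>2 + e"
    using elim(1) unfolding E_def F_def by linarith
   also have "\<dots> \<le> (1 + C0) * \<tau>\<^sup>2 + e" by (simp add: distrib_right)
   finally show ?case unfolding T_def a'_def b'_def F_def .
  qed
 qed
 show ?thesis
  by (intro exI[of _ "1 + C0"] conjI exI[of _ \<tau>0] allI impI main t0) (use C00 in auto)
qed

section \<open>Locating the kink by its moment\<close>

lemma kk_bdd_int:
 fixes f :: "real => 'a::{real_normed_field,euclidean_space}"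
 assumes "f \<in> borel_measurable borel" "\<And>x. norm (f x) \<le> C"
 shows "integrable lborel (%x. kk x *\<^sub>R f x)"
proof (rule kk_times_integrable(1)[OF assms(1)])
 fix x
 have "0 \<le> C" using norm_ge_zero[of "f 0"] assms(2)[of 0] by linarith
 then have "C * 1 \<le> C * (1 + \<bar>x\<bar>)\<^sup>2" by (intro mult_left_mono one_le_power) auto
 then show "norm (f x) \<le> C * (1 + \<bar>x\<bar>)\<^sup>2" using assms(2)[of x] by linarith
qed

lemma kQ_add: "kQ (x + y) = (kQ x + kQ y) / (1 + kQ x * kQ y)"
 by (simp add: kQ_def add_divide_distrib tanh_add)

lemma kQ_symmetric_sum: "kQ (x + z) + kQ (- x + z) = 2 * (kQ z * ((1 - (kQ x)\<^sup>2) / (1 - (kQ x)\<^sup>2 * (kQ z)\<^sup>2)))"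
proof -
 define p q where "p = kQ x" and "q = kQ z"
 have "\<bar>p * q\<bar> < 1" using abs_mult_less[OF kQ_bounds(1)[of x] kQ_bounds(1)[of z]] by (simp add: p_def q_def abs_mult)
 then have nz: "1 + p * q \<noteq> 0" "1 + (- p) * q \<noteq> 0" by auto
 have f: "1 - p\<^sup>2 * q\<^sup>2 = (1 + p * q) * (1 + (- p) * q)" by (simp add: power2_eq_square algebra_simps)
 have n: "(p + q) * (1 + (- p) * q) + (- p + q) * (1 + p * q) = 2 * (q * (1 - p\<^sup>2))" by (simp add: power2_eq_square algebra_simps)
 have "(p + q) / (1 + p * q) + (- p + q) / (1 + (- p) * q) = 2 * (q * ((1 - p\<^sup>2) / (1 - p\<^sup>2 * q\<^sup>2)))"
  unfolding add_frac_eq[OF nz] f n by simp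
 then show ?thesis unfolding kQ_add kQ_minus p_def q_def .
qed

text \<open>The moment of the unperturbed kink at position z. It serves as a substitute for
  \<open>kQ z\<close>, being that number times a factor between \<kappa>0 and 2.\<close>

definition J0 :: "real => real" where "J0 z = (LINT x|lborel. kk x * kQ (x + z))"

definition \<kappa>0 :: real where "\<kappa>0 = sqrt 2 * (n2 kk)\<^sup>2"

lemma kk_times_one_minus_kQ_sq: "integrable lborel (%x. kk x * (1 - (kQ x)\<^sup>2))" "(LINT x|lborel. kk x * (1 - (kQ x)\<^sup>2)) = \<kappa>0"
proof -
 have e: "kk x * (1 - (kQ x)\<^sup>2) = sqrt 2 * (norm (kk x))\<^sup>2" for x unfolding kk_eq by (simp add: power2_eq_square)
 show "integrable lborel (%x. kk x * (1 - (kQ x)\<^sup>2))" unfolding e by (intro integrable_mult_right l2_int kk_l2)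
 show "(LINT x|lborel. kk x * (1 - (kQ x)\<^sup>2)) = \<kappa>0" unfolding e \<kappa>0_def n2_sq by simp
qed

text \<open>If the norm vanished, the integrals of kk Q^2 and of kk (1 - Q^2) would both be 0, yet
  they add up to 2.\<close>

lemma \<kappa>0_pos: "0 < \<kappa>0"
proof (rule ccontr)
 assume "\<not> 0 < \<kappa>0"
 then have "\<not> 0 < (n2 kk)\<^sup>2" by (simp only: \<kappa>0_def zero_less_mult_iff) simp
 then have n: "n2 kk = 0" by simp
 have i: "integrable lborel (%x. kk x * (kQ x)\<^sup>2)"
  using kk_bdd_int[of "%x. (kQ x)\<^sup>2" 1] less_imp_le[OF kQ_sq] by simp
 have "(LINT x|lborel. kk x * (kQ x)\<^sup>2) = 0" using kk_kQ_identity n by simp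
 moreover have "(LINT x|lborel. kk x * (1 - (kQ x)\<^sup>2)) = 0" using kk_times_one_minus_kQ_sq(2) n by (simp add: \<kappa>0_def)
 moreover have "(LINT x|lborel. kk x * (kQ x)\<^sup>2 + kk x * (1 - (kQ x)\<^sup>2)) = (LINT x|lborel. kk x * (kQ x)\<^sup>2) + (LINT x|lborel. kk x * (1 - (kQ x)\<^sup>2))"
  by (rule Bochner_Integration.integral_add[OF i kk_times_one_minus_kQ_sq(1)])
 moreover have "kk x * (kQ x)\<^sup>2 + kk x * (1 - (kQ x)\<^sup>2) = kk x" for x by (simp add: algebra_simps)
 ultimately show False using kk_integral by simp
qed

text \<open>Averaging over x and -x and using the addition formula of tanh pulls out
  \<open>kQ z\<close>; the remaining factor \<open>t\<close> lies between 1 - Q^2 and 1.\<close>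

lemma J0_bounds: obtains I where "\<kappa>0 \<le> I" "I \<le> 2" "J0 z = I * kQ z"
proof -
 define q where "q = (kQ z)\<^sup>2"
 have q: "0 \<le> q" "q \<le> 1" using kQ_sq[of z] by (auto simp: q_def)
 define t where "t x = (1 - (kQ x)\<^sup>2) / (1 - (kQ x)\<^sup>2 * q)" for x
 have tb: "1 - (kQ x)\<^sup>2 \<le> t x" "t x \<le> 1" "0 \<le> t x" for x
 proof -
  have p: "0 \<le> (kQ x)\<^sup>2" "(kQ x)\<^sup>2 < 1" using kQ_sq[of x] by auto
  have pq: "(kQ x)\<^sup>2 * q \<le> (kQ x)\<^sup>2" "0 \<le> (kQ x)\<^sup>2 * q" using q p by (auto simp: mult_left_le)
  have d: "0 < 1 - (kQ x)\<^sup>2 * q" using pq p by linarith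
  show "t x \<le> 1" "0 \<le> t x" unfolding t_def using d pq p by (auto simp: divide_le_eq_1)
  have "(1 - (kQ x)\<^sup>2) * (1 - (kQ x)\<^sup>2 * q) \<le> 1 - (kQ x)\<^sup>2" using p pq by (intro mult_left_le) auto
  then show "1 - (kQ x)\<^sup>2 \<le> t x" unfolding t_def using d by (simp add: pos_le_divide_eq)
 qed
 have tm: "t \<in> borel_measurable borel" unfolding t_def[abs_def] by measurable
 have ti: "integrable lborel (%x. kk x * t x)"
  using kk_bdd_int[OF tm, of 1] tb(2,3) by simp
 define I where "I = (LINT x|lborel. kk x * t x)"
 have i1: "integrable lborel (%x. kk x * kQ (x + z))"
  using kk_bdd_int[of "%x. kQ (x + z)" 1] less_imp_le[OF kQ_bounds(1)] by simp
 have i2: "integrable lborel (%x. kk x * kQ (- x + z))"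
  using kk_bdd_int[of "%x. kQ (- x + z)" 1] less_imp_le[OF kQ_bounds(1)] by simp
 have "J0 z = (LINT x|lborel. kk x * kQ (- x + z))"
  using lborel_integral_real_affine[of "-1" "%x. kk x * kQ (x + z)" 0] by (simp add: J0_def kk_minus)
 then have "2 * J0 z = (LINT x|lborel. kk x * kQ (x + z)) + (LINT x|lborel. kk x * kQ (- x + z))" by (simp add: J0_def)
 also have "\<dots> = (LINT x|lborel. kk x * kQ (x + z) + kk x * kQ (- x + z))" by (rule Bochner_Integration.integral_add[OF i1 i2, symmetric])
 also have "\<dots> = (LINT x|lborel. (2 * kQ z) * (kk x * t x))"
  by (rule Bochner_Integration.integral_cong[OF refl]) (simp only: distrib_left[symmetric] kQ_symmetric_sum t_def q_def mult_ac)
 also have "\<dots> = (2 * kQ z) * I" unfolding I_def by (rule integral_mult_right_zero)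
 finally have "J0 z = I * kQ z" by simp
 moreover have "\<kappa>0 \<le> I" unfolding I_def kk_times_one_minus_kQ_sq(2)[symmetric]
  by (rule integral_mono[OF kk_times_one_minus_kQ_sq(1) ti]) (use tb(1) kk_pos in \<open>simp add: less_imp_le mult_left_mono\<close>)
 moreover have "I \<le> 2" unfolding I_def kk_integral[symmetric]
  by (rule integral_mono[OF ti kk_integrable]) (use tb(2) kk_pos in \<open>simp add: less_imp_le mult_left_le\<close>)
 ultimately show ?thesis using that by blast
qed

lemma kQ_lower: assumes "0 \<le> z" "z \<le> 1" shows "kk 1 * z \<le> kQ z"
proof -
 have "kQ 0 - kk 1 * 0 \<le> kQ z - kk 1 * z"
 proof (rule DERIV_nonneg_imp_nondecreasing[of 0 z "%x. kQ x - kk 1 * x", OF assms(1)])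
  fix x assume x: "0 \<le> x" "x \<le> z"
  have "((%x. kQ x - kk 1 * x) has_real_derivative kk x - kk 1 * 1) (at x)"
   by (intro DERIV_diff DERIV_cmult kQ_DERIV DERIV_ident)
  moreover have "0 \<le> kk x - kk 1 * 1" using kk_antimono[of x 1] x assms by simp
  ultimately show "\<exists>y. ((%x. kQ x - kk 1 * x) has_real_derivative y) (at x) \<and> 0 \<le> y" by blast
 qed
 then show ?thesis by (simp add: kQ_0)
qed

lemma kQ_upper: assumes "0 \<le> z" shows "kQ z \<le> z"
proof -
 have "0 - kQ 0 \<le> z - kQ z"
 proof (rule DERIV_nonneg_imp_nondecreasing[of 0 z "%x. x - kQ x", OF assms(1)])
  fix x assume x: "0 \<le> x" "x \<le> z"
  have "((%x. x - kQ x) has_real_derivative 1 - kk x) (at x)" by (intro DERIV_diff kQ_DERIV DERIV_ident)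
  then show "\<exists>y. ((%x. x - kQ x) has_real_derivative y) (at x) \<and> 0 \<le> y" using kk_le_1[of x] by auto
 qed
 then show ?thesis by (simp add: kQ_0)
qed

text \<open>The moment vanishes at the centre of a rotated kink, and near such a kink its modulus controls the distance to the centre.\<close>

definition moment :: "(real => complex) => real => complex" where
 "moment v z = (LINT x|lborel. kk x *\<^sub>R v (x + z))"

context energy_fn_eta
begin

lemma moment_0: "moment v 0 = mm" by (simp add: moment_def mm_def)

lemma moment_minus_J0:
 "integrable lborel (%x. kk x *\<^sub>R (v (x + z) - of_real (kQ (x + z))))"
 "(LINT x|lborel. kk x *\<^sub>R (v (x + z) - of_real (kQ (x + z)))) = moment v z - of_real (J0 z)"
proof -
 obtain B where B: "1 \<le> B" "\<And>x. cmod (v x) \<le> B" using v_bound by blast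
 have i1: "integrable lborel (%x. kk x *\<^sub>R v (x + z))" by (rule kk_bdd_int[OF _ B(2)]) measurable
 have i2: "integrable lborel (%x. kk x *\<^sub>R complex_of_real (kQ (x + z)))"
  by (rule kk_bdd_int[where C = 1]) (use kQ_bounds(1) less_imp_le in auto)
 show "integrable lborel (%x. kk x *\<^sub>R (v (x + z) - of_real (kQ (x + z))))"
  unfolding scaleR_diff_right by (rule Bochner_Integration.integrable_diff[OF i1 i2])
 have "(LINT x|lborel. kk x *\<^sub>R complex_of_real (kQ (x + z))) = (LINT x|lborel. complex_of_real (kk x * kQ (x + z)))"
  by (rule Bochner_Integration.integral_cong[OF refl]) (simp add: scaleR_conv_of_real)
 also have "\<dots> = of_real (J0 z)" unfolding J0_def by (rule integral_complex_of_real)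
 finally show "(LINT x|lborel. kk x *\<^sub>R (v (x + z) - of_real (kQ (x + z)))) = moment v z - of_real (J0 z)"
  unfolding scaleR_diff_right Bochner_Integration.integral_diff[OF i1 i2] moment_def by simp
qed

text \<open>The error is the weighted integral of a translation difference of v - Q, which is
  O(\<tau> |z|) in L2. The factor |z| matters: as z tends to 0 the error stays comparable with the
  first-order change \<open>J0 z\<close>, with a small coefficient.\<close>

lemma moment_kink_diff:
 assumes cl: "close \<tau> v g"
 shows "cmod (moment v z - moment v 0 - of_real (J0 z)) \<le> sqrt kW * \<tau> * \<bar>z\<bar>"
proof -
 define w where "w x = v x - of_real (kQ x)" for x
 have wa: "ac w (%x. g x - of_real (kk x))" unfolding w_def[abs_def] by (intro ac_diff v_ac ac_of_real kQ_ac)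
 have hl: "l2 (%x. g x - of_real (kk x))" by (intro l2_diff g_l2 l2_of_real kk_l2)
 have t: "n2 (%x. g x - of_real (kk x)) \<le> \<tau>" using cl by (simp add: close_def)
 note d = l2_translation_le[OF wa hl, of z]
 have j: "J0 0 = 0" by (simp add: J0_def kk_kQ_integral)
 note m = moment_minus_J0
 have "moment v z - moment v 0 - of_real (J0 z) = (moment v z - of_real (J0 z)) - (moment v 0 - of_real (J0 0))" by (simp add: j)
 also have "\<dots> = (LINT x|lborel. kk x *\<^sub>R (v (x + z) - of_real (kQ (x + z))) - kk x *\<^sub>R (v (x + 0) - of_real (kQ (x + 0))))"
  unfolding m(2)[symmetric] by (rule Bochner_Integration.integral_diff[OF m(1) m(1), symmetric])
 also have "\<dots> = (LINT x|lborel. complex_of_real (kk x) * (w (x + z) - w x))"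
  by (rule Bochner_Integration.integral_cong[OF refl]) (simp add: w_def scaleR_conv_of_real algebra_simps)
 finally have "cmod (moment v z - moment v 0 - of_real (J0 z)) = cmod (LINT x|lborel. complex_of_real (kk x) * (w (x + z) - w x))" by simp
 also have "\<dots> \<le> n2 kk * n2 (%x. w (x + z) - w x)"
  using n2_CS[OF l2_of_real[OF kk_l2(1)] d(1)] by (simp add: n2_of_real)
 also have "\<dots> \<le> sqrt kW * (\<bar>z\<bar> * \<tau>)"
  using kk_l2(2) order_trans[OF d(2) mult_left_mono[OF t]] kW_nonneg by (intro mult_mono) auto
 finally show ?thesis by (simp add: mult_ac)
qed

text \<open>Comparing with the translates by \<open>z\<close> and \<open>- z\<close> as \<open>z\<close> tends to 0 turns minimality into a first-order condition.\<close>

lemma Re_moment_at_minimum: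
 assumes cl: "close \<tau> v g" and t: "0 \<le> \<tau>" and min: "\<And>z. cmod (moment v 0) \<le> cmod (moment v z)"
 shows "(\<kappa>0 * kk 1) * \<bar>Re (moment v 0)\<bar> \<le> sqrt kW * \<tau> * cmod (moment v 0)"
proof (rule field_le_epsilon)
 fix e :: real assume e: "0 < e"
 define m where "m = moment v 0"
 define s where "s = sqrt kW * \<tau>"
 have s0: "0 \<le> s" using kW_nonneg t by (simp add: s_def)
 define L where "L = (2 + s)\<^sup>2"
 have L: "0 < L" using s0 by (simp add: L_def zero_less_power)
 define z where "z = min 1 (e / L)"
 have z: "0 < z" "z \<le> 1" "L * z \<le> e" using e L by (auto simp: z_def min_def field_simps)
 \<comment> \<open>A step against the sign of Re m, so that to first order \<open>J0 \<zeta>\<close>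
   lowers the modulus of m. Its length makes the second-order term L z^2 at most e z.\<close>
 define \<zeta> where "\<zeta> = (if 0 \<le> Re m then - z else z)"
 have az: "\<bar>\<zeta>\<bar> = z" using z by (simp add: \<zeta>_def)
 obtain I where I: "\<kappa>0 \<le> I" "I \<le> 2" "J0 \<zeta> = I * kQ \<zeta>" by (rule J0_bounds)
 have I0: "0 \<le> I" using I \<kappa>0_pos by linarith
 have Jl: "(\<kappa>0 * kk 1) * z \<le> I * kQ z"
  using mult_mono[OF I(1) kQ_lower[of z]] I0 z kk_pos[of 1] by (simp add: mult.assoc)
 have Ju: "I * kQ z \<le> 2 * z" using mult_mono[OF I(2) kQ_upper[of z]] kQ_nonneg[of z] z by simp
 have J: "J0 \<zeta> * Re m = - (I * kQ z * \<bar>Re m\<bar>)" unfolding I(3) by (simp add: \<zeta>_def kQ_minus)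
 have Ja: "\<bar>J0 \<zeta>\<bar> = I * kQ z" unfolding I(3) using I0 kQ_nonneg[of z] z by (simp add: \<zeta>_def kQ_minus abs_mult)
 define d where "d = moment v \<zeta> - m - of_real (J0 \<zeta>)"
 have db: "cmod d \<le> s * z" using moment_kink_diff[OF cl, of \<zeta>] unfolding az d_def m_def s_def .
 define \<Delta> where "\<Delta> = moment v \<zeta> - m"
 have "cmod \<Delta> \<le> \<bar>J0 \<zeta>\<bar> + cmod d" using norm_triangle_ineq[of "of_real (J0 \<zeta>)" d] by (simp add: \<Delta>_def d_def)
 then have "cmod \<Delta> \<le> (2 + s) * z" using Ja Ju db by (simp add: distrib_right)
 then have D2: "(cmod \<Delta>)\<^sup>2 \<le> L * z * z" using power_mono[of "cmod \<Delta>" "(2 + s) * z" 2] by (simp add: L_def power2_eq_square mult_ac)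
 have "(cmod m)\<^sup>2 \<le> (cmod (m + \<Delta>))\<^sup>2" using min[of \<zeta>] by (simp add: m_def \<Delta>_def)
 also have "\<dots> = (cmod m)\<^sup>2 + 2 * Re (cnj m * \<Delta>) + (cmod \<Delta>)\<^sup>2"
  unfolding cmod_power2 by (simp add: power2_eq_square algebra_simps)
 finally have 1: "0 \<le> 2 * Re (cnj m * \<Delta>) + (cmod \<Delta>)\<^sup>2" by simp
 have "Re (cnj m * \<Delta>) = J0 \<zeta> * Re m + Re (cnj m * d)" by (simp add: \<Delta>_def d_def algebra_simps)
 moreover have "Re (cnj m * d) \<le> cmod m * cmod d" using complex_Re_le_cmod[of "cnj m * d"] unfolding norm_mult complex_mod_cnj .
 moreover have "cmod m * cmod d \<le> cmod m * (s * z)" using db by (intro mult_left_mono) auto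
 ultimately have "2 * (I * kQ z * \<bar>Re m\<bar>) \<le> 2 * (cmod m * (s * z)) + L * z * z" using 1 D2 J by linarith
 moreover have "(\<kappa>0 * kk 1) * z * \<bar>Re m\<bar> \<le> I * kQ z * \<bar>Re m\<bar>" using Jl by (intro mult_right_mono) auto
 moreover have "0 \<le> L * z * z" using L z by simp
 ultimately have "(\<kappa>0 * kk 1) * z * \<bar>Re m\<bar> \<le> cmod m * (s * z) + L * z * z" by linarith
 then have "((\<kappa>0 * kk 1) * \<bar>Re m\<bar>) * z \<le> (s * cmod m + L * z) * z" by (simp add: algebra_simps)
 then have "(\<kappa>0 * kk 1) * \<bar>Re m\<bar> \<le> s * cmod m + L * z" using z by simp
 then show "(\<kappa>0 * kk 1) * \<bar>Re (moment v 0)\<bar> \<le> sqrt kW * \<tau> * cmod (moment v 0) + e"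
  using z(3) unfolding m_def s_def by linarith
qed

text \<open>\<open>kk\<close> has mass 2, so the moment of w = v - Q at z is 2 w z up to the
  oscillation of w. Over a distance |x| this is at most \<tau> sqrt |x|, which \<open>kk\<close>
  integrates.\<close>

lemma moment_near_value:
 assumes cl: "close \<tau> v g"
 shows "cmod (moment v z - of_real (J0 z) - 2 * (v z - of_real (kQ z))) \<le> kW * \<tau>"
proof -
 define w where "w x = v x - of_real (kQ x)" for x
 have wa: "ac w (%x. g x - of_real (kk x))" unfolding w_def[abs_def] by (intro ac_diff v_ac ac_of_real kQ_ac)
 note [measurable] = ac_meas[OF wa]
 have hl: "l2 (%x. g x - of_real (kk x))" by (intro l2_diff g_l2 l2_of_real kk_l2)
 have t: "n2 (%x. g x - of_real (kk x)) \<le> \<tau>" using cl by (simp add: close_def)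
 have t0: "0 \<le> \<tau>" using t n2_nonneg order_trans by blast
 have i: "integrable lborel (%x. kk x *\<^sub>R w z)" by (rule kk_bdd_int[where C = "cmod (w z)"]) auto
 have "(LINT x|lborel. kk x *\<^sub>R w z) = 2 * w z"
  using kk_integral integral_scaleR_left[of "w z" lborel kk] kk_integrable by (simp add: scaleR_conv_of_real)
 then have "moment v z - of_real (J0 z) - 2 * w z = (LINT x|lborel. kk x *\<^sub>R w (x + z)) - (LINT x|lborel. kk x *\<^sub>R w z)"
  using moment_minus_J0(2)[of z] by (simp add: w_def)
 also have "\<dots> = (LINT x|lborel. kk x *\<^sub>R w (x + z) - kk x *\<^sub>R w z)"
  using Bochner_Integration.integral_diff[OF moment_minus_J0(1)[of z] i] by (simp add: w_def)
 finally have e: "moment v z - of_real (J0 z) - 2 * w z = (LINT x|lborel. kk x *\<^sub>R (w (x + z) - w z))"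
  by (simp add: scaleR_diff_right)
 have b: "norm (w (x + z) - w z) \<le> \<tau> * (1 + \<bar>x\<bar>)\<^sup>2" for x
 proof -
  have "norm (w (x + z) - w z) \<le> sqrt \<bar>x\<bar> * \<tau>"
   using order_trans[OF ac_l2_le[OF wa hl, of "x + z" z] mult_left_mono[OF t]] by simp
  also have "\<dots> \<le> (1 + \<bar>x\<bar>) * \<tau>" using t0 sqrt_le_one_plus[of "\<bar>x\<bar>"] by (intro mult_right_mono) auto
  also have "\<dots> \<le> ((1 + \<bar>x\<bar>) * (1 + \<bar>x\<bar>)) * \<tau>" using t0 mult_left_mono[of 1 "1 + \<bar>x\<bar>" "1 + \<bar>x\<bar>"] by (intro mult_right_mono) auto
  finally show ?thesis by (simp add: power2_eq_square mult.commute)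
 qed
 have "norm (LINT x|lborel. kk x *\<^sub>R (w (x + z) - w z)) \<le> \<tau> * kW"
  unfolding kW_def by (rule kk_times_integrable(2)[OF _ b]) measurable
 then show ?thesis unfolding e[unfolded w_def] w_def by (simp add: mult.commute)
qed

end

text \<open>The moment is bounded below through |v z|. For |z| \<le> 1 closeness to
  \<open>kQ z\<close> is pointwise; further out the weight spoils it, and the uniform bound on the
  modulus is used instead. Passing from 2 v z to the moment costs (2 - I) |kQ z|, which leaves the
  factor I \<ge> \<kappa>0.\<close>

lemma moment_lower:
 "\<exists>C\<ge>1. \<forall>v g \<tau> z. energy_fn_eta v g --> close \<tau> v g --> 0 \<le> \<tau> --> \<tau> \<le> 1 --> \<kappa>0 * kQ \<bar>z\<bar> - C * \<tau> \<le> cmod (moment v z)"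
proof -
 obtain c where c1: "1 \<le> c" and cb: "\<And>v g \<tau>. energy_fn_eta v g ==> close \<tau> v g ==> 0 \<le> \<tau> ==> \<tau> \<le> 1 ==> (\<forall>x. \<bar>dens v x\<bar> \<le> c * \<tau> \<and> cmod (v x) \<le> c)"
  using close_sup_bounds by blast
 have Q1: "0 < kQ 1" using kQ_lower[of 1] kk_pos[of 1] by simp
 define C2 where "C2 = 2 + c / kQ 1"
 have C2: "2 \<le> C2" "c / kQ 1 \<le> C2" using c1 Q1 by (auto simp: C2_def)
 have "\<kappa>0 * kQ \<bar>z\<bar> - (kW + 2 * C2) * \<tau> \<le> cmod (moment v z)"
  if L: "energy_fn_eta v g" and cl: "close \<tau> v g" and t: "0 \<le> \<tau>" "\<tau> \<le> 1" for v g \<tau> z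
 proof -
  interpret energy_fn_eta v g by fact
  have vz: "\<bar>kQ z\<bar> - C2 * \<tau> \<le> cmod (v z)"
  proof (cases "\<bar>z\<bar> \<le> 1")
   case True
   have "cmod (v z - of_real (kQ z)) \<le> \<tau> * (1 + \<bar>z\<bar>)" using cl by (simp add: close_def)
   also have "\<dots> \<le> \<tau> * 2" using True t by (intro mult_left_mono) auto
   also have "\<dots> \<le> C2 * \<tau>" using C2(1) t mult_right_mono[of 2 C2 \<tau>] by simp
   finally show ?thesis using norm_triangle_ineq2[of "of_real (kQ z)" "v z"] by (simp add: norm_minus_commute)
  next
   case False
   define a b where "a = \<bar>kQ z\<bar>" and "b = cmod (v z)"
   have a: "kQ 1 \<le> a" using False kQ_mono[of 1 "\<bar>z\<bar>"] by (simp add: a_def kQ_abs)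
   have d: "(a - b) * (a + b) \<le> c * \<tau>" using cb[OF L cl t] abs_ge_minus_self[of "dens v z"]
    by (auto simp: a_def b_def dens_def power2_eq_square algebra_simps intro: order_trans)
   have "a - b \<le> c / kQ 1 * \<tau>"
   proof (cases "b \<le> a")
    case True
    have "kQ 1 \<le> a + b" using a norm_ge_zero[of "v z"] unfolding b_def by linarith
    then have "(a - b) * kQ 1 \<le> (a - b) * (a + b)" using True by (intro mult_left_mono) auto
    then have "(a - b) * kQ 1 \<le> c * \<tau>" using d by linarith
    then show ?thesis using Q1 by (simp add: field_simps)
   next
    case False
    then show ?thesis using c1 Q1 t order_trans[of "a - b" 0 "c / kQ 1 * \<tau>"] by simp
   qed
   also have "\<dots> \<le> C2 * \<tau>" using C2(2) t by (intro mult_right_mono)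
   finally show ?thesis by (simp add: a_def b_def)
  qed
  obtain I where I: "\<kappa>0 \<le> I" "I \<le> 2" "J0 z = I * kQ z" by (rule J0_bounds)
  define r where "r = moment v z - of_real (J0 z) - 2 * (v z - of_real (kQ z))"
  have rb: "cmod r \<le> kW * \<tau>" unfolding r_def by (rule moment_near_value[OF cl])
  have e: "2 * v z = moment v z + of_real (2 * kQ z - J0 z) - r" by (simp add: r_def)
  have "2 * cmod (v z) \<le> cmod (moment v z) + \<bar>2 * kQ z - J0 z\<bar> + cmod r"
   using norm_triangle_ineq4[of "moment v z + of_real (2 * kQ z - J0 z)" r] norm_triangle_ineq[of "moment v z" "of_real (2 * kQ z - J0 z)"]
   unfolding e[symmetric] norm_of_real norm_mult norm_numeral by linarith
  moreover have "\<bar>2 * kQ z - J0 z\<bar> = (2 - I) * \<bar>kQ z\<bar>"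
  proof -
   have "2 * kQ z - J0 z = (2 - I) * kQ z" unfolding I(3) by (simp add: algebra_simps)
   then show ?thesis using I(2) by (simp add: abs_mult)
  qed
  moreover have "\<kappa>0 * \<bar>kQ z\<bar> \<le> I * \<bar>kQ z\<bar>" using I(1) by (intro mult_right_mono) auto
  moreover have "(2 - I) * \<bar>kQ z\<bar> = 2 * \<bar>kQ z\<bar> - I * \<bar>kQ z\<bar>" by (simp add: algebra_simps)
  moreover have "(kW + 2 * C2) * \<tau> = kW * \<tau> + 2 * (C2 * \<tau>)" by (simp add: algebra_simps)
  ultimately show ?thesis unfolding kQ_abs using vz rb by linarith
 qed
 moreover have "1 \<le> kW + 2 * C2" using kW_nonneg C2(1) by linarith
 ultimately show ?thesis by blast
qed

text \<open>\<open>moment_lower\<close> bounds \<open>kQ \<bar>z\<bar>\<close>. Smallness of \<tau>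
  + \<beta> excludes |z| > 1, where the kink is at least \<open>kk 1\<close>, and on [0, 1] the kink
  dominates its chord \<open>kk 1 * z\<close>.\<close>

lemma distance_from_moment:
 "\<exists>C\<ge>1. \<forall>v g \<tau> \<beta> z. energy_fn_eta v g --> close \<tau> v g --> 0 \<le> \<tau> --> cmod (moment v z) \<le> \<beta> --> C * (\<tau> + \<beta>) \<le> 1 --> \<bar>z\<bar> \<le> C * (\<tau> + \<beta>)"
proof -
 obtain C1 where C1: "1 \<le> C1" and lo: "\<And>v g \<tau> z. energy_fn_eta v g ==> close \<tau> v g ==> 0 \<le> \<tau> ==> \<tau> \<le> 1 ==> \<kappa>0 * kQ \<bar>z\<bar> - C1 * \<tau> \<le> cmod (moment v z)"
  using moment_lower by blast
 define k where "k = \<kappa>0 * kk 1"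
 have k: "0 < k" using \<kappa>0_pos kk_pos[of 1] by (simp add: k_def)
 define C where "C = 2 * C1 / k + 1"
 have C: "1 \<le> C" "2 * C1 \<le> k * C" using C1 k by (auto simp: C_def field_simps)
 have "\<bar>z\<bar> \<le> C * (\<tau> + \<beta>)"
  if L: "energy_fn_eta v g" and cl: "close \<tau> v g" and t: "0 \<le> \<tau>" and m: "cmod (moment v z) \<le> \<beta>" and sm: "C * (\<tau> + \<beta>) \<le> 1" for v g \<tau> \<beta> z
 proof -
  have b0: "0 \<le> \<beta>" using m norm_ge_zero order_trans by blast
  have "\<tau> + \<beta> \<le> C * (\<tau> + \<beta>)" using mult_right_mono[of 1 C "\<tau> + \<beta>"] C t b0 by simp
  then have "\<tau> + \<beta> \<le> 1" using sm by (rule order_trans)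
  then have t1: "\<tau> \<le> 1" using b0 by linarith
  have "1 * \<beta> \<le> C1 * \<beta>" using C1 b0 by (intro mult_right_mono) auto
  then have q: "\<kappa>0 * kQ \<bar>z\<bar> \<le> C1 * (\<tau> + \<beta>)" using lo[OF L cl t t1, of z] m unfolding distrib_left by linarith
  have h: "2 * (C1 * (\<tau> + \<beta>)) \<le> k * (C * (\<tau> + \<beta>))"
   using mult_right_mono[OF C(2), of "\<tau> + \<beta>"] t b0 by (simp add: mult.assoc)
  have z1: "\<bar>z\<bar> \<le> 1"
  proof (rule ccontr)
   assume "\<not> \<bar>z\<bar> \<le> 1"
   then have "kk 1 * 1 \<le> kQ \<bar>z\<bar>" using kQ_mono[of 1 "\<bar>z\<bar>"] kQ_lower[of 1] by linarith
   then have "k \<le> \<kappa>0 * kQ \<bar>z\<bar>" unfolding k_def using \<kappa>0_pos by (intro mult_left_mono) auto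
   moreover have "k * (C * (\<tau> + \<beta>)) \<le> k * 1" using sm k by (intro mult_left_mono) auto
   ultimately show False using q h k by linarith
  qed
  have "k * \<bar>z\<bar> \<le> \<kappa>0 * kQ \<bar>z\<bar>"
   using mult_left_mono[OF kQ_lower[of "\<bar>z\<bar>"], of \<kappa>0] z1 \<kappa>0_pos by (simp add: k_def mult.assoc)
  moreover have "0 \<le> C1 * (\<tau> + \<beta>)" using C1 t b0 by simp
  ultimately have "k * \<bar>z\<bar> \<le> k * (C * (\<tau> + \<beta>))" using q h by linarith
  then show ?thesis using k by simp
 qed
 then show ?thesis using C(1) by blast
qed

section \<open>Orbital stability\<close>

lemma kk_diff_bound:
 fixes f h :: "real => complex"
 assumes "f \<in> borel_measurable borel" "h \<in> borel_measurable borel" "\<And>x. cmod (f x) \<le> B" "\<And>x. cmod (h x) \<le> B" "\<And>x. cmod (f x - h x) \<le> K"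
 shows "cmod ((LINT x|lborel. kk x *\<^sub>R f x) - (LINT x|lborel. kk x *\<^sub>R h x)) \<le> 2 * K"
proof -
 note i = kk_bdd_int[OF assms(1,3)] kk_bdd_int[OF assms(2,4)]
 have "norm (LINT x|lborel. kk x *\<^sub>R f x - kk x *\<^sub>R h x) \<le> (LINT x|lborel. kk x * K)"
 proof (rule Bochner_Integration.integral_norm_bound_integral)
  show "integrable lborel (%x. kk x *\<^sub>R f x - kk x *\<^sub>R h x)" by (intro Bochner_Integration.integrable_diff i)
  show "integrable lborel (%x. kk x * K)" by (intro integrable_mult_left kk_integrable)
  show "norm (kk x *\<^sub>R f x - kk x *\<^sub>R h x) \<le> kk x * K" for x
   using mult_left_mono[OF assms(5)[of x], of "kk x"] kk_pos[of x] by (simp add: scaleR_diff_right[symmetric])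
 qed
 also have "\<dots> = 2 * K" using kk_integral by simp
 finally show ?thesis unfolding Bochner_Integration.integral_diff[OF i] .
qed

lemma close_mono: "close \<tau> v g ==> \<tau> \<le> \<tau>' ==> close \<tau>' v g"
 unfolding close_def by (meson add_nonneg_nonneg abs_ge_zero mult_right_mono order_trans zero_le_one)

lemma sin_ge_half: fixes x :: real assumes "0 \<le> x" "x \<le> 1" shows "x / 2 \<le> sin x"
proof -
 have "sin 0 - 0 / 2 \<le> sin x - x / 2"
 proof (rule DERIV_nonneg_imp_nondecreasing[of 0 x "%x::real. sin x - x / 2", OF assms(1)])
  fix y assume y: "0 \<le> y" "y \<le> x"
  have "((%x::real. sin x - x / 2) has_real_derivative cos y - 1 / 2) (at y)" by (auto intro!: derivative_eq_intros)
  moreover have "1 / 2 \<le> cos y"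
  proof -
   have "\<bar>sin (y / 2)\<bar> \<le> \<bar>1 / 2\<bar>" using abs_sin_x_le_abs_x[of "y / 2"] y assms by auto
   then have "(sin (y / 2))\<^sup>2 \<le> (1 / 2)\<^sup>2" by (rule abs_le_square_iff[THEN iffD1])
   then show ?thesis using cos_double_sin[of "y / 2"] by (simp add: power2_eq_square)
  qed
  ultimately show "\<exists>z. ((%x::real. sin x - x / 2) has_real_derivative z) (at y) \<and> 0 \<le> z" by (intro exI[of _ "cos y - 1 / 2"]) auto
 qed
 then show ?thesis by simp
qed

lemma exp_i_minus_1_lower: assumes "\<bar>x\<bar> \<le> 1" shows "\<bar>x\<bar> / 2 \<le> cmod (exp (\<i> * complex_of_real x) - 1)"
proof -
 have "Im (exp (\<i> * complex_of_real x) - 1) = sin x" by (simp add: Im_exp)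
 then have "\<bar>sin x\<bar> \<le> cmod (exp (\<i> * complex_of_real x) - 1)" using abs_Im_le_cmod by metis
 moreover have "\<bar>x\<bar> / 2 \<le> \<bar>sin x\<bar>"
  using sin_ge_half[of x] sin_ge_half[of "- x"] assms by (cases "0 \<le> x") auto
 ultimately show ?thesis by linarith
qed

lemma filterlim_minus_const:
 fixes c :: real
 shows "filterlim (%n. - real n - c) at_bot sequentially" "filterlim (%n. real n - c) at_top sequentially"
proof -
 show "filterlim (%n. real n - c) at_top sequentially"
  using filterlim_tendsto_add_at_top[OF tendsto_const[of "- c"] filterlim_real_sequentially] by (simp add: add.commute)
 have "filterlim (%n. - (c + real n)) at_bot sequentially"
  using filterlim_tendsto_add_at_top[OF tendsto_const[of c] filterlim_real_sequentially] by (simp only: filterlim_uminus_at_bot minus_minus)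
 moreover have "(%n. - (c + real n)) = (%n. - real n - c)" by (simp add: fun_eq_iff)
 ultimately show "filterlim (%n. - real n - c) at_bot sequentially" by simp
qed

section \<open>Moments and renormalised momentum along a flow\<close>

context gp_flow
begin

lemma shifted_energy_fn:
 assumes "cmod u = 1" shows "energy_fn_eta (%x. u * V s (x + b)) (%x. u * G s (x + b))"
proof (intro energy_fn_eta.intro energy_fn.intro energy_fn_eta_axioms.intro)
 show "ac (%x. u * V s (x + b)) (%x. u * G s (x + b))" by (rule ac_cmult[OF ac_shift[OF V_ac]])
 show "l2 (%x. u * G s (x + b))" by (rule l2_cmult(1)[OF l2_shift(1)[OF G_l2]])
 show "\<exists>B. \<forall>x. cmod (u * V s (x + b)) \<le> B" using V_bdd1[of s] assms by (auto simp: norm_mult)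
 show "l2 (%x. 1 - (cmod (u * V s (x + b)))\<^sup>2)" using l2_shift(1)[OF eta_l2[of s], of b] assms by (simp add: norm_mult eta_def)
qed

lemma en_shifted:
 assumes "cmod u = 1" shows "energy_fn_eta.en (%x. u * V s (x + b)) (%x. u * G s (x + b)) = en 0"
proof -
 have "n2 (%x. u * G s (x + b)) = n2 (G s)" using l2_cmult(2)[OF l2_shift(1)[OF G_l2[of s], of b], of u] l2_shift(2)[OF G_l2[of s], of b] assms by simp
 moreover have "n2 (%x. 1 - (cmod (u * V s (x + b)))\<^sup>2) = n2 (eta s)"
  using l2_shift(2)[OF eta_l2[of s], of b] assms by (simp add: norm_mult eta_def[abs_def])
 ultimately show ?thesis
  unfolding energy_fn_eta.en_def[OF shifted_energy_fn[OF assms]] energy_conserved[of s, symmetric] by (simp add: en_def)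
qed

lemma moment_shifted: "moment (%x. u * V s (x + b)) z = u * moment (V s) (b + z)"
proof -
 have "(LINT x|lborel. kk x *\<^sub>R (u * V s (x + z + b))) = (LINT x|lborel. u * (kk x *\<^sub>R V s (x + (b + z))))"
  by (rule Bochner_Integration.integral_cong[OF refl]) (simp add: add_ac)
 then show ?thesis unfolding moment_def by (simp only: integral_mult_right_zero)
qed

lemma mm_shifted:
 assumes "cmod u = 1" shows "energy_fn.mm (%x. u * V s (x + b)) = u * moment (V s) b"
 using energy_fn_eta.moment_0[OF shifted_energy_fn[OF assms]] moment_shifted[of u s b 0] by simp

lemma moment_time: "cmod (moment (V s) b - moment (V t) b) \<le> 2 * (nV s t + nG s t)"
proof -
 obtain M where M: "\<And>x. cmod (V s x) \<le> M" using V_bdd1 by blast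
 obtain N where N: "\<And>x. cmod (V t x) \<le> N" using V_bdd1 by blast
 show ?thesis unfolding moment_def
  by (rule kk_diff_bound[where B = "max M N"]) (use M N V_diff_sup_le in \<open>auto simp: le_max_iff_disj\<close>)
qed

lemma moment_cont: "continuous_on UNIV (moment (V s))"
proof -
 obtain M where M: "\<And>x. cmod (V s x) \<le> M" using V_bdd1 by blast
 have d: "cmod (moment (V s) b - moment (V s) c) \<le> 2 * (sqrt \<bar>b - c\<bar> * n2 (G s))" for b c
  unfolding moment_def
 proof (rule kk_diff_bound[where B = M])
  show "cmod (V s (x + b) - V s (x + c)) \<le> sqrt \<bar>b - c\<bar> * n2 (G s)" for x
   using ac_l2_le[OF V_ac G_l2, of s "x + b" "x + c"] by simp
 qed (use M in auto)
 have "isCont (moment (V s)) c" for c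
  unfolding isCont_def
 proof (rule LIM_zero_cancel, rule Lim_null_comparison[OF always_eventually])
  show "\<forall>b. norm (moment (V s) b - moment (V s) c) \<le> 2 * (sqrt \<bar>b - c\<bar> * n2 (G s))" using d by blast
  have "((%b. 2 * (sqrt \<bar>b - c\<bar> * n2 (G s))) \<longlongrightarrow> 2 * (sqrt \<bar>c - c\<bar> * n2 (G s))) (at c)" by (intro tendsto_intros)
  then show "((%b. 2 * (sqrt \<bar>b - c\<bar> * n2 (G s))) \<longlongrightarrow> 0) (at c)" by simp
 qed
 then show ?thesis by (simp add: continuous_on_eq_continuous_at)
qed

lemma nu_set_integrable: "set_integrable lborel {a..b} (nu s)"
proof -
 obtain M where M: "\<And>x. cmod (V s x) \<le> M" using V_bdd1 by blast
 have "l2 (%x. cnj (V s x) * G s x)" by (rule l2_bdd_mult(1)[OF G_l2, of _ M]) (use M in auto)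
 then show ?thesis unfolding nu_def[abs_def] by (intro l2_set_integrable l2_Im(1))
qed

lemma near_in_time: assumes "0 < e" shows "\<exists>d>0. \<forall>t. dist t s < d --> 2 * (nV t s + nG t s) < e"
proof -
 have "((%t. 2 * (nV t s + nG t s)) \<longlongrightarrow> 2 * (0 + 0)) (at s)" by (intro tendsto_intros nV_tendsto nG_tendsto)
 then have "\<forall>\<^sub>F t in at s. 2 * (nV t s + nG t s) < e" using order_tendstoD(2)[of _ "2 * (0 + 0)" _ e] assms by simp
 then obtain d where "d > 0" "\<And>t. t \<noteq> s ==> dist t s < d ==> 2 * (nV t s + nG t s) < e" unfolding eventually_at by auto
 then show ?thesis using assms by (metis add.right_neutral mult_zero_right nG_self nV_self)
qed

text \<open>The phases at the two ends compensate the phase gathered inside the window, so a drift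
  at infinity cancels, and so does a constant rotation of \<open>V s\<close>. The exponential
  forgets multiples of 2 pi.\<close>

definition Th :: "real => nat => complex" where
 "Th s n = exp (\<i> * of_real (LINT x:{- real n..real n}|lborel. nu s x)) * sgn (V s (- real n)) * cnj (sgn (V s (real n)))"

lemma eta_limits: "(eta s \<longlongrightarrow> 0) at_top" "(eta s \<longlongrightarrow> 0) at_bot"
 using energy_fn_eta.eta_tendsto_0[OF shifted_energy_fn[of 1 s 0]] by (simp_all add: eta_def[abs_def])

text \<open>The exponents differ by o(1) by \<open>momentum_conserved\<close>. The end phases do as
  well, because V s - V 0 vanishes at infinity while |V 0| tends to 1.\<close>

lemma Th_conserved: "(%n. Th s n - Th 0 n) \<longlonglongrightarrow> 0"
proof -
 define A where "A t n = (LINT x:{- real n..real n}|lborel. nu t x)" for t n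
 have dA: "(%n. A s n - A 0 n) \<longlonglongrightarrow> 0"
  using momentum_conserved[OF filterlim_minus_real filterlim_real_sequentially, of s]
  unfolding A_def set_integral_diff(2)[OF nu_set_integrable nu_set_integrable] .
 note dl = ac_l2_tendsto_0[OF Vd_ac diff_l2 Gd_l2, of s 0]
 define h where "h x = 2 * cmod (V s x - V 0 x) + 2 * \<bar>eta 0 x\<bar>" for x
 have hs: "cmod (sgn (V s x) - sgn (V 0 x)) \<le> h x" for x
  using sgn_diff_le[of "V s x" "V 0 x"] by (simp add: h_def eta_def abs_minus_commute)
 have "(h \<longlongrightarrow> 2 * 0 + 2 * \<bar>0\<bar>) at_top" "(h \<longlongrightarrow> 2 * 0 + 2 * \<bar>0\<bar>) at_bot"
  unfolding h_def[abs_def] by (intro tendsto_intros tendsto_norm_zero dl eta_limits)+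
 then have hl: "(h \<longlongrightarrow> 0) at_top" "(h \<longlongrightarrow> 0) at_bot" by simp_all
 have "(%n. \<bar>A s n - A 0 n\<bar> + h (- real n) + h (real n)) \<longlonglongrightarrow> 0 + 0 + 0"
  by (intro tendsto_add filterlim_compose[OF hl(2) filterlim_minus_real] filterlim_compose[OF hl(1) filterlim_real_sequentially] tendsto_rabs_zero dA)
 then have l: "(%n. \<bar>A s n - A 0 n\<bar> + h (- real n) + h (real n)) \<longlonglongrightarrow> 0" by simp
 have b: "norm (Th s n - Th 0 n) \<le> \<bar>A s n - A 0 n\<bar> + h (- real n) + h (real n)" for n
 proof -
  define E F where "E = exp (\<i> * complex_of_real (A s n))" and "F = exp (\<i> * complex_of_real (A 0 n))"
  define a c where "a = sgn (V s (- real n))" and "c = sgn (V 0 (- real n))"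
  define b d where "b = cnj (sgn (V s (real n)))" and "d = cnj (sgn (V 0 (real n)))"
  have n: "cmod F = 1" "cmod a \<le> 1" "cmod b \<le> 1" "cmod c \<le> 1"
   unfolding F_def a_def b_def c_def by (simp_all only: norm_exp_i_times complex_mod_cnj) (auto simp: norm_sgn)
  have "E - F = F * (exp (\<i> * complex_of_real (A s n - A 0 n)) - 1)"
   unfolding E_def F_def right_diff_distrib exp_add[symmetric] by (simp add: algebra_simps)
  then have 1: "cmod (E - F) \<le> \<bar>A s n - A 0 n\<bar>" using cmod_exp_i_minus_1[of "A s n - A 0 n"] n by (simp add: norm_mult)
  have 2: "cmod (a - c) \<le> h (- real n)" unfolding a_def c_def by (rule hs)
  have 3: "cmod (b - d) \<le> h (real n)" unfolding b_def d_def complex_cnj_diff[symmetric] complex_mod_cnj by (rule hs)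
  have "Th s n - Th 0 n = (E - F) * a * b + F * (a - c) * b + F * c * (b - d)"
   unfolding Th_def A_def[symmetric] E_def[symmetric] F_def[symmetric] a_def[symmetric] b_def[symmetric] c_def[symmetric] d_def[symmetric]
   by (simp add: algebra_simps)
  then have "cmod (Th s n - Th 0 n) \<le> cmod ((E - F) * a * b) + cmod (F * (a - c) * b) + cmod (F * c * (b - d))"
   using norm_triangle_ineq[of "(E - F) * a * b + F * (a - c) * b" "F * c * (b - d)"] norm_triangle_ineq[of "(E - F) * a * b" "F * (a - c) * b"] by simp
  also have "\<dots> \<le> cmod (E - F) + cmod (a - c) + cmod (b - d)"
   unfolding norm_mult n(1)
   using mult_mono[OF mult_mono[OF order_refl[of "cmod (E - F)"] n(2)] n(3)] mult_mono[OF order_refl[of "cmod (a - c)"] n(3)] mult_mono[OF n(4) order_refl[of "cmod (b - d)"]]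
   by simp
  finally show ?thesis using 1 2 3 by linarith
 qed
 show ?thesis by (rule Lim_null_comparison[OF always_eventually l]) (use b in blast)
qed

end

text \<open>Both exponentials are compared with \<open>Th\<close>, at time s and at time 0, by
  applying \<open>renormalised_momentum\<close> each time in the frame of the nearby kink.
  Translating the window by b undoes the change of frame, and constant rotations drop out.\<close>

theorem moment_phase_conserved:
 "\<exists>C\<ge>1. \<exists>\<tau>0>0. \<tau>0 \<le> 1 \<and> (\<forall>V G s b u \<tau> b' u' \<tau>'. gp_flow V G --> cmod u = 1 --> cmod u' = 1 -->
   close \<tau> (%x. u * V s (x + b)) (%x. u * G s (x + b)) --> 0 \<le> \<tau> --> \<tau> \<le> \<tau>0 -->
   close \<tau>' (%x. u' * V 0 (x + b')) (%x. u' * G 0 (x + b')) --> 0 \<le> \<tau>' --> \<tau>' \<le> \<tau>0 -->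
   cmod (exp (\<i> * of_real (- (2 * Im (u * moment (V s) b)))) - exp (\<i> * of_real (- (2 * Im (u' * moment (V 0) b'))))) \<le> C * (\<tau>\<^sup>2 + \<tau>'\<^sup>2))"
proof -
 obtain C \<tau>0 where C: "C \<ge> 1" "0 < \<tau>0" "\<tau>0 \<le> 1" and R: "\<And>v g \<tau> X Y e. energy_fn_eta v g ==> close \<tau> v g ==> 0 \<le> \<tau> ==> \<tau> \<le> \<tau>0 ==>
   filterlim X at_bot sequentially ==> filterlim Y at_top sequentially ==> 0 < e ==>
   (\<forall>\<^sub>F n in sequentially. cmod (exp (\<i> * of_real (LINT x:{X n..Y n}|lborel. Im (cnj (v x) * g x))) * sgn (v (X n)) * cnj (sgn (v (Y n)))
     + exp (\<i> * of_real (- (2 * Im (energy_fn.mm v))))) \<le> C * \<tau>\<^sup>2 + e)"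
  using renormalised_momentum by blast
 have main: "cmod (exp (\<i> * of_real (- (2 * Im (u * moment (V s) b)))) - exp (\<i> * of_real (- (2 * Im (u' * moment (V 0) b'))))) \<le> C * (\<tau>\<^sup>2 + \<tau>'\<^sup>2)"
  if fl: "gp_flow V G" and u: "cmod u = 1" and u': "cmod u' = 1"
   and c: "close \<tau> (%x. u * V s (x + b)) (%x. u * G s (x + b))" and t: "0 \<le> \<tau>" "\<tau> \<le> \<tau>0"
   and c': "close \<tau>' (%x. u' * V 0 (x + b')) (%x. u' * G 0 (x + b'))" and t': "0 \<le> \<tau>'" "\<tau>' \<le> \<tau>0" for V G s b u \<tau> b' u' \<tau>'
 proof -
  interpret gp_flow V G by fact
  have ev: "\<forall>\<^sub>F n in sequentially. cmod (Th s n + exp (\<i> * of_real (- (2 * Im (u * moment (V s) b))))) \<le> C * \<tau>\<^sup>2 + e"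
   if u: "cmod u = 1" and c: "close \<tau> (%x. u * V s (x + b)) (%x. u * G s (x + b))" and t: "0 \<le> \<tau>" "\<tau> \<le> \<tau>0" and e: "0 < e" for s b u \<tau> e
  proof -
   have uu: "cnj u * u = 1" using complex_norm_square[of u] u by (simp add: mult.commute)
   have su: "sgn u = u" using u by (simp add: sgn_eq)
   have i: "(LINT x:{- real n - b..real n - b}|lborel. Im (cnj (u * V s (x + b)) * (u * G s (x + b)))) = (LINT x:{- real n..real n}|lborel. nu s x)" for n
   proof -
    have p: "cnj (u * V s (x + b)) * (u * G s (x + b)) = cnj (V s (x + b)) * G s (x + b)" for x
    proof -
     have "cnj (u * V s (x + b)) * (u * G s (x + b)) = (cnj u * u) * (cnj (V s (x + b)) * G s (x + b))"
      unfolding complex_cnj_mult by (simp only: mult_ac)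
     then show ?thesis unfolding uu by simp
    qed
    have ii: "(indicator {- real n - b..real n - b} x :: real) = indicator {- real n..real n} (x + b)" for x by (auto simp: indicator_def)
    show ?thesis unfolding set_lebesgue_integral_def p ii nu_def by (rule integral_shift)
   qed
   have sg: "sgn (u * V s (- real n - b + b)) * cnj (sgn (u * V s (real n - b + b))) = sgn (V s (- real n)) * cnj (sgn (V s (real n)))" for n
   proof -
    have "sgn (u * V s (- real n - b + b)) * cnj (sgn (u * V s (real n - b + b))) = (cnj u * u) * (sgn (V s (- real n)) * cnj (sgn (V s (real n))))"
     unfolding sgn_mult su complex_cnj_mult diff_add_cancel by (simp only: mult_ac)
    then show ?thesis unfolding uu by simp
   qed
   show ?thesis
    using R[OF shifted_energy_fn[OF u] c t filterlim_minus_const[of b] e] unfolding i mm_shifted[OF u] mult.assoc sg unfolding Th_def mult.assoc .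
  qed
  define E where "E = exp (\<i> * complex_of_real (- (2 * Im (u * moment (V s) b))))"
  define F where "F = exp (\<i> * complex_of_real (- (2 * Im (u' * moment (V 0) b'))))"
  have "cmod (E - F) \<le> C * (\<tau>\<^sup>2 + \<tau>'\<^sup>2)"
  proof (rule field_le_epsilon)
   fix e :: real assume e: "0 < e"
   have e3: "0 < e / 3" using e by simp
   have "\<forall>\<^sub>F n in sequentially. cmod (Th s n - Th 0 n) < e / 3"
    using order_tendstoD(2)[OF tendsto_norm_zero[OF Th_conserved[of s]] e3] .
   with ev[OF u c t e3] ev[OF u' c' t' e3] have "\<forall>\<^sub>F n in sequentially. cmod (E - F) \<le> C * (\<tau>\<^sup>2 + \<tau>'\<^sup>2) + e"
   proof eventually_elim
    case (elim n)
    have eq: "E - F = (Th s n + E) - (Th 0 n + F) - (Th s n - Th 0 n)" by simp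
    have "cmod (E - F) \<le> cmod (Th s n + E) + cmod (Th 0 n + F) + cmod (Th s n - Th 0 n)"
     using norm_triangle_ineq4[of "(Th s n + E) - (Th 0 n + F)" "Th s n - Th 0 n"] norm_triangle_ineq4[of "Th s n + E" "Th 0 n + F"]
     unfolding eq[symmetric] by linarith
    also have "\<dots> \<le> (C * \<tau>\<^sup>2 + e / 3) + (C * \<tau>'\<^sup>2 + e / 3) + e / 3" using elim unfolding E_def F_def by (intro add_mono) auto
    finally show ?case by (simp add: distrib_left)
   qed
   then show "cmod (E - F) \<le> C * (\<tau>\<^sup>2 + \<tau>'\<^sup>2) + e" by simp
  qed
  then show ?thesis unfolding E_def F_def .
 qed
 show ?thesis by (intro exI[of _ C] exI[of _ \<tau>0] conjI allI impI main C)
qed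

theorem orbital_stability:
 "\<exists>K\<ge>1. \<forall>V G \<delta>. gp_flow V G --> 0 \<le> \<delta> --> K * \<delta> \<le> 1 --> gp_flow.en V G 0 \<le> E0 + \<delta>\<^sup>2 --> cmod (moment (V 0) 0) \<le> \<delta> -->
  (\<forall>s. \<exists>b u. cmod u = 1 \<and> close (K * \<delta>) (%x. u * V s (x + b)) (%x. u * G s (x + b)) \<and> cmod (moment (V s) b) \<le> K * \<delta>)"
proof -
 obtain C1 where C1: "1 \<le> C1" and cls: "\<And>v g \<mu> \<beta>. energy_fn_eta v g ==> energy_fn_eta.en v g \<le> E0 + \<mu> ==> cmod (energy_fn.mm v) \<le> \<beta> ==> 0 \<le> \<mu> ==>
   C1 * (sqrt \<mu> + \<beta>) \<le> 1 ==> (\<exists>u. cmod u = 1 \<and> close (C1 * (sqrt \<mu> + \<beta>)) (%x. u * v x) (%x. u * g x))"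
  using close_if_energy_and_moment_small by blast
 obtain C2 \<tau>0 where C2: "1 \<le> C2" "0 < \<tau>0" "\<tau>0 \<le> 1" and ph: "\<And>V G s b u \<tau> b' u' \<tau>'. gp_flow V G ==> cmod u = 1 ==> cmod u' = 1 ==>
   close \<tau> (%x. u * V s (x + b)) (%x. u * G s (x + b)) ==> 0 \<le> \<tau> ==> \<tau> \<le> \<tau>0 ==>
   close \<tau>' (%x. u' * V 0 (x + b')) (%x. u' * G 0 (x + b')) ==> 0 \<le> \<tau>' ==> \<tau>' \<le> \<tau>0 ==>
   cmod (exp (\<i> * of_real (- (2 * Im (u * moment (V s) b)))) - exp (\<i> * of_real (- (2 * Im (u' * moment (V 0) b'))))) \<le> C2 * (\<tau>\<^sup>2 + \<tau>'\<^sup>2)"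
  using moment_phase_conserved by metis
 define k where "k = \<kappa>0 * kk 1"
 have k: "0 < k" using \<kappa>0_pos kk_pos[of 1] by (simp add: k_def)
 define S where "S = sqrt kW"
 have S: "0 \<le> S" using kW_nonneg by (simp add: S_def)
 \<comment> \<open>Three demands: the phase comparison must be valid, |V s| must be at most 1 / 2 at
   a candidate centre, and at a minimum Re m must be at most half of |m|.\<close>
 define \<tau>1 where "\<tau>1 = min (min \<tau>0 (1 / 2)) (k / (2 * S + 1))"
 have "\<tau>1 \<le> 1 / 2" unfolding \<tau>1_def by (rule order_trans[OF min.cobounded1 min.cobounded2])
 moreover have "0 < \<tau>1" "\<tau>1 \<le> \<tau>0" using k S C2 by (auto simp: \<tau>1_def)
 ultimately have t1: "0 < \<tau>1" "\<tau>1 \<le> \<tau>0" "\<tau>1 \<le> 1 / 2" by auto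
 have t1S: "2 * (S * \<tau>1) \<le> k"
 proof -
  have "\<tau>1 \<le> k / (2 * S + 1)" by (simp add: \<tau>1_def)
  then have "\<tau>1 * (2 * S + 1) \<le> k" using S by (simp add: pos_le_divide_eq)
  then show ?thesis using t1 by (simp add: algebra_simps)
 qed
 define D where "D = C2 * C1\<^sup>2"
 have D: "1 \<le> D" using C1 C2 mult_mono[of 1 C2 1 "C1\<^sup>2"] by (simp add: D_def one_le_power)
 \<comment> \<open>The first bound lets the quadratic term 2 D \<beta>^2 be absorbed as \<beta> / 4;
   the second keeps the closeness below \<tau>1.\<close>
 define r0 where "r0 = min (1 / (8 * D)) (\<tau>1 / (2 * C1))"
 have r0: "0 < r0" "r0 \<le> 1 / (8 * D)" "r0 \<le> \<tau>1 / (2 * C1)" using C1 D t1 by (auto simp: r0_def)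
 have r0D: "8 * (D * r0) \<le> 1" using r0(2) D by (simp add: pos_le_divide_eq mult_ac)
 have r0C: "C1 * (r0 + r0) \<le> \<tau>1" using r0(3) C1 by (simp add: pos_le_divide_eq mult_ac)
 have r01: "8 * r0 \<le> 1" using r0D mult_right_mono[OF D less_imp_le[OF r0(1)]] by linarith
 \<comment> \<open>K \<delta> \<le> 1 has to force 128 D \<delta> \<le> r0, the smallness from which
   the bootstrap starts.\<close>
 define K where "K = 128 * D / r0"
 have Kr: "K * r0 = 128 * D" using r0 by (simp add: K_def)
 have K128: "128 * D \<le> K"
 proof -
  have "128 * D * r0 \<le> 128 * D * 1" using r01 r0 D by (intro mult_left_mono) auto
  then show ?thesis using r0 by (simp add: K_def pos_le_divide_eq)
 qed
 have K33: "C1 * (33 * D) \<le> K"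
 proof -
  have "C1 * r0 \<le> 1" using r0C t1 C1 r0 unfolding distrib_left by linarith
  then have "33 * D * (C1 * r0) \<le> 33 * D * 1" using D by (intro mult_left_mono) auto
  also have "\<dots> \<le> 128 * D" using D by simp
  finally show ?thesis using r0 by (simp add: K_def pos_le_divide_eq mult_ac)
 qed
 have K1: "1 \<le> K" using K128 D by linarith
 have main: "\<exists>b u. cmod u = 1 \<and> close (K * \<delta>) (%x. u * V s (x + b)) (%x. u * G s (x + b)) \<and> cmod (moment (V s) b) \<le> K * \<delta>"
  if fl: "gp_flow V G" and d: "0 \<le> \<delta>" and sm: "K * \<delta> \<le> 1" and en0: "gp_flow.en V G 0 \<le> E0 + \<delta>\<^sup>2" and m0: "cmod (moment (V 0) 0) \<le> \<delta>" for V G \<delta> s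
 proof -
  interpret gp_flow V G by fact
  have "(128 * D) * \<delta> \<le> 1 * r0"
  proof -
   have "(128 * D) * \<delta> = (K * \<delta>) * r0" unfolding Kr[symmetric] by (simp only: mult_ac)
   also have "\<dots> \<le> 1 * r0" using sm r0 by (intro mult_right_mono) auto
   finally show ?thesis .
  qed
  then have dD: "128 * (D * \<delta>) \<le> r0" by simp
  have dd: "\<delta> \<le> D * \<delta>" using mult_right_mono[OF D d] by simp
  have dr: "\<delta> < r0" using dd dD d r0 by linarith
  have d1: "\<delta> \<le> 1" using dr r01 by linarith
  have cl: "\<exists>u. cmod u = 1 \<and> close (C1 * (\<delta> + \<beta>)) (%x. u * V s (x + b)) (%x. u * G s (x + b))"
   if "cmod (moment (V s) b) \<le> \<beta>" "\<beta> \<le> r0" for s b \<beta>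
  proof -
   have c1: "cmod (1::complex) = 1" by simp
   have "C1 * (\<delta> + \<beta>) \<le> C1 * (r0 + r0)" using that dr C1 by (intro mult_left_mono add_mono) auto
   then have "C1 * (sqrt (\<delta>\<^sup>2) + \<beta>) \<le> 1" using r0C t1 d by simp
   from cls[OF shifted_energy_fn[OF c1, of s b] _ _ _ this] show ?thesis
    using that(1) en0 d unfolding en_shifted[OF c1] mm_shifted[OF c1] by simp
  qed
  have tau: "0 \<le> C1 * (\<delta> + \<beta>)" "C1 * (\<delta> + \<beta>) \<le> \<tau>1" if "0 \<le> \<beta>" "\<beta> \<le> r0" for \<beta>
  proof -
   show "0 \<le> C1 * (\<delta> + \<beta>)" using that d C1 by simp
   have "C1 * (\<delta> + \<beta>) \<le> C1 * (r0 + r0)" using that dr C1 by (intro mult_left_mono add_mono) auto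
   then show "C1 * (\<delta> + \<beta>) \<le> \<tau>1" using r0C by linarith
  qed
  obtain u0 where u0: "cmod u0 = 1" "close (C1 * (\<delta> + \<delta>)) (%x. u0 * V 0 (x + 0)) (%x. u0 * G 0 (x + 0))"
   using cl[OF m0] dr by auto
  note tau0 = tau[OF d less_imp_le[OF dr]]
  \<comment> \<open>A moment below \<open>r0\<close> at one position yields, at the minimising
    position, a moment of order \<delta>. The gap between the two sizes is what makes the set of
    good times closed.\<close>
  have improve: "\<exists>b. cmod (moment (V s) b) \<le> 32 * (D * \<delta>)" if b0: "cmod (moment (V s) b0) < r0" for s b0
  proof -
   let ?m = "%b. cmod (moment (V s) b)"
   define B where "B = {b. ?m b \<le> ?m b0}"
   have cB: "continuous_on UNIV ?m" by (intro continuous_on_norm moment_cont)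
   have "closed B" unfolding B_def by (rule closed_Collect_le[OF cB continuous_on_const])
   \<comment> \<open>On the sublevel set |V s| is at most 1 / 2, while |V s| tends to 1 at infinity;
     so the set is bounded and the minimum is attained.\<close>
   moreover have "bounded B"
   proof -
    have small: "1 / 2 < \<bar>eta s b\<bar>" if "b \<in> B" for b
    proof -
     have mb: "?m b \<le> r0" using that b0 by (simp add: B_def)
     obtain u where u: "cmod u = 1" "close (C1 * (\<delta> + ?m b)) (%x. u * V s (x + b)) (%x. u * G s (x + b))"
      using cl[OF order_refl mb] by blast
     have "cmod (u * V s (0 + b) - of_real (kQ 0)) \<le> C1 * (\<delta> + ?m b) * (1 + \<bar>0\<bar>)" using u(2) unfolding close_def by blast
     then have "cmod (V s b) \<le> C1 * (\<delta> + ?m b)" using u(1) by (simp add: kQ_0 norm_mult)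
     also have "\<dots> \<le> 1 / 2" using tau(2)[OF norm_ge_zero mb] t1 by linarith
     finally have "(cmod (V s b))\<^sup>2 \<le> (1 / 2)\<^sup>2" by (intro power_mono) auto
     then show ?thesis unfolding eta_def by (simp add: power2_eq_square)
    qed
    have h: "0 < (1 / 2 :: real)" by simp
    have "\<exists>p. \<forall>b\<ge>p. \<bar>eta s b\<bar> < 1 / 2"
     using tendstoD[OF eta_limits(1) h, of s] unfolding eventually_at_top_linorder dist_real_def diff_zero .
    then obtain p where p: "\<And>b. p \<le> b ==> \<bar>eta s b\<bar> < 1 / 2" by blast
    have "\<exists>q. \<forall>b\<le>q. \<bar>eta s b\<bar> < 1 / 2"
     using tendstoD[OF eta_limits(2) h, of s] unfolding eventually_at_bot_linorder dist_real_def diff_zero .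
    then obtain q where q: "\<And>b. b \<le> q ==> \<bar>eta s b\<bar> < 1 / 2" by blast
    have "B \<subseteq> {q..p}"
    proof
     fix b assume b: "b \<in> B"
     have "\<not> p \<le> b" using p[of b] small[OF b] by (meson less_asym)
     moreover have "\<not> b \<le> q" using q[of b] small[OF b] by (meson less_asym)
     ultimately show "b \<in> {q..p}" by simp
    qed
    then show ?thesis using bounded_subset bounded_closed_interval by blast
   qed
   ultimately have "compact B" by (simp add: compact_eq_bounded_closed)
   moreover have "b0 \<in> B" by (simp add: B_def)
   ultimately obtain b1 where b1: "b1 \<in> B" "\<And>b. b \<in> B ==> ?m b1 \<le> ?m b"
    using continuous_attains_inf[of B ?m] continuous_on_subset[OF cB] by blast
   have gmin: "?m b1 \<le> ?m b" for b
    using b1(1) b1(2)[of b] by (cases "b \<in> B") (auto simp: B_def)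
   define \<beta> where "\<beta> = ?m b1"
   have \<beta>: "0 \<le> \<beta>" "\<beta> \<le> r0" using b1(1) b0 by (auto simp: \<beta>_def B_def)
   define \<tau> where "\<tau> = C1 * (\<delta> + \<beta>)"
   have t: "0 \<le> \<tau>" "\<tau> \<le> \<tau>1" using tau[OF \<beta>] by (simp_all add: \<tau>_def)
   obtain u where u: "cmod u = 1" "close \<tau> (%x. u * V s (x + b1)) (%x. u * G s (x + b1))"
    using cl[OF _ \<beta>(2), of s b1] unfolding \<tau>_def \<beta>_def by blast
   define m where "m = u * moment (V s) b1"
   have mb: "cmod m = \<beta>" using u by (simp add: m_def \<beta>_def norm_mult)
   have "k * \<bar>Re m\<bar> \<le> S * \<tau> * cmod m"
    using energy_fn_eta.Re_moment_at_minimum[OF shifted_energy_fn[OF u(1)] u(2) t(1)] gmin u(1)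
    unfolding moment_shifted m_def k_def S_def by (simp add: norm_mult)
   moreover have "2 * (S * \<tau> * cmod m) \<le> k * \<beta>"
   proof -
    have "2 * (S * \<tau>) \<le> 2 * (S * \<tau>1)" using t S by (intro mult_left_mono) auto
    then have "2 * (S * \<tau>) \<le> k" using t1S by linarith
    from mult_right_mono[OF this \<beta>(1)] show ?thesis by (simp add: mb mult.assoc)
   qed
   ultimately have "k * (2 * \<bar>Re m\<bar>) \<le> k * \<beta>" by simp
   then have re: "2 * \<bar>Re m\<bar> \<le> \<beta>" using k by simp
   then have bi: "\<beta> \<le> 2 * \<bar>Im m\<bar>" using cmod_le[of m] mb by linarith
   \<comment> \<open>Within this range the exponential determines Im m, so the ambiguity modulo 2 pi
     disappears.\<close>
   have ib: "\<bar>2 * Im m\<bar> \<le> 1" using abs_Im_le_cmod[of m] mb \<beta> r01 by simp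
   define E where "E = exp (\<i> * complex_of_real (- (2 * Im m)))"
   define F where "F = exp (\<i> * complex_of_real (- (2 * Im (u0 * moment (V 0) 0))))"
   have EF: "cmod (E - F) \<le> C2 * (\<tau>\<^sup>2 + (C1 * (\<delta> + \<delta>))\<^sup>2)"
    unfolding E_def F_def m_def by (rule ph[OF fl u(1) u0(1) u(2) t(1) _ u0(2)]) (use t t1 tau0 in auto)
   have "\<bar>Im (u0 * moment (V 0) 0)\<bar> \<le> \<delta>" using abs_Im_le_cmod[of "u0 * moment (V 0) 0"] u0(1) m0 by (simp add: norm_mult)
   then have F1: "cmod (F - 1) \<le> 2 * \<delta>" using cmod_exp_i_minus_1[of "- (2 * Im (u0 * moment (V 0) 0))"] unfolding F_def by simp
   have "\<bar>Im m\<bar> \<le> cmod (E - 1)" using exp_i_minus_1_lower[of "- (2 * Im m)"] ib unfolding E_def by simp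
   also have "\<dots> \<le> cmod (E - F) + cmod (F - 1)" using norm_triangle_ineq[of "E - F" "F - 1"] by simp
   finally have im: "\<bar>Im m\<bar> \<le> C2 * (\<tau>\<^sup>2 + (C1 * (\<delta> + \<delta>))\<^sup>2) + 2 * \<delta>" using EF F1 by linarith
   have "\<tau>\<^sup>2 \<le> C1\<^sup>2 * (2 * \<delta>\<^sup>2 + 2 * \<beta>\<^sup>2)"
   proof -
    have "(\<delta> + \<beta>)\<^sup>2 \<le> 2 * \<delta>\<^sup>2 + 2 * \<beta>\<^sup>2" using zero_le_power2[of "\<delta> - \<beta>"] by (simp add: power2_sum power2_diff)
    then show ?thesis unfolding \<tau>_def power_mult_distrib by (intro mult_left_mono) auto
   qed
   then have "\<tau>\<^sup>2 + (C1 * (\<delta> + \<delta>))\<^sup>2 \<le> C1\<^sup>2 * (6 * \<delta>\<^sup>2 + 2 * \<beta>\<^sup>2)"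
    by (simp add: power_mult_distrib power2_eq_square algebra_simps)
   then have "C2 * (\<tau>\<^sup>2 + (C1 * (\<delta> + \<delta>))\<^sup>2) \<le> C2 * (C1\<^sup>2 * (6 * \<delta>\<^sup>2 + 2 * \<beta>\<^sup>2))" using C2 by (intro mult_left_mono) auto
   also have "\<dots> = 6 * (D * \<delta> * \<delta>) + 2 * (D * \<beta> * \<beta>)" by (simp add: D_def power2_eq_square algebra_simps)
   also have "\<dots> \<le> 6 * (D * \<delta>) + \<beta> / 4"
   proof -
    have "D * \<delta> * \<delta> \<le> D * \<delta> * 1" using d d1 D by (intro mult_left_mono) auto
    moreover have "(8 * (D * \<beta>)) * \<beta> \<le> 1 * \<beta>"
    proof (rule mult_right_mono[OF _ \<beta>(1)])
     have "8 * (D * \<beta>) \<le> 8 * (D * r0)" using \<beta> D by (intro mult_left_mono) auto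
     then show "8 * (D * \<beta>) \<le> 1" using r0D by linarith
    qed
    ultimately show ?thesis by simp
   qed
   \<comment> \<open>From |Im m| \<le> 6 D \<delta> + \<beta> / 4 + 2 \<delta>, the last term being
     the phase at time 0, and \<beta> \<le> 2 |Im m|. Absorbing \<beta> / 2 gives 32 = 2 (12 +
     4).\<close>
   finally have "\<beta> \<le> 12 * (D * \<delta>) + \<beta> / 2 + 4 * \<delta>" using im bi by linarith
   then have "\<beta> \<le> 32 * (D * \<delta>)" using dd by linarith
   then show ?thesis unfolding \<beta>_def by blast
  qed
  define Good where "Good = {s. \<exists>b. cmod (moment (V s) b) < r0}"
  have mt: "cmod (moment (V t) b) \<le> cmod (moment (V s) b) + 2 * (nV t s + nG t s)" for s t b
   using moment_time[of t b s] norm_triangle_ineq2[of "moment (V t) b" "moment (V s) b"] by linarith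
  have "open Good" unfolding open_dist
  proof
   fix s assume "s \<in> Good"
   then obtain b where b: "cmod (moment (V s) b) < r0" by (auto simp: Good_def)
   then obtain e where e: "e > 0" "\<And>t. dist t s < e ==> 2 * (nV t s + nG t s) < r0 - cmod (moment (V s) b)"
    using near_in_time[of "r0 - cmod (moment (V s) b)" s] by auto
   have "t \<in> Good" if "dist t s < e" for t
    using e(2)[OF that] mt[of t b s] unfolding Good_def by (intro CollectI exI[of _ b]) linarith
   then show "\<exists>e>0. \<forall>t. dist t s < e --> t \<in> Good" using e(1) by blast
  qed
  \<comment> \<open>A good time close to s has, by the improvement, a moment of at most 32 D
    \<delta>, and continuity raises it by less than r0 / 2; the sum stays below r0, so s is good as
    well.\<close>
  moreover have "open (- Good)" unfolding open_dist
  proof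
   fix s assume s: "s \<in> - Good"
   obtain e where e: "e > 0" "\<And>t. dist t s < e ==> 2 * (nV t s + nG t s) < r0 / 2"
    using near_in_time[of "r0 / 2" s] r0 by auto
   have "t \<in> - Good" if "dist t s < e" for t
   proof
    assume "t \<in> Good"
    then obtain b' where "cmod (moment (V t) b') < r0" by (auto simp: Good_def)
    then obtain b where b: "cmod (moment (V t) b) \<le> 32 * (D * \<delta>)" using improve by blast
    have "cmod (moment (V s) b) \<le> cmod (moment (V t) b) + 2 * (nV s t + nG s t)" by (rule mt)
    also have "\<dots> < 32 * (D * \<delta>) + r0 / 2" using b e(2)[OF that] nV_sym[of s t] nG_sym[of s t] by simp
    also have "\<dots> \<le> r0" using dD r0 by linarith
    finally have "s \<in> Good" by (auto simp: Good_def)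
    then show False using s by simp
   qed
   then show "\<exists>e>0. \<forall>t. dist t s < e --> t \<in> - Good" using e(1) by blast
  qed
  moreover have "0 \<in> Good" using m0 dr by (auto simp: Good_def intro: le_less_trans)
  ultimately have "Good = UNIV" using clopen[of Good] by (auto simp: closed_def)
  then obtain b0 where "cmod (moment (V s) b0) < r0" by (auto simp: Good_def)
  then obtain b where b: "cmod (moment (V s) b) \<le> 32 * (D * \<delta>)" using improve by blast
  have b2: "32 * (D * \<delta>) \<le> r0" using dD d D r0 mult_nonneg_nonneg[of D \<delta>] by linarith
  obtain u where u: "cmod u = 1" "close (C1 * (\<delta> + 32 * (D * \<delta>))) (%x. u * V s (x + b)) (%x. u * G s (x + b))"
   using cl[OF b b2] by blast
  have "C1 * (\<delta> + 32 * (D * \<delta>)) \<le> C1 * (33 * (D * \<delta>))" using dd C1 by (intro mult_left_mono) auto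
  also have "\<dots> = (C1 * (33 * D)) * \<delta>" by simp
  also have "\<dots> \<le> K * \<delta>" using K33 d by (intro mult_right_mono)
  finally have "close (K * \<delta>) (%x. u * V s (x + b)) (%x. u * G s (x + b))" using close_mono[OF u(2)] by blast
  moreover have "cmod (moment (V s) b) \<le> K * \<delta>"
  proof -
   have "32 * (D * \<delta>) \<le> (128 * D) * \<delta>" using d D by simp
   also have "\<dots> \<le> K * \<delta>" using K128 d by (intro mult_right_mono)
   finally show ?thesis using b by linarith
  qed
  ultimately show ?thesis using u(1) by blast
 qed
 show ?thesis using K1 main by blast
qed

section \<open>Speed of the centre\<close>

lemma kk_deriv_l2: "l2 (%x. - sqrt 2 * kQ x * kk x)"
proof (rule l2_bound(1)[OF kk_l2(1), where C = "sqrt 2"])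
 show "norm (- sqrt 2 * kQ x * kk x) \<le> sqrt 2 * norm (kk x)" for x
  using mult_right_mono[of "\<bar>kQ x\<bar>" 1 "\<bar>kk x\<bar>"] kQ_bounds(1)[of x] by (simp add: abs_mult)
qed measurable

text \<open>Integration by parts with Q'' = -(1 - Q^2) Q. In other words the pairing that defines
  \<open>Lam\<close> vanishes at the kink.\<close>

lemma kink_is_stationary:
 fixes \<psi> \<psi>' :: "real => complex"
 assumes A: "ac \<psi> \<psi>'" and l: "l2 \<psi>" "l2 \<psi>'"
 shows "(LINT x|lborel. of_real ((1 - (kQ x)\<^sup>2) * kQ x) * \<psi> x) = (LINT x|lborel. of_real (kk x) * \<psi>' x)"
proof -
 have e: "(1 - (kQ x)\<^sup>2) * kQ x = - (- sqrt 2 * kQ x * kk x)" for x unfolding kk_eq by simp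
 have Qk: "l2 (%x. (1 - (kQ x)\<^sup>2) * kQ x)"
 proof (rule l2_bound(1)[OF kk_l2(1), where C = "sqrt 2"])
  show "norm ((1 - (kQ x)\<^sup>2) * kQ x) \<le> sqrt 2 * norm (kk x)" for x
   unfolding kk_eq using kQ_bounds(1)[of x] by (simp add: abs_mult mult_left_le)
 qed measurable
 note i1 = l2_mult[OF l2_of_real[OF Qk] l(1)] and i2 = l2_mult[OF l2_of_real[OF kk_l2(1)] l(2)]
 have a: "ac (%x. of_real (kk x) * \<psi> x) (%x. of_real (- sqrt 2 * kQ x * kk x) * \<psi> x + of_real (kk x) * \<psi>' x)"
  by (rule ac_mult[OF ac_of_real[OF kk_ac] A])
 have d: "of_real (- sqrt 2 * kQ x * kk x) * \<psi> x + of_real (kk x) * \<psi>' x = of_real (kk x) * \<psi>' x - of_real ((1 - (kQ x)\<^sup>2) * kQ x) * \<psi> x" for x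
  unfolding e of_real_minus by simp
 have t: "((%x. of_real (kk x) * \<psi> x) \<longlongrightarrow> 0) at_top" "((%x. of_real (kk x) * \<psi> x) \<longlongrightarrow> 0) at_bot"
  using tendsto_mult[OF tendsto_of_real[OF kk_tendsto_0(1)] ac_l2_tendsto_0(1)[OF A l]] tendsto_mult[OF tendsto_of_real[OF kk_tendsto_0(2)] ac_l2_tendsto_0(2)[OF A l]]
  by simp_all
 have "(LINT x|lborel. of_real (kk x) * \<psi>' x - of_real ((1 - (kQ x)\<^sup>2) * kQ x) * \<psi> x) = 0"
  by (rule ac_l2_integral_deriv_0[OF a[unfolded d] t]) (intro Bochner_Integration.integrable_diff i1 i2)
 then show ?thesis unfolding Bochner_Integration.integral_diff[OF i2 i1] by simp
qed

text \<open>Subtract the stationary equation of the kink. The nonlinear terms differ by (1 - Q^2) (v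
  - Q), in L2 because the decay of the first factor beats the growing weight, and by v times the
  density defect, in L2 by the uniform bound on v.\<close>

lemma stationary_defect:
 "\<exists>C\<ge>1. \<forall>v g \<tau> \<psi> \<psi>'. energy_fn_eta v g --> close \<tau> v g --> 0 \<le> \<tau> --> \<tau> \<le> 1 --> ac \<psi> \<psi>' --> l2 \<psi> --> l2 \<psi>' -->
   cmod ((LINT x|lborel. of_real (1 - (cmod (v x))\<^sup>2) * v x * \<psi> x) - (LINT x|lborel. g x * \<psi>' x)) \<le> C * \<tau> * (n2 \<psi> + n2 \<psi>')"
proof -
 obtain c where c1: "1 \<le> c" and cb: "\<And>v g \<tau>. energy_fn_eta v g ==> close \<tau> v g ==> 0 \<le> \<tau> ==> \<tau> \<le> 1 ==> (\<forall>x. \<bar>dens v x\<bar> \<le> c * \<tau> \<and> cmod (v x) \<le> c)"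
  using close_sup_bounds by blast
 define S where "S = sqrt kW"
 have S: "0 \<le> S" using kW_nonneg by (simp add: S_def)
 define C where "C = 2 * S + c"
 have "cmod ((LINT x|lborel. of_real (1 - (cmod (v x))\<^sup>2) * v x * \<psi> x) - (LINT x|lborel. g x * \<psi>' x)) \<le> C * \<tau> * (n2 \<psi> + n2 \<psi>')"
  if L: "energy_fn_eta v g" and cl: "close \<tau> v g" and t: "0 \<le> \<tau>" "\<tau> \<le> 1" and A: "ac \<psi> \<psi>'" and l: "l2 \<psi>" "l2 \<psi>'" for v g \<tau> \<psi> \<psi>'
 proof -
  interpret energy_fn_eta v g by fact
  have vc: "cmod (v x) \<le> c" for x using cb[OF L cl t] by auto
  define w where "w x = v x - of_real (kQ x)" for x
  have [measurable]: "w \<in> borel_measurable borel" unfolding w_def[abs_def] by measurable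
  have wt: "cmod (w x) \<le> \<tau> * (1 + \<bar>x\<bar>)" for x using cl by (simp add: close_def w_def)
  have hl: "l2 (%x. g x - of_real (kk x))" by (intro l2_diff g_l2 l2_of_real kk_l2)
  have hn: "n2 (%x. g x - of_real (kk x)) \<le> \<tau>" using cl by (simp add: close_def)
  have r2: "sqrt 2 \<le> 2" by (rule real_le_lsqrt) auto
  have b1: "norm (of_real (1 - (kQ x)\<^sup>2) * w x) \<le> (2 * \<tau>) * norm (kk x * (1 + \<bar>x\<bar>))" for x
  proof -
   have "norm (of_real (1 - (kQ x)\<^sup>2) * w x) = sqrt 2 * (kk x * cmod (w x))"
    unfolding kk_eq norm_mult norm_of_real using kk_pos[of x] by (simp add: abs_mult)
   also have "\<dots> \<le> 2 * (kk x * (\<tau> * (1 + \<bar>x\<bar>)))" using r2 kk_pos[of x] wt[of x] by (intro mult_mono) auto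
   also have "\<dots> = (2 * \<tau>) * norm (kk x * (1 + \<bar>x\<bar>))" using kk_pos[of x] by (simp add: abs_mult mult_ac)
   finally show ?thesis .
  qed
  have l1: "l2 (%x. of_real (1 - (kQ x)\<^sup>2) * w x)" by (rule l2_bound(1)[OF kk_wt_l2(1) _ b1]) measurable
  have "n2 (%x. of_real (1 - (kQ x)\<^sup>2) * w x) \<le> (2 * \<tau>) * n2 (%x. kk x * (1 + \<bar>x\<bar>))"
   by (rule l2_bound(2)[OF kk_wt_l2(1) _ b1]) (use t in auto)
  also have "\<dots> \<le> (2 * \<tau>) * S" unfolding S_def using kk_wt_l2(2) t by (intro mult_left_mono) auto
  finally have n1: "n2 (%x. of_real (1 - (kQ x)\<^sup>2) * w x) \<le> (2 * \<tau>) * S" .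
  note d2 = l2_bdd_mult[OF l2_of_real[OF dens_l2] v_meas vc]
  have "c * n2 (%x. complex_of_real (dens v x)) \<le> c * \<tau>" using cl c1 by (intro mult_left_mono) (auto simp: n2_of_real close_def)
  then have n2': "n2 (%x. v x * of_real (dens v x)) \<le> c * \<tau>" using d2(2) by linarith
  define a where "a x = of_real (1 - (kQ x)\<^sup>2) * w x - v x * of_real (dens v x)" for x
  have al: "l2 a" unfolding a_def[abs_def] by (intro l2_diff l1 d2)
  have an: "n2 a \<le> C * \<tau>"
   using n2_triangle_diff[OF l1 d2(1)] n1 n2' unfolding a_def[abs_def] C_def by (simp add: algebra_simps)
  have Qk: "l2 (%x. (1 - (kQ x)\<^sup>2) * kQ x)"
  proof (rule l2_bound(1)[OF kk_l2(1), where C = "sqrt 2"])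
   show "norm ((1 - (kQ x)\<^sup>2) * kQ x) \<le> sqrt 2 * norm (kk x)" for x
    unfolding kk_eq using kQ_bounds(1)[of x] by (simp add: abs_mult mult_left_le)
  qed measurable
  have e1: "of_real (1 - (cmod (v x))\<^sup>2) * v x * \<psi> x = a x * \<psi> x + of_real ((1 - (kQ x)\<^sup>2) * kQ x) * \<psi> x" for x
  proof -
   have "1 - (cmod (v x))\<^sup>2 = (1 - (kQ x)\<^sup>2) - dens v x" by (simp add: dens_def)
   then show ?thesis unfolding a_def w_def by (simp only: of_real_diff of_real_mult) (simp add: algebra_simps)
  qed
  have e2: "g x * \<psi>' x = (g x - of_real (kk x)) * \<psi>' x + of_real (kk x) * \<psi>' x" for x by (simp add: algebra_simps)
  have E1: "(LINT x|lborel. of_real (1 - (cmod (v x))\<^sup>2) * v x * \<psi> x) = (LINT x|lborel. a x * \<psi> x) + (LINT x|lborel. of_real ((1 - (kQ x)\<^sup>2) * kQ x) * \<psi> x)"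
   unfolding e1 by (rule Bochner_Integration.integral_add[OF l2_mult[OF al l(1)] l2_mult[OF l2_of_real[OF Qk] l(1)]])
  have E2: "(LINT x|lborel. g x * \<psi>' x) = (LINT x|lborel. (g x - of_real (kk x)) * \<psi>' x) + (LINT x|lborel. of_real (kk x) * \<psi>' x)"
   unfolding e2 by (rule Bochner_Integration.integral_add[OF l2_mult[OF hl l(2)] l2_mult[OF l2_of_real[OF kk_l2(1)] l(2)]])
  have "cmod ((LINT x|lborel. of_real (1 - (cmod (v x))\<^sup>2) * v x * \<psi> x) - (LINT x|lborel. g x * \<psi>' x))
    = cmod ((LINT x|lborel. a x * \<psi> x) - (LINT x|lborel. (g x - of_real (kk x)) * \<psi>' x))"
   unfolding E1 E2 kink_is_stationary[OF A l] by simp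
  also have "\<dots> \<le> n2 a * n2 \<psi> + n2 (%x. g x - of_real (kk x)) * n2 \<psi>'"
   by (rule order_trans[OF norm_triangle_ineq4 add_mono[OF n2_CS[OF al l(1)] n2_CS[OF hl l(2)]]])
  also have "\<dots> \<le> (C * \<tau>) * n2 \<psi> + (C * \<tau>) * n2 \<psi>'"
  proof (intro add_mono mult_right_mono an)
   have "1 * \<tau> \<le> C * \<tau>" using c1 S t unfolding C_def by (intro mult_right_mono) auto
   then show "n2 (%x. g x - of_real (kk x)) \<le> C * \<tau>" using hn by linarith
  qed auto
  finally show ?thesis by (simp add: distrib_left)
 qed
 moreover have "1 \<le> C" using c1 S by (simp add: C_def)
 ultimately show ?thesis by blast
qed

context gp_flow
begin

text \<open>The pairing is equivariant under translations and constant rotations, so the defect can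
  be evaluated in the frame in which the solution is close to the kink.\<close>

lemma Lam_shift:
 assumes u: "cmod u = 1"
 shows "cmod (Lam s \<phi> \<phi>') = cmod ((LINT x|lborel. of_real (1 - (cmod (u * V s (x + b)))\<^sup>2) * (u * V s (x + b)) * \<phi> (x + b)) - (LINT x|lborel. (u * G s (x + b)) * \<phi>' (x + b)))"
proof -
 have "(LINT x|lborel. of_real (1 - (cmod (u * V s (x + b)))\<^sup>2) * (u * V s (x + b)) * \<phi> (x + b)) = (LINT x|lborel. u * (of_real (eta s (x + b)) * V s (x + b) * \<phi> (x + b)))"
  by (rule Bochner_Integration.integral_cong[OF refl]) (use u in \<open>simp add: norm_mult eta_def\<close>)
 also have "\<dots> = u * (LINT x|lborel. of_real (eta s x) * V s x * \<phi> x)"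
  using integral_shift[of "%x. of_real (eta s x) * V s x * \<phi> x" b] by (simp only: integral_mult_right_zero)
 finally have 1: "(LINT x|lborel. of_real (1 - (cmod (u * V s (x + b)))\<^sup>2) * (u * V s (x + b)) * \<phi> (x + b)) = u * (LINT x|lborel. of_real (eta s x) * V s x * \<phi> x)" .
 have 2: "(LINT x|lborel. (u * G s (x + b)) * \<phi>' (x + b)) = u * (LINT x|lborel. G s x * \<phi>' x)"
  using integral_shift[of "%x. G s x * \<phi>' x" b] by (simp only: mult.assoc integral_mult_right_zero)
 show ?thesis unfolding 1 2 unfolding right_diff_distrib[symmetric] norm_mult u Lam_def by simp
qed

text \<open>The moment at a fixed position y is the pairing with a translate of \<open>kk\<close>,
  so its time derivative is i times \<open>Lam\<close>, and the mean value inequality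
  applies.\<close>

lemma moment_lipschitz:
 assumes B: "\<And>s. cmod (Lam s (%x. of_real (kk (x + - y))) (%x. of_real (- sqrt 2 * kQ (x + - y) * kk (x + - y)))) \<le> B"
 shows "cmod (moment (V s) y - moment (V t) y) \<le> B * \<bar>s - t\<bar>"
proof -
 define \<phi> where "\<phi> x = complex_of_real (kk (x + - y))" for x
 define \<phi>' where "\<phi>' x = complex_of_real (- sqrt 2 * kQ (x + - y) * kk (x + - y))" for x
 have a: "ac \<phi> \<phi>'" unfolding \<phi>_def[abs_def] \<phi>'_def[abs_def] by (rule ac_of_real[OF ac_shift[OF kk_ac]])
 have l: "l2 \<phi>" unfolding \<phi>_def[abs_def] by (rule l2_of_real[OF l2_shift(1)[OF kk_l2(1)]])
 have "l2 (%x. - sqrt 2 * kQ x * kk x)"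
  by (rule kk_deriv_l2)
 then have l': "l2 \<phi>'" unfolding \<phi>'_def[abs_def] by (intro l2_of_real l2_shift(1)[of "%x. - sqrt 2 * kQ x * kk x" "- y"])
 have f: "(LINT x|lborel. (V s x - V t x) * \<phi> x) = moment (V s) y - moment (V t) y" for s t
 proof -
  obtain M where M: "\<And>x. cmod (V s x) \<le> M" using V_bdd1 by blast
  obtain N where N: "\<And>x. cmod (V t x) \<le> N" using V_bdd1 by blast
  have i: "integrable lborel (%x. kk x *\<^sub>R V s (x + y))" "integrable lborel (%x. kk x *\<^sub>R V t (x + y))"
   by (rule kk_bdd_int[OF _ M], measurable) (rule kk_bdd_int[OF _ N], measurable)
  have "(LINT x|lborel. (V s x - V t x) * \<phi> x) = (LINT x|lborel. (V s (x + y) - V t (x + y)) * \<phi> (x + y))"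
   using integral_shift[of "%x. (V s x - V t x) * \<phi> x" y] by simp
  also have "\<dots> = (LINT x|lborel. kk x *\<^sub>R V s (x + y) - kk x *\<^sub>R V t (x + y))"
   by (rule Bochner_Integration.integral_cong[OF refl]) (simp add: \<phi>_def scaleR_conv_of_real algebra_simps)
  also have "\<dots> = moment (V s) y - moment (V t) y" unfolding moment_def by (rule Bochner_Integration.integral_diff[OF i])
  finally show ?thesis .
 qed
 have "norm ((moment (V s) y - moment (V t) y) - (moment (V t) y - moment (V t) y)) \<le> B * norm (s - t)"
 proof (rule differentiable_bound[of UNIV "%s. moment (V s) y - moment (V t) y" "%r h. h *\<^sub>R (\<i> * Lam r \<phi> \<phi>')"])
  show "((%s. moment (V s) y - moment (V t) y) has_derivative (%h. h *\<^sub>R (\<i> * Lam r \<phi> \<phi>'))) (at r within UNIV)" for r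
   using weak_eq_H1[OF a l l', of t r] unfolding f has_vector_derivative_def by simp
  show "onorm (%h. h *\<^sub>R (\<i> * Lam r \<phi> \<phi>')) \<le> B" for r
  proof (rule onorm_bound)
   have b: "cmod (Lam r \<phi> \<phi>') \<le> B" using B[of r] unfolding \<phi>_def[abs_def] \<phi>'_def[abs_def] .
   then show "0 \<le> B" using norm_ge_zero order_trans by blast
   show "norm (h *\<^sub>R (\<i> * Lam r \<phi> \<phi>')) \<le> B * norm h" for h :: real
    using mult_left_mono[OF b, of "\<bar>h\<bar>"] by (simp add: norm_mult mult.commute)
  qed
 qed auto
 then show ?thesis by simp
qed

end

text \<open>The centres \<open>b s\<close> come from a choice at each time and need not depend
  continuously on s, so they are compared over time steps of length at most one. During such a step
  the moment at the old centre stays small enough for \<open>distance_from_moment\<close>, which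
  over a long time would fail; adding up the steps gives the factor 1 + |t|.\<close>

theorem position_estimate:
 "\<exists>K\<ge>1. \<forall>V G \<delta>. gp_flow V G --> 0 \<le> \<delta> --> gp_flow.en V G 0 \<le> E0 + \<delta>\<^sup>2 --> cmod (moment (V 0) 0) \<le> \<delta> -->
  (\<forall>t a \<beta>. cmod (moment (V t) a) \<le> \<beta> --> K * (\<delta> + \<beta>) \<le> 1 --> \<bar>a\<bar> \<le> K * (\<delta> * (1 + \<bar>t\<bar>) + \<beta>))"
proof -
 obtain Ko where Ko: "1 \<le> Ko" and orb: "\<And>V G \<delta> s. gp_flow V G ==> 0 \<le> \<delta> ==> Ko * \<delta> \<le> 1 ==> gp_flow.en V G 0 \<le> E0 + \<delta>\<^sup>2 ==> cmod (moment (V 0) 0) \<le> \<delta> ==>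
  (\<exists>b u. cmod u = 1 \<and> close (Ko * \<delta>) (%x. u * V s (x + b)) (%x. u * G s (x + b)) \<and> cmod (moment (V s) b) \<le> Ko * \<delta>)"
  using orbital_stability by blast
 obtain Cd where Cd: "1 \<le> Cd" and dist0: "\<forall>v g \<tau> \<beta> z. energy_fn_eta v g --> close \<tau> v g --> 0 \<le> \<tau> --> cmod (moment v z) \<le> \<beta> --> Cd * (\<tau> + \<beta>) \<le> 1 --> \<bar>z\<bar> \<le> Cd * (\<tau> + \<beta>)"
  using distance_from_moment by (elim exE conjE)
 note dist = dist0[rule_format]
 obtain CL where CL: "1 \<le> CL" and def0: "\<forall>v g \<tau> \<psi> \<psi>'. energy_fn_eta v g --> close \<tau> v g --> 0 \<le> \<tau> --> \<tau> \<le> 1 --> ac \<psi> \<psi>' --> l2 \<psi> --> l2 \<psi>' -->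
   cmod ((LINT x|lborel. of_real (1 - (cmod (v x))\<^sup>2) * v x * \<psi> x) - (LINT x|lborel. g x * \<psi>' x)) \<le> CL * \<tau> * (n2 \<psi> + n2 \<psi>')"
  using stationary_defect by (elim exE conjE)
 note def = def0[rule_format]
 define kk' where "kk' x = - sqrt 2 * kQ x * kk x" for x
 have kl: "l2 kk'" unfolding kk'_def[abs_def]
  by (rule kk_deriv_l2)
 define N where "N = n2 kk + n2 kk'"
 have N: "0 \<le> N" by (simp add: N_def)
 define K2 where "K2 = CL * Ko * N"
 have K2: "0 \<le> K2" using CL Ko N by (simp add: K2_def)
 define K3 where "K3 = Cd * (2 * Ko + K2)"
 have K3: "Cd * Ko \<le> K3" "Cd * (Ko + 1) \<le> K3" "Cd \<le> K3" "1 \<le> K3" "Ko \<le> K3"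
 proof -
  show "Cd * Ko \<le> K3" "Cd * (Ko + 1) \<le> K3" unfolding K3_def using Cd Ko K2 by (auto intro!: mult_left_mono)
  moreover have "Cd * 1 \<le> Cd * Ko" "1 * Ko \<le> Cd * Ko" using Cd Ko by (intro mult_left_mono mult_right_mono; simp)+
  ultimately show "Cd \<le> K3" "1 \<le> K3" "Ko \<le> K3" using Cd by linarith+
 qed
 have main: "\<bar>a\<bar> \<le> (3 * K3) * (\<delta> * (1 + \<bar>t\<bar>) + \<beta>)"
  if fl: "gp_flow V G" and d: "0 \<le> \<delta>" and en0: "gp_flow.en V G 0 \<le> E0 + \<delta>\<^sup>2" and m0: "cmod (moment (V 0) 0) \<le> \<delta>"
   and ma: "cmod (moment (V t) a) \<le> \<beta>" and sm: "(3 * K3) * (\<delta> + \<beta>) \<le> 1" for V G \<delta> t a \<beta>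
 proof -
  interpret gp_flow V G by fact
  have b0: "0 \<le> \<beta>" using ma norm_ge_zero order_trans by blast
  have nn: "0 \<le> K3 * \<delta>" "0 \<le> K3 * \<beta>" using K3 d b0 by auto
  have sm2: "K3 * \<delta> + K3 * \<beta> \<le> 1" using sm nn unfolding distrib_left by (simp add: mult.assoc)
  have k3d: "K3 * \<delta> \<le> 1" using sm2 nn by linarith
  have kod: "Ko * \<delta> \<le> 1" using mult_right_mono[OF K3(5) d] k3d by linarith
  have kod0: "0 \<le> Ko * \<delta>" using Ko d by simp
  have "\<forall>s. \<exists>p. cmod (snd p) = 1 \<and> close (Ko * \<delta>) (%x. snd p * V s (x + fst p)) (%x. snd p * G s (x + fst p)) \<and> cmod (moment (V s) (fst p)) \<le> Ko * \<delta>"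
   using orb[OF fl d kod en0 m0] by simp
  then obtain P where P: "\<And>s. cmod (snd (P s)) = 1 \<and> close (Ko * \<delta>) (%x. snd (P s) * V s (x + fst (P s))) (%x. snd (P s) * G s (x + fst (P s))) \<and> cmod (moment (V s) (fst (P s))) \<le> Ko * \<delta>"
   by metis
  define b u where "b s = fst (P s)" and "u s = snd (P s)" for s
  have u1: "cmod (u s) = 1" and cl: "close (Ko * \<delta>) (%x. u s * V s (x + b s)) (%x. u s * G s (x + b s))" and mb: "cmod (moment (V s) (b s)) \<le> Ko * \<delta>" for s
   using P[of s] by (simp_all add: b_def u_def)
  have near: "\<bar>c - b s\<bar> \<le> Cd * (Ko * \<delta> + \<gamma>)" if "cmod (moment (V s) c) \<le> \<gamma>" "Cd * (Ko * \<delta> + \<gamma>) \<le> 1" for s c \<gamma>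
  proof (rule dist[OF shifted_energy_fn[OF u1] cl kod0 _ that(2)])
   show "cmod (moment (%x. u s * V s (x + b s)) (c - b s)) \<le> \<gamma>"
    unfolding moment_shifted norm_mult u1 using that(1) by simp
  qed
  have lam: "cmod (Lam s (%x. of_real (kk (x + - y))) (%x. of_real (- sqrt 2 * kQ (x + - y) * kk (x + - y)))) \<le> K2 * \<delta>" for s y
  proof -
   define \<phi> where "\<phi> x = complex_of_real (kk (x + (- y)))" for x
   define \<phi>' where "\<phi>' x = complex_of_real (kk' (x + (- y)))" for x
   have a: "ac \<phi> \<phi>'" unfolding \<phi>_def[abs_def] \<phi>'_def[abs_def] kk'_def by (rule ac_of_real[OF ac_shift[OF kk_ac]])
   have l: "l2 \<phi>" "l2 \<phi>'" unfolding \<phi>_def[abs_def] \<phi>'_def[abs_def] by (intro l2_of_real l2_shift(1) kk_l2 kl)+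
   have n: "n2 \<phi> = n2 kk" "n2 \<phi>' = n2 kk'" unfolding \<phi>_def[abs_def] \<phi>'_def[abs_def] n2_of_real by (intro l2_shift(2) kk_l2 kl)+
   have "cmod (Lam s \<phi> \<phi>') \<le> CL * (Ko * \<delta>) * (n2 (%x. \<phi> (x + b s)) + n2 (%x. \<phi>' (x + b s)))"
    unfolding Lam_shift[OF u1[of s], of s \<phi> \<phi>' "b s"]
    by (rule def[OF shifted_energy_fn[OF u1] cl kod0 kod ac_shift[OF a] l2_shift(1)[OF l(1)] l2_shift(1)[OF l(2)]])
   also have "\<dots> = K2 * \<delta>" unfolding l2_shift(2)[OF l(1)] l2_shift(2)[OF l(2)] n K2_def N_def by simp
   finally show ?thesis unfolding \<phi>_def[abs_def] \<phi>'_def[abs_def] kk'_def .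
  qed
  have step: "\<bar>b r - b s\<bar> \<le> K3 * \<delta>" if "\<bar>s - r\<bar> \<le> 1" for r s
  proof -
   have "cmod (moment (V s) (b r)) \<le> cmod (moment (V r) (b r)) + cmod (moment (V s) (b r) - moment (V r) (b r))"
    using norm_triangle_ineq[of "moment (V r) (b r)" "moment (V s) (b r) - moment (V r) (b r)"] by simp
   also have "cmod (moment (V s) (b r) - moment (V r) (b r)) \<le> K2 * \<delta> * \<bar>s - r\<bar>" by (rule moment_lipschitz[OF lam])
   also have "\<dots> \<le> K2 * \<delta>" using that K2 d by (intro mult_left_le) auto
   finally have "cmod (moment (V s) (b r)) \<le> Ko * \<delta> + K2 * \<delta>" using mb[of r] by linarith
   moreover have e: "Cd * (Ko * \<delta> + (Ko * \<delta> + K2 * \<delta>)) = K3 * \<delta>" by (simp add: K3_def algebra_simps)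
   ultimately show ?thesis using near[of s "b r" "Ko * \<delta> + K2 * \<delta>"] k3d unfolding e by blast
  qed
  have iter: "\<bar>b r - b 0\<bar> \<le> real n * (K3 * \<delta>)" if "\<bar>r\<bar> \<le> real n" for n r
   using that
  proof (induction n arbitrary: r)
   case 0
   then show ?case by simp
  next
   case (Suc n)
   \<comment> \<open>The preceding point on the way from 0 to r: it is within distance one of r, and
     its modulus is at most n.\<close>
   define r' where "r' = r * (real n / real (Suc n))"
   have "\<bar>r'\<bar> = \<bar>r\<bar> * (real n / real (Suc n))" by (simp add: r'_def abs_mult)
   also have "\<dots> \<le> real (Suc n) * (real n / real (Suc n))" using Suc.prems by (intro mult_right_mono) auto
   finally have "\<bar>r'\<bar> \<le> real n" by simp
   then have i: "\<bar>b r' - b 0\<bar> \<le> real n * (K3 * \<delta>)" by (rule Suc.IH)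
   have "r' - r = - (r / real (Suc n))" by (simp add: r'_def field_simps)
   then have "\<bar>r' - r\<bar> = \<bar>r\<bar> / real (Suc n)" by simp
   also have "\<dots> \<le> 1" using Suc.prems by simp
   finally have "\<bar>b r - b r'\<bar> \<le> K3 * \<delta>" by (rule step)
   then have "\<bar>b r - b 0\<bar> \<le> K3 * \<delta> + real n * (K3 * \<delta>)" using i by linarith
   then show ?case by (simp add: distrib_right)
  qed
  have "\<bar>0 - b 0\<bar> \<le> Cd * (Ko * \<delta> + \<delta>)"
  proof (rule near[OF m0])
   have "Cd * (Ko * \<delta> + \<delta>) = (Cd * (Ko + 1)) * \<delta>" by (simp add: algebra_simps)
   also have "\<dots> \<le> K3 * \<delta>" using K3(2) d by (intro mult_right_mono)
   finally show "Cd * (Ko * \<delta> + \<delta>) \<le> 1" using k3d by linarith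
  qed
  also have "Cd * (Ko * \<delta> + \<delta>) = (Cd * (Ko + 1)) * \<delta>" by (simp add: algebra_simps)
  also have "\<dots> \<le> K3 * \<delta>" using K3(2) d by (intro mult_right_mono)
  finally have bz: "\<bar>b 0\<bar> \<le> K3 * \<delta>" by simp
  have "\<bar>b t - b 0\<bar> \<le> real (nat \<lceil>\<bar>t\<bar>\<rceil>) * (K3 * \<delta>)" by (rule iter) linarith
  also have "\<dots> \<le> (1 + \<bar>t\<bar>) * (K3 * \<delta>)" by (intro mult_right_mono nn) linarith
  finally have bt: "\<bar>b t\<bar> \<le> K3 * \<delta> + (1 + \<bar>t\<bar>) * (K3 * \<delta>)" using bz by linarith
  have ca: "Cd * (Ko * \<delta> + \<beta>) \<le> K3 * \<delta> + K3 * \<beta>"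
   using mult_right_mono[OF K3(1) d] mult_right_mono[OF K3(3) b0] unfolding distrib_left by (simp add: mult.assoc)
  then have "\<bar>a - b t\<bar> \<le> K3 * \<delta> + K3 * \<beta>" using near[OF ma] sm2 by linarith
  then have "\<bar>a\<bar> \<le> 2 * (K3 * \<delta>) + (1 + \<bar>t\<bar>) * (K3 * \<delta>) + K3 * \<beta>" using bt by linarith
  also have "\<dots> \<le> 2 * ((1 + \<bar>t\<bar>) * (K3 * \<delta>)) + (1 + \<bar>t\<bar>) * (K3 * \<delta>) + 3 * (K3 * \<beta>)"
  proof (rule add_mono[OF add_mono[OF mult_left_mono order_refl]])
   show "K3 * \<delta> \<le> (1 + \<bar>t\<bar>) * (K3 * \<delta>)" using nn mult_right_mono[of 1 "1 + \<bar>t\<bar>" "K3 * \<delta>"] by simp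
   show "K3 * \<beta> \<le> 3 * (K3 * \<beta>)" using nn by linarith
  qed simp
  also have "\<dots> = (3 * K3) * (\<delta> * (1 + \<bar>t\<bar>) + \<beta>)" by (simp add: algebra_simps)
  finally show ?thesis .
 qed
 show ?thesis by (intro exI[of _ "3 * K3"] conjI allI impI main) (use K3 in auto)
qed

section \<open>From weak solutions to flows\<close>

lemma AE_le_imp_le_on_open:
 fixes f :: "real => real"
 assumes f: "continuous_on UNIV f" and U: "open U" and ae: "AE x in lborel. x \<in> U --> f x \<le> M" and x: "x \<in> U"
 shows "f x \<le> M"
proof (rule ccontr)
 assume n: "\<not> f x \<le> M"
 define N where "N = U \<inter> {y. M < f y}"
 have o: "open N" unfolding N_def by (intro open_Int U open_Collect_less continuous_on_const f)
 have "x \<in> N" using x n by (simp add: N_def)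
 then obtain e where e: "0 < e" "ball x e \<subseteq> N" using o open_contains_ball by blast
 have "AE y in lborel. y \<notin> N" using ae by eventually_elim (auto simp: N_def)
 then have "N \<in> null_sets lborel" using o by (subst AE_iff_null_sets) auto
 moreover have "{x - e / 2..x + e / 2} \<subseteq> N" using e by (auto simp: subset_eq dist_real_def)
 ultimately have "emeasure lborel {x - e / 2..x + e / 2} = 0"
  using emeasure_mono[of "{x - e / 2..x + e / 2}" N lborel] o by (auto simp: null_sets_def)
 then show False using e(1) by (simp add: emeasure_lborel_Icc_eq split: if_splits)
qed

lemma has_weak_deriv_AE:
 assumes W: "has_weak_deriv F g" and ae: "AE x in lborel. f x = F x" and m: "f \<in> borel_measurable borel"
 shows "has_weak_deriv f g"
proof -
 have F: "loc_int F" and g: "loc_int g" using W by (auto simp: has_weak_deriv_def)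
 have [measurable]: "F \<in> borel_measurable borel" using F by (simp add: loc_int_def)
 note [measurable] = m
 have "set_integrable lborel {a..b} f" for a b
 proof -
  have "integrable lborel (%x. indicator {a..b} x *\<^sub>R f x) = integrable lborel (%x. indicator {a..b} x *\<^sub>R F x)"
   by (rule integrable_cong_AE) (use ae in \<open>auto\<close>)
  then show ?thesis using F by (auto simp: loc_int_def set_integrable_def)
 qed
 then have "loc_int f" by (simp add: loc_int_def)
 moreover have "(LINT x|lborel. f x * complex_of_real (deriv \<phi> x)) = (LINT x|lborel. F x * complex_of_real (deriv \<phi> x))" if "test_fun \<phi>" for \<phi>
 proof -
  have [measurable]: "deriv \<phi> \<in> borel_measurable borel" by (rule l2_meas'[OF test_fun_l2(1)[OF test_fun_deriv[OF that]]])
  show ?thesis by (rule integral_cong_AE) (use ae in auto)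
 qed
 ultimately show ?thesis using W by (simp add: has_weak_deriv_def)
qed

lemma L2norm_AE:
 assumes "AE x in lborel. f x = h x" "f \<in> borel_measurable borel" "l2 h"
 shows "L2norm f = ereal (n2 h)"
 using n2_AE_cong[OF assms(1,2) l2_meas'[OF assms(3)]] assms(3) L2norm_n2[of f] by simp

lemma AE_shift:
 fixes d :: "real => complex"
 assumes m: "d \<in> borel_measurable borel" and ae: "AE x in lborel. d x = 0"
 shows "AE x in lborel. d (x + a) = 0"
proof -
 have "AE x in distr lborel borel ((+) a). d x = 0" using ae unfolding lborel_distr_plus .
 then have "AE x in lborel. d (a + x) = 0" by (subst (asm) AE_distr_iff) (use m in measurable)
 then show ?thesis by (simp add: add.commute)
qed

text \<open>H1 information is given only for v t - v0, so representatives are chosen for v0 and for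
  each difference, and \<open>V t\<close> is their sum. The extended-real H1 distances turn into
  real L2 distances of representatives, because \<open>wderiv\<close> is determined almost
  everywhere.\<close>

lemma flow_of_solution:
 assumes v0: "v0 \<in> X1" and S: "GP_solution v0 v"
 obtains V G where "gp_flow V G" "\<And>t. AE x in lborel. v t x = V t x" "\<And>t. v t \<in> borel_measurable borel"
proof -
 obtain g0 where g0: "has_weak_deriv v0 g0" "L2 g0" using v0 by (auto simp: X1_def)
 have v0m [measurable]: "v0 \<in> borel_measurable borel" using v0 by (simp add: X1_def)
 obtain F0 where F0: "ac F0 g0" "AE x in lborel. v0 x = F0 x" using weak_deriv_ac_representative[OF g0(1)] by blast
 have H: "H1 (%x. v t x - v0 x)" for t using S by (simp add: GP_solution_def)
 have "\<exists>p. ac (fst p) (snd p) \<and> l2 (snd p) \<and> (AE x in lborel. v t x - v0 x = fst p x)" for t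
 proof -
  obtain g where g: "has_weak_deriv (%x. v t x - v0 x) g" "L2 g" using H[of t] by (auto simp: H1_def)
  obtain F where "ac F g" "AE x in lborel. v t x - v0 x = F x" using weak_deriv_ac_representative[OF g(1)] by blast
  then show ?thesis using g(2) by (intro exI[of _ "(F, g)"]) (simp add: L2_l2)
 qed
 then obtain P where P: "\<And>t. ac (fst (P t)) (snd (P t)) \<and> l2 (snd (P t)) \<and> (AE x in lborel. v t x - v0 x = fst (P t) x)" by metis
 define W g where "W t = fst (P t)" and "g t = snd (P t)" for t
 have W: "ac (W t) (g t)" and gl: "l2 (g t)" and ae: "AE x in lborel. v t x - v0 x = W t x" for t
  using P[of t] by (simp_all add: W_def g_def)
 have dl: "l2 (%x. v t x - v0 x)" for t using H[of t] by (simp add: H1_def L2_l2)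
 have Wl: "l2 (W t)" for t by (rule l2_AE_cong[OF ae dl ac_meas[OF W]])
 define V where "V t x = F0 x + W t x" for t x
 define G where "G t x = g0 x + g t x" for t x
 have VG: "ac (V t) (G t)" for t unfolding V_def[abs_def] G_def[abs_def] by (rule ac_add[OF F0(1) W])
 have Gl: "l2 (G t)" for t unfolding G_def[abs_def] using g0(2) gl by (intro l2_add) (simp_all add: L2_l2)
 have vm [measurable]: "v t \<in> borel_measurable borel" for t
 proof -
  have "(%x. (v t x - v0 x) + v0 x) \<in> borel_measurable borel" by (rule borel_measurable_add[OF l2_meas'[OF dl] v0m])
  then show ?thesis by simp
 qed
 have Vm [measurable]: "V t \<in> borel_measurable borel" for t by (rule ac_meas[OF VG])
 have vV: "AE x in lborel. v t x = V t x" for t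
  using ae[of t] F0(2) by eventually_elim (simp add: V_def algebra_simps)
 have v00: "v 0 = v0" using S by (simp add: GP_solution_def)
 have VW: "V s x - V t x = W s x - W t x" and Gg: "G s x - G t x = g s x - g t x" for s t x by (simp_all add: V_def G_def)
 have dm: "(%x. (v s x - v0 x) - (v t x - v0 x)) \<in> borel_measurable borel" for s t by measurable
 have dd: "AE x in lborel. (v s x - v0 x) - (v t x - v0 x) = V s x - V t x" for s t
  using vV[of s] vV[of t] by eventually_elim simp
 have Vdl: "l2 (%x. V s x - V t x)" for s t unfolding VW by (intro l2_diff Wl)
 have Gdl: "l2 (%x. G s x - G t x)" for s t by (intro l2_diff Gl)
 have h1: "H1norm (%x. (v s x - v0 x) - (v t x - v0 x)) = ereal (n2 (%x. V s x - V t x) + n2 (%x. G s x - G t x))" for s t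
 proof -
  have w: "has_weak_deriv (%x. (v s x - v0 x) - (v t x - v0 x)) (%x. G s x - G t x)"
   by (rule has_weak_deriv_AE[OF ac_has_weak_deriv[OF ac_diff[OF VG VG]] dd dm])
  show ?thesis unfolding H1norm_def
   using L2norm_AE[OF dd dm Vdl] L2norm_AE[OF wderiv_AE[OF w] Gdl] by simp
 qed
 have lim: "((%s. n2 (%x. V s x - V t x) + n2 (%x. G s x - G t x)) \<longlongrightarrow> 0) (at t)" for t
 proof -
  have "((%s. H1norm (%x. (v s x - v0 x) - (v t x - v0 x))) \<longlongrightarrow> 0) (at t)" using S by (simp add: GP_solution_def)
  then show ?thesis unfolding h1 zero_ereal_def by simp
 qed
 have flow: "gp_flow V G"
 proof
  show "ac (V t) (G t)" "l2 (G t)" "l2 (%x. V s x - V t x)" for s t by (fact VG Gl Vdl)+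
  obtain M where M: "AE x in lborel. cmod (v0 x) \<le> M" using v0 by (auto simp: X1_def)
  have "AE x in lborel. x \<in> UNIV --> cmod (V 0 x) \<le> M" using M vV[of 0] unfolding v00 by eventually_elim simp
  then have "cmod (V 0 x) \<le> M" for x
   by (rule AE_le_imp_le_on_open[OF continuous_on_norm[OF ac_cont[OF VG]] open_UNIV _ UNIV_I])
  then show "\<exists>B. \<forall>x. cmod (V 0 x) \<le> B" by blast
  have el: "l2 (%x. complex_of_real (1 - (cmod (v0 x))\<^sup>2))" using v0 unfolding X1_def L2_l2 by blast
  have ea: "AE x in lborel. complex_of_real (1 - (cmod (v0 x))\<^sup>2) = complex_of_real (1 - (cmod (V 0 x))\<^sup>2)"
   using vV[of 0] unfolding v00 by eventually_elim simp
  have em: "(%x. complex_of_real (1 - (cmod (V 0 x))\<^sup>2)) \<in> borel_measurable borel" by measurable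
  from l2_Re(1)[OF l2_AE_cong[OF ea el em]] show "l2 (%x. 1 - (cmod (V 0 x))\<^sup>2)" unfolding Re_complex_of_real .
  show "((%s. n2 (%x. V s x - V t x)) \<longlongrightarrow> 0) (at t)" "((%s. n2 (%x. G s x - G t x)) \<longlongrightarrow> 0) (at t)" for t
   by (rule Lim_null_comparison[OF always_eventually lim]; simp)+
  fix \<phi> t assume p: "test_fun \<phi>"
  have [measurable]: "\<phi> \<in> borel_measurable borel" "deriv (deriv \<phi>) \<in> borel_measurable borel"
   by (intro l2_meas' test_fun_l2(1) test_fun_deriv p)+
  have 1: "(LINT x|lborel. v s x * complex_of_real (\<phi> x)) = (LINT x|lborel. V s x * complex_of_real (\<phi> x))" for s
   by (rule integral_cong_AE) (use vV[of s] in auto)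
  have 2: "(LINT x|lborel. v s x * complex_of_real (deriv (deriv \<phi>) x)) = (LINT x|lborel. V s x * complex_of_real (deriv (deriv \<phi>) x))" for s
   by (rule integral_cong_AE) (use vV[of s] in auto)
  have 3: "(LINT x|lborel. v s x * complex_of_real ((cmod (v s x))\<^sup>2 - 1) * complex_of_real (\<phi> x)) = (LINT x|lborel. V s x * complex_of_real ((cmod (V s x))\<^sup>2 - 1) * complex_of_real (\<phi> x))" for s
   by (rule integral_cong_AE) (use vV[of s] in auto)
  have "((%s. LINT x|lborel. v s x * complex_of_real (\<phi> x)) has_vector_derivative
      (\<i> * (LINT x|lborel. v t x * complex_of_real (deriv (deriv \<phi>) x))
      - \<i> * (LINT x|lborel. v t x * complex_of_real ((cmod (v t x))\<^sup>2 - 1) * complex_of_real (\<phi> x)))) (at t)"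
   using S p unfolding GP_solution_def by blast
  then show "((%s. LINT x|lborel. V s x * complex_of_real (\<phi> x)) has_vector_derivative
      (\<i> * (LINT x|lborel. V t x * complex_of_real (deriv (deriv \<phi>) x))
      - \<i> * (LINT x|lborel. V t x * complex_of_real ((cmod (V t x))\<^sup>2 - 1) * complex_of_real (\<phi> x)))) (at t)"
   unfolding 1 2 3 .
 qed
 show ?thesis by (rule that[OF flow vV vm])
qed

text \<open>The essential supremum bounds the continuous representatives everywhere on the open
  interval, which contains 0 as A is positive. The value at 0 is the only pointwise information
  kept.\<close>

lemma dAX_le:
 assumes A: "0 < A" and F: "ac F g" "AE x in lborel. f x = F x" "f \<in> borel_measurable borel"
  and H: "ac H h" "AE x in lborel. k x = H x" "k \<in> borel_measurable borel"
  and le: "dAX A f k \<le> ereal e"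
 shows "cmod (F 0 - H 0) \<le> e" "n2 (%x. g x - h x) \<le> e" "l2 (%x. cmod (F x) - cmod (H x))" "n2 (%x. cmod (F x) - cmod (H x)) \<le> e"
proof -
 note [measurable] = F(3) H(3) ac_meas[OF F(1)] ac_meas[OF H(1)]
 let ?M = "restrict_space lborel {-A..A}"
 let ?s = "esssup ?M (%x. ereal (cmod (f x - k x)))"
 let ?a = "L2norm (%x. wderiv f x - wderiv k x)"
 let ?b = "L2norm (%x. complex_of_real (cmod (f x) - cmod (k x)))"
 \<comment> \<open>The interval has positive measure, so the essential supremum of a nonnegative
   function on it is nonnegative. Only then is each of the three summands bounded by their
   sum.\<close>
 have s0: "0 \<le> ?s"
 proof (rule ccontr)
  assume "\<not> 0 \<le> ?s"
  then have "?s < 0" by simp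
  moreover have "AE x in ?M. ereal (cmod (f x - k x)) \<le> ?s" by (rule esssup_AE)
  ultimately have "AE x in ?M. False" by (auto elim!: eventually_mono dest: le_less_trans)
  then have "AE x in lborel. x \<notin> {-A..A}" by (subst (asm) AE_restrict_space_iff) auto
  then have "{-A..A} \<in> null_sets lborel" by (subst AE_iff_null_sets) auto
  then show False using A by (simp add: null_sets_def emeasure_lborel_Icc_eq)
 qed
 have a0: "0 \<le> ?a" and b0: "0 \<le> ?b" by (rule L2norm_nonneg)+
 have sum: "?s + ?a + ?b \<le> ereal e" using le by (simp add: dAX_def)
 have sa: "?s \<le> ?s + ?a" "?a \<le> ?s + ?a" "?s + ?a \<le> ?s + ?a + ?b" "?b \<le> ?s + ?a + ?b"
  using s0 a0 b0 by (simp_all add: ereal_le_add_self ereal_le_add_self2 add_nonneg_nonneg)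
 then have parts: "?s \<le> ereal e" "?a \<le> ereal e" "?b \<le> ereal e" using sum by (meson order_trans)+
 have "AE x in ?M. ereal (cmod (f x - k x)) \<le> ?s" by (rule esssup_AE)
 then have "AE x in ?M. cmod (f x - k x) \<le> e"
 proof eventually_elim
  case (elim x)
  then have "ereal (cmod (f x - k x)) \<le> ereal e" using parts(1) by (rule order_trans)
  then show ?case by simp
 qed
 then have "AE x in lborel. x \<in> {-A..A} --> cmod (f x - k x) \<le> e" by (subst (asm) AE_restrict_space_iff) auto
 with F(2) H(2) have "AE x in lborel. x \<in> {-A<..<A} --> cmod (F x - H x) \<le> e" by eventually_elim auto
 then show "cmod (F 0 - H 0) \<le> e"
  using A by (intro AE_le_imp_le_on_open[of "%x. cmod (F x - H x)" "{-A<..<A}" e 0] continuous_on_norm continuous_on_diff ac_cont[OF F(1)] ac_cont[OF H(1)]) auto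
 have wf: "has_weak_deriv f g" by (rule has_weak_deriv_AE[OF ac_has_weak_deriv[OF F(1)] F(2,3)])
 have wk: "has_weak_deriv k h" by (rule has_weak_deriv_AE[OF ac_has_weak_deriv[OF H(1)] H(2,3)])
 have "?a < \<infinity>" using parts(2) by (rule le_less_trans) simp
 then have al: "l2 (%x. wderiv f x - wderiv k x)" by (rule L2norm_finite)
 have aae: "AE x in lborel. wderiv f x - wderiv k x = g x - h x"
  using wderiv_AE(1)[OF wf] wderiv_AE(1)[OF wk] by eventually_elim simp
 have [measurable]: "g \<in> borel_measurable borel" "h \<in> borel_measurable borel" by (rule ac_meas_deriv[OF F(1)], rule ac_meas_deriv[OF H(1)])
 have ghl: "l2 (%x. g x - h x)" by (rule l2_AE_cong[OF aae al]) measurable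
 show "n2 (%x. g x - h x) \<le> e" using parts(2) L2norm_AE[OF aae l2_meas'[OF al] ghl] by simp
 have "?b < \<infinity>" using parts(3) by (rule le_less_trans) simp
 then have bl: "l2 (%x. complex_of_real (cmod (f x) - cmod (k x)))" by (rule L2norm_finite)
 have bae: "AE x in lborel. complex_of_real (cmod (f x) - cmod (k x)) = complex_of_real (cmod (F x) - cmod (H x))"
  using F(2) H(2) by eventually_elim simp
 have bl': "l2 (%x. complex_of_real (cmod (F x) - cmod (H x)))" by (rule l2_AE_cong[OF bae bl]) measurable
 from l2_Re(1)[OF this] show "l2 (%x. cmod (F x) - cmod (H x))" by simp
 show "n2 (%x. cmod (F x) - cmod (H x)) \<le> e"
  using parts(3) L2norm_AE[OF bae l2_meas'[OF bl] bl'] n2_of_real[of "%x. cmod (F x) - cmod (H x)"] by simp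
qed

section \<open>Functions close to the kink, and the conclusion\<close>

lemma kink_kQ: "kink x = of_real (kQ x)" by (simp add: kink_def kQ_def)

text \<open>The value at 0 and the L2 norm of the derivative bound the difference from the rotated
  kink by (2 + |x|) e, which \<open>kk\<close> integrates; the kink itself has moment zero.\<close>

lemma moment_small_near_kink:
 assumes F: "ac F g" "l2 g" and c: "cmod c = 1" and b: "\<And>x. cmod (F x) \<le> B"
  and z: "cmod (F 0 - c * of_real (kQ 0)) \<le> e" and n: "n2 (%x. g x - c * of_real (kk x)) \<le> e"
 shows "cmod (moment F 0) \<le> 2 * kW * e"
proof -
 define w where "w x = F x - c * of_real (kQ x)" for x
 have wa: "ac w (%x. g x - c * of_real (kk x))" unfolding w_def[abs_def] by (rule ac_diff[OF F(1) ac_cmult[OF ac_of_real[OF kQ_ac]]])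
 have hl: "l2 (%x. g x - c * of_real (kk x))" by (intro l2_diff F(2) l2_cmult(1) l2_of_real kk_l2)
 note [measurable] = ac_meas[OF F(1)] ac_meas[OF wa]
 have e0: "0 \<le> e" using z norm_ge_zero order_trans by blast
 have wb: "cmod (w x) \<le> (2 * e) * (1 + \<bar>x\<bar>)\<^sup>2" for x
 proof -
  have "cmod (w x) \<le> cmod (w 0) + cmod (w x - w 0)" using norm_triangle_ineq[of "w 0" "w x - w 0"] by simp
  also have "\<dots> \<le> e + sqrt \<bar>x\<bar> * e"
   using z order_trans[OF ac_l2_le[OF wa hl, of x 0] mult_left_mono[OF n]] unfolding w_def by (intro add_mono) auto
  also have "\<dots> \<le> e + (1 + \<bar>x\<bar>) * e" using e0 sqrt_le_one_plus[of "\<bar>x\<bar>"] by (intro add_left_mono mult_right_mono) auto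
  also have "\<dots> = (2 + \<bar>x\<bar>) * e" by (simp add: algebra_simps)
  also have "\<dots> \<le> (2 * (1 + \<bar>x\<bar>)\<^sup>2) * e" using e0 by (intro mult_right_mono) (auto simp: power2_sum)
  finally show ?thesis by (simp add: mult_ac)
 qed
 have i1: "integrable lborel (%x. kk x *\<^sub>R F x)" by (rule kk_bdd_int[OF _ b]) measurable
 have i2: "integrable lborel (%x. kk x *\<^sub>R (c * of_real (kQ x)))"
  by (rule kk_bdd_int[where C = 1]) (use c kQ_bounds(1) less_imp_le in \<open>auto simp: norm_mult\<close>)
 have "(LINT x|lborel. kk x *\<^sub>R (c * of_real (kQ x))) = (LINT x|lborel. c * complex_of_real (kk x * kQ x))"
  by (rule Bochner_Integration.integral_cong[OF refl]) (simp add: scaleR_conv_of_real)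
 also have "\<dots> = 0" unfolding integral_mult_right_zero integral_complex_of_real kk_kQ_integral by simp
 finally have "moment F 0 = (LINT x|lborel. kk x *\<^sub>R F x) - (LINT x|lborel. kk x *\<^sub>R (c * of_real (kQ x)))" by (simp add: moment_def)
 also have "\<dots> = (LINT x|lborel. kk x *\<^sub>R w x)"
  unfolding Bochner_Integration.integral_diff[OF i1 i2, symmetric] by (simp add: w_def scaleR_diff_right)
 finally have "cmod (moment F 0) = norm (LINT x|lborel. kk x *\<^sub>R w x)" by simp
 also have "\<dots> \<le> (2 * e) * kW" unfolding kW_def by (rule kk_times_integrable(2)[OF _ wb]) measurable
 finally show ?thesis by (simp add: mult_ac)
qed

text \<open>On unit windows the closeness of |v| to |Q| and the bound on the derivative control the
  supremum of |v|. Then dens = (|v| + |Q|) (|v| - |Q|) is O(e) in L2. First-order terms are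
  estimated rather than cancelled, so the excess is linear in e.\<close>

lemma energy_near_kink:
 "\<exists>C\<ge>1. \<forall>v g e. energy_fn_eta v g --> 0 \<le> e --> e \<le> 1 --> n2 (%x. g x - of_real (kk x)) \<le> e -->
   l2 (%x. cmod (v x) - \<bar>kQ x\<bar>) --> n2 (%x. cmod (v x) - \<bar>kQ x\<bar>) \<le> e --> energy_fn_eta.en v g \<le> E0 + C * e"
proof -
 define a where "a = n2 kk"
 define b where "b = n2 (%x. 1 - (kQ x)\<^sup>2)"
 have ab: "0 \<le> a" "0 \<le> b" by (simp_all add: a_def b_def)
 define B where "B = 4 + a"
 define C where "C = 1 + (2 * a + 1) + (2 * b * B + B\<^sup>2)"
 have "energy_fn_eta.en v g \<le> E0 + C * e"
  if L: "energy_fn_eta v g" and e: "0 \<le> e" "e \<le> 1" and n: "n2 (%x. g x - of_real (kk x)) \<le> e"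
   and rl: "l2 (%x. cmod (v x) - \<bar>kQ x\<bar>)" and rn: "n2 (%x. cmod (v x) - \<bar>kQ x\<bar>) \<le> e" for v g e
 proof -
  interpret energy_fn_eta v g by fact
  have hl: "l2 (%x. g x - of_real (kk x))" by (intro l2_diff g_l2 l2_of_real kk_l2)
  have gn: "n2 g \<le> a + e"
   using n2_triangle[OF hl l2_of_real[OF kk_l2(1)]] n unfolding a_def by (simp add: n2_of_real)
  define \<rho> where "\<rho> x = cmod (v x) - \<bar>kQ x\<bar>" for x
  have rl': "l2 \<rho>" and rn': "n2 \<rho> \<le> e" using rl rn by (simp_all add: \<rho>_def[abs_def])
  have ic: "set_integrable lborel {y..y+1} (%x::real. 1 :: real)" for y :: real
   unfolding set_integrable_def by (intro borel_integrable_compact) auto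
  have il: "(LINT x:{y..y+1}|lborel. (1::real)) = 1" for y :: real by (simp add: set_lebesgue_integral_def)
  have vB: "cmod (v y) \<le> 3 + a" for y
  proof -
   have ir: "set_integrable lborel {y..y+1} (%x. norm (\<rho> x))" by (intro set_integrable_norm l2_set_integrable rl')
   have iv: "set_integrable lborel {y..y+1} (%x. norm (v x))"
    unfolding set_integrable_def by (intro borel_integrable_compact continuous_on_norm ac_cont[OF v_ac]) auto
   have "(LINT x:{y..y+1}|lborel. norm (v x)) \<le> (LINT x:{y..y+1}|lborel. norm (\<rho> x) + 1)"
   proof (rule set_integral_mono[OF iv set_integral_add(1)[OF ir ic]])
    show "norm (v x) \<le> norm (\<rho> x) + 1" for x using kQ_bounds(1)[of x] by (simp add: \<rho>_def)
   qed
   also have "\<dots> = (LINT x:{y..y+1}|lborel. norm (\<rho> x)) + 1" unfolding set_integral_add(2)[OF ir ic] il ..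
   also have "\<dots> \<le> e + 1" using n2_set_CS[OF rl', of y "y + 1"] rn' by simp
   finally have "(LINT x:{y..y+1}|lborel. norm (v x)) \<le> e + 1" .
   moreover have "(LINT x:{y..y+1}|lborel. norm (g x)) \<le> a + e" using n2_set_CS[OF g_l2, of y "y + 1"] gn by simp
   ultimately show ?thesis using ac_le_unit_window[OF v_ac, of y] e by linarith
  qed
  have dn: "n2 (dens v) \<le> B * e"
  proof -
   have "n2 (dens v) \<le> B * n2 \<rho>"
   proof (rule l2_bound(2)[OF rl'])
    show "dens v \<in> borel_measurable borel" by (rule l2_meas'[OF dens_l2])
    fix x
    have "dens v x = (cmod (v x) + \<bar>kQ x\<bar>) * \<rho> x" by (simp add: dens_def \<rho>_def power2_eq_square algebra_simps)
    then have "norm (dens v x) = (cmod (v x) + \<bar>kQ x\<bar>) * norm (\<rho> x)" by (simp add: abs_mult)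
    also have "\<dots> \<le> B * norm (\<rho> x)" using vB[of x] kQ_bounds(1)[of x] by (intro mult_right_mono) (auto simp: B_def)
    finally show "norm (dens v x) \<le> B * norm (\<rho> x)" .
   qed (use ab in \<open>simp add: B_def\<close>)
   also have "\<dots> \<le> B * e" using rn' ab by (intro mult_left_mono) (auto simp: B_def)
   finally show ?thesis .
  qed
  have "n2 (%x. 1 - (cmod (v x))\<^sup>2) \<le> b + B * e"
  proof -
   have eq: "1 - (cmod (v x))\<^sup>2 = (1 - (kQ x)\<^sup>2) - dens v x" for x by (simp add: dens_def)
   show ?thesis using n2_triangle_diff[OF one_minus_kQ_l2 dens_l2] dn unfolding eq b_def by linarith
  qed
  then have "(n2 (%x. 1 - (cmod (v x))\<^sup>2))\<^sup>2 \<le> (b + B * e)\<^sup>2" by (intro power_mono) auto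
  moreover have "(b + B * e)\<^sup>2 = b\<^sup>2 + 2 * b * B * e + B\<^sup>2 * (e * e)" by (simp add: power2_eq_square algebra_simps)
  moreover have "B\<^sup>2 * (e * e) \<le> B\<^sup>2 * e" using e by (intro mult_left_mono) (auto simp: mult_left_le)
  ultimately have 1: "(n2 (%x. 1 - (cmod (v x))\<^sup>2))\<^sup>2 \<le> b\<^sup>2 + (2 * b * B + B\<^sup>2) * e" unfolding distrib_right by linarith
  have "(n2 g)\<^sup>2 \<le> (a + e)\<^sup>2" using gn by (intro power_mono) auto
  moreover have "(a + e)\<^sup>2 = a\<^sup>2 + 2 * a * e + e * e" by (simp add: power2_eq_square algebra_simps)
  moreover have "e * e \<le> 1 * e" using e by (intro mult_right_mono) auto
  ultimately have 2: "(n2 g)\<^sup>2 \<le> a\<^sup>2 + (2 * a + 1) * e" unfolding distrib_right by linarith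
  have 3: "0 \<le> (2 * b * B + B\<^sup>2) * e" "0 \<le> (2 * a + 1) * e" using ab e by (auto simp: B_def)
  have "C * e = e + (2 * a + 1) * e + (2 * b * B + B\<^sup>2) * e" unfolding C_def by (simp only: distrib_right mult_1)
  moreover have "E0 = a\<^sup>2 / 2 + b\<^sup>2 / 4" by (simp add: E0_def a_def b_def)
  ultimately show ?thesis unfolding en_def using 1 2 3 e by linarith
 qed
 moreover have "1 \<le> C" using ab by (simp add: C_def B_def)
 ultimately show ?thesis by blast
qed

theorem theorem3:
  fixes A :: real
  assumes "A > 0"
  shows "\<exists>K>0. \<exists>\<epsilon>0>0. \<forall>\<epsilon>. 0 < \<epsilon> \<and> \<epsilon> < \<epsilon>0 \<longrightarrow>
           (\<exists>\<delta>>0. \<forall>v0 v. v0 \<in> X1 \<and> dAX A v0 kink \<le> ereal \<delta> \<and> GP_solution v0 v \<longrightarrow>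
              (\<forall>t a. (\<exists>\<theta>::real. dAX A (\<lambda>x. v t (x + a)) (\<lambda>x. exp (\<i> * complex_of_real \<theta>) * kink x) < ereal \<epsilon>)
                 \<longrightarrow> \<bar>a\<bar> \<le> K * \<epsilon> * (1 + \<bar>t\<bar>)))"
proof -
 obtain Kp where Kp: "1 \<le> Kp" and pos0: "\<forall>V G \<delta>. gp_flow V G --> 0 \<le> \<delta> --> gp_flow.en V G 0 \<le> E0 + \<delta>\<^sup>2 --> cmod (moment (V 0) 0) \<le> \<delta> -->
  (\<forall>t a \<beta>. cmod (moment (V t) a) \<le> \<beta> --> Kp * (\<delta> + \<beta>) \<le> 1 --> \<bar>a\<bar> \<le> Kp * (\<delta> * (1 + \<bar>t\<bar>) + \<beta>))"
  using position_estimate by (elim exE conjE)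
 note pos = pos0[rule_format]
 obtain Ce where Ce: "1 \<le> Ce" and enk0: "\<forall>v g e. energy_fn_eta v g --> 0 \<le> e --> e \<le> 1 --> n2 (%x. g x - of_real (kk x)) \<le> e -->
   l2 (%x. cmod (v x) - \<bar>kQ x\<bar>) --> n2 (%x. cmod (v x) - \<bar>kQ x\<bar>) \<le> e --> energy_fn_eta.en v g \<le> E0 + Ce * e"
  using energy_near_kink by (elim exE conjE)
 note enk = enk0[rule_format]
 define w where "w = 2 * kW"
 have w: "0 \<le> w" using kW_nonneg by (simp add: w_def)
 \<comment> \<open>At a position \<epsilon>-close to a rotated kink the moment is at most w
   \<epsilon>, which is the \<beta> of \<open>position_estimate\<close>. Its smallness condition Kp
   (\<epsilon> + w \<epsilon>) \<le> 1 becomes K \<epsilon> \<le> 1, whence the choice of 1 / K for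
   the range of \<epsilon>.\<close>
 define K where "K = Kp * (1 + w)"
 have K: "0 < K" using Kp w by (simp add: K_def)
 have km [measurable]: "kink \<in> borel_measurable borel" unfolding kink_kQ[abs_def] by measurable
 \<comment> \<open>\<open>position_estimate\<close> is applied with \<epsilon> as its small
   parameter. The energy excess Ce \<delta> must be at most \<epsilon>^2 and the initial moment w
   \<delta> at most \<epsilon>; these are the last two entries of the minimum, and the entry 1 is
   the range of \<open>energy_near_kink\<close>.\<close>
 have main: "\<bar>a\<bar> \<le> K * \<epsilon> * (1 + \<bar>t\<bar>)"
  if \<epsilon>: "0 < \<epsilon>" "\<epsilon> < 1 / K" and d: "\<delta> = min 1 (min (\<epsilon>\<^sup>2 / Ce) (\<epsilon> / (w + 1)))"
   and v0: "v0 \<in> X1" "dAX A v0 kink \<le> ereal \<delta>" and S: "GP_solution v0 v"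
   and th: "dAX A (%x. v t (x + a)) (%x. exp (\<i> * complex_of_real \<theta>) * kink x) < ereal \<epsilon>"
  for \<epsilon> \<delta> v0 v t a and \<theta> :: real
 proof -
  have d0: "0 \<le> \<delta>" "\<delta> \<le> 1" unfolding d using \<epsilon> Ce w by auto
  have "\<delta> \<le> \<epsilon>\<^sup>2 / Ce" "\<delta> \<le> \<epsilon> / (w + 1)" unfolding d by (auto simp: min.coboundedI2)
  then have dC: "Ce * \<delta> \<le> \<epsilon>\<^sup>2" and dw: "\<delta> * (w + 1) \<le> \<epsilon>" using Ce w by (simp_all add: pos_le_divide_eq mult.commute)
  obtain V G where flow: "gp_flow V G" and vV: "\<And>t. AE x in lborel. v t x = V t x" and vm: "\<And>t. v t \<in> borel_measurable borel"
   using flow_of_solution[OF v0(1) S] by blast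
  interpret gp_flow V G by (rule flow)
  have v00: "v 0 = v0" using S by (simp add: GP_solution_def)
  have one: "cmod (1 :: complex) = 1" by simp
  have L0: "energy_fn_eta (V 0) (G 0)" using shifted_energy_fn[OF one, of 0 0] by simp
  have e0: "energy_fn_eta.en (V 0) (G 0) = en 0" using en_shifted[OF one, of 0 0] by simp
  note D = dAX_le[OF assms V_ac[of 0] vV[of 0, unfolded v00] vm[of 0, unfolded v00] ac_of_real[OF kQ_ac] AE_I2[OF kink_kQ] km v0(2)]
  have E: "en 0 \<le> E0 + \<epsilon>\<^sup>2"
   using enk[OF L0 d0 D(2)] D(3,4) dC unfolding e0 by simp
  obtain M0 where M0: "\<And>x. cmod (V 0 x) \<le> M0" using V_0_bdd by blast
  have "cmod (moment (V 0) 0) \<le> 2 * kW * \<delta>"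
   by (rule moment_small_near_kink[OF V_ac G_l2 one M0]) (use D(1,2) in simp_all)
  also have "\<dots> = w * \<delta>" by (simp add: w_def)
  also have "\<dots> \<le> \<delta> * (w + 1)" using d0 by (simp add: algebra_simps)
  also note dw
  finally have m0: "cmod (moment (V 0) 0) \<le> \<epsilon>" .
  define c where "c = exp (\<i> * complex_of_real \<theta>)"
  have c: "cmod c = 1" unfolding c_def by (rule norm_exp_i_times)
  have sh: "AE x in lborel. v t (x + a) = V t (x + a)"
  proof -
   have "(%x. v t x - V t x) \<in> borel_measurable borel" by (intro borel_measurable_diff vm V_meas)
   moreover have "AE x in lborel. v t x - V t x = 0" using vV[of t] by eventually_elim simp
   ultimately show ?thesis using AE_shift[of "%x. v t x - V t x" a] by simp
  qed
  have shm: "(%x. v t (x + a)) \<in> borel_measurable borel" by (rule measurable_compose[OF _ vm]) measurable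
  have kAE: "AE x in lborel. c * kink x = c * of_real (kQ x)" by (simp add: kink_kQ)
  have ckm: "(%x. c * kink x) \<in> borel_measurable borel" by measurable
  note T = dAX_le[OF assms ac_shift[OF V_ac] sh shm ac_cmult[OF ac_of_real[OF kQ_ac], of c] kAE ckm less_imp_le[OF th[folded c_def]]]
  obtain M1 where M1: "\<And>x. cmod (V t x) \<le> M1" using V_bdd1 by blast
  have "cmod (moment (%x. V t (x + a)) 0) \<le> 2 * kW * \<epsilon>"
   by (rule moment_small_near_kink[OF ac_shift[OF V_ac] l2_shift(1)[OF G_l2] c M1 T(1,2)])
  then have m1: "cmod (moment (V t) a) \<le> w * \<epsilon>" using moment_shifted[of 1 t a 0] by (simp add: w_def)
  have "Kp * (\<epsilon> + w * \<epsilon>) = K * \<epsilon>" by (simp add: K_def algebra_simps)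
  also have "\<dots> \<le> 1" using \<epsilon>(2) K by (simp add: pos_less_divide_eq mult.commute)
  finally have "\<bar>a\<bar> \<le> Kp * (\<epsilon> * (1 + \<bar>t\<bar>) + w * \<epsilon>)"
   by (rule pos[OF flow less_imp_le[OF \<epsilon>(1)] E m0 m1])
  also have "\<dots> \<le> Kp * (\<epsilon> * (1 + \<bar>t\<bar>) + w * \<epsilon> * (1 + \<bar>t\<bar>))"
   using mult_left_mono[of 1 "1 + \<bar>t\<bar>" "w * \<epsilon>"] w \<epsilon> Kp by (intro mult_left_mono add_left_mono) auto
  also have "\<dots> = K * \<epsilon> * (1 + \<bar>t\<bar>)" by (simp add: K_def algebra_simps)
  finally show ?thesis .
 qed
 show ?thesis
 proof (rule exI[of _ K], intro conjI K, rule exI[of _ "1 / K"], intro conjI allI impI)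
  show "0 < 1 / K" using K by simp
  fix \<epsilon> :: real assume e: "0 < \<epsilon> \<and> \<epsilon> < 1 / K"
  let ?d = "min 1 (min (\<epsilon>\<^sup>2 / Ce) (\<epsilon> / (w + 1)))"
  have "0 < ?d" using e Ce w by auto
  moreover have "\<forall>v0 v. v0 \<in> X1 \<and> dAX A v0 kink \<le> ereal ?d \<and> GP_solution v0 v -->
       (\<forall>t a. (\<exists>\<theta>::real. dAX A (%x. v t (x + a)) (%x. exp (\<i> * complex_of_real \<theta>) * kink x) < ereal \<epsilon>)
         --> \<bar>a\<bar> \<le> K * \<epsilon> * (1 + \<bar>t\<bar>))"
   using main[OF _ _ refl] e by blast
  ultimately show "\<exists>\<delta>>0. \<forall>v0 v. v0 \<in> X1 \<and> dAX A v0 kink \<le> ereal \<delta> \<and> GP_solution v0 v -->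
       (\<forall>t a. (\<exists>\<theta>::real. dAX A (%x. v t (x + a)) (%x. exp (\<i> * complex_of_real \<theta>) * kink x) < ereal \<epsilon>)
         --> \<bar>a\<bar> \<le> K * \<epsilon> * (1 + \<bar>t\<bar>))" by blast
 qed
qed

end
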